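(* Let $\mathcal{Z}$ be an arc diagram, $\mathcal{A}=\mathcal{A}(\mathcal{Z})$, $\mathcal{H}=H(\mathcal{A})$, and let $U_n,X_n,f_n$ be maps obtained by Kadeishvili's construction. Suppose $f_2$ is balanced. Let $M=M_1\otimes M_2\otimes M_3$ be a tensor product of nonzero homology classes of diagrams. Then $X_3(M)$ is nonzero if and only if $M$ is viable, critical at precisely one matched pair $P$, and tight at all other matched pairs.
   Context: All algebra is over $\mathbb{Z}_2$. An arc diagram $\mathcal{Z}=(\mathbf{Z},\mathbf{a},r)$ consists of oriented intervals $\mathbf{Z}=\{Z_1,\dots,Z_l\}$, distinct points $\mathbf{a}=(a_1,\dots,a_{2k})$ (places) in the interiors of the intervals, ordered along them, and a 2-to-1 map $r:\mathbf{a}\to\{1,\dots,k\}$ such that oriented surgery on $\mathbf{Z}$ at all $0$-spheres $r^{-1}(i)$ yields a 1-manifold with no circle components. The fibres $P=\{p,q\}$ of $r$ are the matched pairs, identified with $1,\dots,k$. Let $-\infty_i,+\infty_i$ be the start and end of $Z_i$ and $\mathbf{a}_{\pm\infty}=\mathbf{a}\cup\{\pm\infty_i\}$, partially ordered along the intervals; the places cut the intervals into steps. A strand diagram is a triple $(S,T,\phi)$ with $S,T\subseteq\mathbf{a}_{\pm\infty}$ and $\phi:S\to T$ a bijection with $\phi(x)\ge x$; it is drawn as strands in $[0,1]\times\mathbf{Z}$ from $\{0\}\times S$ to $\{1\}\times T$, meeting efficiently; crossings are inversions ($x<y$ with $\phi(x)>\phi(y)$), counted by $\mathrm{inv}$.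 The product of $(S,T,\phi)$ and $(U,V,\psi)$ is $(S,V,\psi\phi)$ if $T=U$ and $\mathrm{inv}(\psi\phi)=\mathrm{inv}(\phi)+\mathrm{inv}(\psi)$, and $0$ otherwise; $\partial$ is the sum of all resolutions of one crossing which lower the number of crossings by exactly $1$. $I(S)$ is the identity diagram on $S$. For a set $s$ of matched pairs let $I(s)=\sum_S I(S)$, over all $S\subseteq \mathbf{a}_{\pm\infty}$ consisting of exactly one place of each pair in $s$, no other places, and any subset of $\{\pm\infty_i\}$. For $\mu=(S,T,\phi)$ without horizontal strands (fixed points) let $a(\mu)=\sum_U(S\cup U,T\cup U,\phi_U)$ over $U\subseteq\mathbf{a}_{\pm\infty}\setminus(S\cup T)$, $\phi_U$ extending $\phi$ by the identity. A diagram from $s$ to $t$ is a nonzero element $I(s)a(\mu)I(t)$; it is drawn as one picture with dotted horizontal strands at both places $p,q$ of every matched pair carrying a horizontal strand. The (augmented) strand algebra $\mathcal{A}=\mathcal{A}(\mathcal{Z})$ is the DGA with basis the diagrams; $\mathcal{H}=H(\mathcal{A})$, a DGA with zero differential. H-data is a triple $(h,s,t)$ with $h\in H_1(\mathbf{Z},\mathbf{a}_{\pm\infty})$ and $s,t$ sets of matched pairs. A diagram from $s$ to $t$ has H-data $(h,s,t)$, $h=\sum_x[x,\phi(x)]$; $\mathcal{A}(h,s,t)$ is the span of diagrams with this H-data and $\mathcal{H}(h,s,t)$ its homology, so $\mathcal{A}=\bigoplus\mathcal{A}(h,s,t)$, $\mathcal{H}=\bigoplus\mathcal{H}(h,s,t)$.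 The Maslov grading is $\iota(D)=\mathrm{inv}(\mu)-m(h,S)$ for any term $\mu=(S,T,\phi)$ of $D$, where $m(h,S)$ is the sum over places $a\in S\cap\mathbf{a}$ of the average multiplicity of $h$ on the two steps at $a$ (and $m$ is extended linearly to $0$-chains, ignoring $\pm\infty_i$). $h$ (and any H-data or diagram with H-grading $h$) is viable if $h$ has multiplicity $0$ or $1$ on every step. In a viable diagram every crossing involves a horizontal strand, hence lies at a matched pair. Cutting the intervals between consecutive places gives, for each matched pair $P=\{p,q\}$, the fragment $\mathcal{Z}_P$ (two intervals with one place each); cutting a viable diagram $D$ accordingly gives local diagrams $D_P\in\mathcal{A}(\mathcal{Z}_P)$. A viable diagram is tight if it has no crossings and is nonzero in homology, twisted if it has no crossings and is zero in homology, crossed if it has crossings. Each $\mathcal{H}(h,s,t)$ is $0$ or $\mathbb{Z}_2$; when nonzero its generator is represented by any tight diagram with H-data $(h,s,t)$. For classes $M_i$ with H-data $(h_i,s_i,t_i)$, $M=M_1\otimes\cdots\otimes M_n$ is viable if $t_i=s_{i+1}$ for all $i$ and $\sum h_i$ is viable. Its H-data is $(h,s,t)=(\sum h_i,s_1,t_n)$ and its Maslov grading is $\sum\iota(M_i)+\sum_{j<k}m(h_k,\partial h_j)$. A map preserves H-data if it sends such $M$ into the $(\sum h_i,s_1,t_n)$ summand. Tightness of a viable tensor product $M$ of nonzero classes: let $D_i$ be (tight) diagrams representing $M_i$; $M$ is tight if $D_1\cdots D_n$ is nonzero and tight; twisted if $D_1\cdots D_n$ is nonzero and twisted; critical if $D_1\cdots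 D_n=0$ but $\mathcal{A}(h,s,t)\ne0$; singular if $\mathcal{A}(h,s,t)=0$. Exactly one holds, independently of the choice of $D_i$. $M$ is tight, twisted, critical or singular at a matched pair $P$ if $M_P=(M_1)_P\otimes\cdots\otimes(M_n)_P$ is so on $\mathcal{Z}_P$, where $(M_i)_P$ is the homology class of $(D_i)_P$. Kadeishvili's construction: $U_1=0$, $X_1=0$, $f_1:\mathcal{H}\to\mathcal{A}$ is a cycle selection map (linear, preserving H-data and Maslov grading, sending each homology class to a cycle representing it), and for $n\ge2$ the linear maps $U_n,f_n:\mathcal{H}^{\otimes n}\to\mathcal{A}$, $X_n:\mathcal{H}^{\otimes n}\to\mathcal{H}$ satisfy $U_n(a_1\otimes\cdots\otimes a_n)=\sum_{j=1}^{n-1}f_j(a_1\otimes\cdots\otimes a_j)f_{n-j}(a_{j+1}\otimes\cdots\otimes a_n)+\sum_{2\le j\le n-1,\,0\le k\le n-j}f_{n-j+1}(a_1\otimes\cdots\otimes a_k\otimes X_j(a_{k+1}\otimes\cdots\otimes a_{k+j})\otimes\cdots\otimes a_n)$, $X_n=[U_n]$ (homology class; $U_n$ takes values in cycles), and $\partial f_n=f_1X_n-U_n$. All $U_n,X_n,f_n$ preserve H-data and have Maslov degrees $n-2,n-2,n-1$ respectively. The map $f_n$ is balanced if for every tensor product $M$ of nonzero homology classes of diagrams, $(f_1X_n-U_n)(M)=0$ implies $f_n(M)=0$. *)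

theory Defs
  imports Complex_Main "HOL-Library.Poly_Mapping" "HOL-Library.Z2"
begin

section \<open>Arc diagrams\<close>

text \<open>An arc diagram is given by its finite set of intervals, the number of places on each of them,
  and the label of the matched pair containing each place. The points of an interval \<open>i\<close> with \<open>n\<close>
  places are encoded as \<open>(i, 0)\<close> for minus infinity, \<open>(i, 1), \<dots>, (i, n)\<close> for the places in
  their order along the interval, and \<open>(i, n + 1)\<close> for plus infinity; the step from \<open>(i, j)\<close> to
  \<open>(i, j + 1)\<close> is encoded as \<open>(i, j)\<close>. Interval names and matched-pair labels may be of any type,
  so that the intervals of a fragment can be named by places.\<close>

record ('i, 'l) arc_diag =
  intervals :: "'i set"
  nplaces :: "'i \<Rightarrow> nat"
  pair_of :: "'i \<times> nat \<Rightarrow> 'l"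

definition places :: "('i, 'l) arc_diag \<Rightarrow> ('i \<times> nat) set" where
  "places Z = {(i, j). i \<in> intervals Z \<and> 1 \<le> j \<and> j \<le> nplaces Z i}"

definition points :: "('i, 'l) arc_diag \<Rightarrow> ('i \<times> nat) set" where
  "points Z = {(i, j). i \<in> intervals Z \<and> j \<le> nplaces Z i + 1}"

definition steps :: "('i, 'l) arc_diag \<Rightarrow> ('i \<times> nat) set" where
  "steps Z = {(i, j). i \<in> intervals Z \<and> j \<le> nplaces Z i}"

definition pairs :: "('i, 'l) arc_diag \<Rightarrow> 'l set" where
  "pairs Z = pair_of Z ` places Z"

text \<open>Oriented surgery at a matched pair \<open>{p, q}\<close> joins the step ending at \<open>p\<close> to the step starting
  at \<open>q\<close>. The components of the surgered 1-manifold are the orbits of this relation on steps.\<close>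

definition surgery :: "('i, 'l) arc_diag \<Rightarrow> (('i \<times> nat) \<times> ('i \<times> nat)) set" where
  "surgery Z = {((i, j), q) | i j q. (i, Suc j) \<in> places Z \<and> q \<in> places Z \<and>
      q \<noteq> (i, Suc j) \<and> pair_of Z q = pair_of Z (i, Suc j)}"

definition arc_diagram :: "('i, 'l) arc_diag \<Rightarrow> bool" where
  "arc_diagram Z \<longleftrightarrow> finite (intervals Z) \<and>
    (\<forall>P\<in>pairs Z. card {p \<in> places Z. pair_of Z p = P} = 2) \<and>
    acyclic (surgery Z)"

definition pt_less :: "'i \<times> nat \<Rightarrow> 'i \<times> nat \<Rightarrow> bool" where
  "pt_less x y \<longleftrightarrow> fst x = fst y \<and> snd x < snd y"

definition pt_le :: "'i \<times> nat \<Rightarrow> 'i \<times> nat \<Rightarrow> bool" where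
  "pt_le x y \<longleftrightarrow> fst x = fst y \<and> snd x \<le> snd y"


section \<open>Strand diagrams\<close>

text \<open>A strand diagram \<open>(S, T, \<phi>)\<close> is represented by the graph of \<open>\<phi>\<close>, so \<open>S\<close> and \<open>T\<close> are its
  domain and range.\<close>

type_synonym 'i strands = "(('i \<times> nat) \<times> ('i \<times> nat)) set"

definition strand_diagram :: "('i, 'l) arc_diag \<Rightarrow> 'i strands \<Rightarrow> bool" where
  "strand_diagram Z \<mu> \<longleftrightarrow> \<mu> \<subseteq> points Z \<times> points Z \<and> single_valued \<mu> \<and> single_valued (\<mu>\<inverse>) \<and>
    (\<forall>(x, y)\<in>\<mu>. pt_le x y)"

definition crossings :: "'i strands \<Rightarrow> ((('i \<times> nat) \<times> ('i \<times> nat)) \<times> (('i \<times> nat) \<times> ('i \<times> nat))) set" where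
  "crossings \<mu> = {((x, x'), (y, y')). (x, x') \<in> \<mu> \<and> (y, y') \<in> \<mu> \<and> pt_less x y \<and> pt_less y' x'}"

definition inv_num :: "'i strands \<Rightarrow> nat" where
  "inv_num \<mu> = card (crossings \<mu>)"

definition resolve :: "'i strands \<Rightarrow> (('i \<times> nat) \<times> ('i \<times> nat)) \<times> (('i \<times> nat) \<times> ('i \<times> nat)) \<Rightarrow> 'i strands" where
  "resolve \<mu> c = (case c of ((x, x'), (y, y')) \<Rightarrow> (\<mu> - {(x, x'), (y, y')}) \<union> {(x, y'), (y, x')})"

type_synonym 'i chain = "'i strands \<Rightarrow>\<^sub>0 bit"

abbreviation basis :: "'i strands \<Rightarrow> 'i chain" where
  "basis \<mu> \<equiv> Poly_Mapping.single \<mu> 1"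

definition mult_strands :: "'i strands \<Rightarrow> 'i strands \<Rightarrow> 'i chain" where
  "mult_strands \<mu> \<nu> = (if Range \<mu> = Domain \<nu> \<and> inv_num (\<mu> O \<nu>) = inv_num \<mu> + inv_num \<nu>
     then basis (\<mu> O \<nu>) else 0)"

definition mult :: "'i chain \<Rightarrow> 'i chain \<Rightarrow> 'i chain" (infixl "\<odot>" 70) where
  "x \<odot> y = (\<Sum>\<mu>\<in>Poly_Mapping.keys x. \<Sum>\<nu>\<in>Poly_Mapping.keys y. mult_strands \<mu> \<nu>)"

definition diff_strands :: "'i strands \<Rightarrow> 'i chain" where
  "diff_strands \<mu> =
     (\<Sum>c\<in>{c \<in> crossings \<mu>. inv_num (resolve \<mu> c) + 1 = inv_num \<mu>}. basis (resolve \<mu> c))"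

definition diff :: "'i chain \<Rightarrow> 'i chain" where
  "diff x = (\<Sum>\<mu>\<in>Poly_Mapping.keys x. diff_strands \<mu>)"

definition idem :: "('i, 'l) arc_diag \<Rightarrow> 'l set \<Rightarrow> 'i chain" where
  "idem Z s = (\<Sum>S | S \<subseteq> points Z \<and>
      (\<forall>P\<in>pairs Z. card {p \<in> S \<inter> places Z. pair_of Z p = P} = (if P \<in> s then 1 else 0)).
    basis (Id_on S))"

definition add_horizontals :: "('i, 'l) arc_diag \<Rightarrow> 'i strands \<Rightarrow> 'i chain" where
  "add_horizontals Z \<mu> = (\<Sum>V\<in>Pow (points Z - (Domain \<mu> \<union> Range \<mu>)). basis (\<mu> \<union> Id_on V))"


section \<open>Diagrams and the strand algebra\<close>

text \<open>A triple \<open>(\<mu>, s, t)\<close> is the datum from which the diagram \<open>I(s) a(\<mu>) I(t)\<close> is built;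
  \<open>elt\<close> is the resulting algebra element.\<close>

type_synonym ('i, 'l) diag = "'i strands \<times> 'l set \<times> 'l set"

definition elt :: "('i, 'l) arc_diag \<Rightarrow> ('i, 'l) diag \<Rightarrow> 'i chain" where
  "elt Z D = (case D of (\<mu>, s, t) \<Rightarrow> idem Z s \<odot> add_horizontals Z \<mu> \<odot> idem Z t)"

definition diagram :: "('i, 'l) arc_diag \<Rightarrow> ('i, 'l) diag \<Rightarrow> bool" where
  "diagram Z D \<longleftrightarrow> (case D of (\<mu>, s, t) \<Rightarrow>
     strand_diagram Z \<mu> \<and> (\<forall>x. (x, x) \<notin> \<mu>) \<and> s \<subseteq> pairs Z \<and> t \<subseteq> pairs Z) \<and> elt Z D \<noteq> 0"

text \<open>Linear span over the field with two elements.\<close>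

definition span2 :: "'i chain set \<Rightarrow> 'i chain set" where
  "span2 B = {(\<Sum>x\<in>F. x) | F. finite F \<and> F \<subseteq> B}"

definition alg :: "('i, 'l) arc_diag \<Rightarrow> 'i chain set" where
  "alg Z = span2 {elt Z D | D. diagram Z D}"

text \<open>The group \<open>H\<^sub>1(Z, a\<^sub>\<plusminus>\<^sub>\<infinity>)\<close> is free on the steps; a class is given by its multiplicities.\<close>

type_synonym 'i h1 = "'i \<times> nat \<Rightarrow> int"

type_synonym ('i, 'l) hdata = "'i h1 \<times> 'l set \<times> 'l set"

definition segment :: "'i \<times> nat \<Rightarrow> 'i \<times> nat \<Rightarrow> 'i h1" where
  "segment x y = (\<lambda>(i, j). if i = fst x \<and> i = fst y \<and> snd x \<le> j \<and> j < snd y then 1 else 0)"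

definition h_grading :: "'i strands \<Rightarrow> 'i h1" where
  "h_grading \<mu> = (\<lambda>e. \<Sum>(x, y)\<in>\<mu>. segment x y e)"

definition hdata_of :: "('i, 'l) diag \<Rightarrow> ('i, 'l) hdata" where
  "hdata_of D = (case D of (\<mu>, s, t) \<Rightarrow> (h_grading \<mu>, s, t))"

definition alg_at :: "('i, 'l) arc_diag \<Rightarrow> ('i, 'l) hdata \<Rightarrow> 'i chain set" where
  "alg_at Z d = span2 {elt Z D | D. diagram Z D \<and> hdata_of D = d}"

text \<open>The average multiplicity of \<open>h\<close> on the two steps at a place, and the bilinear function
  \<open>m(h, c)\<close> for a 0-chain \<open>c\<close>; points at infinity are ignored.\<close>

definition avg_mult :: "'i h1 \<Rightarrow> 'i \<times> nat \<Rightarrow> rat" where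
  "avg_mult h p = (of_int (h (fst p, snd p - 1)) + of_int (h p)) / 2"

definition m_chain :: "('i, 'l) arc_diag \<Rightarrow> 'i h1 \<Rightarrow> ('i \<times> nat \<Rightarrow> int) \<Rightarrow> rat" where
  "m_chain Z h c = (\<Sum>p\<in>places Z. of_int (c p) * avg_mult h p)"

text \<open>The coefficient at the place \<open>(i, j)\<close> of the boundary of \<open>h\<close> (only used at places).\<close>

definition h_bdry :: "'i h1 \<Rightarrow> 'i \<times> nat \<Rightarrow> int" where
  "h_bdry h p = h (fst p, snd p - 1) - h p"

definition maslov :: "('i, 'l) arc_diag \<Rightarrow> 'i strands \<Rightarrow> rat" where
  "maslov Z \<mu> = of_nat (inv_num \<mu>) -
     m_chain Z (h_grading \<mu>) (\<lambda>p. if p \<in> Domain \<mu> then 1 else 0)"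

definition alg_piece :: "('i, 'l) arc_diag \<Rightarrow> ('i, 'l) hdata \<Rightarrow> rat \<Rightarrow> 'i chain set" where
  "alg_piece Z d e = {x \<in> alg_at Z d. \<forall>\<mu>\<in>Poly_Mapping.keys x. maslov Z \<mu> = e}"


section \<open>Homology\<close>

text \<open>Homology classes are cosets of the space of boundaries in the space of cycles.\<close>

type_synonym 'i hclass = "'i chain set"

definition cycles :: "('i, 'l) arc_diag \<Rightarrow> 'i chain set" where
  "cycles Z = {x \<in> alg Z. diff x = 0}"

definition boundaries :: "('i, 'l) arc_diag \<Rightarrow> 'i chain set" where
  "boundaries Z = diff ` alg Z"

definition hclass :: "('i, 'l) arc_diag \<Rightarrow> 'i chain \<Rightarrow> 'i hclass" where
  "hclass Z z = {z + b | b. b \<in> boundaries Z}"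

definition homology :: "('i, 'l) arc_diag \<Rightarrow> 'i hclass set" where
  "homology Z = hclass Z ` cycles Z"

definition hzero :: "('i, 'l) arc_diag \<Rightarrow> 'i hclass" where
  "hzero Z = hclass Z 0"

definition hadd :: "'i hclass \<Rightarrow> 'i hclass \<Rightarrow> 'i hclass" where
  "hadd a b = {x + y | x y. x \<in> a \<and> y \<in> b}"

text \<open>The summands of homology, as subspaces of the homology of the whole algebra.\<close>

definition homology_at :: "('i, 'l) arc_diag \<Rightarrow> ('i, 'l) hdata \<Rightarrow> 'i hclass set" where
  "homology_at Z d = hclass Z ` (cycles Z \<inter> alg_at Z d)"

definition homology_piece :: "('i, 'l) arc_diag \<Rightarrow> ('i, 'l) hdata \<Rightarrow> rat \<Rightarrow> 'i hclass set" where
  "homology_piece Z d e = hclass Z ` (cycles Z \<inter> alg_piece Z d e)"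

definition nonzero_diagram_classes :: "('i, 'l) arc_diag \<Rightarrow> 'i hclass set" where
  "nonzero_diagram_classes Z =
     {hclass Z (elt Z D) | D. diagram Z D \<and> elt Z D \<in> cycles Z} - {hzero Z}"


section \<open>Viability and tightness\<close>

definition viable_h :: "('i, 'l) arc_diag \<Rightarrow> 'i h1 \<Rightarrow> bool" where
  "viable_h Z h \<longleftrightarrow> (\<forall>e\<in>steps Z. h e = 0 \<or> h e = 1)"

text \<open>In the picture of a diagram, dotted strands are drawn at both places of a matched pair. Each of
  them is present in some term of the diagram, so the picture has no crossings iff no term has.\<close>

definition tight :: "('i, 'l) arc_diag \<Rightarrow> ('i, 'l) diag \<Rightarrow> bool" where
  "tight Z D \<longleftrightarrow> diagram Z D \<and> viable_h Z (h_grading (fst D)) \<and>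
     (\<forall>\<nu>\<in>Poly_Mapping.keys (elt Z D). crossings \<nu> = {}) \<and> hclass Z (elt Z D) \<noteq> hzero Z"

text \<open>A pure tensor is represented by the list of its (nonzero) factors. Its tightness does not depend
  on the tight diagrams chosen to represent the factors, so it is defined by an arbitrary choice of
  such representatives.\<close>

definition tensor_hdata :: "('i, 'l) hdata list \<Rightarrow> ('i, 'l) hdata" where
  "tensor_hdata ds = ((\<lambda>e. \<Sum>d\<leftarrow>ds. fst d e), fst (snd (hd ds)), snd (snd (last ds)))"

definition tensor_maslov :: "('i, 'l) arc_diag \<Rightarrow> ('i, 'l) hdata list \<Rightarrow> rat list \<Rightarrow> rat" where
  "tensor_maslov Z ds es = (\<Sum>e\<leftarrow>es. e) +
     (\<Sum>k<length ds. \<Sum>j<k. m_chain Z (fst (ds ! k)) (h_bdry (fst (ds ! j))))"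

definition viable_tensor :: "('i, 'l) arc_diag \<Rightarrow> 'i hclass list \<Rightarrow> bool" where
  "viable_tensor Z Ms \<longleftrightarrow> (\<exists>ds. list_all2 (\<lambda>M d. M \<in> homology_at Z d \<and> M \<noteq> hzero Z) Ms ds \<and>
     (\<forall>i. Suc i < length ds \<longrightarrow> snd (snd (ds ! i)) = fst (snd (ds ! Suc i))) \<and>
     viable_h Z (fst (tensor_hdata ds)))"

definition tight_reps :: "('i, 'l) arc_diag \<Rightarrow> ('i, 'l) diag list \<Rightarrow> 'i hclass list \<Rightarrow> bool" where
  "tight_reps Z Ds Ms \<longleftrightarrow> list_all2 (\<lambda>D M. tight Z D \<and> hclass Z (elt Z D) = M) Ds Ms"

definition prod_elts :: "('i, 'l) arc_diag \<Rightarrow> ('i, 'l) diag list \<Rightarrow> 'i chain" where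
  "prod_elts Z Ds = foldl (\<odot>) (elt Z (hd Ds)) (map (elt Z) (tl Ds))"

definition tight_tensor :: "('i, 'l) arc_diag \<Rightarrow> 'i hclass list \<Rightarrow> bool" where
  "tight_tensor Z Ms \<longleftrightarrow> viable_tensor Z Ms \<and>
     (\<exists>Ds. tight_reps Z Ds Ms \<and> (\<exists>D. tight Z D \<and> prod_elts Z Ds = elt Z D))"

definition critical_tensor :: "('i, 'l) arc_diag \<Rightarrow> 'i hclass list \<Rightarrow> bool" where
  "critical_tensor Z Ms \<longleftrightarrow> viable_tensor Z Ms \<and>
     (\<exists>Ds. tight_reps Z Ds Ms \<and> prod_elts Z Ds = 0 \<and>
        alg_at Z (tensor_hdata (map hdata_of Ds)) \<noteq> {0})"


section \<open>Cutting into fragments\<close>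

text \<open>The two intervals of the fragment at \<open>P\<close> are named by the two places of \<open>P\<close>. Cutting sends a
  point before, at, or after the place \<open>p\<close> (on the same interval) to minus infinity, the place, or
  plus infinity of the interval \<open>p\<close>; strands which do not meet the fragment are discarded.\<close>

definition fragment :: "('i, 'l) arc_diag \<Rightarrow> 'l \<Rightarrow> ('i \<times> nat, 'l) arc_diag" where
  "fragment Z P = \<lparr>intervals = {p \<in> places Z. pair_of Z p = P}, nplaces = (\<lambda>_. 1), pair_of = (\<lambda>_. P)\<rparr>"

definition clip :: "'i \<times> nat \<Rightarrow> 'i \<times> nat \<Rightarrow> nat" where
  "clip p x = (if snd x < snd p then 0 else if snd x = snd p then 1 else 2)"

definition cut_strands :: "('i, 'l) arc_diag \<Rightarrow> 'l \<Rightarrow> 'i strands \<Rightarrow> ('i \<times> nat) strands" where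
  "cut_strands Z P \<mu> = {((p, clip p x), (p, clip p y)) | p x y. p \<in> places Z \<and> pair_of Z p = P \<and>
     (x, y) \<in> \<mu> \<and> fst x = fst p \<and> fst y = fst p \<and> clip p x < clip p y}"

definition cut_diag :: "('i, 'l) arc_diag \<Rightarrow> 'l \<Rightarrow> ('i, 'l) diag \<Rightarrow> ('i \<times> nat, 'l) diag" where
  "cut_diag Z P D = (case D of (\<mu>, s, t) \<Rightarrow> (cut_strands Z P \<mu>, s \<inter> {P}, t \<inter> {P}))"

definition local_tensor :: "('i, 'l) arc_diag \<Rightarrow> 'l \<Rightarrow> ('i, 'l) diag list \<Rightarrow> ('i \<times> nat) hclass list" where
  "local_tensor Z P Ds = map (\<lambda>D. hclass (fragment Z P) (elt (fragment Z P) (cut_diag Z P D))) Ds"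

definition tight_at :: "('i, 'l) arc_diag \<Rightarrow> 'l \<Rightarrow> 'i hclass list \<Rightarrow> bool" where
  "tight_at Z P Ms \<longleftrightarrow>
     (\<exists>Ds. tight_reps Z Ds Ms \<and> tight_tensor (fragment Z P) (local_tensor Z P Ds))"

definition critical_at :: "('i, 'l) arc_diag \<Rightarrow> 'l \<Rightarrow> 'i hclass list \<Rightarrow> bool" where
  "critical_at Z P Ms \<longleftrightarrow>
     (\<exists>Ds. tight_reps Z Ds Ms \<and> critical_tensor (fragment Z P) (local_tensor Z P Ds))"


section \<open>Kadeishvili's construction\<close>

text \<open>A linear map on the \<open>n\<close>-th tensor power of homology is represented by the corresponding
  multilinear map, a function on lists of length \<open>n\<close> of homology classes. Over the field with two
  elements, linear means additive.\<close>

definition multilinear :: "('i, 'l) arc_diag \<Rightarrow> nat \<Rightarrow> ('v \<Rightarrow> 'v \<Rightarrow> 'v) \<Rightarrow> ('i hclass list \<Rightarrow> 'v) \<Rightarrow> bool" where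
  "multilinear Z n plus_v F \<longleftrightarrow> (\<forall>as b c bs. set as \<union> {b, c} \<union> set bs \<subseteq> homology Z \<longrightarrow>
     length as + 1 + length bs = n \<longrightarrow>
     F (as @ hadd b c # bs) = plus_v (F (as @ b # bs)) (F (as @ c # bs)))"

text \<open>\<open>F\<close> preserves H-data and has Maslov degree \<open>r\<close>; the codomain is given by its graded pieces. This is
  required on all tensor products of homogeneous classes, viable or not.\<close>

definition graded :: "('i, 'l) arc_diag \<Rightarrow> nat \<Rightarrow> rat \<Rightarrow> (('i, 'l) hdata \<Rightarrow> rat \<Rightarrow> 'v set) \<Rightarrow>
    ('i hclass list \<Rightarrow> 'v) \<Rightarrow> bool" where
  "graded Z n r piece F \<longleftrightarrow> (\<forall>Ms ds es. length Ms = n \<longrightarrow> length ds = n \<longrightarrow> length es = n \<longrightarrow>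
     (\<forall>i<n. Ms ! i \<in> homology_piece Z (ds ! i) (es ! i)) \<longrightarrow>
     F Ms \<in> piece (tensor_hdata ds) (tensor_maslov Z ds es + r))"

definition kadeishvili :: "('i, 'l) arc_diag \<Rightarrow> (nat \<Rightarrow> 'i hclass list \<Rightarrow> 'i chain) \<Rightarrow>
    (nat \<Rightarrow> 'i hclass list \<Rightarrow> 'i hclass) \<Rightarrow> (nat \<Rightarrow> 'i hclass list \<Rightarrow> 'i chain) \<Rightarrow> bool" where
  "kadeishvili Z U X f \<longleftrightarrow>
     (\<forall>n\<ge>1.
        multilinear Z n (+) (U n) \<and> graded Z n (of_nat n - 2) (alg_piece Z) (U n) \<and>
        multilinear Z n hadd (X n) \<and> graded Z n (of_nat n - 2) (homology_piece Z) (X n) \<and>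
        multilinear Z n (+) (f n) \<and> graded Z n (of_nat n - 1) (alg_piece Z) (f n) \<and>
        (\<forall>Ms. length Ms = n \<longrightarrow> set Ms \<subseteq> homology Z \<longrightarrow>
           U n Ms \<in> cycles Z \<and> X n Ms \<in> homology Z \<and> f n Ms \<in> alg Z)) \<and>
     (\<forall>a\<in>homology Z. U 1 [a] = 0 \<and> X 1 [a] = hzero Z \<and> f 1 [a] \<in> a) \<and>
     (\<forall>n\<ge>2. \<forall>Ms. length Ms = n \<longrightarrow> set Ms \<subseteq> homology Z \<longrightarrow>
        U n Ms = (\<Sum>j=1..n - 1. f j (take j Ms) \<odot> f (n - j) (drop j Ms)) +
          (\<Sum>j=2..n - 1. \<Sum>k=0..n - j.
             f (n - j + 1) (take k Ms @ X j (take j (drop k Ms)) # drop (k + j) Ms)) \<and>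
        X n Ms = hclass Z (U n Ms) \<and>
        diff (f n Ms) = f 1 [X n Ms] - U n Ms)"

definition balanced :: "('i, 'l) arc_diag \<Rightarrow> nat \<Rightarrow> (nat \<Rightarrow> 'i hclass list \<Rightarrow> 'i chain) \<Rightarrow>
    (nat \<Rightarrow> 'i hclass list \<Rightarrow> 'i hclass) \<Rightarrow> (nat \<Rightarrow> 'i hclass list \<Rightarrow> 'i chain) \<Rightarrow> bool" where
  "balanced Z n U X f \<longleftrightarrow> (\<forall>Ms. length Ms = n \<longrightarrow> set Ms \<subseteq> nonzero_diagram_classes Z \<longrightarrow>
     f 1 [X n Ms] - U n Ms = 0 \<longrightarrow> f n Ms = 0)"

end

theory Submission
  imports Defs
begin

text \<open>Viable H-data are analysed one matched pair at a time, and non-viable H-data have no homology: where two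
  strands cover the first step of multiplicity at least two, exchanging their ends is a contracting homotopy.
  In viable H-data the differential resolves the crossings of strands with dotted strands. The homology vanishes
  if at some pair in both idempotents exactly one place is interior to the support. Otherwise a cycle is
  nonzero in homology iff it has an odd number of terms which have no crossings and whose horizontal strands are at
  prescribed places.

  If \<open>X\<^sub>3(M)\<close> is nonzero, the idempotents of the factors match because \<open>f\<^sub>2\<close> is balanced, and
  the result is represented by a tight diagram. The Maslov grading of this diagram exceeds
  that of \<open>M\<close> by one for each critical pair. As \<open>X\<^sub>3\<close> has Maslov degree one, there is exactly
  one critical pair.

  Conversely, at a unique critical pair two adjacent factors, say the first two, have a product whose H-data
  have zero homology, while the H-data of the other two adjacent factors contain no diagrams at all. Hence \<open>U\<^sub>3(M)\<close>
  reduces to \<open>f\<^sub>2(M\<^sub>1 \<otimes> M\<^sub>2) f\<^sub>1(M\<^sub>3)\<close>, where \<open>f\<^sub>2(M\<^sub>1 \<otimes> M\<^sub>2)\<close> is a primitive of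
  \<open>f\<^sub>1(M\<^sub>1) f\<^sub>1(M\<^sub>2)\<close>. The number of crossingless terms of this product is odd: the differential turns
  terms crossed only at the critical pair into terms without crossings of \<open>f\<^sub>1(M\<^sub>1) f\<^sub>1(M\<^sub>2)\<close>, whose number
  is odd, and multiplication by \<open>f\<^sub>1(M\<^sub>3)\<close> removes those crossings.\<close>

text \<open>The maps f_1 and f_2 are arbitrary choices, so their values are unknown sums of
  diagrams. What is known about them is extracted by one linear functional,
  \<open>crossless_count\<close>, and it has to depend on a selected place in each matched pair: a
  tight diagram with a dotted pair has an even number of terms, all without crossings, so an
  unrestricted count modulo two would see nothing. On good H-data any selection yields an invariant
  of homology classes. At the critical pair the product of two adjacent factors has H-data which are
  not good, and there the interior place must be selected. For this selection the count no longer
  vanishes on boundaries, and its value on the boundary of a diagram is exactly what multiplication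
  by the remaining factor sees. The converse direction never needs f_2 itself beyond the matching of
  idempotents; it uses gradings only. Whatever happens at a matched pair depends on the four steps
  at its two places, so the local claims about two or three factors are propositional and are
  decided by exhaustion.\<close>

abbreviation lookup where "lookup \<equiv> Poly_Mapping.lookup"
abbreviation keys where "keys \<equiv> Poly_Mapping.keys"

section \<open>Chains over the field with two elements\<close>

lemma chain_add_self [simp]: "(x::'i chain) + x = 0"
  by (rule poly_mapping_eqI) (simp add: lookup_add)

lemma chain_add_eq_0: "x + y = 0 \<longleftrightarrow> x = (y::'i chain)"
proof
  assume "x + y = 0"
  then have "x + y + y = y" by simp
  then show "x = y" by (simp only: add.assoc chain_add_self add_0_right)
qed simp

lemma chain_minus: "x - y = x + (y::'i chain)"
  using chain_add_eq_0[of "- y" y] by (simp add: diff_conv_add_uminus)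

lemma in_keys_bit: "\<nu> \<in> keys x \<longleftrightarrow> lookup x \<nu> = (1::bit)"
  by (cases "lookup x \<nu>") (auto simp: in_keys_iff)

lemma keys_add_bit: "keys (x + y :: 'i chain) = (keys x - keys y) \<union> (keys y - keys x)"
  by (auto simp: in_keys_bit lookup_add)

text \<open>The linear extension of a function on strand diagrams. The codomain is general because
  the values are chains for the differential and the projections below, but scalars for the count of
  terms.\<close>

definition lin :: "('i strands \<Rightarrow> 'v::comm_monoid_add) \<Rightarrow> 'i chain \<Rightarrow> 'v" where
  "lin g x = (\<Sum>\<nu>\<in>keys x. g \<nu>)"

lemma lin_0 [simp]: "lin g 0 = 0"
  by (simp add: lin_def)

lemma lin_basis [simp]: "lin g (basis \<nu>) = g \<nu>"
  by (simp add: lin_def)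

text \<open>Supports add by symmetric difference, so each common basis element contributes its value
  twice to the right-hand side; the assumption makes such double contributions vanish.\<close>

lemma lin_add:
  assumes "\<And>\<nu>. g \<nu> + g \<nu> = 0"
  shows "lin g (x + y) = lin g x + lin g y"
proof -
  have 1: "sum g (keys x) = sum g (keys x - keys y) + sum g (keys x \<inter> keys y)"
    using sum.Int_Diff[of "keys x" g "keys y"] by (simp add: add.commute)
  have 2: "sum g (keys y) = sum g (keys y - keys x) + sum g (keys x \<inter> keys y)"
    using sum.Int_Diff[of "keys y" g "keys x"] by (simp add: add.commute Int_commute)
  have 3: "sum g (keys x \<inter> keys y) + sum g (keys x \<inter> keys y) = 0"
    by (simp add: assms flip: sum.distrib)
  have "sum g (keys x) + sum g (keys y) = (sum g (keys x - keys y) + sum g (keys y - keys x)) +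
      (sum g (keys x \<inter> keys y) + sum g (keys x \<inter> keys y))"
    unfolding 1 2 by (simp only: ac_simps)
  then have "sum g (keys x) + sum g (keys y) = sum g (keys x - keys y) + sum g (keys y - keys x)"
    by (simp add: 3)
  moreover have "sum g (keys (x + y)) = sum g (keys x - keys y) + sum g (keys y - keys x)"
    unfolding keys_add_bit by (rule sum.union_disjoint) auto
  ultimately show ?thesis by (simp add: lin_def)
qed

lemma lin_sum:
  assumes "\<And>\<nu>. g \<nu> + g \<nu> = 0"
  shows "lin g (\<Sum>i\<in>I. x i) = (\<Sum>i\<in>I. lin g (x i))"
  by (induction I rule: infinite_finite_induct) (simp_all add: lin_add[OF assms])

lemma lin_basis_sum:
  assumes "\<And>\<nu>. g \<nu> + g \<nu> = 0"
  shows "lin g (\<Sum>i\<in>I. basis (m i)) = (\<Sum>i\<in>I. g (m i))"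
  by (simp add: lin_sum[OF assms])

lemma chain_as_sum: "x = (\<Sum>\<nu>\<in>keys x. basis \<nu>)" for x :: "'i chain"
proof (rule poly_mapping_eqI)
  fix \<nu>
  show "lookup x \<nu> = lookup (\<Sum>\<nu>\<in>keys x. basis \<nu>) \<nu>"
    by (cases "lookup x \<nu>") (auto simp: lookup_sum lookup_single when_def sum.delta in_keys_iff)
qed

lemma keys_sum_basis:
  assumes "finite A" "inj_on m A"
  shows "keys (\<Sum>i\<in>A. basis (m i)) = m ` A"
proof -
  have "lookup (\<Sum>i\<in>A. basis (m i)) \<nu> = of_bool (\<nu> \<in> m ` A)" for \<nu>
    using assms
  proof (induction A rule: finite_induct)
    case (insert a A)
    then show ?case by (auto simp: lookup_add lookup_single when_def)
  qed simp
  then show ?thesis by (auto simp: in_keys_bit)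
qed

lemma keys_sum_subset: "keys (\<Sum>i\<in>A. x i :: 'i chain) \<subseteq> (\<Union>i\<in>A. keys (x i))"
  by (induction A rule: infinite_finite_induct) (auto simp: keys_add_bit)

lemma lin_image_subset: "keys (lin g x) \<subseteq> (\<Union>\<nu>\<in>keys x. keys (g \<nu> :: 'i chain))"
  unfolding lin_def by (rule keys_sum_subset)

lemma diff_lin: "diff x = lin diff_strands x"
  by (simp add: diff_def lin_def)

lemma diff_add: "diff (x + y) = diff x + diff y"
  by (simp add: diff_lin lin_add)

lemma diff_0 [simp]: "diff 0 = 0"
  by (simp add: diff_lin)

lemma diff_sum: "diff (\<Sum>i\<in>I. x i) = (\<Sum>i\<in>I. diff (x i))"
  by (simp add: diff_lin lin_sum)

lemma diff_basis: "diff (basis \<nu>) = diff_strands \<nu>"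
  by (simp add: diff_lin)

lemma mult_lin: "x \<odot> y = lin (\<lambda>\<mu>. lin (mult_strands \<mu>) y) x"
  by (simp add: mult_def lin_def)

lemma mult_add_right: "x \<odot> (y + y') = x \<odot> y + x \<odot> y'"
  by (simp add: mult_lin lin_add) (simp add: lin_def sum.distrib)

lemma mult_0_left [simp]: "0 \<odot> y = 0"
  by (simp add: mult_lin)

lemma mult_0_right [simp]: "x \<odot> 0 = 0"
  by (simp add: mult_lin lin_def)

lemma mult_sum_left: "(\<Sum>i\<in>I. x i) \<odot> y = (\<Sum>i\<in>I. x i \<odot> y)"
  by (simp add: mult_lin lin_sum)

lemma mult_sum_right: "x \<odot> (\<Sum>i\<in>I. y i) = (\<Sum>i\<in>I. x \<odot> y i)"
  by (induction I rule: infinite_finite_induct) (auto simp: mult_add_right)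

lemma mult_basis: "basis \<mu> \<odot> basis \<nu> = mult_strands \<mu> \<nu>"
  by (simp add: mult_lin)

section \<open>Linear spans\<close>

lemma span2_0: "0 \<in> span2 B"
  unfolding span2_def by (auto intro!: exI[of _ "{}"])

lemma span2_base: "b \<in> B \<Longrightarrow> b \<in> span2 B"
  unfolding span2_def by (auto intro!: exI[of _ "{b}"])

text \<open>An element of the span is a sum over a set, without multiplicities, so two such sums are
  added by passing to the symmetric difference of the index sets.\<close>

lemma span2_add:
  assumes "x \<in> span2 B" "y \<in> span2 B"
  shows "x + y \<in> span2 B"
proof -
  from assms obtain F G where F: "finite F" "F \<subseteq> B" "x = \<Sum>F" and G: "finite G" "G \<subseteq> B" "y = \<Sum>G"
    by (auto simp: span2_def)
  have 1: "\<Sum>F = \<Sum>(F - G) + \<Sum>(F \<inter> G)"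
    using sum.Int_Diff[OF F(1), of "\<lambda>x. x" G] by (simp add: add.commute)
  have 2: "\<Sum>G = \<Sum>(G - F) + \<Sum>(F \<inter> G)"
    using sum.Int_Diff[OF G(1), of "\<lambda>x. x" F] by (simp add: add.commute Int_commute)
  have "x + y = (\<Sum>(F - G) + \<Sum>(G - F)) + (\<Sum>(F \<inter> G) + \<Sum>(F \<inter> G))"
    unfolding F(3) G(3) 1 2 by (simp only: ac_simps)
  also have "\<dots> = \<Sum>((F - G) \<union> (G - F))"
    using F(1) G(1) by (subst sum.union_disjoint) auto
  finally show ?thesis
    unfolding span2_def using F G by blast
qed

lemma span2_sum: "(\<And>i. i \<in> I \<Longrightarrow> x i \<in> span2 B) \<Longrightarrow> (\<Sum>i\<in>I. x i) \<in> span2 B"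
  by (induction I rule: infinite_finite_induct) (auto simp: span2_0 span2_add)

text \<open>Different data may define the same element while the span sums over elements; one datum
  is therefore selected for each of them.\<close>

lemma span2_imageE:
  assumes "x \<in> span2 {e D | D. Q D}"
  obtains F where "finite F" "\<And>D. D \<in> F \<Longrightarrow> Q D" "x = (\<Sum>D\<in>F. e D)"
proof -
  have "{e D | D. Q D} = e ` {D. Q D}" by auto
  with assms obtain G where G: "finite G" "G \<subseteq> e ` {D. Q D}" "x = \<Sum>G"
    unfolding span2_def by auto
  then obtain F where "F \<subseteq> {D. Q D}" "G = e ` F" "inj_on e F"
    by (metis subset_image_inj)
  with G show ?thesis
    by (intro that[of F]) (auto simp: sum.reindex dest: finite_imageD)
qed

lemma span2_imageI:
  assumes "\<And>D. D \<in> F \<Longrightarrow> Q D"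
  shows "(\<Sum>D\<in>F. e D) \<in> span2 {e D | D. Q D}"
  by (rule span2_sum) (use assms in \<open>auto intro!: span2_base\<close>)

section \<open>The terms of a diagram\<close>

definition plc :: "('i, 'l) arc_diag \<Rightarrow> 'l \<Rightarrow> ('i \<times> nat) set" where
  "plc Z P = {p \<in> places Z. pair_of Z p = P}"

text \<open>The sets \<open>S\<close> whose identity diagrams make up the idempotent of
  \<open>s\<close>; points at infinity are unrestricted.\<close>

definition section_of :: "('i, 'l) arc_diag \<Rightarrow> 'l set \<Rightarrow> ('i \<times> nat) set \<Rightarrow> bool" where
  "section_of Z s S \<longleftrightarrow> S \<subseteq> points Z \<and> (\<forall>P\<in>pairs Z. card (S \<inter> plc Z P) = of_bool (P \<in> s))"

definition moving :: "('i, 'l) arc_diag \<Rightarrow> 'i strands \<Rightarrow> bool" where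
  "moving Z \<mu> \<longleftrightarrow> strand_diagram Z \<mu> \<and> (\<forall>x. (x, x) \<notin> \<mu>)"

text \<open>The sets of horizontal strands which complete the moving strands to a term of the diagram.\<close>

definition fills :: "('i, 'l) arc_diag \<Rightarrow> 'i strands \<Rightarrow> 'l set \<Rightarrow> 'l set \<Rightarrow> ('i \<times> nat) set set" where
  "fills Z \<mu> s t = {V. V \<subseteq> points Z - (Domain \<mu> \<union> Range \<mu>) \<and>
     section_of Z s (Domain \<mu> \<union> V) \<and> section_of Z t (Range \<mu> \<union> V)}"

definition dotted :: "('i, 'l) arc_diag \<Rightarrow> ('i, 'l) diag \<Rightarrow> 'l \<Rightarrow> bool" where
  "dotted Z D P \<longleftrightarrow> (case D of (\<mu>, s, t) \<Rightarrow> P \<in> s \<and> P \<in> t \<and>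
     Domain \<mu> \<inter> plc Z P = {} \<and> Range \<mu> \<inter> plc Z P = {})"

text \<open>The condition at a single pair for the moving strands to be completable to a term.
  Either the pair carries a horizontal strand, or the moving strands alone account for both
  idempotents there.\<close>

definition compat :: "('i, 'l) arc_diag \<Rightarrow> ('i, 'l) diag \<Rightarrow> 'l \<Rightarrow> bool" where
  "compat Z D P \<longleftrightarrow> dotted Z D P \<or> (case D of (\<mu>, s, t) \<Rightarrow>
     card (Domain \<mu> \<inter> plc Z P) = of_bool (P \<in> s) \<and> card (Range \<mu> \<inter> plc Z P) = of_bool (P \<in> t))"

lemma crossings_Id_on [simp]: "crossings (Id_on S) = {}"
  by (auto simp: crossings_def pt_less_def)

lemma inv_num_Id_on [simp]: "inv_num (Id_on S) = 0"
  by (simp add: inv_num_def)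

lemma mult_strands_Id_left: "mult_strands (Id_on S) \<nu> = (if S = Domain \<nu> then basis \<nu> else 0)"
proof -
  have "Id_on (Domain \<nu>) O \<nu> = \<nu>" by auto
  then show ?thesis by (auto simp: mult_strands_def)
qed

lemma mult_strands_Id_right: "mult_strands \<nu> (Id_on S) = (if S = Range \<nu> then basis \<nu> else 0)"
proof -
  have "\<nu> O Id_on (Range \<nu>) = \<nu>" by auto
  then show ?thesis by (auto simp: mult_strands_def)
qed

lemma places_subset_points: "places Z \<subseteq> points Z"
  by (auto simp: places_def points_def)

lemma plc_subset_points: "plc Z P \<subseteq> points Z"
  using places_subset_points by (auto simp: plc_def)

lemma place_in_plc: "p \<in> places Z \<Longrightarrow> p \<in> plc Z (pair_of Z p) \<and> pair_of Z p \<in> pairs Z"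
  by (auto simp: plc_def pairs_def)

lemma Domain_fill [simp]: "Domain (\<mu> \<union> Id_on V) = Domain \<mu> \<union> V"
  by auto

lemma Range_fill [simp]: "Range (\<mu> \<union> Id_on V) = Range \<mu> \<union> V"
  by auto

text \<open>The horizontal strands are the diagonal part of a term and the moving strands the rest,
  so a term determines both.\<close>

lemma fill_inj: 
  assumes "moving Z \<mu>" "moving Z \<mu>'" "\<mu> \<union> Id_on V = \<mu>' \<union> Id_on V'"
  shows "\<mu> = \<mu>'" "V = V'"
proof -
  have irr: "(x, x) \<notin> \<mu>" "(x, x) \<notin> \<mu>'" for x using assms by (cases x; auto simp: moving_def)+
  have "V = {x. (x, x) \<in> \<mu> \<union> Id_on V}" using irr by auto
  also have "\<dots> = V'" unfolding assms(3) using irr by auto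
  finally show "V = V'" .
  have "\<mu> = (\<mu> \<union> Id_on V) - Id" using irr by auto
  also have "\<dots> = \<mu>'" unfolding assms(3) using irr by auto
  finally show "\<mu> = \<mu>'" .
qed

text \<open>These properties pass to the fragment at a matched pair, so that everything proved in
  this locale can also be applied locally.\<close>

locale arc =
  fixes Z :: "('i, 'l) arc_diag"
  assumes finite_intervals: "finite (intervals Z)"
    and card_plc: "P \<in> pairs Z \<Longrightarrow> card (plc Z P) = 2"
begin

lemma finite_points: "finite (points Z)"
proof -
  have "points Z = (SIGMA i:intervals Z. {..nplaces Z i + 1})" by (auto simp: points_def)
  then show ?thesis by (simp add: finite_intervals)
qed

lemma finite_places: "finite (places Z)"
  using finite_subset[OF places_subset_points finite_points] .

lemma finite_plc [simp]: "finite (plc Z P)"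
  using finite_places by (auto simp: plc_def)

lemma finite_pairs: "finite (pairs Z)"
  using finite_places by (simp add: pairs_def)

lemma finite_strands: "strand_diagram Z \<mu> \<Longrightarrow> finite \<mu>"
  unfolding strand_diagram_def using finite_points finite_subset by blast

lemma plc_obtain:
  assumes "P \<in> pairs Z" "p \<in> plc Z P"
  obtains q where "q \<noteq> p" "plc Z P = {p, q}"
proof -
  from card_plc[OF assms(1)] obtain x y where "plc Z P = {x, y}" "x \<noteq> y"
    by (metis card_2_iff)
  with assms(2) that[of x] that[of y] show ?thesis by (auto simp: insert_commute)
qed

lemma finite_sections: "finite {S. section_of Z s S}"
  by (rule finite_subset[of _ "Pow (points Z)"]) (auto simp: section_of_def finite_points)

lemma finite_fills: "finite (fills Z \<mu> s t)"
  by (rule finite_subset[of _ "Pow (points Z)"]) (auto simp: fills_def finite_points)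

lemma idem_eq: "idem Z s = (\<Sum>S | section_of Z s S. basis (Id_on S))"
proof -
  have "{p \<in> S \<inter> places Z. pair_of Z p = P} = S \<inter> plc Z P" for S P by (auto simp: plc_def)
  then show ?thesis by (simp add: idem_def section_of_def of_bool_def)
qed

lemma elt_eq:
  assumes "moving Z \<mu>"
  shows "elt Z (\<mu>, s, t) = (\<Sum>V\<in>fills Z \<mu> s t. basis (\<mu> \<union> Id_on V))"
proof -
  let ?W = "Pow (points Z - (Domain \<mu> \<union> Range \<mu>))"
  let ?b = "\<lambda>V. basis (\<mu> \<union> Id_on V)"
  have fin: "finite ?W" by (simp add: finite_points)
  have 1: "idem Z s \<odot> ?b V = (if section_of Z s (Domain \<mu> \<union> V) then ?b V else 0)" for V
    by (simp add: idem_eq mult_sum_left mult_basis mult_strands_Id_left if_distrib[of "\<lambda>x. _ = x"]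
        finite_sections sum.delta cong: if_cong)
  have 2: "?b V \<odot> idem Z t = (if section_of Z t (Range \<mu> \<union> V) then ?b V else 0)" for V
    by (simp add: idem_eq mult_sum_right mult_basis mult_strands_Id_right
        finite_sections sum.delta cong: if_cong)
  have "elt Z (\<mu>, s, t) = (\<Sum>V\<in>?W. (idem Z s \<odot> ?b V) \<odot> idem Z t)"
    by (simp add: elt_def add_horizontals_def mult_sum_right mult_sum_left)
  also have "\<dots> = (\<Sum>V\<in>?W. if V \<in> fills Z \<mu> s t then ?b V else 0)"
    by (rule sum.cong) (auto simp: 1 2 fills_def)
  also have "\<dots> = (\<Sum>V\<in>?W \<inter> fills Z \<mu> s t. ?b V)"
    using fin by (simp add: sum.inter_restrict)
  also have "?W \<inter> fills Z \<mu> s t = fills Z \<mu> s t" by (auto simp: fills_def)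
  finally show ?thesis .
qed

lemma keys_elt:
  assumes "moving Z \<mu>"
  shows "keys (elt Z (\<mu>, s, t)) = (\<lambda>V. \<mu> \<union> Id_on V) ` fills Z \<mu> s t"
  unfolding elt_eq[OF assms]
  by (rule keys_sum_basis[OF finite_fills]) (use fill_inj[OF assms assms] in \<open>auto simp: inj_on_def\<close>)

lemma lin_elt:
  assumes "moving Z \<mu>" "\<And>\<nu>. g \<nu> + g \<nu> = 0"
  shows "lin g (elt Z (\<mu>, s, t)) = (\<Sum>V\<in>fills Z \<mu> s t. g (\<mu> \<union> Id_on V))"
  by (simp add: elt_eq[OF assms(1)] lin_basis_sum[OF assms(2)])

text \<open>A horizontal strand contributes the same place to both ends, and each end has at most
  one place of the pair. Hence either the horizontal strand uses up the pair and no moving strand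
  touches it, or the moving strands match the idempotents by themselves.\<close>

lemma fill_at_pair:
  assumes "V \<in> fills Z \<mu> s t" "P \<in> pairs Z"
  shows "if dotted Z (\<mu>, s, t) P then card (V \<inter> plc Z P) = 1
    else V \<inter> plc Z P = {} \<and> compat Z (\<mu>, s, t) P"
proof -
  have V: "V \<inter> Domain \<mu> = {}" "V \<inter> Range \<mu> = {}" using assms by (auto simp: fills_def)
  have fin: "finite (V \<inter> plc Z P)" "finite (Domain \<mu> \<inter> plc Z P)" "finite (Range \<mu> \<inter> plc Z P)" by auto
  have "card ((Domain \<mu> \<union> V) \<inter> plc Z P) = of_bool (P \<in> s)" "card ((Range \<mu> \<union> V) \<inter> plc Z P) = of_bool (P \<in> t)"
    using assms by (auto simp: fills_def section_of_def)
  moreover have "(Domain \<mu> \<union> V) \<inter> plc Z P = (Domain \<mu> \<inter> plc Z P) \<union> (V \<inter> plc Z P)"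
    "(Range \<mu> \<union> V) \<inter> plc Z P = (Range \<mu> \<inter> plc Z P) \<union> (V \<inter> plc Z P)" by auto
  ultimately have "card (Domain \<mu> \<inter> plc Z P) + card (V \<inter> plc Z P) = of_bool (P \<in> s)"
    "card (Range \<mu> \<inter> plc Z P) + card (V \<inter> plc Z P) = of_bool (P \<in> t)"
    using V fin by (subst card_Un_disjoint[symmetric]; auto)+
  then show ?thesis
    using fin unfolding dotted_def compat_def
    by (cases "P \<in> s"; cases "P \<in> t"; cases "card (V \<inter> plc Z P)") auto
qed

lemma fills_iff:
  "V \<in> fills Z \<mu> s t \<longleftrightarrow> strand_diagram Z \<mu> \<and> V \<subseteq> points Z - (Domain \<mu> \<union> Range \<mu>) \<and>
    (\<forall>P\<in>pairs Z. if dotted Z (\<mu>, s, t) P then card (V \<inter> plc Z P) = 1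
      else V \<inter> plc Z P = {} \<and> compat Z (\<mu>, s, t) P)"
  if "strand_diagram Z \<mu>"
proof
  assume "V \<in> fills Z \<mu> s t"
  then show "strand_diagram Z \<mu> \<and> V \<subseteq> points Z - (Domain \<mu> \<union> Range \<mu>) \<and>
    (\<forall>P\<in>pairs Z. if dotted Z (\<mu>, s, t) P then card (V \<inter> plc Z P) = 1
      else V \<inter> plc Z P = {} \<and> compat Z (\<mu>, s, t) P)"
    using fill_at_pair[of V \<mu> s t] that by (auto simp: fills_def split: if_splits)
next
  assume R: "strand_diagram Z \<mu> \<and> V \<subseteq> points Z - (Domain \<mu> \<union> Range \<mu>) \<and>
    (\<forall>P\<in>pairs Z. if dotted Z (\<mu>, s, t) P then card (V \<inter> plc Z P) = 1
      else V \<inter> plc Z P = {} \<and> compat Z (\<mu>, s, t) P)"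
  have dr: "Domain \<mu> \<subseteq> points Z" "Range \<mu> \<subseteq> points Z" using that by (auto simp: strand_diagram_def)
  have "card ((Domain \<mu> \<union> V) \<inter> plc Z P) = of_bool (P \<in> s) \<and> card ((Range \<mu> \<union> V) \<inter> plc Z P) = of_bool (P \<in> t)"
    if "P \<in> pairs Z" for P
  proof (cases "dotted Z (\<mu>, s, t) P")
    case True
    then have "(Domain \<mu> \<union> V) \<inter> plc Z P = V \<inter> plc Z P" "(Range \<mu> \<union> V) \<inter> plc Z P = V \<inter> plc Z P" "P \<in> s" "P \<in> t"
      by (auto simp: dotted_def)
    then show ?thesis using R that True by simp
  next
    case False
    then have "V \<inter> plc Z P = {}" and c: "compat Z (\<mu>, s, t) P" using R that by auto
    then have "(Domain \<mu> \<union> V) \<inter> plc Z P = Domain \<mu> \<inter> plc Z P" "(Range \<mu> \<union> V) \<inter> plc Z P = Range \<mu> \<inter> plc Z P"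
      by auto
    then show ?thesis using c False by (auto simp: compat_def)
  qed
  then show "V \<in> fills Z \<mu> s t" using R dr by (auto simp: fills_def section_of_def)
qed

text \<open>The completion in which every horizontal strand of a dotted pair is at the place
  selected by \<open>can\<close>. It singles out one term of each diagram.\<close>

definition can_fill :: "('l \<Rightarrow> 'i \<times> nat) \<Rightarrow> ('i, 'l) diag \<Rightarrow> ('i \<times> nat) set" where
  "can_fill can D = can ` {P \<in> pairs Z. dotted Z D P}"

definition choice :: "('l \<Rightarrow> 'i \<times> nat) \<Rightarrow> bool" where
  "choice can \<longleftrightarrow> (\<forall>P\<in>pairs Z. can P \<in> plc Z P)"

lemma can_fill_at:
  assumes "choice can" "P \<in> pairs Z"
  shows "can_fill can D \<inter> plc Z P = (if dotted Z D P then {can P} else {})"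
  using assms by (auto simp: can_fill_def choice_def plc_def)

lemma can_fill_in_fills:
  assumes "strand_diagram Z \<mu>" "choice can" "\<And>P. P \<in> pairs Z \<Longrightarrow> compat Z (\<mu>, s, t) P"
  shows "can_fill can (\<mu>, s, t) \<in> fills Z \<mu> s t"
proof -
  have "can_fill can (\<mu>, s, t) \<subseteq> points Z - (Domain \<mu> \<union> Range \<mu>)"
  proof
    fix x assume "x \<in> can_fill can (\<mu>, s, t)"
    then obtain P where "P \<in> pairs Z" "dotted Z (\<mu>, s, t) P" "x = can P" by (auto simp: can_fill_def)
    then show "x \<in> points Z - (Domain \<mu> \<union> Range \<mu>)"
      using assms(2) plc_subset_points unfolding choice_def dotted_def by fastforce
  qed
  then show ?thesis
    using assms by (simp add: fills_iff can_fill_at)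
qed

lemma ex_choice: "\<exists>can. choice can"
proof -
  have "\<forall>P\<in>pairs Z. \<exists>p. p \<in> plc Z P" by (auto simp: pairs_def plc_def)
  then show ?thesis unfolding choice_def by metis
qed

lemma fills_ne_iff:
  assumes "strand_diagram Z \<mu>"
  shows "fills Z \<mu> s t \<noteq> {} \<longleftrightarrow> (\<forall>P\<in>pairs Z. compat Z (\<mu>, s, t) P)"
proof
  assume "fills Z \<mu> s t \<noteq> {}"
  then show "\<forall>P\<in>pairs Z. compat Z (\<mu>, s, t) P"
    using fill_at_pair[of _ \<mu> s t] by (fastforce simp: compat_def split: if_splits)
next
  assume "\<forall>P\<in>pairs Z. compat Z (\<mu>, s, t) P"
  then show "fills Z \<mu> s t \<noteq> {}" using ex_choice can_fill_in_fills assms by blast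
qed

text \<open>Different completions give different terms, so nothing cancels in the element, and it is
  nonzero as soon as one completion exists; this can be tested pair by pair.\<close>

lemma diagram_iff:
  "diagram Z (\<mu>, s, t) \<longleftrightarrow> moving Z \<mu> \<and> s \<subseteq> pairs Z \<and> t \<subseteq> pairs Z \<and> (\<forall>P\<in>pairs Z. compat Z (\<mu>, s, t) P)"
proof -
  have "elt Z (\<mu>, s, t) \<noteq> 0 \<longleftrightarrow> (\<forall>P\<in>pairs Z. compat Z (\<mu>, s, t) P)" if "moving Z \<mu>"
  proof -
    have "elt Z (\<mu>, s, t) = 0 \<longleftrightarrow> fills Z \<mu> s t = {}"
      using keys_elt[OF that, of s t] keys_eq_empty[of "elt Z (\<mu>, s, t)"] by simp
    then show ?thesis using fills_ne_iff that by (auto simp: moving_def)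
  qed
  then show ?thesis by (auto simp: diagram_def moving_def)
qed

end

section \<open>The square of the differential\<close>

text \<open>Strand diagrams with fixed sources in functional form: a resolution becomes the exchange
  of two values, and the square of the differential a statement about products of
  transpositions.\<close>

definition graph_on :: "('i \<times> nat) set \<Rightarrow> ('i \<times> nat \<Rightarrow> 'i \<times> nat) \<Rightarrow> 'i strands" where
  "graph_on D g = (\<lambda>u. (u, g u)) ` D"

definition exchange :: "'a \<Rightarrow> 'a \<Rightarrow> ('a \<Rightarrow> 'b) \<Rightarrow> 'a \<Rightarrow> 'b" where
  "exchange x y g = g(x := g y, y := g x)"

definition inverted :: "('i \<times> nat) set \<Rightarrow> ('i \<times> nat \<Rightarrow> 'i \<times> nat) \<Rightarrow> 'i \<times> nat \<Rightarrow> 'i \<times> nat \<Rightarrow> bool" where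
  "inverted D g u v \<longleftrightarrow> u \<in> D \<and> v \<in> D \<and> pt_less u v \<and> pt_less (g v) (g u)"

definition between :: "('i \<times> nat) set \<Rightarrow> ('i \<times> nat \<Rightarrow> 'i \<times> nat) \<Rightarrow> 'i \<times> nat \<Rightarrow> 'i \<times> nat \<Rightarrow> ('i \<times> nat) set" where
  "between D g x y = {z \<in> D. pt_less x z \<and> pt_less z y \<and> pt_less (g y) (g z) \<and> pt_less (g z) (g x)}"

definition interval_inj :: "('i \<times> nat) set \<Rightarrow> ('i \<times> nat \<Rightarrow> 'i \<times> nat) \<Rightarrow> bool" where
  "interval_inj D g \<longleftrightarrow> finite D \<and> inj_on g D \<and> (\<forall>u\<in>D. fst (g u) = fst u)"

lemma crossings_graph_on:
  "crossings (graph_on D g) = (\<lambda>(x, y). ((x, g x), (y, g y))) ` {(x, y). inverted D g x y}"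
  by (auto simp: crossings_def graph_on_def inverted_def)

lemma inv_num_graph_on:
  assumes "finite D"
  shows "inv_num (graph_on D g) = (\<Sum>u\<in>D. \<Sum>v\<in>D. of_bool (pt_less u v \<and> pt_less (g v) (g u)))"
proof -
  have "inv_num (graph_on D g) = card {(x, y). inverted D g x y}"
    unfolding inv_num_def crossings_graph_on by (rule card_image) (auto simp: inj_on_def)
  also have "{(x, y). inverted D g x y} = (SIGMA u:D. {v\<in>D. pt_less u v \<and> pt_less (g v) (g u)})"
    by (auto simp: inverted_def)
  also have "card \<dots> = (\<Sum>u\<in>D. card {v\<in>D. pt_less u v \<and> pt_less (g v) (g u)})"
    using assms by simp
  also have "\<dots> = (\<Sum>u\<in>D. \<Sum>v\<in>D. of_bool (pt_less u v \<and> pt_less (g v) (g u)))"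
    using assms by (simp add: of_bool_def sum.If_cases Int_def)
  finally show ?thesis .
qed

lemma resolve_graph_on:
  assumes "inverted D g x y"
  shows "resolve (graph_on D g) ((x, g x), (y, g y)) = graph_on D (exchange x y g)"
proof -
  have "x \<noteq> y" "x \<in> D" "y \<in> D" using assms by (auto simp: inverted_def pt_less_def)
  show ?thesis
  proof (rule set_eqI)
    fix q :: "('a \<times> nat) \<times> ('a \<times> nat)"
    obtain u w where q: "q = (u, w)" by (cases q)
    have m: "(u, w) \<in> graph_on D g \<longleftrightarrow> u \<in> D \<and> w = g u" for u w and g :: "'a \<times> nat \<Rightarrow> 'a \<times> nat"
      by (auto simp: graph_on_def)
    show "q \<in> resolve (graph_on D g) ((x, g x), (y, g y)) \<longleftrightarrow> q \<in> graph_on D (exchange x y g)"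
      unfolding q resolve_def exchange_def prod.case Un_iff Diff_iff m insert_iff empty_iff prod.inject
      using \<open>x \<noteq> y\<close> \<open>x \<in> D\<close> \<open>y \<in> D\<close>
      by (cases "u = x"; cases "u = y") simp_all
  qed
qed

lemma exchange_interval_inj:
  assumes "interval_inj D g" "inverted D g x y"
  shows "interval_inj D (exchange x y g)"
proof -
  have xy: "x \<in> D" "y \<in> D" "fst x = fst y" using assms by (auto simp: inverted_def pt_less_def)
  then have "inj_on (exchange x y g) D"
    using assms(1) unfolding interval_inj_def inj_on_def exchange_def by (auto split: if_splits)
  then show ?thesis using assms(1) xy by (auto simp: interval_inj_def exchange_def)
qed

text \<open>Each side counts the inversions of \<open>z\<close> with \<open>x\<close> and with
  \<open>y\<close>, before and after the exchange. Comparing the positions of \<open>z\<close> and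
  \<open>g z\<close> with those of the two strands, the counts differ only if \<open>z\<close> lies
  strictly between them on both sides; then \<open>z\<close> crosses both strands before and neither
  afterwards.\<close>

lemma drop_point:
  assumes "interval_inj D g" "inverted D g x y" "z \<in> D" "z \<noteq> x" "z \<noteq> y"
  defines "h \<equiv> exchange x y g"
  shows "of_bool (pt_less z x \<and> pt_less (g x) (g z)) + of_bool (pt_less z y \<and> pt_less (g y) (g z)) +
      (of_bool (pt_less x z \<and> pt_less (g z) (g x)) + of_bool (pt_less y z \<and> pt_less (g z) (g y))) =
      of_bool (pt_less z x \<and> pt_less (h x) (h z)) + of_bool (pt_less z y \<and> pt_less (h y) (h z)) +
      (of_bool (pt_less x z \<and> pt_less (h z) (h x)) + of_bool (pt_less y z \<and> pt_less (h z) (h y))) +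
      2 * (of_bool (z \<in> between D g x y) :: nat)"
proof -
  have D: "x \<in> D" "y \<in> D" "fst x = fst y" "snd x < snd y" "fst (g x) = fst x" "fst (g y) = fst y"
     "snd (g y) < snd (g x)" "fst (g z) = fst z"
    using assms by (auto simp: inverted_def pt_less_def interval_inj_def)
  have h: "h x = g y" "h y = g x" "h z = g z" using assms by (auto simp: h_def exchange_def)
  show ?thesis
  proof (cases "fst z = fst x")
    case False
    then show ?thesis using D by (simp add: h pt_less_def between_def)
  next
    case True
    have "g z \<noteq> g x" "g z \<noteq> g y" using assms D by (auto simp: interval_inj_def inj_on_def)
    then have "snd (g z) \<noteq> snd (g x)" "snd (g z) \<noteq> snd (g y)" "snd z \<noteq> snd x" "snd z \<noteq> snd y"
      using D True assms by (auto simp: prod_eq_iff)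
    then have o: "snd (g z) < snd (g y) \<or> (snd (g y) < snd (g z) \<and> snd (g z) < snd (g x)) \<or> snd (g x) < snd (g z)"
      "snd z < snd x \<or> (snd x < snd z \<and> snd z < snd y) \<or> snd y < snd z" by auto
    have simp1: "pt_less z x \<longleftrightarrow> snd z < snd x" "pt_less z y \<longleftrightarrow> snd z < snd y"
      "pt_less x z \<longleftrightarrow> snd x < snd z" "pt_less y z \<longleftrightarrow> snd y < snd z"
      "pt_less (g x) (g z) \<longleftrightarrow> snd (g x) < snd (g z)" "pt_less (g y) (g z) \<longleftrightarrow> snd (g y) < snd (g z)"
      "pt_less (g z) (g x) \<longleftrightarrow> snd (g z) < snd (g x)" "pt_less (g z) (g y) \<longleftrightarrow> snd (g z) < snd (g y)"
      using True D by (auto simp: pt_less_def)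
    show ?thesis
      unfolding h between_def mem_Collect_eq simp1 using o D(4,7) \<open>z \<in> D\<close> by (elim disjE conjE) auto
  qed
qed

lemma sum_two_points:
  assumes "finite D" "x \<in> D" "y \<in> D" "x \<noteq> y"
  shows "(\<Sum>u\<in>D. \<Sum>v\<in>D. f u v) = (\<Sum>u\<in>D - {x, y}. \<Sum>v\<in>D - {x, y}. f u v) +
    (\<Sum>z\<in>D - {x, y}. f z x + f z y + (f x z + f y z)) + (f x x + f x y + f y x + (f y y :: nat))"
proof -
  have D: "D = insert x (insert y (D - {x, y}))" using assms by auto
  have s: "sum g D = g x + g y + sum g (D - {x, y})" for g :: "'a \<Rightarrow> nat"
    by (subst D, subst sum.insert, use assms in auto)
  show ?thesis
    by (simp add: s sum.distrib)
qed

text \<open>Inversions away from \<open>x\<close> and \<open>y\<close> are untouched, the one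
  between \<open>x\<close> and \<open>y\<close> disappears, and \<open>drop_point\<close> accounts
  for every third strand. In particular a resolution lowers the number of crossings by exactly one
  iff no strand lies between the two.\<close>

lemma inv_num_exchange:
  assumes "interval_inj D g" "inverted D g x y"
  shows "inv_num (graph_on D g) = inv_num (graph_on D (exchange x y g)) + 1 + 2 * card (between D g x y)"
proof -
  let ?h = "exchange x y g" and ?R = "D - {x, y}"
  let ?f = "\<lambda>g u v. of_bool (pt_less u v \<and> pt_less (g v) (g u)) :: nat"
  have fin: "finite D" and xy: "x \<in> D" "y \<in> D" "x \<noteq> y" "pt_less x y" "\<not> pt_less y x" "pt_less (g y) (g x)" "\<not> pt_less (g x) (g y)"
    using assms by (auto simp: interval_inj_def inverted_def pt_less_def)
  have irr: "\<not> pt_less a a" for a :: "'a \<times> nat" by (simp add: pt_less_def)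
  have 0: "?h x = g y" "?h y = g x" using xy by (auto simp: exchange_def)
  have 1: "(\<Sum>u\<in>?R. \<Sum>v\<in>?R. ?f g u v) = (\<Sum>u\<in>?R. \<Sum>v\<in>?R. ?f ?h u v)"
    by (intro sum.cong) (auto simp: exchange_def)
  have "(\<Sum>z\<in>?R. of_bool (z \<in> between D g x y)) = card (between D g x y)"
  proof -
    have "?R \<inter> between D g x y = between D g x y" by (auto simp: between_def pt_less_def)
    then show ?thesis using fin by (simp add: of_bool_def sum.If_cases)
  qed
  moreover have 2: "(\<Sum>z\<in>?R. ?f g z x + ?f g z y + (?f g x z + ?f g y z)) =
      (\<Sum>z\<in>?R. ?f ?h z x + ?f ?h z y + (?f ?h x z + ?f ?h y z)) + 2 * (\<Sum>z\<in>?R. of_bool (z \<in> between D g x y))"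
    unfolding sum_distrib_left sum.distrib[symmetric]
    by (rule sum.cong) (use drop_point[OF assms] in auto)
  ultimately have 3: "(\<Sum>z\<in>?R. ?f g z x + ?f g z y + (?f g x z + ?f g y z)) =
      (\<Sum>z\<in>?R. ?f ?h z x + ?f ?h z y + (?f ?h x z + ?f ?h y z)) + 2 * card (between D g x y)" by simp
  have 4: "?f g x x + ?f g x y + ?f g y x + ?f g y y = 1" "?f ?h x x + ?f ?h x y + ?f ?h y x + ?f ?h y y = 0"
    using xy irr by (auto simp: 0)
  show ?thesis
    unfolding inv_num_graph_on[OF fin] sum_two_points[OF fin xy(1-3)] 1 3 4 by simp
qed

lemma sum_involution_0:
  fixes G :: "'a \<Rightarrow> 'b::comm_monoid_add"
  assumes "finite Q" "\<And>q. q \<in> Q \<Longrightarrow> \<iota> q \<in> Q \<and> \<iota> q \<noteq> q \<and> \<iota> (\<iota> q) = q \<and> G (\<iota> q) = G q"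
    and "\<And>b::'b. b + b = 0"
  shows "sum G Q = 0"
  using assms(1,2)
proof (induction Q rule: finite_psubset_induct)
  case (psubset Q)
  show ?case
  proof (cases "Q = {}")
    case False
    then obtain q where q: "q \<in> Q" by blast
    note i = psubset.prems[OF q]
    let ?R = "Q - {q, \<iota> q}"
    have "sum G ?R = 0"
    proof (rule psubset.IH)
      show "?R \<subset> Q" using q by auto
      fix r assume "r \<in> ?R"
      then have r: "r \<in> Q" "r \<noteq> q" "r \<noteq> \<iota> q" by auto
      note j = psubset.prems[OF r(1)]
      have "\<iota> r \<noteq> q" using j r i by metis
      moreover have "\<iota> r \<noteq> \<iota> q" using j r i by metis
      ultimately show "\<iota> r \<in> ?R \<and> \<iota> r \<noteq> r \<and> \<iota> (\<iota> r) = r \<and> G (\<iota> r) = G r" using j by auto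
    qed
    moreover have "Q = insert q (insert (\<iota> q) ?R)" using q i by auto
    then have "sum G Q = G q + (G (\<iota> q) + sum G ?R)"
      using psubset.hyps i by (metis (no_types, lifting) DiffE finite_Diff insertCI insertE sum.insert finite.insertI)
    ultimately show ?thesis using i assms(3) by simp
  qed simp
qed

text \<open>Pairs of successive resolutions, each given by the two sources involved. Two resolutions with
  disjoint sources commute. If they share one source, they can be exchanged for exactly one of the
  two other factorisations \<open>\<tau>\<^sub>1\<tau>\<^sub>2 = \<tau>\<^sub>2\<tau>\<^sub>3 = \<tau>\<^sub>3\<tau>\<^sub>1\<close> of the same three-cycle.\<close>

definition two_step :: "('i \<times> nat) set \<Rightarrow> ('i \<times> nat \<Rightarrow> 'i \<times> nat) \<Rightarrow>
    ((('i \<times> nat) \<times> ('i \<times> nat)) \<times> (('i \<times> nat) \<times> ('i \<times> nat))) set" where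
  "two_step D g = {((x, y), (u, v)). inverted D g x y \<and> inverted D (exchange x y g) u v \<and>
     inv_num (graph_on D (exchange u v (exchange x y g))) + 2 = inv_num (graph_on D g)}"

definition sorted_pair :: "'i \<times> nat \<Rightarrow> 'i \<times> nat \<Rightarrow> ('i \<times> nat) \<times> ('i \<times> nat)" where
  "sorted_pair x y = (if pt_less x y then (x, y) else (y, x))"

text \<open>For two transpositions with exactly one common point, the third transposition of the
  same three points, which is the conjugate of either by the other. The pair is sorted since
  resolutions are recorded with the smaller source first.\<close>

definition third :: "('i \<times> nat) \<times> ('i \<times> nat) \<Rightarrow> ('i \<times> nat) \<times> ('i \<times> nat) \<Rightarrow> ('i \<times> nat) \<times> ('i \<times> nat)" where
  "third a b = (case (a, b) of ((x, y), (u, v)) \<Rightarrow>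
     if x = u then sorted_pair y v else if x = v then sorted_pair y u
     else if y = u then sorted_pair x v else sorted_pair x u)"

definition partner where
  "partner D g q = (case q of ((x, y), (u, v)) \<Rightarrow>
     if {x, y} \<inter> {u, v} = {} then ((u, v), (x, y))
     else if ((u, v), third (x, y) (u, v)) \<in> two_step D g then ((u, v), third (x, y) (u, v))
     else (third (x, y) (u, v), (x, y)))"

text \<open>The six ordered pairs of distinct transpositions of three points fall into two groups of
  three with equal products. In each group either none or exactly two pairs consist of successive
  resolutions, which is what makes the pairing possible. The condition on the number of crossings
  depends only on the product, hence is common to a group, and only the order of the three values
  remains to be compared.\<close>

lemma two_step_triple:
  assumes "interval_inj D g" "a \<in> D" "b \<in> D" "c \<in> D" "pt_less a b" "pt_less b c"
  defines "T \<equiv> two_step D g"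
  shows "((b, c), (a, b)) \<in> T \<longleftrightarrow> (((a, b), (a, c)) \<in> T) \<noteq> (((a, c), (b, c)) \<in> T)"
    "\<not> (((a, b), (a, c)) \<in> T \<and> ((a, c), (b, c)) \<in> T)"
    "((a, b), (b, c)) \<in> T \<longleftrightarrow> (((a, c), (a, b)) \<in> T) \<noteq> (((b, c), (a, c)) \<in> T)"
    "\<not> (((a, c), (a, b)) \<in> T \<and> ((b, c), (a, c)) \<in> T)"
proof -
  have i: "fst b = fst a" "fst c = fst a" "snd a < snd b" "snd b < snd c" using assms by (auto simp: pt_less_def)
  have ne: "a \<noteq> b" "b \<noteq> c" "a \<noteq> c" using i by auto
  have g: "fst (g a) = fst a" "fst (g b) = fst a" "fst (g c) = fst a" using assms i by (auto simp: interval_inj_def)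
  have "g a \<noteq> g b" "g b \<noteq> g c" "g a \<noteq> g c" using assms ne by (auto simp: interval_inj_def inj_on_def)
  then have gn: "snd (g a) \<noteq> snd (g b)" "snd (g b) \<noteq> snd (g c)" "snd (g a) \<noteq> snd (g c)"
    using g by (auto simp: prod_eq_iff)
  have e1: "exchange b c (exchange a c g) = exchange a c (exchange a b g)"
    "exchange a b (exchange b c g) = exchange a c (exchange a b g)"
    using ne by (auto simp: exchange_def fun_eq_iff)
  have e2: "exchange b c (exchange a b g) = exchange a b (exchange a c g)"
    "exchange a c (exchange b c g) = exchange a b (exchange a c g)"
    using ne by (auto simp: exchange_def fun_eq_iff)
  have m: "inverted D h u v \<longleftrightarrow> u \<in> D \<and> v \<in> D \<and> fst u = fst v \<and> snd u < snd v \<and> fst (h v) = fst (h u) \<and> snd (h v) < snd (h u)" for h u v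
    by (auto simp: inverted_def pt_less_def)
  have ex: "exchange x y g z = (if z = y then g x else if z = x then g y else g z)" for x y z
    by (simp add: exchange_def)
  show "((b, c), (a, b)) \<in> T \<longleftrightarrow> (((a, b), (a, c)) \<in> T) \<noteq> (((a, c), (b, c)) \<in> T)"
    "\<not> (((a, b), (a, c)) \<in> T \<and> ((a, c), (b, c)) \<in> T)"
    "((a, b), (b, c)) \<in> T \<longleftrightarrow> (((a, c), (a, b)) \<in> T) \<noteq> (((b, c), (a, c)) \<in> T)"
    "\<not> (((a, c), (a, b)) \<in> T \<and> ((b, c), (a, c)) \<in> T)"
    unfolding T_def two_step_def mem_Collect_eq prod.case e1 e2 m
    using assms(2-4) i ne g gn by (auto simp: ex)
qed

lemma partner_two_step:
  assumes "interval_inj D g" "q \<in> two_step D g"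
  shows "partner D g q \<in> two_step D g" "partner D g q \<noteq> q" "partner D g (partner D g q) = q"
    "(case partner D g q of ((x, y), (u, v)) \<Rightarrow> exchange u v (exchange x y g)) =
     (case q of ((x, y), (u, v)) \<Rightarrow> exchange u v (exchange x y g))"
proof -
  obtain x y u v where q: "q = ((x, y), (u, v))" by (metis surj_pair)
  let ?T = "two_step D g"
  have inv: "inverted D g x y" "inverted D (exchange x y g) u v"
     "inv_num (graph_on D (exchange u v (exchange x y g))) + 2 = inv_num (graph_on D g)"
    using assms(2) by (auto simp: q two_step_def)
  have xy: "x \<in> D" "y \<in> D" "pt_less x y" "x \<noteq> y" "\<not> pt_less y x" and uv: "u \<in> D" "v \<in> D" "pt_less u v" "u \<noteq> v" "\<not> pt_less v u"
    using inv by (auto simp: inverted_def pt_less_def)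
  have lin: "pt_less a b \<or> pt_less b a" if "fst a = fst b" "a \<noteq> b" for a b :: "'a \<times> nat"
    using that by (cases a; cases b) (auto simp: pt_less_def)
  have tr: "pt_less a c" if "pt_less a b" "pt_less b c" for a b c :: "'a \<times> nat" using that by (auto simp: pt_less_def)
  have ns: "\<not> pt_less b a" "a \<noteq> b" "b \<noteq> a" if "pt_less a b" for a b :: "'a \<times> nat" using that by (auto simp: pt_less_def)
  have goal: "partner D g q \<in> two_step D g \<and> partner D g q \<noteq> q \<and> partner D g (partner D g q) = q \<and>
    (case partner D g q of ((x, y), (u, v)) \<Rightarrow> exchange u v (exchange x y g)) =
     (case q of ((x, y), (u, v)) \<Rightarrow> exchange u v (exchange x y g))"
  proof (cases "{x, y} \<inter> {u, v} = {}")
    case True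
    have 1: "exchange u v g = (\<lambda>z. if z = u then g v else if z = v then g u else g z)" 
      using uv by (auto simp: exchange_def)
    have e: "exchange x y (exchange u v g) = exchange u v (exchange x y g)"
      using True xy uv by (auto simp: exchange_def fun_eq_iff)
    have "inverted D g u v" "inverted D (exchange u v g) x y"
      using inv True by (auto simp: inverted_def exchange_def)
    then have "((u, v), (x, y)) \<in> ?T" using inv(3) by (simp add: two_step_def e)
    then show ?thesis using True xy e by (auto simp: q partner_def)
  next
    case False
    \<comment> \<open>The same two sources cannot be used twice, since after the exchange their
      values are in increasing order.\<close>
    have ndup: "\<not> (x = u \<and> y = v)"
    proof
      assume "x = u \<and> y = v"
      then have "pt_less (g x) (g y)" using inv(2) xy by (simp add: inverted_def exchange_def)
      then show False using inv(1) by (simp add: inverted_def pt_less_def)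
    qed
    \<comment> \<open>The common source, together with the order of the other two, identifies one of
      the six pairs in \<open>two_step_triple\<close>.\<close>
    consider (a) "x = u" "pt_less y v" | (b) "x = u" "pt_less v y" | (c) "x = v" | (d) "y = u" 
      | (e) "y = v" "pt_less x u" | (f) "y = v" "pt_less u x"
      using False ndup xy uv lin[of y v] lin[of x u] by (auto simp: pt_less_def) 
    then show ?thesis
    proof cases
      case a
      with two_step_triple[OF assms(1), of x y v] assms(2) xy uv tr[of x y v] ns[of y v] show ?thesis
        by (auto simp: q partner_def third_def sorted_pair_def exchange_def fun_eq_iff)
    next
      case b
      with two_step_triple[OF assms(1), of x v y] assms(2) xy uv tr[of x v y] ns[of v y] show ?thesis
        by (auto simp: q partner_def third_def sorted_pair_def exchange_def fun_eq_iff)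
    next
      case c
      with two_step_triple[OF assms(1), of u x y] assms(2) xy uv tr[of u x y] ns[of u y] show ?thesis
        by (auto simp: q partner_def third_def sorted_pair_def exchange_def fun_eq_iff)
    next
      case d
      with two_step_triple[OF assms(1), of x y v] assms(2) xy uv tr[of x y v] ns[of x v] show ?thesis
        by (auto simp: q partner_def third_def sorted_pair_def exchange_def fun_eq_iff)
    next
      case e
      with two_step_triple[OF assms(1), of x u y] assms(2) xy uv tr[of x u y] ns[of x u] show ?thesis
        by (auto simp: q partner_def third_def sorted_pair_def exchange_def fun_eq_iff)
    next
      case f
      with two_step_triple[OF assms(1), of u x y] assms(2) xy uv tr[of u x y] ns[of u x] show ?thesis
        by (auto simp: q partner_def third_def sorted_pair_def exchange_def fun_eq_iff)
    qed
  qed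
  then show "partner D g q \<in> two_step D g" "partner D g q \<noteq> q" "partner D g (partner D g q) = q"
    "(case partner D g q of ((x, y), (u, v)) \<Rightarrow> exchange u v (exchange x y g)) =
     (case q of ((x, y), (u, v)) \<Rightarrow> exchange u v (exchange x y g))" by auto
qed

definition simple_inversions where
  "simple_inversions D g = {(x, y). inverted D g x y \<and>
     inv_num (graph_on D (exchange x y g)) + 1 = inv_num (graph_on D g)}"

lemma finite_simple_inversions: "finite D \<Longrightarrow> finite (simple_inversions D g)"
  by (rule finite_subset[of _ "D \<times> D"]) (auto simp: simple_inversions_def inverted_def)

lemma diff_graph_on:
  "diff (basis (graph_on D g)) = (\<Sum>(x, y)\<in>simple_inversions D g. basis (graph_on D (exchange x y g)))"
proof -
  let ?e = "\<lambda>(x, y). ((x, g x), (y, g y))"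
  have "{c \<in> crossings (graph_on D g). inv_num (resolve (graph_on D g) c) + 1 = inv_num (graph_on D g)} =
    ?e ` simple_inversions D g"
    by (auto simp: crossings_graph_on simple_inversions_def resolve_graph_on image_iff)
  then have "diff_strands (graph_on D g) = (\<Sum>c\<in>?e ` simple_inversions D g. basis (resolve (graph_on D g) c))"
    by (simp add: diff_strands_def)
  also have "\<dots> = (\<Sum>q\<in>simple_inversions D g. basis (resolve (graph_on D g) (?e q)))"
    by (subst sum.reindex) (auto simp: inj_on_def)
  also have "\<dots> = (\<Sum>(x, y)\<in>simple_inversions D g. basis (graph_on D (exchange x y g)))"
    by (rule sum.cong) (auto simp: simple_inversions_def resolve_graph_on)
  finally show ?thesis by (simp add: diff_basis)
qed

lemma diff_diff_graph_on:
  assumes "interval_inj D g"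
  shows "diff (diff (basis (graph_on D g))) = 0"
proof -
  have fin: "finite D" using assms by (simp add: interval_inj_def)
  let ?G = "\<lambda>q. case q of ((x, y), (u, v)) \<Rightarrow> basis (graph_on D (exchange u v (exchange x y g)))"
  have "two_step D g = (SIGMA p:simple_inversions D g. simple_inversions D (exchange (fst p) (snd p) g))"
  proof -
    \<comment> \<open>By \<open>inv_num_exchange\<close> every exchange of an inversion lowers the
      number by at least one, so a total drop of two means a drop of one at each step.\<close>
    have "inv_num (graph_on D (exchange u v (exchange x y g))) + 2 = inv_num (graph_on D g) \<longleftrightarrow>
      inv_num (graph_on D (exchange x y g)) + 1 = inv_num (graph_on D g) \<and>
      inv_num (graph_on D (exchange u v (exchange x y g))) + 1 = inv_num (graph_on D (exchange x y g))"
      if "inverted D g x y" "inverted D (exchange x y g) u v" for x y u v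
      using inv_num_exchange[OF assms that(1)] inv_num_exchange[OF exchange_interval_inj[OF assms that(1)] that(2)]
      by arith
    then show ?thesis by (auto simp: two_step_def simple_inversions_def)
  qed
  then have "diff (diff (basis (graph_on D g))) = (\<Sum>q\<in>two_step D g. ?G q)"
    by (simp add: diff_graph_on diff_sum case_prod_unfold sum.Sigma finite_simple_inversions fin)
  also have "\<dots> = 0"
  proof (rule sum_involution_0[where \<iota> = "partner D g"])
    show "finite (two_step D g)"
      by (rule finite_subset[of _ "(D \<times> D) \<times> (D \<times> D)"]) (auto simp: fin two_step_def inverted_def)
    fix q assume q: "q \<in> two_step D g"
    have "?G q = basis (graph_on D (case q of ((x, y), (u, v)) \<Rightarrow> exchange u v (exchange x y g)))" for q
      by (simp add: case_prod_unfold)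
    then have "?G (partner D g q) = ?G q" by (simp only: partner_two_step(4)[OF assms q])
    then show "partner D g q \<in> two_step D g \<and> partner D g q \<noteq> q \<and> partner D g (partner D g q) = q \<and> ?G (partner D g q) = ?G q"
      using partner_two_step(1-3)[OF assms q] by blast
  qed simp
  finally show ?thesis .
qed

section \<open>Homology classes and H-data\<close>

definition covers :: "('i \<times> nat) \<times> ('i \<times> nat) \<Rightarrow> 'i \<times> nat \<Rightarrow> bool" where
  "covers u e \<longleftrightarrow> fst (fst u) = fst e \<and> snd (fst u) \<le> snd e \<and> snd e < snd (snd u)"

text \<open>The H-data as seen by a single term. They are shared by all terms of a diagram and
  preserved by resolutions, so the decomposition of the algebra can be traced term by term.\<close>

definition strand_data :: "('i, 'l) arc_diag \<Rightarrow> 'i strands \<Rightarrow> ('i, 'l) hdata" where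
  "strand_data Z \<nu> = (h_grading \<nu>, {P \<in> pairs Z. Domain \<nu> \<inter> plc Z P \<noteq> {}}, {P \<in> pairs Z. Range \<nu> \<inter> plc Z P \<noteq> {}})"

lemma strand_sv: "strand_diagram Z \<nu> \<Longrightarrow> (x, y) \<in> \<nu> \<Longrightarrow> (x, y') \<in> \<nu> \<Longrightarrow> y = y'"
  by (auto simp: strand_diagram_def dest: single_valuedD)

lemma strand_inj: "strand_diagram Z \<nu> \<Longrightarrow> (x, y) \<in> \<nu> \<Longrightarrow> (x', y) \<in> \<nu> \<Longrightarrow> x = x'"
  unfolding strand_diagram_def by (meson converseI single_valuedD)

lemma strand_le: "strand_diagram Z \<nu> \<Longrightarrow> (x, y) \<in> \<nu> \<Longrightarrow> fst y = fst x \<and> snd x \<le> snd y \<and> x \<in> points Z \<and> y \<in> points Z"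
  by (auto simp: strand_diagram_def pt_le_def)

lemma strand_graph:
  assumes "strand_diagram Z \<nu>" "finite \<nu>"
  obtains g where "\<nu> = graph_on (Domain \<nu>) g" "interval_inj (Domain \<nu>) g"
proof -
  define g where "g x = (THE y. (x, y) \<in> \<nu>)" for x
  have g: "(x, g x) \<in> \<nu>" "(x, y) \<in> \<nu> \<Longrightarrow> g x = y" if "x \<in> Domain \<nu>" for x y
  proof -
    from that obtain y' where "(x, y') \<in> \<nu>" by blast
    then have "g x = y'" unfolding g_def using strand_sv[OF assms(1)] by blast
    then show "(x, g x) \<in> \<nu>" "(x, y) \<in> \<nu> \<Longrightarrow> g x = y"
      using \<open>(x, y') \<in> \<nu>\<close> strand_sv[OF assms(1)] by blast+
  qed
  have "\<nu> = graph_on (Domain \<nu>) g"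
    unfolding graph_on_def using g by fastforce
  moreover have "interval_inj (Domain \<nu>) g"
    unfolding interval_inj_def inj_on_def
    using assms(2) g strand_inj[OF assms(1)] strand_le[OF assms(1)] by (metis finite_Domain)
  ultimately show ?thesis by (rule that)
qed

lemma h_grading_card:
  assumes "strand_diagram Z \<nu>" "finite \<nu>"
  shows "h_grading \<nu> e = int (card {u \<in> \<nu>. covers u e})"
proof -
  have "h_grading \<nu> e = (\<Sum>u\<in>\<nu>. if covers u e then 1 else 0)"
    unfolding h_grading_def
  proof (rule sum.cong[OF refl])
    fix u assume "u \<in> \<nu>"
    moreover obtain x y where "u = (x, y)" by (cases u)
    ultimately have "fst y = fst x" "u = (x, y)" using strand_le[OF assms(1), of x y] by auto
    then show "(case u of (x, y) \<Rightarrow> segment x y e) = (if covers u e then 1 else 0)"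
      by (cases e) (auto simp: segment_def covers_def)
  qed
  then show ?thesis using assms(2) by (simp add: sum.If_cases Int_def)
qed

lemma h_grading_fill:
  assumes "moving Z \<mu>" "finite \<mu>" "finite V"
  shows "h_grading (\<mu> \<union> Id_on V) = h_grading \<mu>"
proof
  fix e
  have "\<mu> \<inter> Id_on V = {}" using assms(1) by (auto simp: moving_def)
  moreover have "finite (Id_on V)" using assms(3) by (simp add: Id_on_def)
  moreover have "(\<Sum>(x, y)\<in>Id_on V. segment x y e) = 0"
    by (rule sum.neutral) (auto simp: segment_def split: prod.split)
  ultimately show "h_grading (\<mu> \<union> Id_on V) e = h_grading \<mu> e"
    unfolding h_grading_def using assms(2) by (simp add: sum.union_disjoint)
qed

context arc
begin

lemma crossingE:
  assumes "c \<in> crossings \<nu>" "strand_diagram Z \<nu>"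
  obtains x x' y y' where "c = ((x, x'), (y, y'))" "(x, x') \<in> \<nu>" "(y, y') \<in> \<nu>"
    "fst x' = fst x" "fst y = fst x" "fst y' = fst x" "snd x < snd y" "snd y \<le> snd y'" "snd y' < snd x'"
proof -
  from assms(1) obtain x x' y y' where c: "c = ((x, x'), (y, y'))" "(x, x') \<in> \<nu>" "(y, y') \<in> \<nu>" "pt_less x y" "pt_less y' x'"
    unfolding crossings_def by blast
  moreover have "fst x' = fst x" "fst y' = fst y" "snd y \<le> snd y'"
    using strand_le[OF assms(2)] c by blast+
  ultimately show ?thesis using that by (auto simp: pt_less_def)
qed

text \<open>Only the monotonicity of the new strands is assumed, not that the old ones cross. Thus
  the lemma also covers exchanges which create a crossing and those which split off a horizontal
  strand.\<close>

lemma resolve_strand_gen: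
  assumes "strand_diagram Z \<nu>" "(x, x') \<in> \<nu>" "(y, y') \<in> \<nu>" "x \<noteq> y" "pt_le x y'" "pt_le y x'"
  defines "c \<equiv> ((x, x'), (y, y'))"
  shows "strand_diagram Z (resolve \<nu> c)" "Domain (resolve \<nu> c) = Domain \<nu>" "Range (resolve \<nu> c) = Range \<nu>"
    "h_grading (resolve \<nu> c) = h_grading \<nu>" "strand_data Z (resolve \<nu> c) = strand_data Z \<nu>"
proof -
  have c: "c = ((x, x'), (y, y'))" "(x, x') \<in> \<nu>" "(y, y') \<in> \<nu>" using assms by auto
  have o: "fst x' = fst x" "fst y = fst x" "fst y' = fst x" "snd x \<le> snd x'" "snd y \<le> snd y'" "snd x \<le> snd y'" "snd y \<le> snd x'"
    using strand_le[OF assms(1)] assms(2,3,5,6) by (auto simp: pt_le_def)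
  have ne: "x \<noteq> y" "x' \<noteq> y'" using assms(4) strand_inj[OF assms(1,2)] assms(3) by blast+
  let ?R = "\<nu> - {(x, x'), (y, y')}"
  have r: "resolve \<nu> c = insert (x, y') (insert (y, x') ?R)" by (auto simp: resolve_def c)
  have n: "\<nu> = insert (x, x') (insert (y, y') ?R)" using c by auto
  have sv: "(x, w) \<notin> ?R" "(y, w) \<notin> ?R" "(w, x') \<notin> ?R" "(w, y') \<notin> ?R" for w
    using strand_sv[OF assms(1)] strand_inj[OF assms(1)] c by blast+
  have R: "single_valued ?R" "single_valued (?R\<inverse>)"
    using assms(1) by (auto simp: strand_diagram_def intro: single_valued_subset)
  have svi: "single_valued (insert (a, b) R)" if "single_valued R" "a \<notin> Domain R" for a b and R :: "'x rel"
    using that unfolding single_valued_def by blast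
  have "single_valued (resolve \<nu> c)"
    unfolding r by (intro svi R) (use sv ne in auto)
  moreover have "single_valued ((resolve \<nu> c)\<inverse>)"
  proof -
    have "(resolve \<nu> c)\<inverse> = insert (y', x) (insert (x', y) (?R\<inverse>))" unfolding r by auto
    moreover have "single_valued (insert (y', x) (insert (x', y) (?R\<inverse>)))"
      by (intro svi R) (use sv ne in auto)
    ultimately show ?thesis by simp
  qed
  ultimately show s: "strand_diagram Z (resolve \<nu> c)"
    using assms(1,2,3,5,6) unfolding strand_diagram_def r by auto
  show D: "Domain (resolve \<nu> c) = Domain \<nu>" "Range (resolve \<nu> c) = Range \<nu>"
    unfolding r using c by auto
  show h: "h_grading (resolve \<nu> c) = h_grading \<nu>"
  proof
    fix e
    have fin: "finite ?R" using finite_strands[OF assms(1)] by simp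
    have new: "(x, y') \<notin> insert (y, x') ?R" "(y, x') \<notin> ?R" using sv[of y'] sv[of x'] ne by blast+
    have old: "(x, x') \<notin> insert (y, y') ?R" "(y, y') \<notin> ?R" using ne by blast+
    have "h_grading (resolve \<nu> c) e = segment x y' e + (segment y x' e + (\<Sum>(x, y)\<in>?R. segment x y e))"
      unfolding r h_grading_def using fin new by simp
    moreover have "h_grading \<nu> e = segment x x' e + (segment y y' e + (\<Sum>(x, y)\<in>?R. segment x y e))"
      unfolding h_grading_def by (subst n) (use fin old in simp)
    moreover have "segment x y' e + segment y x' e = segment x x' e + segment y y' e"
      using o by (cases e) (auto simp: segment_def)
    ultimately show "h_grading (resolve \<nu> c) e = h_grading \<nu> e" by simp
  qed
  show "strand_data Z (resolve \<nu> c) = strand_data Z \<nu>"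
    by (simp add: strand_data_def D h)
qed

lemma resolve_strand:
  assumes "c \<in> crossings \<nu>" "strand_diagram Z \<nu>"
  shows "strand_diagram Z (resolve \<nu> c)" "Domain (resolve \<nu> c) = Domain \<nu>" "Range (resolve \<nu> c) = Range \<nu>"
    "h_grading (resolve \<nu> c) = h_grading \<nu>" "strand_data Z (resolve \<nu> c) = strand_data Z \<nu>"
proof -
  from assms obtain x x' y y' where c: "c = ((x, x'), (y, y'))" "(x, x') \<in> \<nu>" "(y, y') \<in> \<nu>"
    "fst x' = fst x" "fst y = fst x" "fst y' = fst x" "snd x < snd y" "snd y \<le> snd y'" "snd y' < snd x'"
    by (rule crossingE)
  then have "x \<noteq> y" "pt_le x y'" "pt_le y x'" by (auto simp: pt_le_def)
  then show "strand_diagram Z (resolve \<nu> c)" "Domain (resolve \<nu> c) = Domain \<nu>" "Range (resolve \<nu> c) = Range \<nu>"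
    "h_grading (resolve \<nu> c) = h_grading \<nu>" "strand_data Z (resolve \<nu> c) = strand_data Z \<nu>"
    unfolding c(1) using resolve_strand_gen[OF assms(2) c(2,3)] by blast+
qed

lemma keys_diff_basis: "keys (diff (basis \<nu>)) \<subseteq> resolve \<nu> ` crossings \<nu>"
proof -
  have "keys (diff (basis \<nu>)) \<subseteq> (\<Union>c\<in>{c \<in> crossings \<nu>. inv_num (resolve \<nu> c) + 1 = inv_num \<nu>}. keys (basis (resolve \<nu> c)))"
    unfolding diff_basis diff_strands_def by (rule keys_sum_subset)
  then show ?thesis by auto
qed

lemma keys_diff:
  assumes "\<nu>' \<in> keys (diff x)"
  obtains \<nu> c where "\<nu> \<in> keys x" "c \<in> crossings \<nu>" "\<nu>' = resolve \<nu> c"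
proof -
  from assms have "\<nu>' \<in> (\<Union>\<nu>\<in>keys x. keys (diff_strands \<nu>))"
    unfolding diff_lin using lin_image_subset by fast
  then obtain \<nu> where \<nu>: "\<nu> \<in> keys x" "\<nu>' \<in> keys (diff (basis \<nu>))" by (auto simp: diff_basis)
  then obtain c where "c \<in> crossings \<nu>" "\<nu>' = resolve \<nu> c" using keys_diff_basis[of \<nu>] by blast
  then show ?thesis using \<nu>(1) that by blast
qed

lemma diff_diff:
  assumes "\<And>\<nu>. \<nu> \<in> keys x \<Longrightarrow> strand_diagram Z \<nu>"
  shows "diff (diff x) = 0"
proof -
  have "diff (diff (basis \<nu>)) = 0" if "\<nu> \<in> keys x" for \<nu>
    using strand_graph[OF assms[OF that] finite_strands[OF assms[OF that]]] diff_diff_graph_on by metis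
  then have "(\<Sum>\<nu>\<in>keys x. diff (diff (basis \<nu>))) = 0" by simp
  then have "diff (diff (\<Sum>\<nu>\<in>keys x. basis \<nu>)) = 0" by (simp only: diff_sum)
  then show ?thesis by (simp flip: chain_as_sum)
qed

lemma elt_strand:
  assumes "diagram Z (\<mu>, s, t)" "\<nu> \<in> keys (elt Z (\<mu>, s, t))"
  shows "strand_diagram Z \<nu>" "strand_data Z \<nu> = (h_grading \<mu>, s, t)"
proof -
  have m: "moving Z \<mu>" and st: "s \<subseteq> pairs Z" "t \<subseteq> pairs Z" using assms by (auto simp: diagram_iff)
  from assms(2) obtain V where V: "V \<in> fills Z \<mu> s t" "\<nu> = \<mu> \<union> Id_on V" using keys_elt[OF m] by auto
  have Vd: "V \<inter> Domain \<mu> = {}" "V \<inter> Range \<mu> = {}" "V \<subseteq> points Z" using V by (auto simp: fills_def)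
  have sd: "strand_diagram Z \<mu>" using m by (simp add: moving_def)
  have "single_valued \<nu>" unfolding V single_valued_def using Vd strand_sv[OF sd] by blast
  moreover have "single_valued (\<nu>\<inverse>)" unfolding V single_valued_def converse_iff using Vd strand_inj[OF sd] by blast
  ultimately show "strand_diagram Z \<nu>"
    using sd Vd unfolding strand_diagram_def V by (auto simp: pt_le_def)
  have hg: "h_grading \<nu> = h_grading \<mu>"
    unfolding V using h_grading_fill m finite_strands[OF sd] Vd finite_points finite_subset by metis
  have "S \<inter> plc Z P \<noteq> {} \<longleftrightarrow> P \<in> s'" if "section_of Z s' S" "P \<in> pairs Z" for s' S P
    using that by (auto simp: section_of_def of_bool_def dest!: bspec split: if_splits)
  then have "{P \<in> pairs Z. S \<inter> plc Z P \<noteq> {}} = s'" if "section_of Z s' S" "s' \<subseteq> pairs Z" for s' S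
    using that by blast
  moreover have "section_of Z s (Domain \<mu> \<union> V)" "section_of Z t (Range \<mu> \<union> V)" using V(1) by (auto simp: fills_def)
  ultimately show "strand_data Z \<nu> = (h_grading \<mu>, s, t)"
    using st hg unfolding strand_data_def V(2) Domain_fill Range_fill by blast
qed

section \<open>Decomposition by H-data\<close>

lemma alg_atE:
  assumes "x \<in> alg_at Z (h, s, t)"
  obtains F where "finite F" "\<And>\<mu>. \<mu> \<in> F \<Longrightarrow> diagram Z (\<mu>, s, t) \<and> h_grading \<mu> = h" "x = (\<Sum>\<mu>\<in>F. elt Z (\<mu>, s, t))"
proof -
  from assms obtain G where G: "finite G" "\<And>D. D \<in> G \<Longrightarrow> diagram Z D \<and> hdata_of D = (h, s, t)" "x = (\<Sum>D\<in>G. elt Z D)"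
    unfolding alg_at_def by (rule span2_imageE) blast
  have e: "D = (fst D, s, t)" if "D \<in> G" for D using G(2)[OF that] by (cases D) (auto simp: hdata_of_def)
  then have "inj_on fst G" by (intro inj_onI) metis
  then have "(\<Sum>\<mu>\<in>fst ` G. elt Z (\<mu>, s, t)) = (\<Sum>D\<in>G. elt Z (fst D, s, t))" by (simp add: sum.reindex)
  also have "\<dots> = x" unfolding G(3) by (rule sum.cong) (use e in auto)
  finally have x: "x = (\<Sum>\<mu>\<in>fst ` G. elt Z (\<mu>, s, t))" by simp
  show ?thesis
  proof (rule that[OF _ _ x])
    show "finite (fst ` G)" using G by simp
    show "diagram Z (\<mu>, s, t) \<and> h_grading \<mu> = h" if "\<mu> \<in> fst ` G" for \<mu>
      using that G(2) e by (auto simp: hdata_of_def)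
  qed
qed

lemma alg_atI:
  assumes "\<And>\<mu>. \<mu> \<in> F \<Longrightarrow> diagram Z (\<mu>, s, t) \<and> h_grading \<mu> = h"
  shows "(\<Sum>\<mu>\<in>F. elt Z (\<mu>, s, t)) \<in> alg_at Z (h, s, t)"
  unfolding alg_at_def
  by (rule span2_sum) (use assms in \<open>auto intro!: span2_base exI simp: hdata_of_def\<close>)

lemma elt_alg_at: "diagram Z (\<mu>, s, t) \<Longrightarrow> elt Z (\<mu>, s, t) \<in> alg_at Z (h_grading \<mu>, s, t)"
  using alg_atI[of "{\<mu>}" s t "h_grading \<mu>"] by simp

lemma alg_at_add: "x \<in> alg_at Z d \<Longrightarrow> y \<in> alg_at Z d \<Longrightarrow> x + y \<in> alg_at Z d"
  unfolding alg_at_def by (rule span2_add)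

lemma alg_at_0: "0 \<in> alg_at Z d"
  unfolding alg_at_def by (rule span2_0)

lemma alg_add: "x \<in> alg Z \<Longrightarrow> y \<in> alg Z \<Longrightarrow> x + y \<in> alg Z"
  unfolding alg_def by (rule span2_add)

lemma alg_0: "0 \<in> alg Z"
  unfolding alg_def by (rule span2_0)

lemma alg_at_subset: "alg_at Z d \<subseteq> alg Z"
  unfolding alg_at_def alg_def span2_def by blast

lemma alg_strand: "x \<in> alg Z \<Longrightarrow> \<nu> \<in> keys x \<Longrightarrow> strand_diagram Z \<nu>"
  unfolding alg_def
proof (elim span2_imageE)
  fix F assume a: "\<nu> \<in> keys x" "x = (\<Sum>D\<in>F. elt Z D)" "\<And>D. D \<in> F \<Longrightarrow> diagram Z D"
  then obtain D where "D \<in> F" "\<nu> \<in> keys (elt Z D)" using keys_sum_subset[of "elt Z" F] by blast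
  then show "strand_diagram Z \<nu>" using a(3) elt_strand(1) by (metis prod_cases3)
qed

lemma alg_at_data: "x \<in> alg_at Z d \<Longrightarrow> \<nu> \<in> keys x \<Longrightarrow> strand_data Z \<nu> = d"
  unfolding alg_at_def
proof (elim span2_imageE)
  fix F assume a: "\<nu> \<in> keys x" "x = (\<Sum>D\<in>F. elt Z D)" "\<And>D. D \<in> F \<Longrightarrow> diagram Z D \<and> hdata_of D = d"
  then obtain D where D: "D \<in> F" "\<nu> \<in> keys (elt Z D)" using keys_sum_subset[of "elt Z" F] by blast
  obtain \<mu> s t where "D = (\<mu>, s, t)" by (cases D)
  then show "strand_data Z \<nu> = d" using a(3)[OF D(1)] D(2) elt_strand(2)[of \<mu> s t \<nu>] by (simp add: hdata_of_def)
qed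

lemma diff_data: "(\<And>\<nu>. \<nu> \<in> keys x \<Longrightarrow> strand_diagram Z \<nu> \<and> Q (strand_data Z \<nu>)) \<Longrightarrow> \<nu> \<in> keys (diff x) \<Longrightarrow>
   strand_diagram Z \<nu> \<and> Q (strand_data Z \<nu>)"
  by (elim keys_diff) (simp add: resolve_strand)

text \<open>The primitive is split into its diagrams with H-data \<open>d\<close> and the others. As
  the differential preserves the H-data of terms, the equation splits accordingly: the two sides of
  the rearranged equation have no possible terms in common, so both vanish.\<close>

lemma diff_alg_at_split:
  assumes "w \<in> alg Z" "z \<in> alg_at Z d" "diff w = z + z'" "\<And>\<nu>. \<nu> \<in> keys z' \<Longrightarrow> strand_data Z \<nu> \<noteq> d"
  shows "\<exists>w'\<in>alg_at Z d. z = diff w'"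
proof -
  from assms(1) obtain F where F: "finite F" "\<And>D. D \<in> F \<Longrightarrow> diagram Z D" "w = (\<Sum>D\<in>F. elt Z D)"
    unfolding alg_def by (rule span2_imageE) blast
  let ?A = "{D \<in> F. hdata_of D = d}"
  define a where "a = (\<Sum>D\<in>?A. elt Z D)"
  define b where "b = (\<Sum>D\<in>F - ?A. elt Z D)"
  have w: "w = a + b" unfolding a_def b_def F(3) using F(1) by (subst sum.subset_diff[of ?A]) (auto simp: add.commute)
  have a: "a \<in> alg_at Z d" unfolding a_def alg_at_def by (rule span2_imageI) (use F in auto)
  have bs: "strand_diagram Z \<nu> \<and> strand_data Z \<nu> \<noteq> d" if "\<nu> \<in> keys b" for \<nu>
  proof -
    from that obtain D where "D \<in> F - ?A" "\<nu> \<in> keys (elt Z D)" unfolding b_def using keys_sum_subset by fast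
    moreover obtain \<mu> s t where "D = (\<mu>, s, t)" by (cases D)
    ultimately show ?thesis using elt_strand[of \<mu> s t \<nu>] F(2)[of D] by (auto simp: hdata_of_def)
  qed
  have as: "strand_diagram Z \<nu> \<and> strand_data Z \<nu> = d" if "\<nu> \<in> keys a" for \<nu>
    using a alg_at_data alg_strand alg_at_subset that by blast
  have "z + diff a = z' + diff b"
  proof -
    have "z + z' + (diff a + z') = diff a + diff b + (diff a + z')" using assms(3) by (simp add: w diff_add)
    then have "z + diff a + (z' + z') = z' + diff b + (diff a + diff a)" by (simp only: ac_simps)
    then show ?thesis by simp
  qed
  moreover have "strand_data Z \<nu> = d" if "\<nu> \<in> keys (z + diff a)" for \<nu>
    using that diff_data[of a "\<lambda>e. e = d", OF as] alg_at_data[OF assms(2)] by (auto simp: keys_add_bit)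
  moreover have "strand_data Z \<nu> \<noteq> d" if "\<nu> \<in> keys (z' + diff b)" for \<nu>
    using that diff_data[of b "\<lambda>e. e \<noteq> d", OF bs] assms(4) by (auto simp: keys_add_bit)
  ultimately have "\<nu> \<notin> keys (z + diff a)" for \<nu> by metis
  then have "keys (z + diff a) = {}" by blast
  then have "z = diff a" by (simp only: keys_eq_empty chain_add_eq_0)
  then show ?thesis using a by blast
qed

lemma boundary_alg_at:
  assumes "z \<in> boundaries Z" "z \<in> alg_at Z d"
  shows "\<exists>w\<in>alg_at Z d. z = diff w"
  using assms diff_alg_at_split[of _ z d 0] by (auto simp: boundaries_def)

lemma boundary_alg_atI: "w \<in> alg_at Z d \<Longrightarrow> diff w \<in> boundaries Z"
  using alg_at_subset by (fastforce simp: boundaries_def)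

lemma boundaries_0: "0 \<in> boundaries Z"
  unfolding boundaries_def using alg_0 by force

lemma boundaries_add: "x \<in> boundaries Z \<Longrightarrow> y \<in> boundaries Z \<Longrightarrow> x + y \<in> boundaries Z"
  unfolding boundaries_def by (metis (no_types, lifting) alg_add diff_add image_iff)

section \<open>Homology classes as cosets\<close>

lemma hclass_mem: "x \<in> hclass Z z \<longleftrightarrow> x + z \<in> boundaries Z"
proof
  assume "x \<in> hclass Z z"
  then obtain b where "b \<in> boundaries Z" "x = z + b" by (auto simp: hclass_def)
  then show "x + z \<in> boundaries Z" by (simp add: add.commute[of z] add.assoc)
next
  assume "x + z \<in> boundaries Z"
  moreover have "x = z + (x + z)" by (simp add: add.commute[of x] flip: add.assoc)
  ultimately show "x \<in> hclass Z z" unfolding hclass_def by blast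
qed

lemma hclass_eq_iff: "hclass Z z = hclass Z z' \<longleftrightarrow> z + z' \<in> boundaries Z"
proof
  assume "hclass Z z = hclass Z z'"
  moreover have "z \<in> hclass Z z" by (simp add: hclass_mem boundaries_0)
  ultimately show "z + z' \<in> boundaries Z" using hclass_mem by blast
next
  assume b: "z + z' \<in> boundaries Z"
  have "x + z \<in> boundaries Z \<longleftrightarrow> x + z' \<in> boundaries Z" for x
  proof -
    have "(x + z) + (z + z') = x + z' + (z + z)" "(x + z') + (z + z') = x + z + (z' + z')"
      by (simp_all only: ac_simps)
    then have "x + z' = (x + z) + (z + z')" "x + z = (x + z') + (z + z')" by simp_all
    then show ?thesis using b boundaries_add by metis
  qed
  then show "hclass Z z = hclass Z z'" by (auto simp: hclass_mem)
qed

lemma hclass_eq_hzero: "hclass Z z = hzero Z \<longleftrightarrow> z \<in> boundaries Z"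
  unfolding hzero_def hclass_eq_iff by simp

text \<open>If a class had representatives with two different H-data, their sum would be a boundary,
  and then already its part with the first H-data, contradicting that the class is nonzero.\<close>

lemma homology_at_unique:
  assumes "M \<in> homology_at Z d" "M \<in> homology_at Z d'" "M \<noteq> hzero Z"
  shows "d = d'"
proof (rule ccontr)
  assume ne: "d \<noteq> d'"
  obtain z z' where z: "z \<in> alg_at Z d" "M = hclass Z z" "z' \<in> alg_at Z d'" "M = hclass Z z'"
    using assms by (auto simp: homology_at_def)
  then have "z + z' \<in> boundaries Z" by (simp flip: hclass_eq_iff)
  then obtain w where "w \<in> alg Z" "diff w = z + z'" by (auto simp: boundaries_def)
  then obtain w' where "w' \<in> alg_at Z d" "z = diff w'"
    using diff_alg_at_split[OF _ z(1)] alg_at_data[OF z(3)] ne by metis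
  then show False using assms(3) z(2) boundary_alg_atI hclass_eq_hzero by blast
qed

end

section \<open>Homology of non-viable H-data\<close>

text \<open>The step from \<open>p = (i, j)\<close> is the first one with multiplicity at least two on its interval. Then
  exactly one strand passes over \<open>p\<close>, and another one starts there. Exchanging their end points is a
  contracting homotopy up to terms which do not matter since the differential squares to zero.\<close>

locale nonviable = arc Z for Z :: "('i, 'l) arc_diag" +
  fixes h :: "'i h1" and i :: 'i and j :: nat
  assumes two_at: "h (i, j) \<ge> 2" and one_before: "j' < j \<Longrightarrow> h (i, j') \<le> 1"
begin

abbreviation p where "p \<equiv> (i, j)"

definition has_h :: "'i strands \<Rightarrow> bool" where
  "has_h \<nu> \<longleftrightarrow> strand_diagram Z \<nu> \<and> h_grading \<nu> = h"

definition over :: "'i strands \<Rightarrow> 'i \<times> nat \<Rightarrow> 'i \<times> nat \<Rightarrow> 'i \<times> nat \<Rightarrow> bool" where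
  "over \<nu> x x' y \<longleftrightarrow> (x, x') \<in> \<nu> \<and> (p, y) \<in> \<nu> \<and> pt_less x p \<and> pt_less p x' \<and> pt_less p y"

definition crossed :: "'i strands \<Rightarrow> bool" where
  "crossed \<nu> \<longleftrightarrow> (\<exists>x x' y. over \<nu> x x' y \<and> pt_less y x')"

text \<open>The two strands are exchanged whether or not they cross, so this both resolves and
  creates the distinguished crossing and is an involution.\<close>

definition swap :: "'i strands \<Rightarrow> 'i strands" where
  "swap \<nu> = resolve \<nu> (THE c. \<exists>x x' y. c = ((x, x'), (p, y)) \<and> over \<nu> x x' y)"

text \<open>At most one strand starts at \<open>p\<close>, so one of the at least two strands over
  the step from \<open>p\<close> comes from further left. It also covers the preceding step, whose
  multiplicity is at most one, hence it is the only such strand and the other one starts at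
  \<open>p\<close>.\<close>

lemma has_h_over:
  assumes "has_h \<nu>"
  obtains x x' y where "over \<nu> x x' y" "\<And>a b. (a, b) \<in> \<nu> \<Longrightarrow> pt_less a p \<Longrightarrow> pt_le p b \<Longrightarrow> a = x \<and> b = x'"
proof -
  have s: "strand_diagram Z \<nu>" and h: "h_grading \<nu> = h" using assms by (auto simp: has_h_def)
  have fin: "finite \<nu>" using finite_strands[OF s] .
  let ?A = "{u \<in> \<nu>. covers u p}" and ?S = "{u \<in> \<nu>. fst u = p}"
  have "card ?A \<ge> 2" using h_grading_card[OF s fin, of p] two_at h by auto
  moreover have S1: "card ?S \<le> 1"
    using fin strand_sv[OF s] by (auto simp: card_le_Suc0_iff_eq)
  ultimately have ns: "\<not> ?A \<subseteq> ?S" using card_mono[of ?S ?A] fin by auto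
  then obtain u where "u \<in> \<nu>" "covers u p" "fst u \<noteq> p" by blast
  then obtain x x' where x: "(x, x') \<in> \<nu>" "covers (x, x') p" "x \<noteq> p" by (cases u) auto
  then have j: "snd x < j" "fst x = i" "j < snd x'" by (auto simp: covers_def prod_eq_iff)
  have "fst x' = i" using strand_le[OF s x(1)] j by simp
  let ?B = "{u \<in> \<nu>. covers u (i, j - 1)}"
  have "card ?B \<le> 1" using h_grading_card[OF s fin, of "(i, j - 1)"] one_before[of "j - 1"] h j by auto
  then have "card ?B \<le> Suc 0" by simp
  moreover have "finite ?B" using fin by simp
  ultimately have B: "u = v" if "u \<in> ?B" "v \<in> ?B" for u v
    using that card_le_Suc0_iff_eq[of ?B] by blast
  have xB: "(x, x') \<in> ?B" using x j by (auto simp: covers_def)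
  have un: "a = x \<and> b = x'" if "(a, b) \<in> \<nu>" "pt_less a p" "pt_le p b" for a b
  proof -
    have "(a, b) \<in> ?B" using that by (auto simp: covers_def pt_less_def pt_le_def)
    then show ?thesis using B xB by blast
  qed
  have "?A \<noteq> {(x, x')}" using \<open>card ?A \<ge> 2\<close> by force
  then obtain a y where a: "(a, y) \<in> ?A" "(a, y) \<noteq> (x, x')" using x by auto
  have "a = p"
  proof (rule ccontr)
    assume "a \<noteq> p"
    then have "pt_less a p" using a by (auto simp: covers_def pt_less_def prod_eq_iff)
    moreover have "pt_le p y" using a strand_le[OF s, of a y] by (auto simp: covers_def pt_le_def)
    ultimately show False using un a by blast
  qed
  then have "over \<nu> x x' y"
    using a x j \<open>fst x' = i\<close> strand_le[OF s, of a y] by (auto simp: over_def covers_def pt_less_def)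
  then show ?thesis using that un by blast
qed

lemma over_unique:
  assumes "has_h \<nu>" "over \<nu> x x' y" "over \<nu> a a' b"
  shows "a = x" "a' = x'" "b = y"
proof -
  have s: "strand_diagram Z \<nu>" using assms(1) by (simp add: has_h_def)
  obtain u u' v where u: "\<And>a b. (a, b) \<in> \<nu> \<Longrightarrow> pt_less a p \<Longrightarrow> pt_le p b \<Longrightarrow> a = u \<and> b = u'"
    using has_h_over[OF assms(1)] by metis
  have le: "pt_le p c" if "pt_less p c" for c using that by (simp add: pt_less_def pt_le_def)
  have "a = u \<and> a' = u'" "x = u \<and> x' = u'"
    using u[of a a'] u[of x x'] le assms(2,3) unfolding over_def by blast+
  then show "a = x" "a' = x'" by auto
  show "b = y" using assms(2,3) strand_sv[OF s, of p b y] unfolding over_def by blast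
qed

lemma swap_eq:
  assumes "has_h \<nu>" "over \<nu> x x' y"
  shows "swap \<nu> = resolve \<nu> ((x, x'), (p, y))"
proof -
  have "(THE c. \<exists>x x' y. c = ((x, x'), (p, y)) \<and> over \<nu> x x' y) = ((x, x'), (p, y))"
    by (rule the_equality) (use assms over_unique[OF assms] in blast)+
  then show ?thesis by (simp add: swap_def)
qed

lemma swap_facts:
  assumes "has_h \<nu>" "over \<nu> x x' y"
  shows "has_h (swap \<nu>)" "over (swap \<nu>) x y x'" "swap (swap \<nu>) = \<nu>" "Domain (swap \<nu>) = Domain \<nu>" "Range (swap \<nu>) = Range \<nu>"
proof -
  have s: "strand_diagram Z \<nu>" and h: "h_grading \<nu> = h" using assms by (auto simp: has_h_def)
  have o: "(x, x') \<in> \<nu>" "(p, y) \<in> \<nu>" "pt_less x p" "pt_less p x'" "pt_less p y" using assms(2) by (auto simp: over_def)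
  have ne: "x \<noteq> p" "pt_le x y" "pt_le p x'" using o by (auto simp: pt_less_def pt_le_def)
  note g = resolve_strand_gen[OF s o(1,2) ne]
  have e: "swap \<nu> = resolve \<nu> ((x, x'), (p, y))" by (rule swap_eq[OF assms])
  show 1: "has_h (swap \<nu>)" "Domain (swap \<nu>) = Domain \<nu>" "Range (swap \<nu>) = Range \<nu>" using g h by (simp_all add: e has_h_def)
  show 2: "over (swap \<nu>) x y x'" unfolding e over_def resolve_def using o by auto
  have "x' \<noteq> y" using strand_inj[OF s] o ne by blast
  have "swap (swap \<nu>) = resolve (swap \<nu>) ((x, y), (p, x'))" by (rule swap_eq[OF 1(1) 2])
  also have "\<dots> = \<nu>"
    unfolding e resolve_def prod.case
    using o ne \<open>x' \<noteq> y\<close> strand_sv[OF s] strand_inj[OF s] by blast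
  finally show "swap (swap \<nu>) = \<nu>" .
qed

lemma crossed_iff:
  assumes "has_h \<nu>" "over \<nu> x x' y"
  shows "crossed \<nu> \<longleftrightarrow> pt_less y x'"
  unfolding crossed_def using over_unique[OF assms] assms(2) by blast

lemma crossed_swap:
  assumes "has_h \<nu>"
  shows "crossed (swap \<nu>) \<longleftrightarrow> \<not> crossed \<nu>"
proof -
  obtain x x' y where o: "over \<nu> x x' y" using has_h_over[OF assms] by metis
  have s: "strand_diagram Z \<nu>" using assms by (simp add: has_h_def)
  have "x' \<noteq> y" using o strand_inj[OF s, of x y p] by (auto simp: over_def pt_less_def)
  then have "pt_less y x' \<longleftrightarrow> \<not> pt_less x' y"
    using o by (cases x'; cases y) (auto simp: over_def pt_less_def)
  then show ?thesis using crossed_iff[OF assms o] crossed_iff[OF swap_facts(1,2)[OF assms o]] by simp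
qed

text \<open>The critical case is a crossing of the strand over \<open>p\<close> with a strand which
  starts after \<open>p\<close>. If the latter ended before \<open>y\<close>, the strand from
  \<open>p\<close> would lie between the two, and the resolution would lower the number of crossings
  by at least three. So it ends after \<open>y\<close>, and the strand from \<open>x\<close> still
  crosses the one from \<open>p\<close>.\<close>

lemma resolve_uncrossed:
  assumes "has_h \<nu>" "crossed \<nu>" "over \<nu> x x' y"
    "c \<in> crossings \<nu>" "inv_num (resolve \<nu> c) + 1 = inv_num \<nu>" "c \<noteq> ((x, x'), (p, y))"
  shows "crossed (resolve \<nu> c)"
proof -
  have s: "strand_diagram Z \<nu>" using assms by (simp add: has_h_def)
  from assms(4) s obtain a a' b b' where c: "c = ((a, a'), (b, b'))" "(a, a') \<in> \<nu>" "(b, b') \<in> \<nu>"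
    "fst a' = fst a" "fst b = fst a" "fst b' = fst a" "snd a < snd b" "snd b \<le> snd b'" "snd b' < snd a'"
    by (rule crossingE)
  have o: "(x, x') \<in> \<nu>" "(p, y) \<in> \<nu>" "pt_less x p" "pt_less p x'" "pt_less p y" using assms(3) by (auto simp: over_def)
  have yx: "pt_less y x'" using crossed_iff[OF assms(1,3)] assms(2) by simp
  have un: "a = x" if "(a, b) \<in> \<nu>" "pt_less a p" "pt_le p b" for a b
  proof -
    obtain u u' v where u: "over \<nu> u u' v" "\<And>a b. (a, b) \<in> \<nu> \<Longrightarrow> pt_less a p \<Longrightarrow> pt_le p b \<Longrightarrow> a = u \<and> b = u'"
      using has_h_over[OF assms(1)] by metis
    show ?thesis using u(2)[OF that] over_unique[OF assms(1,3) u(1)] by simp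
  qed
  have r: "(u, v) \<in> resolve \<nu> c \<longleftrightarrow> ((u, v) \<in> \<nu> \<and> (u, v) \<noteq> (a, a') \<and> (u, v) \<noteq> (b, b')) \<or> (u, v) = (a, b') \<or> (u, v) = (b, a')" for u v
    by (auto simp: resolve_def c)
  have crI: "crossed (resolve \<nu> c)" if "(u, u') \<in> resolve \<nu> c" "(p, v) \<in> resolve \<nu> c" "pt_less u p" "pt_less p v" "pt_less v u'" for u u' v
  proof -
    have "pt_less p u'" using that(4,5) by (simp add: pt_less_def)
    then show ?thesis unfolding crossed_def over_def using that by blast
  qed
  \<comment> \<open>A strand starting before \<open>x\<close> and ending after \<open>x'\<close>
    would be a second one passing over \<open>p\<close>.\<close>
  have "\<not> (b = x)"
  proof
    assume "b = x"
    then have "b' = x'" using c o strand_sv[OF s, of x b' x'] by simp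
    have "pt_less a p" using c(5,7) o(3) \<open>b = x\<close> by (simp add: pt_less_def)
    moreover have "pt_le p a'" using c(4-6,9) o(3,4) \<open>b = x\<close> \<open>b' = x'\<close> by (simp add: pt_less_def pt_le_def)
    ultimately have "a = x" using un[OF c(2)] by blast
    then show False using c \<open>b = x\<close> by simp
  qed
  consider "a = x" "b = p" | "a = x" "b \<noteq> p" | "a = p" | "a \<noteq> x" "b = p" | "a \<noteq> x" "a \<noteq> p" "b \<noteq> x" "b \<noteq> p"
    using \<open>b \<noteq> x\<close> by blast
  then show ?thesis
  proof cases
    case 1
    then have "c = ((x, x'), (p, y))" using c o strand_sv[OF s, of x a' x'] strand_sv[OF s, of p b' y] by simp
    then show ?thesis using assms(6) by simp
  next
    case 2
    have a': "a' = x'" using 2 c o strand_sv[OF s, of x a' x'] by simp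
    have py: "(p, y) \<in> resolve \<nu> c" using r o 2 by (auto simp: pt_less_def)
    have bp: "fst b = i" "snd b \<noteq> j" using 2 c o by (auto simp: pt_less_def prod_eq_iff)
    show ?thesis
    proof (cases "snd b < j")
      case True
      have "(b, x') \<in> resolve \<nu> c" using r a' by simp
      moreover have "pt_less b p" using True bp by (simp add: pt_less_def)
      ultimately show ?thesis using crI[OF _ py] o yx by blast
    next
      case False
      have xb: "(x, b') \<in> resolve \<nu> c" using r 2 by simp
      have "b' \<noteq> y" using strand_inj[OF s, of b y p] c o 2 by auto
      moreover have "\<not> pt_less b' y"
      proof
        assume "pt_less b' y"
        obtain g where g: "\<nu> = graph_on (Domain \<nu>) g" "interval_inj (Domain \<nu>) g"
          using strand_graph[OF s finite_strands[OF s]] .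
        have gv: "g u = v" "u \<in> Domain \<nu>" if "(u, v) \<in> \<nu>" for u v
        proof -
          have "(u, v) \<in> graph_on (Domain \<nu>) g" using that g(1) by simp
          then show "g u = v" "u \<in> Domain \<nu>" by (auto simp: graph_on_def)
        qed
        have gg: "g x = x'" "g b = b'" "g p = y" "x \<in> Domain \<nu>" "b \<in> Domain \<nu>" "p \<in> Domain \<nu>" using gv o c by blast+
        have inv: "inverted (Domain \<nu>) g x b"
          using gg c 2 a' by (auto simp: inverted_def pt_less_def)
        have "p \<in> between (Domain \<nu>) g x b"
          using gg o yx \<open>pt_less b' y\<close> False bp by (auto simp: between_def pt_less_def)
        then have "card (between (Domain \<nu>) g x b) > 0"
          using g(2) by (auto simp: card_gt_0_iff between_def interval_inj_def)
        moreover have "resolve \<nu> c = graph_on (Domain \<nu>) (exchange x b g)"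
          using resolve_graph_on[OF inv] g(1) gg c 2 a' by metis
        ultimately show False using inv_num_exchange[OF g(2) inv] assms(5) g(1) by simp
      qed
      ultimately have "pt_less y b'" using c o 2 by (cases y; cases b') (auto simp: pt_less_def)
      then show ?thesis using crI[OF xb py] o by blast
    qed
  next
    case 3
    then have "a' = y" using c o strand_sv[OF s, of p a' y] by simp
    have "(x, x') \<in> resolve \<nu> c" using r o 3 \<open>b \<noteq> x\<close> by (auto simp: pt_less_def)
    moreover have "(p, b') \<in> resolve \<nu> c" using r 3 by simp
    moreover have "pt_less p b'" "pt_less b' x'" using c 3 \<open>a' = y\<close> yx o by (auto simp: pt_less_def)
    ultimately show ?thesis using crI o by blast
  next
    case 4
    then have "b' = y" using c o strand_sv[OF s, of p b' y] by simp
    then have "a = x" using un[OF c(2)] c o 4 by (auto simp: pt_less_def pt_le_def)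
    then show ?thesis using 4 by simp
  next
    case 5
    then have "(x, x') \<in> resolve \<nu> c" "(p, y) \<in> resolve \<nu> c" using r o by auto
    then show ?thesis using crI o yx by blast
  qed
qed

text \<open>A strand between the two would start before \<open>p\<close> and end after
  \<open>y\<close>, hence pass over \<open>p\<close>, which only the strand from \<open>x\<close>
  does.\<close>

lemma over_crossing:
  assumes "has_h \<nu>" "crossed \<nu>" "over \<nu> x x' y"
  shows "((x, x'), (p, y)) \<in> crossings \<nu>" "inv_num (resolve \<nu> ((x, x'), (p, y))) + 1 = inv_num \<nu>"
proof -
  have s: "strand_diagram Z \<nu>" using assms by (simp add: has_h_def)
  have o: "(x, x') \<in> \<nu>" "(p, y) \<in> \<nu>" "pt_less x p" "pt_less p x'" "pt_less p y" using assms(3) by (auto simp: over_def)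
  have yx: "pt_less y x'" using crossed_iff[OF assms(1,3)] assms(2) by simp
  show "((x, x'), (p, y)) \<in> crossings \<nu>" using o yx by (simp add: crossings_def)
  obtain g where g: "\<nu> = graph_on (Domain \<nu>) g" "interval_inj (Domain \<nu>) g"
    using strand_graph[OF s finite_strands[OF s]] .
  have gv: "g u = v" "u \<in> Domain \<nu>" if "(u, v) \<in> \<nu>" for u v
  proof -
    have "(u, v) \<in> graph_on (Domain \<nu>) g" using that g(1) by simp
    then show "g u = v" "u \<in> Domain \<nu>" by (auto simp: graph_on_def)
  qed
  have gg: "g x = x'" "g p = y" "x \<in> Domain \<nu>" "p \<in> Domain \<nu>" using gv o by blast+
  have inv: "inverted (Domain \<nu>) g x p" using gg o yx by (simp add: inverted_def)
  have "between (Domain \<nu>) g x p = {}"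
  proof (rule ccontr)
    assume "between (Domain \<nu>) g x p \<noteq> {}"
    then obtain z where z: "z \<in> Domain \<nu>" "pt_less x z" "pt_less z p" "pt_less y (g z)" by (auto simp: between_def gg)
    then have "(z, g z) \<in> \<nu>" using gv by blast
    moreover have "pt_less p (g z)" using z o by (auto simp: pt_less_def)
    ultimately have "over \<nu> z (g z) y" using z o by (simp add: over_def)
    then have "z = x" using over_unique[OF assms(1,3)] by blast
    then show False using z by (simp add: pt_less_def)
  qed
  moreover have "resolve \<nu> ((x, x'), (p, y)) = graph_on (Domain \<nu>) (exchange x p g)"
    using resolve_graph_on[OF inv] g(1) gg by metis
  ultimately show "inv_num (resolve \<nu> ((x, x'), (p, y))) + 1 = inv_num \<nu>"
    using inv_num_exchange[OF g(2) inv] g(1) by simp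
qed

definition uncrossed_part :: "'i chain \<Rightarrow> 'i chain" where
  "uncrossed_part = lin (\<lambda>\<nu>. if crossed \<nu> then 0 else basis \<nu>)"

lemma uncrossed_part_sum: "uncrossed_part (\<Sum>k\<in>K. x k) = (\<Sum>k\<in>K. uncrossed_part (x k))"
  unfolding uncrossed_part_def by (rule lin_sum) simp

text \<open>Every other simple resolution keeps the distinguished crossing. So on crossed diagrams
  the uncrossed part of the differential is a bijection between basis elements, an invertible block
  which is used for cancellation.\<close>

lemma uncrossed_part_diff_basis:
  assumes "has_h \<nu>" "crossed \<nu>"
  shows "uncrossed_part (diff (basis \<nu>)) = basis (swap \<nu>)"
proof -
  obtain x x' y where o: "over \<nu> x x' y" using has_h_over[OF assms(1)] by metis
  let ?c = "((x, x'), (p, y))" and ?C = "{c \<in> crossings \<nu>. inv_num (resolve \<nu> c) + 1 = inv_num \<nu>}"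
  have s: "strand_diagram Z \<nu>" using assms by (simp add: has_h_def)
  have fin: "finite ?C" 
    by (rule finite_subset[of _ "\<nu> \<times> \<nu>"]) (use finite_strands[OF s] in \<open>auto simp: crossings_def\<close>)
  have sw: "swap \<nu> = resolve \<nu> ?c" by (rule swap_eq[OF assms(1) o])
  have "uncrossed_part (diff (basis \<nu>)) = (\<Sum>c\<in>?C. if crossed (resolve \<nu> c) then 0 else basis (resolve \<nu> c))"
    unfolding diff_basis diff_strands_def uncrossed_part_sum by (simp add: uncrossed_part_def)
  also have "\<dots> = (\<Sum>c\<in>?C. if c = ?c then basis (swap \<nu>) else 0)"
  proof (rule sum.cong[OF refl])
    fix c assume "c \<in> ?C"
    then show "(if crossed (resolve \<nu> c) then 0 else basis (resolve \<nu> c)) = (if c = ?c then basis (swap \<nu>) else 0)"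
      using resolve_uncrossed[OF assms o, of c] crossed_swap[OF assms(1)] assms(2) sw by (cases "c = ?c") auto
  qed
  also have "\<dots> = basis (swap \<nu>)"
    using over_crossing[OF assms o] fin by (simp add: sum.delta)
  finally show ?thesis .
qed

lemma swap_fill:
  assumes "moving Z \<mu>" "h_grading \<mu> = h" "V \<subseteq> points Z - (Domain \<mu> \<union> Range \<mu>)" "has_h (\<mu> \<union> Id_on V)"
  shows "swap (\<mu> \<union> Id_on V) = swap \<mu> \<union> Id_on V" "crossed (\<mu> \<union> Id_on V) = crossed \<mu>"
proof -
  have H: "has_h \<mu>" using assms by (simp add: moving_def has_h_def)
  obtain x x' y where o: "over \<mu> x x' y" using has_h_over[OF H] by metis
  then have o2: "over (\<mu> \<union> Id_on V) x x' y" by (simp add: over_def)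
  have "x \<noteq> x'" "p \<noteq> y" using o by (auto simp: over_def pt_less_def)
  then have "resolve (\<mu> \<union> Id_on V) ((x, x'), (p, y)) = resolve \<mu> ((x, x'), (p, y)) \<union> Id_on V"
    by (auto simp: resolve_def)
  then show "swap (\<mu> \<union> Id_on V) = swap \<mu> \<union> Id_on V"
    by (simp add: swap_eq[OF H o] swap_eq[OF assms(4) o2])
  show "crossed (\<mu> \<union> Id_on V) = crossed \<mu>"
    using crossed_iff[OF H o] crossed_iff[OF assms(4) o2] by simp
qed

lemma diagram_swap:
  assumes "diagram Z (\<mu>, s, t)" "h_grading \<mu> = h"
  shows "diagram Z (swap \<mu>, s, t)" "h_grading (swap \<mu>) = h"
    "lin (\<lambda>\<nu>. basis (swap \<nu>)) (elt Z (\<mu>, s, t)) = elt Z (swap \<mu>, s, t)"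
    "uncrossed_part (elt Z (\<mu>, s, t)) = (if crossed \<mu> then 0 else elt Z (\<mu>, s, t))"
    "crossed (swap \<mu>) \<longleftrightarrow> \<not> crossed \<mu>" "swap (swap \<mu>) = \<mu>"
proof -
  have m: "moving Z \<mu>" using assms by (simp add: diagram_iff)
  have H: "has_h \<mu>" using assms m by (simp add: moving_def has_h_def)
  obtain x x' y where o: "over \<mu> x x' y" using has_h_over[OF H] by metis
  note f = swap_facts[OF H o]
  have "a \<noteq> b" if "pt_less a b" for a b :: "'i \<times> nat" using that by (auto simp: pt_less_def)
  moreover have "pt_less x y" using o by (auto simp: over_def pt_less_def)
  ultimately have "x \<noteq> y" "p \<noteq> x'" using o unfolding over_def by blast+
  then have "(u, u) \<notin> swap \<mu>" for u
  proof -
    have "(u, u) \<notin> \<mu>" using m by (simp only: moving_def simp_thms)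
    then show ?thesis unfolding swap_eq[OF H o] resolve_def prod.case
      using \<open>x \<noteq> y\<close> \<open>p \<noteq> x'\<close> by simp
  qed
  then have m': "moving Z (swap \<mu>)" using f by (auto simp: moving_def has_h_def)
  show "diagram Z (swap \<mu>, s, t)"
    using assms m' by (simp add: diagram_iff compat_def dotted_def f)
  show "h_grading (swap \<mu>) = h" using f by (simp add: has_h_def)
  show "crossed (swap \<mu>) \<longleftrightarrow> \<not> crossed \<mu>" by (rule crossed_swap[OF H])
  show "swap (swap \<mu>) = \<mu>" by (rule f)
  have fl: "fills Z (swap \<mu>) s t = fills Z \<mu> s t" by (simp add: fills_def f)
  have Hf: "has_h (\<mu> \<union> Id_on V) \<and> V \<subseteq> points Z - (Domain \<mu> \<union> Range \<mu>)" if "V \<in> fills Z \<mu> s t" for V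
  proof -
    have "\<mu> \<union> Id_on V \<in> keys (elt Z (\<mu>, s, t))" using that by (simp add: keys_elt[OF m])
    then show ?thesis using elt_strand[OF assms(1), of "\<mu> \<union> Id_on V"] assms(2) that
      by (auto simp: has_h_def strand_data_def fills_def)
  qed
  have eq: "swap (\<mu> \<union> Id_on V) = swap \<mu> \<union> Id_on V" "crossed (\<mu> \<union> Id_on V) = crossed \<mu>" if "V \<in> fills Z \<mu> s t" for V
    using Hf[OF that] swap_fill[OF m assms(2)] by blast+
  show "lin (\<lambda>\<nu>. basis (swap \<nu>)) (elt Z (\<mu>, s, t)) = elt Z (swap \<mu>, s, t)"
    by (simp add: lin_elt[OF m] elt_eq[OF m'] fl eq)
  show "uncrossed_part (elt Z (\<mu>, s, t)) = (if crossed \<mu> then 0 else elt Z (\<mu>, s, t))"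
    unfolding uncrossed_part_def elt_eq[OF m] by (subst lin_basis_sum) (simp_all add: eq)
qed

text \<open>Let \<open>w\<close> be the swap of the uncrossed part of the cycle \<open>z\<close>.
  Then \<open>z + diff w\<close> has only crossed terms. It is again a cycle, and a cycle with only
  crossed terms vanishes, because the uncrossed part of its differential is its swap.\<close>

lemma cycle_boundary:
  assumes "z \<in> alg_at Z (h, s, t)" "diff z = 0"
  shows "z \<in> boundaries Z"
proof -
  let ?S = "lin (\<lambda>\<nu>. basis (swap \<nu>))"
  have S_sum: "?S (\<Sum>k\<in>K. x k) = (\<Sum>k\<in>K. ?S (x k))" for x :: "'b \<Rightarrow> 'i chain" and K by (rule lin_sum) simp
  obtain F where F: "finite F" "\<And>\<mu>. \<mu> \<in> F \<Longrightarrow> diagram Z (\<mu>, s, t) \<and> h_grading \<mu> = h" "z = (\<Sum>\<mu>\<in>F. elt Z (\<mu>, s, t))"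
    by (rule alg_atE[OF assms(1)]) blast
  note dF = diagram_swap[OF conjunct1[OF F(2)] conjunct2[OF F(2)]]
  have dsF: "uncrossed_part (elt Z (swap \<mu>, s, t)) = (if crossed \<mu> then elt Z (swap \<mu>, s, t) else 0)"
    "lin (\<lambda>\<nu>. basis (swap \<nu>)) (elt Z (swap \<mu>, s, t)) = elt Z (\<mu>, s, t)" if "\<mu> \<in> F" for \<mu>
    using diagram_swap(3,4)[OF dF(1,2)[OF that that]] dF(5,6)[OF that that] by simp_all
  define w where "w = (\<Sum>\<mu>\<in>{\<mu>\<in>F. \<not> crossed \<mu>}. elt Z (swap \<mu>, s, t))"
  have w_alg: "w \<in> alg_at Z (h, s, t)"
  proof -
    have i: "inj_on swap {\<mu>\<in>F. \<not> crossed \<mu>}" 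
      by (rule inj_on_inverseI[where g = swap])
        (use diagram_swap(6)[OF conjunct1[OF F(2)] conjunct2[OF F(2)]] in blast)
    have "w = (\<Sum>\<mu>\<in>swap ` {\<mu>\<in>F. \<not> crossed \<mu>}. elt Z (\<mu>, s, t))" unfolding w_def by (simp add: sum.reindex[OF i])
    also have "\<dots> \<in> alg_at Z (h, s, t)" 
      by (rule alg_atI) (use diagram_swap(1,2)[OF conjunct1[OF F(2)] conjunct2[OF F(2)]] in blast)
    finally show ?thesis .
  qed
  have has: "has_h \<nu>" if "x \<in> alg_at Z (h, s, t)" "\<nu> \<in> keys x" for x \<nu>
    using alg_at_data[OF that] alg_strand alg_at_subset that by (fastforce simp: has_h_def strand_data_def)
  have diff_has: "has_h \<nu>" if "x \<in> alg_at Z (h, s, t)" "\<nu> \<in> keys (diff x)" for x \<nu>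
    using that(2) has[OF that(1)] resolve_strand by (elim keys_diff) (auto simp: has_h_def)
  have wc: "crossed \<nu>" if "\<nu> \<in> keys w" for \<nu>
  proof -
    have "uncrossed_part w = 0"
      unfolding w_def uncrossed_part_sum by (rule sum.neutral) (simp add: dsF)
    moreover have "lookup (uncrossed_part w) \<nu> = 1" if "\<not> crossed \<nu>"
    proof -
      have "uncrossed_part w = (\<Sum>\<nu>\<in>keys w. if crossed \<nu> then 0 else basis \<nu>)" by (simp add: uncrossed_part_def lin_def)
      also have "lookup \<dots> \<nu> = (\<Sum>\<nu>'\<in>keys w. if \<nu>' = \<nu> then 1 else 0)"
        unfolding lookup_sum by (rule sum.cong) (use that in \<open>auto simp: lookup_single when_def\<close>)
      also have "\<dots> = 1" using \<open>\<nu> \<in> keys w\<close> by (simp add: sum.delta')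
      finally show ?thesis .
    qed
    ultimately show ?thesis by auto
  qed
  have Rd: "uncrossed_part (diff x) = ?S x" if "\<And>\<nu>. \<nu> \<in> keys x \<Longrightarrow> has_h \<nu> \<and> crossed \<nu>" for x
  proof -
    have "uncrossed_part (diff (\<Sum>\<nu>\<in>keys x. basis \<nu>)) = (\<Sum>\<nu>\<in>keys x. basis (swap \<nu>))"
      unfolding diff_sum uncrossed_part_sum by (rule sum.cong) (use that uncrossed_part_diff_basis in auto)
    then show ?thesis by (simp add: lin_def flip: chain_as_sum)
  qed
  have "uncrossed_part (diff w) = ?S w" by (rule Rd) (use has[OF w_alg] wc in auto)
  also have "\<dots> = (\<Sum>\<mu>\<in>{\<mu>\<in>F. \<not> crossed \<mu>}. elt Z (\<mu>, s, t))"
    unfolding w_def S_sum by (rule sum.cong) (simp_all add: dsF)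
  also have "\<dots> = uncrossed_part z"
    unfolding F(3) uncrossed_part_sum sum.inter_filter[OF F(1)] by (rule sum.cong) (simp_all add: dF(4))
  finally have e: "uncrossed_part (diff w) = uncrossed_part z" .
  define v where "v = z + diff w"
  have uv: "uncrossed_part v = 0"
    unfolding v_def using e by (simp add: uncrossed_part_def lin_add)
  have vh: "has_h \<nu>" if "\<nu> \<in> keys v" for \<nu>
    using that has[OF assms(1)] diff_has[OF w_alg] by (auto simp: v_def keys_add_bit)
  have vc: "crossed \<nu>" if "\<nu> \<in> keys v" for \<nu>
  proof (rule ccontr)
    assume n: "\<not> crossed \<nu>"
    have "uncrossed_part v = (\<Sum>\<nu>\<in>keys v. if crossed \<nu> then 0 else basis \<nu>)" by (simp add: uncrossed_part_def lin_def)
    also have "lookup \<dots> \<nu> = (\<Sum>\<nu>'\<in>keys v. if \<nu>' = \<nu> then 1 else 0)"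
      unfolding lookup_sum by (rule sum.cong) (use n in \<open>auto simp: lookup_single when_def\<close>)
    also have "\<dots> = 1" using that by (simp add: sum.delta')
    finally show False using uv by simp
  qed
  have "diff v = 0"
    unfolding v_def diff_add assms(2) using diff_diff[of w] has[OF w_alg] by (auto simp: has_h_def)
  then have "?S v = 0" using Rd[of v] vh vc by (simp add: uncrossed_part_def)
  then have "?S (?S v) = 0" by simp
  moreover have "?S (?S v) = v"
  proof -
    have "?S (?S v) = (\<Sum>\<nu>\<in>keys v. basis (swap (swap \<nu>)))"
      by (simp add: lin_def[of _ v] S_sum)
    also have "\<dots> = (\<Sum>\<nu>\<in>keys v. basis \<nu>)"
      by (rule sum.cong) (use vh has_h_over swap_facts(3) in metis)+
    finally show ?thesis by (simp flip: chain_as_sum)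
  qed
  ultimately have "z = diff w" unfolding v_def by (simp add: chain_add_eq_0)
  then show ?thesis using boundary_alg_atI[OF w_alg] by simp
qed

end

context arc
begin

lemma h_grading_nonneg: "strand_diagram Z \<nu> \<Longrightarrow> h_grading \<nu> e \<ge> 0"
  using h_grading_card[of Z \<nu> e] finite_strands[of \<nu>] by simp

lemma nonviable_boundary:
  assumes "z \<in> alg_at Z (h, s, t)" "diff z = 0" "\<not> viable_h Z h"
  shows "z \<in> boundaries Z"
proof (cases "z = 0")
  case False
  obtain F where F: "finite F" "\<And>\<mu>. \<mu> \<in> F \<Longrightarrow> diagram Z (\<mu>, s, t) \<and> h_grading \<mu> = h" "z = (\<Sum>\<mu>\<in>F. elt Z (\<mu>, s, t))"
    by (rule alg_atE[OF assms(1)]) blast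
  with False obtain \<mu> where "\<mu> \<in> F" by force
  then have "h e \<ge> 0" for e using F(2) h_grading_nonneg[of \<mu> e] by (auto simp: diagram_iff moving_def)
  moreover obtain e where "h e \<noteq> 0" "h e \<noteq> 1" using assms(3) by (auto simp: viable_h_def)
  ultimately have "h e \<ge> 2" using \<open>\<And>e. h e \<ge> 0\<close>[of e] by linarith
  then have "h (fst e, snd e) \<ge> 2" by simp
  \<comment> \<open>Multiplicities are nonnegative, so a violation of viability has value at least
    two; the locale \<open>nonviable\<close> needs the first such step on its interval.\<close>
  then obtain i where "\<exists>j. h (i, j) \<ge> 2" by blast
  then have L: "h (i, LEAST j. h (i, j) \<ge> 2) \<ge> 2" by (rule LeastI_ex)
  have "h (i, j') \<le> 1" if "j' < (LEAST j. h (i, j) \<ge> 2)" for j'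
    using not_less_Least[OF that] by linarith
  with L interpret nonviable Z h i "LEAST j. h (i, j) \<ge> 2"
    by unfold_locales blast+
  show ?thesis by (rule cycle_boundary[OF assms(1,2)])
qed (simp add: boundaries_0)

end

section \<open>Viable diagrams\<close>

text \<open>The multiplicity on the step ending at the point. It has this meaning only for points of
  positive index, such as places; at minus infinity the truncated subtraction would return the step
  starting there.\<close>

definition before :: "'i h1 \<Rightarrow> 'i \<times> nat \<Rightarrow> int" where
  "before h p = h (fst p, snd p - 1)"

definition through :: "'i h1 \<Rightarrow> 'i \<times> nat \<Rightarrow> bool" where
  "through h p \<longleftrightarrow> before h p = 1 \<and> h p = 1"

definition passes :: "'i strands \<Rightarrow> 'i \<times> nat \<Rightarrow> bool" where
  "passes \<mu> p \<longleftrightarrow> (\<exists>x y. (x, y) \<in> \<mu> \<and> pt_less x p \<and> pt_less p y)"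

text \<open>The moving strands after the strand passing over \<open>p\<close> has been resolved
  against a horizontal strand at \<open>p\<close>; \<open>join_at\<close> reverses this.\<close>

definition break_at :: "'i \<times> nat \<Rightarrow> 'i strands \<Rightarrow> 'i strands" where
  "break_at p \<mu> = {(x, y) \<in> \<mu>. \<not> (pt_less x p \<and> pt_less p y)} \<union>
     {(x, p) | x. \<exists>y. (x, y) \<in> \<mu> \<and> pt_less x p \<and> pt_less p y} \<union>
     {(p, y) | y. \<exists>x. (x, y) \<in> \<mu> \<and> pt_less x p \<and> pt_less p y}"

definition join_at :: "'i \<times> nat \<Rightarrow> 'i strands \<Rightarrow> 'i strands" where
  "join_at p \<mu> = {(x, y) \<in> \<mu>. x \<noteq> p \<and> y \<noteq> p} \<union> {(x, y). (x, p) \<in> \<mu> \<and> (p, y) \<in> \<mu>}"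

definition crossing_places :: "('i, 'l) arc_diag \<Rightarrow> ('i, 'l) diag \<Rightarrow> ('i \<times> nat) set" where
  "crossing_places Z D = {p \<in> places Z. dotted Z D (pair_of Z p) \<and> passes (fst D) p}"

lemma pt_less_irrefl [simp]: "\<not> pt_less x x"
  by (simp add: pt_less_def)

lemma pt_less_trans: "pt_less x y \<Longrightarrow> pt_less y z \<Longrightarrow> pt_less x z"
  by (simp add: pt_less_def)

lemma pt_less_imp_le: "pt_less x y \<Longrightarrow> pt_le x y"
  by (simp add: pt_less_def pt_le_def)

lemma moving_less: "moving Z \<mu> \<Longrightarrow> (x, y) \<in> \<mu> \<Longrightarrow> pt_less x y"
proof -
  assume a: "moving Z \<mu>" "(x, y) \<in> \<mu>"
  then have "fst y = fst x" "snd x \<le> snd y" using strand_le unfolding moving_def by blast+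
  moreover have "x \<noteq> y" using a unfolding moving_def by blast
  ultimately show "pt_less x y" by (cases x; cases y) (auto simp: pt_less_def)
qed

lemma place_snd: "p \<in> places Z \<Longrightarrow> snd p > 0"
  by (auto simp: places_def)

context arc
begin

lemma between_place:
  assumes "x \<in> points Z" "y \<in> points Z" "pt_less x p" "pt_less p y"
  shows "p \<in> places Z"
  using assms by (cases p) (auto simp: points_def places_def pt_less_def)

definition viable_strands :: "'i strands \<Rightarrow> bool" where
  "viable_strands \<mu> \<longleftrightarrow> moving Z \<mu> \<and> viable_h Z (h_grading \<mu>)"

lemma viable_strands_sd: "viable_strands \<mu> \<Longrightarrow> strand_diagram Z \<mu>"
  by (simp add: viable_strands_def moving_def)

lemma covers_step:
  assumes "strand_diagram Z \<mu>" "u \<in> \<mu>" "covers u e"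
  shows "e \<in> steps Z"
proof -
  obtain x y where u: "u = (x, y)" by (cases u)
  then show ?thesis using strand_le[OF assms(1), of x y] assms(2,3)
    by (cases e; cases x; cases y) (auto simp: covers_def points_def steps_def)
qed

lemma cover_unique:
  assumes "viable_strands \<mu>" "u \<in> \<mu>" "v \<in> \<mu>" "covers u e" "covers v e"
  shows "u = v"
proof -
  have s: "strand_diagram Z \<mu>" using viable_strands_sd[OF assms(1)] .
  have "h_grading \<mu> e \<le> 1"
    using covers_step[OF s assms(2,4)] assms(1) by (auto simp: viable_strands_def viable_h_def)
  then have "card {u \<in> \<mu>. covers u e} \<le> Suc 0" by (simp add: h_grading_card[OF s finite_strands[OF s]])
  moreover have "finite {u \<in> \<mu>. covers u e}" using finite_strands[OF s] by simp
  ultimately show ?thesis using assms card_le_Suc0_iff_eq[of "{u \<in> \<mu>. covers u e}"] by blast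
qed

lemma h_eq_1_iff:
  assumes "viable_strands \<mu>"
  shows "h_grading \<mu> e = 1 \<longleftrightarrow> (\<exists>u\<in>\<mu>. covers u e)" "h_grading \<mu> e = 0 \<longleftrightarrow> \<not> (\<exists>u\<in>\<mu>. covers u e)"
proof -
  have s: "strand_diagram Z \<mu>" using viable_strands_sd[OF assms(1)] .
  have f: "finite {u \<in> \<mu>. covers u e}" using finite_strands[OF s] by simp
  have c: "h_grading \<mu> e = int (card {u \<in> \<mu>. covers u e})" by (simp add: h_grading_card[OF s finite_strands[OF s]])
  show z: "h_grading \<mu> e = 0 \<longleftrightarrow> \<not> (\<exists>u\<in>\<mu>. covers u e)" unfolding c using f by auto
  show "h_grading \<mu> e = 1 \<longleftrightarrow> (\<exists>u\<in>\<mu>. covers u e)"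
  proof
    assume "\<exists>u\<in>\<mu>. covers u e"
    then obtain u where "u \<in> \<mu>" "covers u e" by blast
    then have "{u \<in> \<mu>. covers u e} = {u}" using cover_unique[OF assms] by blast
    then show "h_grading \<mu> e = 1" by (simp add: c)
  qed (use z in auto)
qed

text \<open>Each step has multiplicity at most one. Hence the strand covering the step before a
  place either ends there or passes over it, and the one covering the step after it either starts
  there or passes. This dictionary reduces the local analysis of viable diagrams to propositional
  logic.\<close>

lemma local_bits:
  assumes "viable_strands \<mu>" "snd p > 0"
  defines "h \<equiv> h_grading \<mu>"
  shows "before h p = 1 \<longleftrightarrow> p \<in> Range \<mu> \<or> passes \<mu> p" "before h p = 0 \<longleftrightarrow> \<not> (p \<in> Range \<mu> \<or> passes \<mu> p)"
    "h p = 1 \<longleftrightarrow> p \<in> Domain \<mu> \<or> passes \<mu> p" "h p = 0 \<longleftrightarrow> \<not> (p \<in> Domain \<mu> \<or> passes \<mu> p)"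
    "passes \<mu> p \<Longrightarrow> p \<notin> Domain \<mu>" "passes \<mu> p \<Longrightarrow> p \<notin> Range \<mu>"
proof -
  have m: "moving Z \<mu>" using assms by (simp add: viable_strands_def)
  let ?b = "(fst p, snd p - 1)"
  have cb: "covers (x, y) ?b \<longleftrightarrow> (pt_less x p \<and> (y = p \<or> pt_less p y))" if "(x, y) \<in> \<mu>" for x y
    using moving_less[OF m that] assms(2) by (cases p; cases y) (auto simp: covers_def pt_less_def)
  have ca: "covers (x, y) p \<longleftrightarrow> ((x = p \<or> pt_less x p) \<and> pt_less p y)" if "(x, y) \<in> \<mu>" for x y
    using moving_less[OF m that] assms(2) by (cases p; cases x) (auto simp: covers_def pt_less_def)
  have B: "(\<exists>u\<in>\<mu>. covers u ?b) \<longleftrightarrow> p \<in> Range \<mu> \<or> passes \<mu> p"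
  proof
    assume "\<exists>u\<in>\<mu>. covers u ?b"
    then obtain x y where "(x, y) \<in> \<mu>" "covers (x, y) ?b" by (metis surj_pair)
    then show "p \<in> Range \<mu> \<or> passes \<mu> p" using cb unfolding passes_def by blast
  next
    assume "p \<in> Range \<mu> \<or> passes \<mu> p"
    then obtain x y where "(x, y) \<in> \<mu>" "pt_less x p \<and> (y = p \<or> pt_less p y)"
      using moving_less[OF m] unfolding passes_def by blast
    then show "\<exists>u\<in>\<mu>. covers u ?b" using cb by blast
  qed
  have A: "(\<exists>u\<in>\<mu>. covers u p) \<longleftrightarrow> p \<in> Domain \<mu> \<or> passes \<mu> p"
  proof
    assume "\<exists>u\<in>\<mu>. covers u p"
    then obtain x y where "(x, y) \<in> \<mu>" "covers (x, y) p" by (metis surj_pair)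
    then show "p \<in> Domain \<mu> \<or> passes \<mu> p" using ca unfolding passes_def by blast
  next
    assume "p \<in> Domain \<mu> \<or> passes \<mu> p"
    then obtain x y where "(x, y) \<in> \<mu>" "(x = p \<or> pt_less x p) \<and> pt_less p y"
      using moving_less[OF m] unfolding passes_def by blast
    then show "\<exists>u\<in>\<mu>. covers u p" using ca by blast
  qed
  show "before h p = 1 \<longleftrightarrow> p \<in> Range \<mu> \<or> passes \<mu> p" "before h p = 0 \<longleftrightarrow> \<not> (p \<in> Range \<mu> \<or> passes \<mu> p)"
    "h p = 1 \<longleftrightarrow> p \<in> Domain \<mu> \<or> passes \<mu> p" "h p = 0 \<longleftrightarrow> \<not> (p \<in> Domain \<mu> \<or> passes \<mu> p)"
    unfolding before_def h_def h_eq_1_iff[OF assms(1)] A B by auto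
  show "p \<notin> Domain \<mu>" if "passes \<mu> p"
  proof
    assume "p \<in> Domain \<mu>"
    then obtain y where y: "(p, y) \<in> \<mu>" by blast
    from that obtain x z where x: "(x, z) \<in> \<mu>" "pt_less x p" "pt_less p z" by (auto simp: passes_def)
    have "(x, z) = (p, y)"
      by (rule cover_unique[OF assms(1) x(1) y]) (use ca[OF x(1)] ca[OF y] x moving_less[OF m y] in auto)
    then show False using x by simp
  qed
  show "p \<notin> Range \<mu>" if "passes \<mu> p"
  proof
    assume "p \<in> Range \<mu>"
    then obtain y where y: "(y, p) \<in> \<mu>" by blast
    from that obtain x z where x: "(x, z) \<in> \<mu>" "pt_less x p" "pt_less p z" by (auto simp: passes_def)
    have "(x, z) = (y, p)"
      by (rule cover_unique[OF assms(1) x(1) y]) (use cb[OF x(1)] cb[OF y] x moving_less[OF m y] in auto)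
    then show False using x by simp
  qed
qed

lemma pass_unique:
  assumes "viable_strands \<mu>" "(x, y) \<in> \<mu>" "pt_less x p" "pt_less p y" "(x', y') \<in> \<mu>" "pt_less x' p" "pt_less p y'"
  shows "x' = x" "y' = y"
proof -
  have "(x', y') = (x, y)"
    by (rule cover_unique[OF assms(1) assms(5) assms(2), of p]) (use assms in \<open>auto simp: covers_def pt_less_def\<close>)
  then show "x' = x" "y' = y" by auto
qed

text \<open>Two crossing moving strands would both cover the step from the source of the second one,
  which viability forbids. So every crossing is that of a moving strand with a horizontal one below
  which it starts and above which it ends.\<close>

lemma crossings_fill:
  assumes "viable_strands \<mu>" "V \<inter> Domain \<mu> = {}" "V \<inter> Range \<mu> = {}"
  shows "crossings (\<mu> \<union> Id_on V) = {((x, y), (p, p)) | x y p. (x, y) \<in> \<mu> \<and> p \<in> V \<and> pt_less x p \<and> pt_less p y}"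
    (is "?L = ?R")
proof
  have m: "moving Z \<mu>" using assms by (simp add: viable_strands_def)
  show "?R \<subseteq> ?L" by (auto simp: crossings_def)
  show "?L \<subseteq> ?R"
  proof
    fix c assume "c \<in> ?L"
    then obtain a a' b b' where c: "c = ((a, a'), (b, b'))" "(a, a') \<in> \<mu> \<union> Id_on V" "(b, b') \<in> \<mu> \<union> Id_on V" "pt_less a b" "pt_less b' a'"
      unfolding crossings_def by blast
    have le: "pt_le b b'" using c(3) moving_less[OF m, of b b'] by (auto simp: pt_less_def pt_le_def)
    then have "pt_less a a'" "pt_less b a'" using c by (auto simp: pt_less_def pt_le_def)
    then have 1: "(a, a') \<in> \<mu>" using c(2) by auto
    have "(b, b') \<notin> \<mu>"
    proof
      assume b: "(b, b') \<in> \<mu>"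
      have "(a, a') = (b, b')"
        by (rule cover_unique[OF assms(1) 1 b, of b])
          (use c(4) \<open>pt_less b a'\<close> moving_less[OF m b] in \<open>auto simp: covers_def pt_less_def\<close>)
      then show False using c by simp
    qed
    then have "b' = b" "b \<in> V" using c(3) by auto
    then have "c = ((a, a'), (b, b))" "pt_less b a'" using c by auto
    then show "c \<in> ?R" using c(4) 1 \<open>b \<in> V\<close> by blast
  qed
qed

lemma inv_num_fill:
  assumes "viable_strands \<mu>" "V \<inter> Domain \<mu> = {}" "V \<inter> Range \<mu> = {}"
  shows "inv_num (\<mu> \<union> Id_on V) = card {p \<in> V. passes \<mu> p}"
proof -
  have "bij_betw (\<lambda>c. fst (snd c)) (crossings (\<mu> \<union> Id_on V)) {p \<in> V. passes \<mu> p}"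
    unfolding bij_betw_def crossings_fill[OF assms]
  proof
    show "inj_on (\<lambda>c. fst (snd c)) {((x, y), (p, p)) | x y p. (x, y) \<in> \<mu> \<and> p \<in> V \<and> pt_less x p \<and> pt_less p y}"
    proof (rule inj_onI)
      fix c c' assume "c \<in> {((x, y), (p, p)) | x y p. (x, y) \<in> \<mu> \<and> p \<in> V \<and> pt_less x p \<and> pt_less p y}"
        "c' \<in> {((x, y), (p, p)) | x y p. (x, y) \<in> \<mu> \<and> p \<in> V \<and> pt_less x p \<and> pt_less p y}" "fst (snd c) = fst (snd c')"
      then obtain x y x' y' p where "c = ((x, y), (p, p))" "c' = ((x', y'), (p, p))" "(x, y) \<in> \<mu>" "pt_less x p" "pt_less p y"
        "(x', y') \<in> \<mu>" "pt_less x' p" "pt_less p y'" by auto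
      then show "c = c'" using pass_unique[OF assms(1)] by blast
    qed
    show "(\<lambda>c. fst (snd c)) ` {((x, y), (p, p)) | x y p. (x, y) \<in> \<mu> \<and> p \<in> V \<and> pt_less x p \<and> pt_less p y} = {p \<in> V. passes \<mu> p}"
      unfolding passes_def by force
  qed
  then show ?thesis unfolding inv_num_def by (rule bij_betw_same_card)
qed

section \<open>Breaking and joining strands at a place\<close>

lemma break_eq:
  assumes "viable_strands \<mu>" "(x, y) \<in> \<mu>" "pt_less x p" "pt_less p y"
  shows "break_at p \<mu> = \<mu> - {(x, y)} \<union> {(x, p), (p, y)}"
proof (rule set_eqI)
  fix q :: "('i \<times> nat) \<times> ('i \<times> nat)"
  obtain u v where q: "q = (u, v)" by (cases q)
  have "(u, v) \<in> \<mu> \<and> pt_less u p \<and> pt_less p v \<longleftrightarrow> u = x \<and> v = y"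
    using pass_unique[OF assms] assms by blast
  moreover have "(\<exists>w. (u, w) \<in> \<mu> \<and> pt_less u p \<and> pt_less p w) \<longleftrightarrow> u = x"
    using pass_unique[OF assms] assms by blast
  moreover have "(\<exists>w. (w, v) \<in> \<mu> \<and> pt_less w p \<and> pt_less p v) \<longleftrightarrow> v = y"
    using pass_unique[OF assms] assms by blast
  ultimately show "q \<in> break_at p \<mu> \<longleftrightarrow> q \<in> \<mu> - {(x, y)} \<union> {(x, p), (p, y)}"
    unfolding break_at_def q by blast
qed

lemma resolve_fill:
  assumes "viable_strands \<mu>" "(x, y) \<in> \<mu>" "pt_less x p" "pt_less p y" "p \<in> V" "V \<inter> Domain \<mu> = {}"
  shows "resolve (\<mu> \<union> Id_on V) ((x, y), (p, p)) = break_at p \<mu> \<union> Id_on (V - {p})"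
proof -
  have "x \<notin> V" using assms by blast
  have "x \<noteq> p" "y \<noteq> p" using assms by auto
  have "(p, p) \<notin> \<mu>" using assms by blast
  show ?thesis
    unfolding break_eq[OF assms(1-4)] resolve_def prod.case
    using \<open>x \<notin> V\<close> \<open>(p, p) \<notin> \<mu>\<close> \<open>x \<noteq> p\<close> by auto
qed

lemma break_facts:
  assumes "viable_strands \<mu>" "passes \<mu> p"
  shows "viable_strands (break_at p \<mu>)" "h_grading (break_at p \<mu>) = h_grading \<mu>"
    "Domain (break_at p \<mu>) = insert p (Domain \<mu>)" "Range (break_at p \<mu>) = insert p (Range \<mu>)"
    "p \<in> places Z" "p \<notin> Domain \<mu>" "p \<notin> Range \<mu>"
    "p' \<noteq> p \<Longrightarrow> passes (break_at p \<mu>) p' \<longleftrightarrow> passes \<mu> p'"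
proof -
  obtain x y where xy: "(x, y) \<in> \<mu>" "pt_less x p" "pt_less p y" using assms(2) by (auto simp: passes_def)
  have s: "strand_diagram Z \<mu>" and m: "moving Z \<mu>" using assms by (auto simp: viable_strands_def moving_def)
  have "x \<in> points Z" "y \<in> points Z" using strand_le[OF s xy(1)] by auto
  then show p: "p \<in> places Z" using between_place xy by blast
  show pn: "p \<notin> Domain \<mu>" "p \<notin> Range \<mu>" using local_bits(5,6)[OF assms(1) place_snd[OF p] assms(2)] by auto
  note b = break_eq[OF assms(1) xy]
  show "Domain (break_at p \<mu>) = insert p (Domain \<mu>)" "Range (break_at p \<mu>) = insert p (Range \<mu>)"
    unfolding b using xy(1) by auto
  \<comment> \<open>With a horizontal strand added at \<open>p\<close>, breaking is the resolution
    of an actual crossing, and the general facts on resolutions apply.\<close>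
  let ?\<nu> = "\<mu> \<union> Id_on {p}"
  have s\<nu>: "strand_diagram Z ?\<nu>"
  proof -
    have "single_valued ?\<nu>" using pn strand_sv[OF s] unfolding single_valued_def by blast
    moreover have "single_valued (?\<nu>\<inverse>)" using pn strand_inj[OF s] unfolding single_valued_def converse_iff by blast
    ultimately show ?thesis using s p places_subset_points unfolding strand_diagram_def by (auto simp: pt_le_def)
  qed
  have r: "resolve ?\<nu> ((x, y), (p, p)) = break_at p \<mu>"
    using resolve_fill[OF assms(1) xy, of "{p}"] pn by simp
  have c: "((x, y), (p, p)) \<in> crossings ?\<nu>" unfolding crossings_def using xy by blast
  show h: "h_grading (break_at p \<mu>) = h_grading \<mu>"
    using resolve_strand(4)[OF c s\<nu>] h_grading_fill[OF m finite_strands[OF s], of "{p}"] by (simp add: r)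
  have "strand_diagram Z (break_at p \<mu>)" using resolve_strand(1)[OF c s\<nu>] by (simp add: r)
  moreover have "(u, u) \<notin> break_at p \<mu>" for u
    unfolding b using moving_less[OF m, of u u] xy by auto
  ultimately show "viable_strands (break_at p \<mu>)"
    using assms(1) by (simp add: viable_strands_def moving_def h)
  show "passes (break_at p \<mu>) p' \<longleftrightarrow> passes \<mu> p'" if "p' \<noteq> p"
  proof
    assume "passes (break_at p \<mu>) p'"
    then obtain u v where u: "(u, v) \<in> break_at p \<mu>" "pt_less u p'" "pt_less p' v" by (auto simp: passes_def)
    from u(1) consider "(u, v) \<in> \<mu>" | "u = x" "v = p" | "u = p" "v = y" unfolding b by auto
    then show "passes \<mu> p'"
      unfolding passes_def using u xy pt_less_trans by cases blast+
  next
    assume "passes \<mu> p'"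
    then obtain u v where u: "(u, v) \<in> \<mu>" "pt_less u p'" "pt_less p' v" by (auto simp: passes_def)
    show "passes (break_at p \<mu>) p'"
    proof (cases "(u, v) = (x, y)")
      case True
      have "pt_less p p' \<or> pt_less p' p"
        using True u xy that by (cases p; cases p') (auto simp: pt_less_def)
      then show ?thesis unfolding passes_def b using True u xy by blast
    next
      case False
      then show ?thesis unfolding passes_def b using u by blast
    qed
  qed
qed

lemma join_facts:
  assumes "viable_strands \<mu>" "p \<in> Domain \<mu>" "p \<in> Range \<mu>"
  shows "viable_strands (join_at p \<mu>)" "h_grading (join_at p \<mu>) = h_grading \<mu>" "passes (join_at p \<mu>) p"
    "break_at p (join_at p \<mu>) = \<mu>"
proof -
  obtain x y where xy: "(x, p) \<in> \<mu>" "(p, y) \<in> \<mu>" using assms by blast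
  have s: "strand_diagram Z \<mu>" and m: "moving Z \<mu>" using assms by (auto simp: viable_strands_def moving_def)
  have l: "pt_less x p" "pt_less p y" using moving_less[OF m] xy by auto
  have j: "join_at p \<mu> = \<mu> - {(x, p), (p, y)} \<union> {(x, y)}"
    unfolding join_at_def using xy strand_sv[OF s] strand_inj[OF s] by blast
  have ne: "p \<noteq> x" "x \<noteq> y" "p \<noteq> y" "pt_le p p" "pt_le x y" using l by (auto simp: pt_less_def pt_le_def)
  \<comment> \<open>Exchanging the ends of these two strands yields the joined strand together with
    a horizontal strand at \<open>p\<close>, so joining is an instance of
    \<open>resolve_strand_gen\<close>.\<close>
  let ?c = "((p, y), (x, p))"
  have r: "resolve \<mu> ?c = join_at p \<mu> \<union> Id_on {p}"
    unfolding resolve_def j by auto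
  note g = resolve_strand_gen[OF s xy(2,1) ne(1,4,5)]
  have sub: "join_at p \<mu> \<subseteq> resolve \<mu> ?c" by (simp add: r)
  have sj: "strand_diagram Z (join_at p \<mu>)"
    using g(1) sub unfolding strand_diagram_def
    by (meson converse_mono single_valued_subset subset_iff order_trans)
  moreover have "(u, u) \<notin> join_at p \<mu>" for u
    unfolding j using moving_less[OF m, of u u] ne by auto
  ultimately have mj: "moving Z (join_at p \<mu>)" by (simp add: moving_def)
  show h: "h_grading (join_at p \<mu>) = h_grading \<mu>"
    using g(4) h_grading_fill[OF mj finite_strands[OF sj], of "{p}"] by (simp add: r)
  show v: "viable_strands (join_at p \<mu>)" using mj assms(1) by (simp add: viable_strands_def h)
  have xyj: "(x, y) \<in> join_at p \<mu>" by (simp add: j)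
  then show "passes (join_at p \<mu>) p" using l unfolding passes_def by blast
  show "break_at p (join_at p \<mu>) = \<mu>"
  proof -
    have "(x, y) \<notin> \<mu>" using xy strand_sv[OF s] ne by blast
    then show ?thesis unfolding break_eq[OF v xyj l] unfolding j using xy ne by auto
  qed
qed

text \<open>Where strands run is determined by the multiplicities. The only freedom is whether a
  strand is broken at a place in the interior of the support, and the last two assumptions say that
  both diagrams are broken at the same places.\<close>

lemma viable_strands_eqI:
  assumes "viable_strands \<mu>" "viable_strands \<mu>'" "h_grading \<mu> = h_grading \<mu>'"
    "\<And>p. p \<in> places Z \<Longrightarrow> p \<in> Domain \<mu> \<Longrightarrow> p \<in> Range \<mu> \<Longrightarrow> p \<in> Domain \<mu>'"
    "\<And>p. p \<in> places Z \<Longrightarrow> p \<in> Domain \<mu>' \<Longrightarrow> p \<in> Range \<mu>' \<Longrightarrow> p \<in> Domain \<mu>"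
  shows "\<mu> = \<mu>'"
proof -
  have key: "\<mu> \<subseteq> \<mu>'" if v: "viable_strands \<mu>" "viable_strands \<mu>'" and h: "h_grading \<mu> = h_grading \<mu>'"
    and 1: "\<And>p. p \<in> places Z \<Longrightarrow> p \<in> Domain \<mu> \<Longrightarrow> p \<in> Range \<mu> \<Longrightarrow> p \<in> Domain \<mu>'"
    and 2: "\<And>p. p \<in> places Z \<Longrightarrow> p \<in> Domain \<mu>' \<Longrightarrow> p \<in> Range \<mu>' \<Longrightarrow> p \<in> Domain \<mu>" for \<mu> \<mu>'
  proof
    fix q assume "q \<in> \<mu>"
    moreover obtain x y where q: "q = (x, y)" by (cases q)
    ultimately have xy: "(x, y) \<in> \<mu>" by simp
    have s: "strand_diagram Z \<mu>" "strand_diagram Z \<mu>'" using v by (auto dest: viable_strands_sd)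
    have m: "moving Z \<mu>" "moving Z \<mu>'" using v by (auto simp: viable_strands_def)
    have lt: "pt_less x y" using moving_less[OF m(1) xy] .
    note b = local_bits[OF v(1)] and b' = local_bits[OF v(2), folded h]
    have pts: "x \<in> points Z" "y \<in> points Z" using strand_le[OF s(1) xy] by auto
    have xD: "x \<in> Domain \<mu>'"
    proof (cases "snd x > 0")
      case True
      then have xp: "x \<in> places Z" using pts lt by (cases x; cases y) (auto simp: points_def places_def pt_less_def)
      show ?thesis
      proof (cases "x \<in> Range \<mu>")
        case True
        then show ?thesis using 1[OF xp] xy by blast
      next
        case False
        have np: "\<not> passes \<mu> x" using b(5)[OF \<open>snd x > 0\<close>] xy by blast
        then have "\<not> passes \<mu>' x" "x \<notin> Range \<mu>'" using b(1)[OF \<open>snd x > 0\<close>] b'(1)[OF \<open>snd x > 0\<close>] False by blast+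
        then show ?thesis using b(3)[OF \<open>snd x > 0\<close>] b'(3)[OF \<open>snd x > 0\<close>] xy by blast
      qed
    next
      case False
      have "covers (x, y) x" using lt by (simp add: covers_def pt_less_def)
      then have "h_grading \<mu>' x = 1" using xy h_eq_1_iff[OF v(1)] h by auto
      then obtain u w where u: "(u, w) \<in> \<mu>'" "covers (u, w) x" using h_eq_1_iff[OF v(2)] by (metis surj_pair)
      then have "u = x" using False by (cases u; cases x) (auto simp: covers_def)
      then show ?thesis using u by blast
    qed
    then obtain y' where y': "(x, y') \<in> \<mu>'" by blast
    have lt': "pt_less x y'" using moving_less[OF m(2) y'] .
    have y0: "snd y > 0" "snd y' > 0" using lt lt' by (auto simp: pt_less_def)
    \<comment> \<open>Otherwise one strand passes over the end of the other. That end is interior to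
      the support, and there only one of the two diagrams would be broken.\<close>
    have "y = y'"
    proof (rule ccontr)
      assume "y \<noteq> y'"
      then consider "pt_less y y'" | "pt_less y' y"
        using lt lt' by (cases y; cases y') (fastforce simp: pt_less_def)
      then show False
      proof cases
        case 1
        then have "passes \<mu>' y" using y' lt unfolding passes_def by blast
        then have "y \<notin> Domain \<mu>'" "h_grading \<mu> y = 1" "y \<in> places Z"
          using b'[OF y0(1)] between_place[of x y' y] strand_le[OF s(2) y'] lt 1 by auto
        moreover have "y \<in> Range \<mu>" using xy by blast
        ultimately show False using b[OF y0(1)] \<open>\<And>p. p \<in> places Z \<Longrightarrow> p \<in> Domain \<mu> \<Longrightarrow> p \<in> Range \<mu> \<Longrightarrow> p \<in> Domain \<mu>'\<close> by blast
      next
        case 2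
        then have "passes \<mu> y'" using xy lt' unfolding passes_def by blast
        then have "y' \<notin> Domain \<mu>" "h_grading \<mu> y' = 1" "y' \<in> places Z"
          using b[OF y0(2)] between_place[of x y y'] strand_le[OF s(1) xy] lt' 2 by auto
        moreover have "y' \<in> Range \<mu>'" using y' by blast
        ultimately show False using b'[OF y0(2)] \<open>\<And>p. p \<in> places Z \<Longrightarrow> p \<in> Domain \<mu>' \<Longrightarrow> p \<in> Range \<mu>' \<Longrightarrow> p \<in> Domain \<mu>\<close> by blast
      qed
    qed
    then show "q \<in> \<mu>'" using y' q by simp
  qed
  show ?thesis
    using key[OF assms] key[OF assms(2,1) assms(3)[symmetric] assms(5,4)] by blast
qed

text \<open>Breaking turns the horizontal strand at \<open>p\<close> into two ends of moving
  strands, so the sources and targets of the whole term stay the same.\<close>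

lemma fills_break:
  assumes "viable_strands \<mu>" "passes \<mu> p"
  shows "V \<in> fills Z (break_at p \<mu>) s t \<longleftrightarrow> p \<notin> V \<and> insert p V \<in> fills Z \<mu> s t"
proof -
  note f = break_facts[OF assms]
  have "insert p (Domain \<mu>) \<union> V = Domain \<mu> \<union> insert p V" "insert p (Range \<mu>) \<union> V = Range \<mu> \<union> insert p V" by auto
  moreover have "p \<in> points Z" using f(5) places_subset_points by blast
  ultimately show ?thesis unfolding fills_def f(3,4) mem_Collect_eq using f(6,7) by auto
qed

lemma fill_crossing:
  assumes "diagram Z (\<mu>, s, t)" "V \<in> fills Z \<mu> s t" "p \<in> V" "passes \<mu> p" "viable_strands \<mu>"
  shows "p \<in> crossing_places Z (\<mu>, s, t)"
proof -
  have p: "p \<in> places Z" using break_facts(5)[OF assms(5,4)] .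
  then have "V \<inter> plc Z (pair_of Z p) \<noteq> {}" "pair_of Z p \<in> pairs Z" using assms(3) place_in_plc by blast+
  then have "dotted Z (\<mu>, s, t) (pair_of Z p)" using fill_at_pair[OF assms(2)] by (metis (full_types))
  then show ?thesis using p assms(4) by (simp add: crossing_places_def)
qed

lemma crossing_in_fill:
  assumes "diagram Z (\<mu>, s, t)" "p \<in> crossing_places Z (\<mu>, s, t)"
  shows "\<exists>V\<in>fills Z \<mu> s t. p \<in> V"
proof -
  have p: "p \<in> places Z" "dotted Z (\<mu>, s, t) (pair_of Z p)" using assms by (auto simp: crossing_places_def)
  obtain can where can: "choice can" using ex_choice by blast
  \<comment> \<open>A dotted pair may carry its horizontal strand at either place, so the selection
    can be changed to \<open>p\<close> there.\<close>
  define c where "c = can (pair_of Z p := p)"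
  have c: "choice c" using can place_in_plc[OF p(1)] by (auto simp: choice_def c_def)
  have "can_fill c (\<mu>, s, t) \<in> fills Z \<mu> s t"
    by (rule can_fill_in_fills[OF _ c]) (use assms in \<open>auto simp: diagram_iff moving_def\<close>)
  moreover have "p \<in> can_fill c (\<mu>, s, t)"
    using p place_in_plc[OF p(1)] by (auto simp: can_fill_def c_def image_iff intro!: bexI[of _ "pair_of Z p"])
  ultimately show ?thesis by blast
qed

lemma break_diagram:
  assumes "diagram Z (\<mu>, s, t)" "viable_strands \<mu>" "p \<in> crossing_places Z (\<mu>, s, t)"
  shows "diagram Z (break_at p \<mu>, s, t)"
proof -
  have pa: "passes \<mu> p" using assms by (simp add: crossing_places_def)
  obtain V where "V \<in> fills Z \<mu> s t" "p \<in> V" using crossing_in_fill[OF assms(1,3)] by blast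
  then have "V - {p} \<in> fills Z (break_at p \<mu>) s t" using fills_break[OF assms(2) pa] by (simp add: insert_absorb)
  moreover have "moving Z (break_at p \<mu>)" using break_facts(1)[OF assms(2) pa] by (simp add: viable_strands_def)
  ultimately show ?thesis using fills_ne_iff[of "break_at p \<mu>" s t] assms(1) by (auto simp: diagram_iff moving_def)
qed

lemma join_diagram:
  assumes "diagram Z (\<mu>, s, t)" "viable_strands \<mu>" "p \<in> places Z" "p \<in> Domain \<mu>" "p \<in> Range \<mu>"
  shows "diagram Z (join_at p \<mu>, s, t)" "p \<in> crossing_places Z (join_at p \<mu>, s, t)"
proof -
  note j = join_facts[OF assms(2,4,5)]
  obtain V where V: "V \<in> fills Z \<mu> s t" using fills_ne_iff[of \<mu> s t] assms(1) by (auto simp: diagram_iff moving_def)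
  then have V': "insert p V \<in> fills Z (join_at p \<mu>) s t" using fills_break[OF j(1,3)] by (simp add: j(4))
  then show d: "diagram Z (join_at p \<mu>, s, t)"
    using fills_ne_iff[of "join_at p \<mu>" s t] assms(1) j(1) by (auto simp: diagram_iff moving_def viable_strands_def)
  show "p \<in> crossing_places Z (join_at p \<mu>, s, t)"
    by (rule fill_crossing[OF d V' _ j(3,1)]) simp
qed

lemma finite_crossing_places: "finite (crossing_places Z D)"
  using finite_places by (simp add: crossing_places_def)

text \<open>Each crossing of a term lies on a horizontal strand, and each of its resolutions is
  simple. After interchanging the sum over terms with the sum over places, the terms with a
  horizontal strand at \<open>p\<close> resolve exactly to the terms of the diagram broken at
  \<open>p\<close>.\<close>

lemma diff_elt:
  assumes "diagram Z (\<mu>, s, t)" "viable_strands \<mu>"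
  shows "diff (elt Z (\<mu>, s, t)) = (\<Sum>p\<in>crossing_places Z (\<mu>, s, t). elt Z (break_at p \<mu>, s, t))"
proof -
  have m: "moving Z \<mu>" using assms by (simp add: viable_strands_def)
  let ?F = "fills Z \<mu> s t" and ?c = "crossing_places Z (\<mu>, s, t)"
  let ?T = "\<lambda>p V. basis (break_at p \<mu> \<union> Id_on (V - {p}))"
  have 1: "diff (basis (\<mu> \<union> Id_on V)) = (\<Sum>p\<in>{p\<in>?c. p \<in> V}. ?T p V)" if V: "V \<in> ?F" for V
  proof -
    have Vd: "V \<inter> Domain \<mu> = {}" "V \<inter> Range \<mu> = {}" "finite V"
      using V finite_points finite_subset by (auto simp: fills_def)
    let ?C = "crossings (\<mu> \<union> Id_on V)"
    have C: "?C = {((x, y), (p, p)) | x y p. (x, y) \<in> \<mu> \<and> p \<in> V \<and> pt_less x p \<and> pt_less p y}"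
      using crossings_fill[OF assms(2) Vd(1,2)] .
    have pc: "{p\<in>?c. p \<in> V} = {p\<in>V. passes \<mu> p}"
      using fill_crossing[OF assms(1) V] assms(2) by (auto simp: crossing_places_def)
    \<comment> \<open>Breaking at \<open>p\<close> does not affect which other places are passed
      over, so exactly one crossing is lost.\<close>
    have simple: "inv_num (resolve (\<mu> \<union> Id_on V) c) + 1 = inv_num (\<mu> \<union> Id_on V)" if "c \<in> ?C" for c
    proof -
      from that C obtain x y p where c: "c = ((x, y), (p, p))" "(x, y) \<in> \<mu>" "p \<in> V" "pt_less x p" "pt_less p y" by auto
      then have pa: "passes \<mu> p" unfolding passes_def by blast
      note b = break_facts[OF assms(2) pa]
      have "inv_num (resolve (\<mu> \<union> Id_on V) c) = inv_num (break_at p \<mu> \<union> Id_on (V - {p}))"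
        using resolve_fill[OF assms(2) c(2,4,5,3) Vd(1)] c(1) by simp
      also have "\<dots> = card {q \<in> V - {p}. passes (break_at p \<mu>) q}"
        by (rule inv_num_fill[OF b(1)]) (use Vd b(3,4) in auto)
      also have "{q \<in> V - {p}. passes (break_at p \<mu>) q} = {q \<in> V. passes \<mu> q} - {p}" using b(8) by auto
      also have "card \<dots> + 1 = card {q \<in> V. passes \<mu> q}"
        using card_Suc_Diff1[of "{q \<in> V. passes \<mu> q}" p] Vd(3) c(3) pa by simp
      finally show ?thesis using inv_num_fill[OF assms(2) Vd(1,2)] by simp
    qed
    have bij: "bij_betw (\<lambda>c. fst (snd c)) ?C {p\<in>V. passes \<mu> p}"
      unfolding bij_betw_def C
    proof
      show "inj_on (\<lambda>c. fst (snd c)) {((x, y), (p, p)) | x y p. (x, y) \<in> \<mu> \<and> p \<in> V \<and> pt_less x p \<and> pt_less p y}"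
      proof (rule inj_onI)
        fix c c' assume "c \<in> {((x, y), (p, p)) | x y p. (x, y) \<in> \<mu> \<and> p \<in> V \<and> pt_less x p \<and> pt_less p y}"
          "c' \<in> {((x, y), (p, p)) | x y p. (x, y) \<in> \<mu> \<and> p \<in> V \<and> pt_less x p \<and> pt_less p y}" "fst (snd c) = fst (snd c')"
        then obtain x y x' y' p where "c = ((x, y), (p, p))" "c' = ((x', y'), (p, p))" "(x, y) \<in> \<mu>" "pt_less x p" "pt_less p y"
          "(x', y') \<in> \<mu>" "pt_less x' p" "pt_less p y'" by auto
        then show "c = c'" using pass_unique[OF assms(2)] by blast
      qed
      show "(\<lambda>c. fst (snd c)) ` {((x, y), (p, p)) | x y p. (x, y) \<in> \<mu> \<and> p \<in> V \<and> pt_less x p \<and> pt_less p y} = {p \<in> V. passes \<mu> p}"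
        unfolding passes_def by force
    qed
    have "{c \<in> ?C. inv_num (resolve (\<mu> \<union> Id_on V) c) + 1 = inv_num (\<mu> \<union> Id_on V)} = ?C" using simple by blast
    then have "diff (basis (\<mu> \<union> Id_on V)) = (\<Sum>c\<in>?C. basis (resolve (\<mu> \<union> Id_on V) c))"
      unfolding diff_basis diff_strands_def by simp
    also have "\<dots> = (\<Sum>c\<in>?C. ?T (fst (snd c)) V)"
    proof (rule sum.cong[OF refl])
      fix c assume "c \<in> ?C"
      then obtain x y p where c: "c = ((x, y), (p, p))" "(x, y) \<in> \<mu>" "p \<in> V" "pt_less x p" "pt_less p y" using C by auto
      then show "basis (resolve (\<mu> \<union> Id_on V) c) = ?T (fst (snd c)) V"
        using resolve_fill[OF assms(2) c(2,4,5,3) Vd(1)] by simp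
    qed
    also have "\<dots> = (\<Sum>p\<in>{p\<in>V. passes \<mu> p}. ?T p V)"
      by (rule sum.reindex_bij_betw[OF bij])
    finally show ?thesis by (simp add: pc)
  qed
  have "diff (elt Z (\<mu>, s, t)) = (\<Sum>V\<in>?F. \<Sum>p\<in>{p\<in>?c. p \<in> V}. ?T p V)"
    unfolding elt_eq[OF m] diff_sum by (rule sum.cong) (use 1 in auto)
  also have "\<dots> = (\<Sum>V\<in>?F. \<Sum>p\<in>?c. if p \<in> V then ?T p V else 0)"
    by (simp add: sum.inter_filter finite_crossing_places)
  also have "\<dots> = (\<Sum>p\<in>?c. \<Sum>V\<in>?F. if p \<in> V then ?T p V else 0)"
    by (rule sum.swap)
  also have "\<dots> = (\<Sum>p\<in>?c. elt Z (break_at p \<mu>, s, t))"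
  proof (rule sum.cong[OF refl])
    fix p assume p: "p \<in> ?c"
    then have pa: "passes \<mu> p" by (simp add: crossing_places_def)
    have mb: "moving Z (break_at p \<mu>)" using break_facts(1)[OF assms(2) pa] by (simp add: viable_strands_def)
    have "bij_betw (\<lambda>V. V - {p}) {V\<in>?F. p \<in> V} (fills Z (break_at p \<mu>) s t)"
      unfolding bij_betw_def
    proof
      show "inj_on (\<lambda>V. V - {p}) {V\<in>?F. p \<in> V}" by (rule inj_onI) blast
      show "(\<lambda>V. V - {p}) ` {V\<in>?F. p \<in> V} = fills Z (break_at p \<mu>) s t"
      proof
        show "(\<lambda>V. V - {p}) ` {V\<in>?F. p \<in> V} \<subseteq> fills Z (break_at p \<mu>) s t"
          using fills_break[OF assms(2) pa] by (auto simp: insert_absorb)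
        show "fills Z (break_at p \<mu>) s t \<subseteq> (\<lambda>V. V - {p}) ` {V\<in>?F. p \<in> V}"
        proof
          fix V assume "V \<in> fills Z (break_at p \<mu>) s t"
          then have "p \<notin> V" "insert p V \<in> ?F" using fills_break[OF assms(2) pa] by auto
          then show "V \<in> (\<lambda>V. V - {p}) ` {V\<in>?F. p \<in> V}" by (intro image_eqI[of _ _ "insert p V"]) auto
        qed
      qed
    qed
    then have "(\<Sum>V\<in>{V\<in>?F. p \<in> V}. basis (break_at p \<mu> \<union> Id_on (V - {p}))) = elt Z (break_at p \<mu>, s, t)"
      unfolding elt_eq[OF mb] by (rule sum.reindex_bij_betw)
    then show "(\<Sum>V\<in>?F. if p \<in> V then ?T p V else 0) = elt Z (break_at p \<mu>, s, t)"
      by (simp add: sum.inter_filter finite_fills)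
  qed
  finally show ?thesis .
qed

end

section \<open>Homology of viable H-data\<close>

text \<open>At a matched pair in both idempotents the local homology vanishes iff exactly one of its places
  lies in the interior of the support of \<open>h\<close>.\<close>

definition good :: "('i, 'l) arc_diag \<Rightarrow> ('i, 'l) hdata \<Rightarrow> bool" where
  "good Z d \<longleftrightarrow> (case d of (h, s, t) \<Rightarrow> \<forall>P\<in>pairs Z. P \<in> s \<longrightarrow> P \<in> t \<longrightarrow>
     (\<forall>p\<in>plc Z P. through h p) \<or> (\<forall>p\<in>plc Z P. \<not> through h p))"

context arc
begin

text \<open>For good H-data this functional on chains vanishes on boundaries and detects the homology class. Only the
  terms with their horizontal strands at chosen places are counted, so that each diagram has exactly one such term.\<close>

definition crossless_count :: "('l \<Rightarrow> 'i \<times> nat) \<Rightarrow> 'i chain \<Rightarrow> bit" where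
  "crossless_count can = lin (\<lambda>\<nu>. of_bool (crossings \<nu> = {} \<and> (\<forall>x. (x, x) \<in> \<nu> \<longrightarrow> x \<in> can ` pairs Z)))"

text \<open>If some place of a pair in both idempotents is interior to the support, the selected one
  has to be. Then a crossing at the pair is always visible in the selected term. On good H-data
  every selection has this property.\<close>

definition adapted :: "('l \<Rightarrow> 'i \<times> nat) \<Rightarrow> ('i, 'l) hdata \<Rightarrow> bool" where
  "adapted can d \<longleftrightarrow> choice can \<and> (case d of (h, s, t) \<Rightarrow> \<forall>P\<in>pairs Z. P \<in> s \<longrightarrow> P \<in> t \<longrightarrow>
     (\<exists>p\<in>plc Z P. through h p) \<longrightarrow> through h (can P))"

definition viable_diagram :: "'i strands \<Rightarrow> 'l set \<Rightarrow> 'l set \<Rightarrow> bool" where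
  "viable_diagram \<mu> s t \<longleftrightarrow> diagram Z (\<mu>, s, t) \<and> viable_h Z (h_grading \<mu>)"

lemma viable_diagramD:
  assumes "viable_diagram \<mu> s t"
  shows "diagram Z (\<mu>, s, t)" "viable_strands \<mu>" "moving Z \<mu>" "strand_diagram Z \<mu>"
    "s \<subseteq> pairs Z" "t \<subseteq> pairs Z" "P \<in> pairs Z \<Longrightarrow> compat Z (\<mu>, s, t) P"
  using assms by (auto simp: viable_diagram_def viable_strands_def diagram_iff moving_def)

lemma crossless_count_add: "crossless_count can (x + y) = crossless_count can x + crossless_count can y"
  unfolding crossless_count_def by (rule lin_add) simp

lemma crossless_count_sum: "crossless_count can (\<Sum>i\<in>I. x i) = (\<Sum>i\<in>I. crossless_count can (x i))"
  unfolding crossless_count_def by (rule lin_sum) simp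

lemma crossless_count_0 [simp]: "crossless_count can 0 = 0"
  by (simp add: crossless_count_def)

lemma ex_adapted: "\<exists>can. adapted can d"
proof -
  obtain h s t where d: "d = (h, s, t)" by (cases d)
  have "\<forall>P\<in>pairs Z. \<exists>p. p \<in> plc Z P \<and> ((\<exists>p\<in>plc Z P. through h p) \<longrightarrow> through h p)"
    by (auto simp: pairs_def plc_def)
  then obtain can where "\<forall>P\<in>pairs Z. can P \<in> plc Z P \<and> ((\<exists>p\<in>plc Z P. through h p) \<longrightarrow> through h (can P))"
    by metis
  then show ?thesis unfolding adapted_def choice_def d by auto
qed

lemma good_adapted: "good Z d \<Longrightarrow> choice can \<Longrightarrow> adapted can d"
  unfolding good_def adapted_def choice_def by (cases d) fastforce

lemma crossing_through:
  assumes "viable_strands \<mu>" "p \<in> places Z" "p \<notin> Domain \<mu> \<or> p \<notin> Range \<mu>"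
  shows "passes \<mu> p \<longleftrightarrow> through (h_grading \<mu>) p"
  using local_bits[OF assms(1) place_snd[OF assms(2)]] assms(3) unfolding through_def by blast

lemma through_iff:
  assumes "viable_strands \<mu>" "p \<in> places Z"
  shows "through (h_grading \<mu>) p \<longleftrightarrow> passes \<mu> p \<or> (p \<in> Domain \<mu> \<and> p \<in> Range \<mu>)"
  using local_bits[OF assms(1) place_snd[OF assms(2)]] unfolding through_def by blast

lemma crossing_places_iff:
  assumes "viable_diagram \<mu> s t"
  shows "p \<in> crossing_places Z (\<mu>, s, t) \<longleftrightarrow>
    p \<in> places Z \<and> dotted Z (\<mu>, s, t) (pair_of Z p) \<and> through (h_grading \<mu>) p"
proof -
  have "p \<notin> Domain \<mu>" if "p \<in> places Z" "dotted Z (\<mu>, s, t) (pair_of Z p)"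
    using that place_in_plc[OF that(1)] unfolding dotted_def by auto
  then show ?thesis
    using crossing_through[OF viable_diagramD(2)[OF assms], of p] unfolding crossing_places_def by auto
qed

lemma crossings_elt:
  assumes "viable_diagram \<mu> s t"
  shows "(\<forall>\<nu>\<in>keys (elt Z (\<mu>, s, t)). crossings \<nu> = {}) \<longleftrightarrow> crossing_places Z (\<mu>, s, t) = {}"
proof -
  note v = viable_diagramD[OF assms]
  have c: "crossings (\<mu> \<union> Id_on V) = {} \<longleftrightarrow> \<not> (\<exists>p\<in>V. passes \<mu> p)" if "V \<in> fills Z \<mu> s t" for V
  proof -
    have "V \<inter> Domain \<mu> = {}" "V \<inter> Range \<mu> = {}" using that by (auto simp: fills_def)
    then show ?thesis using crossings_fill[OF v(2), of V] unfolding passes_def by blast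
  qed
  show ?thesis
    unfolding keys_elt[OF v(3)]
  proof
    assume a: "\<forall>\<nu>\<in>(\<lambda>V. \<mu> \<union> Id_on V) ` fills Z \<mu> s t. crossings \<nu> = {}"
    show "crossing_places Z (\<mu>, s, t) = {}"
    proof (rule ccontr)
      assume "crossing_places Z (\<mu>, s, t) \<noteq> {}"
      then obtain p where p: "p \<in> crossing_places Z (\<mu>, s, t)" by blast
      then obtain V where V: "V \<in> fills Z \<mu> s t" "p \<in> V" using crossing_in_fill[OF v(1)] by blast
      moreover have "passes \<mu> p" using p by (simp add: crossing_places_def)
      ultimately show False using c[OF V(1)] a by blast
    qed
  next
    assume "crossing_places Z (\<mu>, s, t) = {}"
    then show "\<forall>\<nu>\<in>(\<lambda>V. \<mu> \<union> Id_on V) ` fills Z \<mu> s t. crossings \<nu> = {}"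
      using c fill_crossing[OF v(1) _ _ _ v(2)] by blast
  qed
qed

text \<open>Every dotted pair carries exactly one horizontal strand, so the restriction to selected
  places leaves no choice; it also excludes horizontal strands at infinity.\<close>

lemma fill_canonical:
  assumes "strand_diagram Z \<mu>" "choice can" "V \<in> fills Z \<mu> s t" "V \<subseteq> can ` pairs Z"
  shows "V = can_fill can (\<mu>, s, t)"
proof -
  have "x \<in> V \<longleftrightarrow> x \<in> can_fill can (\<mu>, s, t)" if "P \<in> pairs Z" "x = can P" for x P
  proof -
    have x: "x \<in> plc Z P" using assms(2) that by (simp add: choice_def)
    have sub: "V \<inter> plc Z P \<subseteq> {can P}"
    proof
      fix y assume y: "y \<in> V \<inter> plc Z P"
      then obtain Q where Q: "Q \<in> pairs Z" "y = can Q" using assms(4) by blast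
      then have "y \<in> plc Z Q" using assms(2) by (simp add: choice_def)
      then have "Q = P" using y by (auto simp: plc_def)
      then show "y \<in> {can P}" using Q by simp
    qed
    have "x \<in> V \<longleftrightarrow> dotted Z (\<mu>, s, t) P"
    proof (cases "dotted Z (\<mu>, s, t) P")
      case True
      then have "card (V \<inter> plc Z P) = 1" using fill_at_pair[OF assms(3) that(1)] by simp
      then have "V \<inter> plc Z P \<noteq> {}" by auto
      then show ?thesis using sub that(2) True by auto
    next
      case False
      then show ?thesis using fill_at_pair[OF assms(3) that(1)] x by auto
    qed
    also have "\<dots> \<longleftrightarrow> x \<in> can_fill can (\<mu>, s, t)"
      using can_fill_at[OF assms(2) that(1), of "(\<mu>, s, t)"] x that(2) by (auto split: if_splits)
    finally show ?thesis .
  qed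
  moreover have "can_fill can (\<mu>, s, t) \<subseteq> can ` pairs Z" by (auto simp: can_fill_def)
  ultimately show ?thesis using assms(4) by blast
qed

text \<open>The only term which can be counted is the one with its horizontal strands at the
  selected places. Since the selection is adapted, this term has a crossing as soon as any term has
  one.\<close>

lemma crossless_count_elt:
  assumes "viable_diagram \<mu> s t" "adapted can (h_grading \<mu>, s, t)"
  shows "crossless_count can (elt Z (\<mu>, s, t)) = of_bool (crossing_places Z (\<mu>, s, t) = {})"
proof -
  note v = viable_diagramD[OF assms(1)]
  have ch: "choice can" using assms(2) by (simp add: adapted_def)
  let ?C = "can_fill can (\<mu>, s, t)"
  have C: "?C \<in> fills Z \<mu> s t" by (rule can_fill_in_fills[OF v(4) ch v(7)])
  have hor: "(\<forall>x. (x, x) \<in> \<mu> \<union> Id_on V \<longrightarrow> x \<in> can ` pairs Z) \<longleftrightarrow> V \<subseteq> can ` pairs Z" for V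
    using v(3) unfolding moving_def by blast
  have "(\<forall>x. (x, x) \<in> \<mu> \<union> Id_on V \<longrightarrow> x \<in> can ` pairs Z) \<longleftrightarrow> V = ?C" if "V \<in> fills Z \<mu> s t" for V
    unfolding hor using fill_canonical[OF v(4) ch that] by (auto simp: can_fill_def)
  then have "crossless_count can (elt Z (\<mu>, s, t)) =
      (\<Sum>V\<in>fills Z \<mu> s t. if V = ?C then of_bool (crossings (\<mu> \<union> Id_on V) = {}) else 0)"
    unfolding crossless_count_def by (subst lin_elt[OF v(3)]) (auto intro!: sum.cong)
  also have "\<dots> = of_bool (crossings (\<mu> \<union> Id_on ?C) = {})"
    using C by (simp add: sum.delta finite_fills)
  also have "crossings (\<mu> \<union> Id_on ?C) = {} \<longleftrightarrow> crossing_places Z (\<mu>, s, t) = {}"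
  proof
    assume e: "crossings (\<mu> \<union> Id_on ?C) = {}"
    show "crossing_places Z (\<mu>, s, t) = {}"
    proof (rule ccontr)
      assume "crossing_places Z (\<mu>, s, t) \<noteq> {}"
      then obtain p where p: "p \<in> places Z" "dotted Z (\<mu>, s, t) (pair_of Z p)" "through (h_grading \<mu>) p"
        using crossing_places_iff[OF assms(1)] by blast
      let ?P = "pair_of Z p"
      have P: "?P \<in> pairs Z" "p \<in> plc Z ?P" using place_in_plc[OF p(1)] by auto
      have "?P \<in> s" "?P \<in> t" using p(2) by (auto simp: dotted_def)
      then have th: "through (h_grading \<mu>) (can ?P)" using assms(2) P p(3) by (auto simp: adapted_def)
      have cp: "can ?P \<in> plc Z ?P" using ch P by (simp add: choice_def)
      then have "can ?P \<notin> Domain \<mu>" "can ?P \<in> places Z" using p(2) by (auto simp: dotted_def plc_def)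
      then have "passes \<mu> (can ?P)" using crossing_through[OF v(2)] th by blast
      moreover have "can ?P \<in> ?C" using P p(2) by (auto simp: can_fill_def)
      moreover have "?C \<inter> Domain \<mu> = {}" "?C \<inter> Range \<mu> = {}" using C by (auto simp: fills_def)
      ultimately show False using crossings_fill[OF v(2), of ?C] e unfolding passes_def by blast
    qed
  next
    assume "crossing_places Z (\<mu>, s, t) = {}"
    then have "\<forall>\<nu>\<in>keys (elt Z (\<mu>, s, t)). crossings \<nu> = {}" using crossings_elt[OF assms(1)] by simp
    then show "crossings (\<mu> \<union> Id_on ?C) = {}" using C by (auto simp: keys_elt[OF v(3)])
  qed
  finally show ?thesis .
qed

lemma break_viable_diagram:
  assumes "viable_diagram \<mu> s t" "p \<in> crossing_places Z (\<mu>, s, t)"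
  shows "viable_diagram (break_at p \<mu>) s t" "h_grading (break_at p \<mu>) = h_grading \<mu>"
    "crossing_places Z (break_at p \<mu>, s, t) = crossing_places Z (\<mu>, s, t) - plc Z (pair_of Z p)"
proof -
  note v = viable_diagramD[OF assms(1)]
  have pa: "passes \<mu> p" "p \<in> places Z" using assms(2) by (auto simp: crossing_places_def)
  note b = break_facts[OF v(2) pa(1)]
  show vd: "viable_diagram (break_at p \<mu>) s t" 
    using break_diagram[OF v(1,2) assms(2)] b(1) by (simp add: viable_diagram_def viable_strands_def)
  show h: "h_grading (break_at p \<mu>) = h_grading \<mu>" by (rule b)
  have "dotted Z (break_at p \<mu>, s, t) Q \<longleftrightarrow> dotted Z (\<mu>, s, t) Q \<and> p \<notin> plc Z Q" for Q
    unfolding dotted_def prod.case b(3,4) by blast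
  then show "crossing_places Z (break_at p \<mu>, s, t) = crossing_places Z (\<mu>, s, t) - plc Z (pair_of Z p)"
    using crossing_places_iff[OF assms(1)] crossing_places_iff[OF vd] pa(2) by (auto simp: h plc_def)
qed

text \<open>Resolutions at the two places of a matched pair cancel in the count.\<close>

lemma count_break_cancel:
  assumes "viable_diagram \<mu> s t" "finite A" "A \<subseteq> crossing_places Z (\<mu>, s, t)"
    "\<And>p q. p \<in> A \<Longrightarrow> q \<in> plc Z (pair_of Z p) \<Longrightarrow> q \<in> A"
  shows "(\<Sum>p\<in>A. of_bool (crossing_places Z (break_at p \<mu>, s, t) = {}) :: bit) = 0"
proof -
  define other where "other p = (THE q. q \<noteq> p \<and> plc Z (pair_of Z p) = {p, q})" for p
  have A: "p \<in> places Z" if "p \<in> A" for p using that assms(3) by (auto simp: crossing_places_def)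
  have o: "other p \<noteq> p \<and> plc Z (pair_of Z p) = {p, other p}" if pA: "p \<in> A" for p
  proof -
    obtain q where q: "q \<noteq> p" "plc Z (pair_of Z p) = {p, q}"
      using plc_obtain place_in_plc[OF A[OF pA]] by metis
    have "other p = q" unfolding other_def
    proof (rule the_equality)
      show "q \<noteq> p \<and> plc Z (pair_of Z p) = {p, q}" using q by simp
      fix r assume "r \<noteq> p \<and> plc Z (pair_of Z p) = {p, r}"
      then show "r = q" using q by auto
    qed
    then show ?thesis using q by simp
  qed
  \<comment> \<open>After breaking at either place the pair is no longer dotted, so both of its
    places drop out. The remaining crossing places are therefore the same for the two places of the
    pair.\<close>
  have f: "of_bool (crossing_places Z (break_at p \<mu>, s, t) = {}) =
     (of_bool (crossing_places Z (\<mu>, s, t) - plc Z (pair_of Z p) = {}) :: bit)" if "p \<in> A" for p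
  proof -
    have "p \<in> crossing_places Z (\<mu>, s, t)" using assms(3) that by blast
    then show ?thesis using break_viable_diagram(3)[OF assms(1)] by simp
  qed
  have "(\<Sum>p\<in>A. of_bool (crossing_places Z (\<mu>, s, t) - plc Z (pair_of Z p) = {}) :: bit) = 0"
  proof (rule sum_involution_0[where \<iota> = other])
    fix p assume p: "p \<in> A"
    have q: "other p \<in> A" using assms(4)[OF p] o[OF p] by blast
    have "pair_of Z (other p) = pair_of Z p" using o[OF p] by (auto simp: plc_def)
    moreover from this have "other (other p) = p" using o[OF p] o[OF q] by auto
    ultimately show "other p \<in> A \<and> other p \<noteq> p \<and> other (other p) = p \<and>
      (of_bool (crossing_places Z (\<mu>, s, t) - plc Z (pair_of Z (other p)) = {}) :: bit) =
      of_bool (crossing_places Z (\<mu>, s, t) - plc Z (pair_of Z p) = {})"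
      using q o[OF p] by simp
  qed (use assms(2) in auto)
  then show ?thesis using f by simp
qed

lemma adapted_break: "adapted can (h_grading \<mu>, s, t) \<Longrightarrow> viable_diagram \<mu> s t \<Longrightarrow> p \<in> crossing_places Z (\<mu>, s, t) \<Longrightarrow>
   crossless_count can (elt Z (break_at p \<mu>, s, t)) = of_bool (crossing_places Z (break_at p \<mu>, s, t) = {})"
  using crossless_count_elt break_viable_diagram by metis

lemma crossless_count_diff_elt:
  assumes "viable_diagram \<mu> s t" "adapted can (h_grading \<mu>, s, t)"
  shows "crossless_count can (diff (elt Z (\<mu>, s, t))) =
    (\<Sum>p\<in>crossing_places Z (\<mu>, s, t). of_bool (crossing_places Z (break_at p \<mu>, s, t) = {}))"
  unfolding diff_elt[OF viable_diagramD(1,2)[OF assms(1)]] crossless_count_sum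
  by (rule sum.cong) (use adapted_break[OF assms(2,1)] in auto)

text \<open>For good H-data a crossing at one place of a dotted pair is accompanied by a crossing at
  the other, so all contributions cancel in pairs by \<open>count_break_cancel\<close>.\<close>

lemma crossless_count_diff_good:
  assumes "viable_diagram \<mu> s t" "good Z (h_grading \<mu>, s, t)" "choice can"
  shows "crossless_count can (diff (elt Z (\<mu>, s, t))) = 0"
proof -
  have q: "q \<in> crossing_places Z (\<mu>, s, t)" if p: "p \<in> crossing_places Z (\<mu>, s, t)" and q: "q \<in> plc Z (pair_of Z p)" for p q
  proof -
    let ?P = "pair_of Z p"
    have *: "p \<in> places Z" "dotted Z (\<mu>, s, t) ?P" "through (h_grading \<mu>) p"
      using p crossing_places_iff[OF assms(1)] by auto
    then have "?P \<in> s" "?P \<in> t" "?P \<in> pairs Z" "p \<in> plc Z ?P" using place_in_plc[OF *(1)] by (auto simp: dotted_def)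
    then have "through (h_grading \<mu>) q" using assms(2) *(3) q by (auto simp: good_def)
    then show ?thesis using crossing_places_iff[OF assms(1)] *(2) q by (auto simp: plc_def)
  qed
  show ?thesis
    unfolding crossless_count_diff_elt[OF assms(1) good_adapted[OF assms(2,3)]]
    by (rule count_break_cancel[OF assms(1) finite_crossing_places subset_refl q])
qed

lemma alg_at_viableE:
  assumes "x \<in> alg_at Z (h, s, t)" "viable_h Z h"
  obtains F where "finite F" "\<And>\<mu>. \<mu> \<in> F \<Longrightarrow> viable_diagram \<mu> s t" "\<And>\<mu>. \<mu> \<in> F \<Longrightarrow> h_grading \<mu> = h" "x = (\<Sum>\<mu>\<in>F. elt Z (\<mu>, s, t))"
  by (rule alg_atE[OF assms(1)]) (use assms(2) in \<open>auto simp: viable_diagram_def\<close>)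

lemma alg_at_viableI:
  assumes "\<And>\<mu>. \<mu> \<in> F \<Longrightarrow> viable_diagram \<mu> s t \<and> h_grading \<mu> = h"
  shows "(\<Sum>\<mu>\<in>F. elt Z (\<mu>, s, t)) \<in> alg_at Z (h, s, t)"
  by (rule alg_atI) (use assms in \<open>auto simp: viable_diagram_def\<close>)

lemma crossless_count_diff:
  assumes "x \<in> alg_at Z (h, s, t)" "viable_h Z h" "good Z (h, s, t)" "choice can"
  shows "crossless_count can (diff x) = 0"
proof -
  obtain F where F: "finite F" "\<And>\<mu>. \<mu> \<in> F \<Longrightarrow> viable_diagram \<mu> s t" "\<And>\<mu>. \<mu> \<in> F \<Longrightarrow> h_grading \<mu> = h" "x = (\<Sum>\<mu>\<in>F. elt Z (\<mu>, s, t))"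
    by (rule alg_at_viableE[OF assms(1,2)]) blast
  show ?thesis unfolding F(4) diff_sum crossless_count_sum
    by (rule sum.neutral) (use crossless_count_diff_good F assms(3,4) in auto)
qed

lemma diff_alg_at:
  assumes "x \<in> alg_at Z (h, s, t)" "viable_h Z h"
  shows "diff x \<in> alg_at Z (h, s, t)"
proof -
  obtain F where F: "finite F" "\<And>\<mu>. \<mu> \<in> F \<Longrightarrow> viable_diagram \<mu> s t" "\<And>\<mu>. \<mu> \<in> F \<Longrightarrow> h_grading \<mu> = h" "x = (\<Sum>\<mu>\<in>F. elt Z (\<mu>, s, t))"
    by (rule alg_at_viableE[OF assms]) blast
  have "diff (elt Z (\<mu>, s, t)) \<in> alg_at Z (h, s, t)" if m: "\<mu> \<in> F" for \<mu>
  proof -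
    have "elt Z (break_at p \<mu>, s, t) \<in> alg_at Z (h, s, t)" if "p \<in> crossing_places Z (\<mu>, s, t)" for p
      using break_viable_diagram[OF F(2)[OF m] that] F(3)[OF m] elt_alg_at[of "break_at p \<mu>" s t]
      by (simp add: viable_diagram_def)
    then show ?thesis
      unfolding diff_elt[OF viable_diagramD(1,2)[OF F(2)[OF m]]] alg_at_def by (intro span2_sum)
  qed
  then show ?thesis unfolding F(4) diff_sum alg_at_def by (intro span2_sum)
qed

lemma elt_terms_disjoint:
  assumes "moving Z \<mu>" "moving Z \<mu>'" "\<nu> \<in> keys (elt Z (\<mu>, s, t))" "\<nu> \<in> keys (elt Z (\<mu>', s, t))"
  shows "\<mu> = \<mu>'"
  using assms fill_inj[OF assms(1,2)] by (auto simp: keys_elt)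

text \<open>Distinct diagrams with the same idempotents have no terms in common, so sums of diagrams
  show no cancellation and the diagrams are linearly independent.\<close>

lemma keys_sum_elt:
  assumes "finite F" "\<And>\<mu>. \<mu> \<in> F \<Longrightarrow> moving Z \<mu>"
  shows "keys (\<Sum>\<mu>\<in>F. elt Z (\<mu>, s, t)) = (\<Union>\<mu>\<in>F. keys (elt Z (\<mu>, s, t)))"
proof
  show "keys (\<Sum>\<mu>\<in>F. elt Z (\<mu>, s, t)) \<subseteq> (\<Union>\<mu>\<in>F. keys (elt Z (\<mu>, s, t)))" by (rule keys_sum_subset)
  show "(\<Union>\<mu>\<in>F. keys (elt Z (\<mu>, s, t))) \<subseteq> keys (\<Sum>\<mu>\<in>F. elt Z (\<mu>, s, t))"
  proof
    fix \<nu> assume "\<nu> \<in> (\<Union>\<mu>\<in>F. keys (elt Z (\<mu>, s, t)))"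
    then obtain \<mu> where m: "\<mu> \<in> F" "\<nu> \<in> keys (elt Z (\<mu>, s, t))" by blast
    have "lookup (\<Sum>\<mu>\<in>F. elt Z (\<mu>, s, t)) \<nu> = (\<Sum>\<mu>'\<in>F. if \<mu>' = \<mu> then 1 else 0)"
      unfolding lookup_sum
    proof (rule sum.cong[OF refl])
      fix \<mu>' assume "\<mu>' \<in> F"
      then have "\<mu>' \<noteq> \<mu> \<Longrightarrow> \<nu> \<notin> keys (elt Z (\<mu>', s, t))"
        using elt_terms_disjoint[OF assms(2) assms(2)] m by blast
      then show "lookup (elt Z (\<mu>', s, t)) \<nu> = (if \<mu>' = \<mu> then 1 else 0)"
        using m(2) by (auto simp: in_keys_bit)
    qed
    then show "\<nu> \<in> keys (\<Sum>\<mu>\<in>F. elt Z (\<mu>, s, t))" using assms(1) m(1) by (simp add: in_keys_bit)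
  qed
qed

lemma sum_elt_0:
  assumes "finite F" "\<And>\<mu>. \<mu> \<in> F \<Longrightarrow> viable_diagram \<mu> s t" "(\<Sum>\<mu>\<in>F. elt Z (\<mu>, s, t)) = 0"
  shows "F = {}"
proof (rule ccontr)
  assume "F \<noteq> {}"
  then obtain \<mu> where m: "\<mu> \<in> F" by blast
  then have "elt Z (\<mu>, s, t) \<noteq> 0" using assms(2) by (auto simp: viable_diagram_def diagram_def)
  then have "keys (elt Z (\<mu>, s, t)) \<noteq> {}" by simp
  moreover have "keys (elt Z (\<mu>, s, t)) \<subseteq> keys (\<Sum>\<mu>\<in>F. elt Z (\<mu>, s, t))"
    using keys_sum_elt[OF assms(1), of s t] assms(2) m viable_diagramD(3) by blast
  ultimately show False using assms(3) by simp
qed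

section \<open>Normal form of cycles\<close>

lemma join_break:
  assumes "viable_strands \<mu>" "passes \<mu> p"
  shows "join_at p (break_at p \<mu>) = \<mu>"
proof -
  note b = break_facts[OF assms]
  note j = join_facts[OF b(1)]
  have p: "p \<in> Domain (break_at p \<mu>)" "p \<in> Range (break_at p \<mu>)" using b by auto
  note jf = j[OF p]
  have "insert p (Domain (join_at p (break_at p \<mu>))) = insert p (Domain \<mu>)"
    "insert p (Range (join_at p (break_at p \<mu>))) = insert p (Range \<mu>)"
    using break_facts(3,4)[OF jf(1,3)] b(3,4) by (simp_all add: jf(4))
  moreover have "p \<notin> Domain (join_at p (break_at p \<mu>))" "p \<notin> Range (join_at p (break_at p \<mu>))"
    using break_facts(6,7)[OF jf(1,3)] by auto
  ultimately have "Domain (join_at p (break_at p \<mu>)) = Domain \<mu>" "Range (join_at p (break_at p \<mu>)) = Range \<mu>"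
    using b(6,7) by (metis insert_ident)+
  then show ?thesis
    by (intro viable_strands_eqI[OF jf(1) assms(1)]) (simp_all add: jf(2) b(2))
qed

text \<open>As \<open>can P\<close> is interior to the support, each diagram either passes over it
  or is broken there. Broken diagrams are removed by adding the boundary of their joins. In the
  remaining cycle no diagram has a crossing at this place, since its resolution would be broken
  there and could not cancel. Hence the pair is not dotted, and no horizontal strand is at the place
  either.\<close>

lemma eliminate_pair:
  assumes z: "z \<in> alg_at Z (h, s, t)" "diff z = 0" and v: "viable_h Z h" and ad: "adapted can (h, s, t)"
    and P: "P \<in> pairs Z" "P \<in> s" "P \<in> t" "through h (can P)"
  shows "\<exists>w\<in>alg_at Z (h, s, t). (\<forall>\<nu>\<in>keys (z + diff w). can P \<notin> Domain \<nu>) \<and>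
     (\<forall>Q\<in>pairs Z. Q \<noteq> P \<longrightarrow> (\<forall>\<nu>\<in>keys z. can Q \<notin> Domain \<nu>) \<longrightarrow> (\<forall>\<nu>\<in>keys (z + diff w). can Q \<notin> Domain \<nu>))"
proof -
  define p where "p = can P"
  have ch: "choice can" using ad by (simp add: adapted_def)
  have pP: "p \<in> plc Z P" "p \<in> places Z" "pair_of Z p = P" using ch P(1) by (auto simp: p_def choice_def plc_def)
  have thp: "through h p" using P by (simp add: p_def)
  \<comment> \<open>The projection to the diagrams broken at \<open>p\<close>. It is defined on
    single terms but respects their grouping into diagrams, by \<open>R_elt\<close>.\<close>
  define R where "R = lin (\<lambda>\<nu>. if p \<in> Domain \<nu> \<and> (p, p) \<notin> \<nu> then basis \<nu> else 0)"
  have R_sum: "R (\<Sum>k\<in>K. x k) = (\<Sum>k\<in>K. R (x k))" for x :: "'b \<Rightarrow> 'i chain" and K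
    unfolding R_def by (rule lin_sum) simp
  have R_add: "R (x + y) = R x + R y" for x y unfolding R_def by (rule lin_add) simp
  have R_elt: "R (elt Z (\<mu>, s, t)) = (if p \<in> Domain \<mu> then elt Z (\<mu>, s, t) else 0)" if "viable_diagram \<mu> s t" for \<mu>
  proof -
    have m: "moving Z \<mu>" using viable_diagramD(3)[OF that] .
    have "p \<in> Domain (\<mu> \<union> Id_on V) \<and> (p, p) \<notin> \<mu> \<union> Id_on V \<longleftrightarrow> p \<in> Domain \<mu>" if "V \<in> fills Z \<mu> s t" for V
    proof -
      have "(p, p) \<notin> \<mu>" using m unfolding moving_def by blast
      then show ?thesis using that by (auto simp: fills_def)
    qed
    then show ?thesis unfolding R_def by (subst lin_elt[OF m]) (auto simp: elt_eq[OF m])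
  qed
  obtain F where F: "finite F" "\<And>\<mu>. \<mu> \<in> F \<Longrightarrow> viable_diagram \<mu> s t" "\<And>\<mu>. \<mu> \<in> F \<Longrightarrow> h_grading \<mu> = h" "z = (\<Sum>\<mu>\<in>F. elt Z (\<mu>, s, t))"
    by (rule alg_at_viableE[OF z(1) v]) blast
  have pbits: "p \<in> Domain \<mu> \<longleftrightarrow> p \<in> Range \<mu>" "p \<notin> Domain \<mu> \<longleftrightarrow> passes \<mu> p"
    if "viable_diagram \<mu> s t" "h_grading \<mu> = h" for \<mu>
    using local_bits[OF viable_diagramD(2)[OF that(1)] place_snd[OF pP(2)]] thp that(2) by (auto simp: through_def)
  have R_diff: "R (diff (elt Z (\<mu>, s, t))) = (if p \<in> crossing_places Z (\<mu>, s, t) then elt Z (break_at p \<mu>, s, t) else 0)"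
    if "viable_diagram \<mu> s t" "p \<notin> Domain \<mu>" for \<mu>
  proof -
    note vd = viable_diagramD[OF that(1)]
    have "R (diff (elt Z (\<mu>, s, t))) = (\<Sum>q\<in>crossing_places Z (\<mu>, s, t). if q = p then elt Z (break_at p \<mu>, s, t) else 0)"
      unfolding diff_elt[OF vd(1,2)] R_sum
    proof (rule sum.cong[OF refl])
      fix q assume q: "q \<in> crossing_places Z (\<mu>, s, t)"
      then have "passes \<mu> q" by (simp add: crossing_places_def)
      then have "Domain (break_at q \<mu>) = insert q (Domain \<mu>)" using break_facts(3)[OF vd(2)] by simp
      then show "R (elt Z (break_at q \<mu>, s, t)) = (if q = p then elt Z (break_at p \<mu>, s, t) else 0)"
        using R_elt[OF break_viable_diagram(1)[OF that(1) q]] that(2) by auto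
    qed
    then show ?thesis by (simp add: sum.delta' finite_crossing_places)
  qed
  define FU where "FU = {\<mu>\<in>F. p \<in> Domain \<mu>}"
  \<comment> \<open>A diagram broken at \<open>p\<close> is the resolution at \<open>p\<close> of
    its join, and the other resolutions of the join are not broken at \<open>p\<close>.\<close>
  define w where "w = (\<Sum>\<mu>\<in>FU. elt Z (join_at p \<mu>, s, t))"
  have finU: "finite FU" using F(1) by (simp add: FU_def)
  have J: "viable_diagram (join_at p \<mu>) s t" "h_grading (join_at p \<mu>) = h" "break_at p (join_at p \<mu>) = \<mu>"
    "p \<in> crossing_places Z (join_at p \<mu>, s, t)" "passes (join_at p \<mu>) p" if "\<mu> \<in> FU" for \<mu>
  proof -
    have \<mu>: "\<mu> \<in> F" "p \<in> Domain \<mu>" using that by (auto simp: FU_def)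
    note vd = viable_diagramD[OF F(2)[OF \<mu>(1)]]
    have r: "p \<in> Range \<mu>" using pbits(1)[OF F(2,3)[OF \<mu>(1)]] \<mu>(2) by simp
    note jf = join_facts[OF vd(2) \<mu>(2) r] and jd = join_diagram[OF vd(1,2) pP(2) \<mu>(2) r]
    show "h_grading (join_at p \<mu>) = h" using jf F(3)[OF \<mu>(1)] by simp
    then show "viable_diagram (join_at p \<mu>) s t" using jd v by (simp add: viable_diagram_def)
    show "break_at p (join_at p \<mu>) = \<mu>" "passes (join_at p \<mu>) p" by (rule jf)+
    show "p \<in> crossing_places Z (join_at p \<mu>, s, t)" by (rule jd)
  qed
  have w: "w \<in> alg_at Z (h, s, t)"
  proof -
    have "inj_on (join_at p) FU" by (rule inj_on_inverseI[where g = "break_at p"]) (use J in auto)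
    then have "w = (\<Sum>\<mu>\<in>join_at p ` FU. elt Z (\<mu>, s, t))" by (simp add: w_def sum.reindex)
    also have "\<dots> \<in> alg_at Z (h, s, t)" by (rule alg_at_viableI) (use J in auto)
    finally show ?thesis .
  qed
  have "R (diff w) = (\<Sum>\<mu>\<in>FU. elt Z (\<mu>, s, t))"
    unfolding w_def diff_sum R_sum
  proof (rule sum.cong[OF refl])
    fix \<mu> assume m: "\<mu> \<in> FU"
    have "p \<notin> Domain (join_at p \<mu>)" using break_facts(6)[OF viable_diagramD(2)[OF J(1)[OF m]] J(5)[OF m]] .
    then show "R (diff (elt Z (join_at p \<mu>, s, t))) = elt Z (\<mu>, s, t)"
      using R_diff[OF J(1)[OF m]] J(3,4)[OF m] by simp
  qed
  also have "\<dots> = R z"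
    unfolding F(4) R_sum FU_def sum.inter_filter[OF F(1)] by (rule sum.cong) (use R_elt F(2) in auto)
  finally have Rw: "R (diff w) = R z" .
  define v' where "v' = z + diff w"
  have v'_alg: "v' \<in> alg_at Z (h, s, t)" unfolding v'_def by (rule alg_at_add[OF z(1) diff_alg_at[OF w v]])
  obtain G where G: "finite G" "\<And>\<mu>. \<mu> \<in> G \<Longrightarrow> viable_diagram \<mu> s t" "\<And>\<mu>. \<mu> \<in> G \<Longrightarrow> h_grading \<mu> = h" "v' = (\<Sum>\<mu>\<in>G. elt Z (\<mu>, s, t))"
    by (rule alg_at_viableE[OF v'_alg v]) blast
  have "R v' = 0" unfolding v'_def R_add Rw by simp
  then have "(\<Sum>\<mu>\<in>{\<mu>\<in>G. p \<in> Domain \<mu>}. elt Z (\<mu>, s, t)) = 0"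
    unfolding G(4) R_sum sum.inter_filter[OF G(1)] using R_elt G(2) by (simp cong: sum.cong)
  then have "{\<mu>\<in>G. p \<in> Domain \<mu>} = {}"
    by (rule sum_elt_0[rotated 2]) (use G in auto)
  then have Gp: "p \<notin> Domain \<mu>" if "\<mu> \<in> G" for \<mu> using that by blast
  have "diff (diff w) = 0"
    by (rule diff_diff) (use alg_strand alg_at_subset w in blast)
  then have "diff v' = 0" by (simp add: v'_def diff_add z(2))
  \<comment> \<open>None of the remaining diagrams is broken at \<open>p\<close>, so the broken part
    of their differential stems from resolutions at \<open>p\<close> alone. Breaking at
    \<open>p\<close> is injective, so these contributions are independent and their vanishing sum is
    empty.\<close>
  then have "(\<Sum>\<mu>\<in>G. R (diff (elt Z (\<mu>, s, t)))) = 0" unfolding G(4) diff_sum by (simp flip: R_sum) (simp add: R_def)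
  then have "(\<Sum>\<mu>\<in>{\<mu>\<in>G. p \<in> crossing_places Z (\<mu>, s, t)}. elt Z (break_at p \<mu>, s, t)) = 0"
    unfolding sum.inter_filter[OF G(1)] using R_diff[OF G(2) Gp] by (simp cong: sum.cong)
  moreover have "inj_on (break_at p) {\<mu>\<in>G. p \<in> crossing_places Z (\<mu>, s, t)}"
    by (rule inj_on_inverseI[where g = "join_at p"])
      (use join_break[OF viable_diagramD(2)[OF G(2)], of _ p] in \<open>auto simp: crossing_places_def\<close>)
  ultimately have "(\<Sum>\<mu>\<in>break_at p ` {\<mu>\<in>G. p \<in> crossing_places Z (\<mu>, s, t)}. elt Z (\<mu>, s, t)) = 0"
    by (simp add: sum.reindex)
  then have "break_at p ` {\<mu>\<in>G. p \<in> crossing_places Z (\<mu>, s, t)} = {}"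
    by (rule sum_elt_0[rotated 2]) (use G(1) break_viable_diagram(1)[OF G(2), of _ p] in auto)
  then have Gc: "p \<notin> crossing_places Z (\<mu>, s, t)" if "\<mu> \<in> G" for \<mu> using that by blast
  have 1: "p \<notin> Domain \<nu>" if n: "\<nu> \<in> keys v'" for \<nu>
  proof -
    from n obtain \<mu> where m: "\<mu> \<in> G" "\<nu> \<in> keys (elt Z (\<mu>, s, t))" unfolding G(4) using keys_sum_subset by fast
    obtain V where V: "V \<in> fills Z \<mu> s t" "\<nu> = \<mu> \<union> Id_on V" using m keys_elt[OF viable_diagramD(3)[OF G(2)]] by auto
    have "\<not> dotted Z (\<mu>, s, t) P"
      using Gc[OF m(1)] crossing_places_iff[OF G(2)[OF m(1)]] G(3)[OF m(1)] pP thp by auto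
    then have "p \<notin> V" using fill_at_pair[OF V(1) P(1)] pP(1) by auto
    then show ?thesis using Gp[OF m(1)] V by auto
  qed
  \<comment> \<open>The joins differ from diagrams occurring in \<open>z\<close> only at
    \<open>P\<close>, so pairs cleared earlier stay clear. This permits the iteration over all
    pairs.\<close>
  have 2: "can Q \<notin> Domain \<nu>"
    if Q: "Q \<in> pairs Z" "Q \<noteq> P" "\<forall>\<nu>\<in>keys z. can Q \<notin> Domain \<nu>" and n: "\<nu> \<in> keys v'" for Q \<nu>
  proof (cases "\<nu> \<in> keys z")
    case False
    define q where "q = can Q"
    have qQ: "q \<in> plc Z Q" using ch Q(1) by (simp add: q_def choice_def)
    then have "q \<noteq> p" using pP Q(2) by (auto simp: plc_def)
    have "\<nu> \<in> keys (diff w)" using False n by (auto simp: v'_def keys_add_bit)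
    then obtain \<nu>' c where \<nu>': "\<nu>' \<in> keys w" "c \<in> crossings \<nu>'" "\<nu> = resolve \<nu>' c" by (rule keys_diff)
    have "strand_diagram Z \<nu>'" using alg_strand alg_at_subset w \<nu>'(1) by blast
    then have D: "Domain \<nu> = Domain \<nu>'" using resolve_strand(2)[OF \<nu>'(2)] \<nu>'(3) by simp
    from \<nu>'(1) obtain \<mu> where m: "\<mu> \<in> FU" "\<nu>' \<in> keys (elt Z (join_at p \<mu>, s, t))" unfolding w_def using keys_sum_subset by fast
    note Jm = J[OF m(1)]
    have mF: "\<mu> \<in> F" using m(1) by (simp add: FU_def)
    note vd = viable_diagramD[OF F(2)[OF mF]]
    note b = break_facts[OF viable_diagramD(2)[OF Jm(1)] Jm(5), unfolded Jm(3)]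
    obtain V where V: "V \<in> fills Z (join_at p \<mu>) s t" "\<nu>' = join_at p \<mu> \<union> Id_on V"
      using m(2) keys_elt[OF viable_diagramD(3)[OF Jm(1)]] by auto
    have qz: "q \<notin> Domain \<mu> \<union> V'" if "V' \<in> fills Z \<mu> s t" for V'
    proof -
      have "\<mu> \<union> Id_on V' \<in> keys z"
        unfolding F(4) using keys_sum_elt[OF F(1), of s t] mF that keys_elt[OF vd(3)] F(2) viable_diagramD(3) by blast
      then show ?thesis using Q(3) unfolding q_def by fastforce
    qed
    have cf: "can_fill can (\<mu>, s, t) \<in> fills Z \<mu> s t" by (rule can_fill_in_fills[OF vd(4) ch vd(7)])
    have "\<not> dotted Z (\<mu>, s, t) Q"
      using qz[OF cf] Q(1) by (auto simp: can_fill_def q_def)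
    moreover have "Domain \<mu> \<inter> plc Z Q = Domain (join_at p \<mu>) \<inter> plc Z Q" "Range \<mu> \<inter> plc Z Q = Range (join_at p \<mu>) \<inter> plc Z Q"
      using b(3,4) pP Q(2) by (auto simp: plc_def)
    ultimately have "\<not> dotted Z (join_at p \<mu>, s, t) Q" by (simp add: dotted_def)
    then have "q \<notin> V" using fill_at_pair[OF V(1) Q(1)] qQ by auto
    moreover have "q \<notin> Domain (join_at p \<mu>)" using qz[OF cf] b(3) by blast
    ultimately show ?thesis unfolding D V(2) q_def by auto
  qed (use Q in auto)
  show ?thesis
    by (rule bexI[OF _ w]) (use 1 2 in \<open>auto simp: v'_def p_def\<close>)
qed

text \<open>After \<open>eliminate_pair\<close> has been applied to all relevant pairs, each
  remaining diagram passes over the selected place of such a pair without being dotted there. The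
  idempotents then force strands to end and start at the other place. By
  \<open>viable_strands_eqI\<close> at most one diagram is left, and if one is left, both places of
  each of these pairs are interior.\<close>

lemma cycle_normal_form:
  assumes z: "z \<in> alg_at Z (h, s, t)" "diff z = 0" and v: "viable_h Z h"
  shows "z \<in> boundaries Z \<or> (\<exists>\<mu>. viable_diagram \<mu> s t \<and> h_grading \<mu> = h \<and> crossing_places Z (\<mu>, s, t) = {} \<and>
    good Z (h, s, t) \<and> z + elt Z (\<mu>, s, t) \<in> diff ` alg_at Z (h, s, t))"
proof -
  obtain can where ad: "adapted can (h, s, t)" using ex_adapted by blast
  have ch: "choice can" using ad by (simp add: adapted_def)
  \<comment> \<open>Since the selection is adapted, these are all pairs of both idempotents with at
    least one interior place.\<close>
  define \<Theta> where "\<Theta> = {P\<in>pairs Z. P \<in> s \<and> P \<in> t \<and> through h (can P)}"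
  have ex: "\<exists>w\<in>alg_at Z (h, s, t). \<forall>P\<in>\<Theta>'. \<forall>\<nu>\<in>keys (z + diff w). can P \<notin> Domain \<nu>" if "finite \<Theta>'" "\<Theta>' \<subseteq> \<Theta>" for \<Theta>'
    using that
  proof (induction \<Theta>' rule: finite_induct)
    case empty
    then show ?case using alg_at_0 by (intro bexI[of _ 0]) auto
  next
    case (insert P \<Theta>')
    then obtain w where w: "w \<in> alg_at Z (h, s, t)" "\<forall>P\<in>\<Theta>'. \<forall>\<nu>\<in>keys (z + diff w). can P \<notin> Domain \<nu>" by auto
    have P: "P \<in> pairs Z" "P \<in> s" "P \<in> t" "through h (can P)" using insert.prems by (auto simp: \<Theta>_def)
    have dd: "diff (diff w) = 0" by (rule diff_diff) (use alg_strand alg_at_subset w(1) in blast)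
    have "z + diff w \<in> alg_at Z (h, s, t)" "diff (z + diff w) = 0"
      using alg_at_add[OF z(1) diff_alg_at[OF w(1) v]] z(2) dd by (simp_all add: diff_add)
    from eliminate_pair[OF this v ad P] obtain w' where w': "w' \<in> alg_at Z (h, s, t)"
      "\<forall>\<nu>\<in>keys (z + diff w + diff w'). can P \<notin> Domain \<nu>"
      "\<forall>Q\<in>pairs Z. Q \<noteq> P \<longrightarrow> (\<forall>\<nu>\<in>keys (z + diff w). can Q \<notin> Domain \<nu>) \<longrightarrow> (\<forall>\<nu>\<in>keys (z + diff w + diff w'). can Q \<notin> Domain \<nu>)"
      by blast
    have e: "z + diff (w + w') = z + diff w + diff w'" by (simp add: diff_add add.assoc)
    have "can Q \<notin> Domain \<nu>" if "Q \<in> \<Theta>'" "\<nu> \<in> keys (z + diff w + diff w')" for Q \<nu>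
    proof -
      have "Q \<in> pairs Z" "Q \<noteq> P" using that(1) insert by (auto simp: \<Theta>_def)
      then show ?thesis using w'(3) w(2) that by blast
    qed
    then have "\<forall>Q\<in>insert P \<Theta>'. \<forall>\<nu>\<in>keys (z + diff (w + w')). can Q \<notin> Domain \<nu>"
      unfolding e using w'(2) by blast
    then show ?case using alg_at_add[OF w(1) w'(1)] by blast
  qed
  have "finite \<Theta>" using finite_pairs by (simp add: \<Theta>_def)
  from ex[OF this subset_refl] obtain w where w1: "w \<in> alg_at Z (h, s, t)"
    and w2: "\<forall>P\<in>\<Theta>. \<forall>\<nu>\<in>keys (z + diff w). can P \<notin> Domain \<nu>" by (rule bexE)
  note w = w1 bspec[OF bspec[OF w2]]
  obtain G where G: "finite G" "\<And>\<mu>. \<mu> \<in> G \<Longrightarrow> viable_diagram \<mu> s t" "\<And>\<mu>. \<mu> \<in> G \<Longrightarrow> h_grading \<mu> = h" "z + diff w = (\<Sum>\<mu>\<in>G. elt Z (\<mu>, s, t))"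
    by (rule alg_at_viableE[OF alg_at_add[OF z(1) diff_alg_at[OF w(1) v]] v]) blast
  have nd: "can P \<notin> Domain \<mu>" "\<not> dotted Z (\<mu>, s, t) P" if m: "\<mu> \<in> G" "P \<in> \<Theta>" for \<mu> P
  proof -
    note vd = viable_diagramD[OF G(2)[OF m(1)]]
    have "can_fill can (\<mu>, s, t) \<in> fills Z \<mu> s t" by (rule can_fill_in_fills[OF vd(4) ch vd(7)])
    then have "\<mu> \<union> Id_on (can_fill can (\<mu>, s, t)) \<in> keys (z + diff w)"
      unfolding G(4) using keys_sum_elt[OF G(1), of s t] m(1) keys_elt[OF vd(3)] G(2) viable_diagramD(3) by blast
    then have "can P \<notin> Domain \<mu> \<union> can_fill can (\<mu>, s, t)" using w(2)[OF m(2)] by fastforce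
    then show "can P \<notin> Domain \<mu>" "\<not> dotted Z (\<mu>, s, t) P" using m(2) by (auto simp: can_fill_def \<Theta>_def)
  qed
  \<comment> \<open>The pair is in both idempotents and not dotted, so each end has one of its
    places; it is not the selected one, over which a strand passes.\<close>
  have oth: "q \<in> Domain \<mu>" "q \<in> Range \<mu>" if m: "\<mu> \<in> G" "P \<in> \<Theta>" "q \<in> plc Z P" "q \<noteq> can P" for \<mu> P q
  proof -
    note vd = viable_diagramD[OF G(2)[OF m(1)]]
    have P: "P \<in> pairs Z" "P \<in> s" "P \<in> t" "through h (can P)" "can P \<in> plc Z P" using m(2) ch by (auto simp: \<Theta>_def choice_def)
    obtain q' where "q' \<noteq> can P" "plc Z P = {can P, q'}" using plc_obtain[OF P(1,5)] .
    then have pq: "plc Z P = {can P, q}" using m(3,4) by auto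
    have c: "card (Domain \<mu> \<inter> plc Z P) = 1" "card (Range \<mu> \<inter> plc Z P) = 1"
      using vd(7)[OF P(1)] nd(2)[OF m(1,2)] P by (auto simp: compat_def)
    have "passes \<mu> (can P)"
      using local_bits[OF vd(2) place_snd, of "can P"] nd(1)[OF m(1,2)] P(4,5) G(3)[OF m(1)] by (auto simp: through_def plc_def)
    then have "can P \<notin> Range \<mu>" using local_bits(6)[OF vd(2) place_snd, of "can P"] P(5) by (auto simp: plc_def)
    have "Domain \<mu> \<inter> plc Z P \<noteq> {}" "Range \<mu> \<inter> plc Z P \<noteq> {}" using c by force+
    then show "q \<in> Domain \<mu>" "q \<in> Range \<mu>" using pq nd(1)[OF m(1,2)] \<open>can P \<notin> Range \<mu>\<close> by auto
  qed
  show ?thesis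
  proof (cases "G = {}")
    case True
    then have "z = diff w" using G(4) by (simp add: chain_add_eq_0)
    then show ?thesis using boundary_alg_atI[OF w(1)] by simp
  next
    case False
    then obtain \<mu> where m: "\<mu> \<in> G" by blast
    note vd = viable_diagramD[OF G(2)[OF m]]
    have inT: "P \<in> \<Theta>" if "P \<in> pairs Z" "P \<in> s" "P \<in> t" "p \<in> plc Z P" "through h p" for P p
      using that ad by (auto simp: \<Theta>_def adapted_def)
    \<comment> \<open>Any place at which a remaining diagram is broken is interior, and its pair
      lies in both idempotents; hence it is the unselected place of a pair in
      \<open>\<Theta>\<close>. With \<open>oth\<close> this shows that all remaining diagrams are
      broken at the same places.\<close>
    have brk: "pair_of Z p \<in> \<Theta> \<and> p \<noteq> can (pair_of Z p)" if mu: "\<mu>' \<in> G" and p: "p \<in> places Z" "p \<in> Domain \<mu>'" "p \<in> Range \<mu>'" for \<mu>' p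
    proof -
      note vd' = viable_diagramD[OF G(2)[OF mu]]
      have P: "pair_of Z p \<in> pairs Z" "p \<in> plc Z (pair_of Z p)" using place_in_plc[OF p(1)] by auto
      have th: "through h p" using through_iff[OF vd'(2) p(1)] p G(3)[OF mu] by simp
      have "compat Z (\<mu>', s, t) (pair_of Z p)" by (rule vd'(7)[OF P(1)])
      moreover have ne: "Domain \<mu>' \<inter> plc Z (pair_of Z p) \<noteq> {}" "Range \<mu>' \<inter> plc Z (pair_of Z p) \<noteq> {}" using p P by auto
      ultimately have "card (Domain \<mu>' \<inter> plc Z (pair_of Z p)) = of_bool (pair_of Z p \<in> s)"
        "card (Range \<mu>' \<inter> plc Z (pair_of Z p)) = of_bool (pair_of Z p \<in> t)"
        unfolding compat_def dotted_def by blast+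
      moreover have "card (Domain \<mu>' \<inter> plc Z (pair_of Z p)) \<noteq> 0" "card (Range \<mu>' \<inter> plc Z (pair_of Z p)) \<noteq> 0"
        using ne by simp_all
      ultimately have "pair_of Z p \<in> s" "pair_of Z p \<in> t" by (metis of_bool_eq(1))+
      then have T: "pair_of Z p \<in> \<Theta>" using inT P th by blast
      then show ?thesis using nd(1)[OF mu T] p(2) by auto
    qed
    have "\<mu>' = \<mu>" if mu: "\<mu>' \<in> G" for \<mu>'
    proof (rule viable_strands_eqI[OF viable_diagramD(2)[OF G(2)[OF mu]] vd(2)])
      show "h_grading \<mu>' = h_grading \<mu>" using G(3) m mu by simp
      show "p \<in> Domain \<mu>" if "p \<in> places Z" "p \<in> Domain \<mu>'" "p \<in> Range \<mu>'" for p
        using brk[OF mu that] oth(1)[OF m, of "pair_of Z p" p] place_in_plc[OF that(1)] by blast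
      show "p \<in> Domain \<mu>'" if "p \<in> places Z" "p \<in> Domain \<mu>" "p \<in> Range \<mu>" for p
        using brk[OF m that] oth(1)[OF mu, of "pair_of Z p" p] place_in_plc[OF that(1)] by blast
    qed
    then have "G = {\<mu>}" using m by blast
    then have "z + diff w = elt Z (\<mu>, s, t)" using G(4) by simp
    then have "z + diff w + (diff w + elt Z (\<mu>, s, t)) = elt Z (\<mu>, s, t) + (diff w + elt Z (\<mu>, s, t))" by simp
    then have "z + elt Z (\<mu>, s, t) + (diff w + diff w) = diff w + (elt Z (\<mu>, s, t) + elt Z (\<mu>, s, t))" by (simp only: ac_simps)
    then have "z + elt Z (\<mu>, s, t) = diff w" by simp
    moreover have "crossing_places Z (\<mu>, s, t) = {}"
    proof (rule ccontr)
      assume "crossing_places Z (\<mu>, s, t) \<noteq> {}"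
      then obtain p where p: "p \<in> places Z" "dotted Z (\<mu>, s, t) (pair_of Z p)" "through h p"
        using crossing_places_iff[OF G(2)[OF m]] G(3)[OF m] by blast
      then have "pair_of Z p \<in> \<Theta>" using inT[of "pair_of Z p" p] place_in_plc[OF p(1)] by (auto simp: dotted_def)
      then show False using nd(2)[OF m] p(2) by blast
    qed
    \<comment> \<open>The selected place is interior by choice, and the other one because a strand
      ends and a strand starts there.\<close>
    moreover have "good Z (h, s, t)"
    proof -
      have "through h q" if "P \<in> pairs Z" "P \<in> s" "P \<in> t" "p \<in> plc Z P" "through h p" "q \<in> plc Z P" for P p q
      proof (cases "q = can P")
        case False
        have T: "P \<in> \<Theta>" using inT that by blast
        have "q \<in> places Z" using that by (simp add: plc_def)
        then show ?thesis using through_iff[OF vd(2)] oth[OF m T that(6) False] G(3)[OF m] by auto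
      qed (use inT[OF that(1-5)] in \<open>auto simp: \<Theta>_def\<close>)
      then show ?thesis unfolding good_def by blast
    qed
    ultimately show ?thesis using G(2,3)[OF m] w(1) m by blast
  qed
qed

lemma elt_not_boundary:
  assumes "viable_diagram \<mu> s t" "good Z (h_grading \<mu>, s, t)" "crossing_places Z (\<mu>, s, t) = {}"
  shows "elt Z (\<mu>, s, t) \<notin> boundaries Z"
proof
  assume "elt Z (\<mu>, s, t) \<in> boundaries Z"
  then obtain w where w: "w \<in> alg_at Z (h_grading \<mu>, s, t)" "elt Z (\<mu>, s, t) = diff w"
    using boundary_alg_at elt_alg_at[OF viable_diagramD(1)[OF assms(1)]] by blast
  obtain can where ch: "choice can" using ex_choice by blast
  have "crossless_count can (diff w) = 0"
    by (rule crossless_count_diff[OF w(1) _ assms(2) ch]) (use assms(1) in \<open>simp add: viable_diagram_def\<close>)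
  moreover have "crossless_count can (elt Z (\<mu>, s, t)) = 1"
    using crossless_count_elt[OF assms(1) good_adapted[OF assms(2) ch]] assms(3) by simp
  ultimately show False using w(2) by simp
qed

lemma elt_cycle:
  assumes "viable_diagram \<mu> s t" "crossing_places Z (\<mu>, s, t) = {}"
  shows "diff (elt Z (\<mu>, s, t)) = 0" "elt Z (\<mu>, s, t) \<in> cycles Z"
proof -
  show "diff (elt Z (\<mu>, s, t)) = 0" using diff_elt[OF viable_diagramD(1,2)[OF assms(1)]] assms(2) by simp
  then show "elt Z (\<mu>, s, t) \<in> cycles Z"
    using elt_alg_at[OF viable_diagramD(1)[OF assms(1)]] alg_at_subset by (auto simp: cycles_def)
qed

text \<open>Nonvanishing in homology is traded for a condition on the H-data at each pair, which can
  be cut to fragments and checked locally.\<close>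

lemma tight_iff:
  "tight Z (\<mu>, s, t) \<longleftrightarrow> viable_diagram \<mu> s t \<and> crossing_places Z (\<mu>, s, t) = {} \<and> good Z (h_grading \<mu>, s, t)"
proof
  assume t: "tight Z (\<mu>, s, t)"
  then have vd: "viable_diagram \<mu> s t" by (simp add: tight_def viable_diagram_def)
  then have c: "crossing_places Z (\<mu>, s, t) = {}" using t crossings_elt by (simp add: tight_def)
  have "elt Z (\<mu>, s, t) \<notin> boundaries Z" using t by (simp add: tight_def hclass_eq_hzero)
  then have "good Z (h_grading \<mu>, s, t)"
    using cycle_normal_form[OF elt_alg_at[OF viable_diagramD(1)[OF vd]] elt_cycle(1)[OF vd c]] vd
    by (auto simp: viable_diagram_def)
  then show "viable_diagram \<mu> s t \<and> crossing_places Z (\<mu>, s, t) = {} \<and> good Z (h_grading \<mu>, s, t)" using vd c by simp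
next
  assume a: "viable_diagram \<mu> s t \<and> crossing_places Z (\<mu>, s, t) = {} \<and> good Z (h_grading \<mu>, s, t)"
  then show "tight Z (\<mu>, s, t)"
    using elt_not_boundary crossings_elt by (simp add: tight_def hclass_eq_hzero viable_diagram_def)
qed

lemma nonzero_cycle_tight:
  assumes "z \<in> alg_at Z (h, s, t)" "diff z = 0" "z \<notin> boundaries Z"
  obtains \<mu> where "tight Z (\<mu>, s, t)" "h_grading \<mu> = h" "hclass Z z = hclass Z (elt Z (\<mu>, s, t))"
proof -
  have "viable_h Z h" using nonviable_boundary assms by blast
  then obtain \<mu> where m: "viable_diagram \<mu> s t" "h_grading \<mu> = h" "crossing_places Z (\<mu>, s, t) = {}"
    "good Z (h, s, t)" "z + elt Z (\<mu>, s, t) \<in> diff ` alg_at Z (h, s, t)"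
    using cycle_normal_form[OF assms(1,2)] assms(3) by blast
  show ?thesis
  proof (rule that)
    show "tight Z (\<mu>, s, t)" using m by (simp add: tight_iff)
    show "h_grading \<mu> = h" by (rule m)
    show "hclass Z z = hclass Z (elt Z (\<mu>, s, t))"
      unfolding hclass_eq_iff using m(5) boundary_alg_atI by (metis imageE)
  qed
qed

text \<open>A cycle differs by a boundary from zero or from a single crossingless diagram. The count
  vanishes on boundaries and is one on that diagram, for every selection of places.\<close>

lemma nonzero_cycle_count:
  assumes "z \<in> alg_at Z (h, s, t)" "diff z = 0" "viable_h Z h" "good Z (h, s, t)" "choice can"
  shows "z \<notin> boundaries Z \<longleftrightarrow> crossless_count can z = 1"
proof
  assume "z \<notin> boundaries Z"
  then obtain \<mu> where m: "viable_diagram \<mu> s t" "h_grading \<mu> = h" "crossing_places Z (\<mu>, s, t) = {}"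
    "z + elt Z (\<mu>, s, t) \<in> diff ` alg_at Z (h, s, t)"
    using cycle_normal_form[OF assms(1-3)] by blast
  then obtain w where w: "w \<in> alg_at Z (h, s, t)" "z + elt Z (\<mu>, s, t) = diff w" by blast
  have "crossless_count can z + crossless_count can (elt Z (\<mu>, s, t)) = 0"
    using crossless_count_diff[OF w(1) assms(3-5)] unfolding w(2)[symmetric] crossless_count_add .
  moreover have "crossless_count can (elt Z (\<mu>, s, t)) = 1"
    using crossless_count_elt[OF m(1)] good_adapted[OF assms(4,5)] m(2,3) by simp
  ultimately show "crossless_count can z = 1" by (cases "crossless_count can z") auto
next
  assume c: "crossless_count can z = 1"
  show "z \<notin> boundaries Z"
  proof
    assume "z \<in> boundaries Z"
    then obtain w where "w \<in> alg_at Z (h, s, t)" "z = diff w" using boundary_alg_at assms(1) by blast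
    then show False using crossless_count_diff[OF _ assms(3-5)] c by simp
  qed
qed

end

section \<open>Products of viable diagrams\<close>

text \<open>A strand of one factor which meets no moving strand of the other is continued by a
  horizontal strand; this accounts for the two parts besides the relational composite.\<close>

definition compose :: "'i strands \<Rightarrow> 'i strands \<Rightarrow> 'i strands" where
  "compose \<mu> \<nu> = (\<mu> O \<nu>) \<union> {(x, z) \<in> \<mu>. z \<notin> Domain \<nu>} \<union> {(x, z) \<in> \<nu>. x \<notin> Range \<mu>}"

text \<open>A strand of the first factor ends at one place of the pair while a strand of the second
  starts at the other one. This is the only obstruction to a nonzero product of viable diagrams with
  viable sum.\<close>

definition mismatch :: "('i, 'l) arc_diag \<Rightarrow> 'i strands \<Rightarrow> 'i strands \<Rightarrow> 'l \<Rightarrow> bool" where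
  "mismatch Z \<mu> \<nu> P \<longleftrightarrow> (\<exists>p\<in>plc Z P. \<exists>q\<in>plc Z P. p \<noteq> q \<and> p \<in> Range \<mu> \<and> q \<in> Domain \<nu>)"

context arc
begin

lemma card_plc_of_bool:
  assumes "plc Z P = {p, q}" "p \<noteq> q"
  shows "card (X \<inter> plc Z P) = of_bool b \<longleftrightarrow> (b \<and> (p \<in> X \<longleftrightarrow> q \<notin> X)) \<or> (\<not> b \<and> p \<notin> X \<and> q \<notin> X)"
  using assms by (cases "p \<in> X"; cases "q \<in> X"; cases b) auto

text \<open>With the cardinalities replaced by memberships of the two places, the case analyses at a
  pair become propositional.\<close>

lemma compat_bits:
  assumes "plc Z P = {p, q}" "p \<noteq> q"
  shows "compat Z (\<mu>, s, t) P \<longleftrightarrow> (P \<in> s \<and> P \<in> t \<and> p \<notin> Domain \<mu> \<and> q \<notin> Domain \<mu> \<and> p \<notin> Range \<mu> \<and> q \<notin> Range \<mu>) \<or>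
     (((P \<in> s \<and> (p \<in> Domain \<mu> \<longleftrightarrow> q \<notin> Domain \<mu>)) \<or> (P \<notin> s \<and> p \<notin> Domain \<mu> \<and> q \<notin> Domain \<mu>)) \<and>
     ((P \<in> t \<and> (p \<in> Range \<mu> \<longleftrightarrow> q \<notin> Range \<mu>)) \<or> (P \<notin> t \<and> p \<notin> Range \<mu> \<and> q \<notin> Range \<mu>)))"
proof -
  have "X \<inter> plc Z P = {} \<longleftrightarrow> p \<notin> X \<and> q \<notin> X" for X using assms by auto
  then show ?thesis unfolding compat_def dotted_def prod.case card_plc_of_bool[OF assms] by simp
qed

lemma dotted_bits:
  assumes "plc Z P = {p, q}"
  shows "dotted Z (\<mu>, s, t) P \<longleftrightarrow> P \<in> s \<and> P \<in> t \<and> p \<notin> Domain \<mu> \<and> q \<notin> Domain \<mu> \<and> p \<notin> Range \<mu> \<and> q \<notin> Range \<mu>"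
  using assms by (auto simp: dotted_def)

lemma section_bits:
  assumes "section_of Z s X" "P \<in> pairs Z" "plc Z P = {p, q}" "p \<noteq> q"
  shows "(P \<in> s \<and> (p \<in> X \<longleftrightarrow> q \<notin> X)) \<or> (P \<notin> s \<and> p \<notin> X \<and> q \<notin> X)"
  using assms(1,2) card_plc_of_bool[OF assms(3,4)] by (auto simp: section_of_def)

lemma mismatch_bits:
  assumes "plc Z P = {p, q}" "p \<noteq> q"
  shows "mismatch Z \<mu> \<nu> P \<longleftrightarrow> (p \<in> Range \<mu> \<and> q \<in> Domain \<nu>) \<or> (q \<in> Range \<mu> \<and> p \<in> Domain \<nu>)"
  using assms unfolding mismatch_def by auto

lemma pair_places:
  assumes "P \<in> pairs Z"
  obtains p q where "plc Z P = {p, q}" "p \<noteq> q"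
  using card_plc[OF assms] by (metis card_2_iff)

end

locale composable = arc Z for Z :: "('i, 'l) arc_diag" +
  fixes \<mu>1 \<mu>2 :: "'i strands" and s t u :: "'l set"
  assumes vd1: "viable_diagram \<mu>1 s t" and vd2: "viable_diagram \<mu>2 t u"
    and viable_sum: "viable_h Z (\<lambda>e. h_grading \<mu>1 e + h_grading \<mu>2 e)"
begin

abbreviation "\<mu>12 \<equiv> compose \<mu>1 \<mu>2"

lemmas v1 = viable_diagramD[OF vd1] and v2 = viable_diagramD[OF vd2]

lemma not_both: "u1 \<in> \<mu>1 \<Longrightarrow> u2 \<in> \<mu>2 \<Longrightarrow> covers u1 e \<Longrightarrow> \<not> covers u2 e"
proof
  assume a: "u1 \<in> \<mu>1" "u2 \<in> \<mu>2" "covers u1 e" "covers u2 e"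
  then have "h_grading \<mu>1 e = 1" "h_grading \<mu>2 e = 1" using h_eq_1_iff[OF v1(2)] h_eq_1_iff[OF v2(2)] by auto
  then show False using viable_sum covers_step[OF v1(4) a(1,3)] by (auto simp: viable_h_def)
qed

lemma Domain_disjoint: "Domain \<mu>1 \<inter> Domain \<mu>2 = {}"
proof (rule ccontr)
  assume "Domain \<mu>1 \<inter> Domain \<mu>2 \<noteq> {}"
  then obtain x y z where x: "(x, y) \<in> \<mu>1" "(x, z) \<in> \<mu>2" by blast
  then have "covers (x, y) x" "covers (x, z) x"
    using moving_less[OF v1(3)] moving_less[OF v2(3)] by (auto simp: covers_def pt_less_def)
  then show False using not_both x by blast
qed

lemma Range_disjoint: "Range \<mu>1 \<inter> Range \<mu>2 = {}"
proof (rule ccontr)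
  assume "Range \<mu>1 \<inter> Range \<mu>2 \<noteq> {}"
  then obtain x y z where x: "(y, x) \<in> \<mu>1" "(z, x) \<in> \<mu>2" by blast
  then have "covers (y, x) (fst x, snd x - 1)" "covers (z, x) (fst x, snd x - 1)"
    using moving_less[OF v1(3) x(1)] moving_less[OF v2(3) x(2)] by (auto simp: covers_def pt_less_def)
  then show False using not_both x by blast
qed

lemma passes_disjoint:
  assumes "passes \<mu>1 p"
  shows "p \<notin> Domain \<mu>2" "p \<notin> Range \<mu>2" "\<not> passes \<mu>2 p"
proof -
  obtain x y where x: "(x, y) \<in> \<mu>1" "pt_less x p" "pt_less p y" using assms unfolding passes_def by blast
  then have c: "covers (x, y) p" "covers (x, y) (fst p, snd p - 1)" by (auto simp: covers_def pt_less_def)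
  show "p \<notin> Domain \<mu>2"
  proof
    assume "p \<in> Domain \<mu>2"
    then obtain z where z: "(p, z) \<in> \<mu>2" by blast
    then have "covers (p, z) p" using moving_less[OF v2(3) z] by (simp add: covers_def pt_less_def)
    then show False using not_both x z c by blast
  qed
  show "p \<notin> Range \<mu>2"
  proof
    assume "p \<in> Range \<mu>2"
    then obtain z where z: "(z, p) \<in> \<mu>2" by blast
    then have "covers (z, p) (fst p, snd p - 1)" using moving_less[OF v2(3) z] by (auto simp: covers_def pt_less_def)
    then show False using not_both x z c by blast
  qed
  show "\<not> passes \<mu>2 p"
  proof
    assume "passes \<mu>2 p"
    then obtain z w where z: "(z, w) \<in> \<mu>2" "pt_less z p" "pt_less p w" unfolding passes_def by blast
    then have "covers (z, w) p" by (simp add: covers_def pt_less_def)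
    then show False using not_both x z c by blast
  qed
qed

lemma passes_disjoint':
  assumes "passes \<mu>2 p"
  shows "p \<notin> Domain \<mu>1" "p \<notin> Range \<mu>1"
proof -
  obtain x y where x: "(x, y) \<in> \<mu>2" "pt_less x p" "pt_less p y" using assms unfolding passes_def by blast
  then have c: "covers (x, y) p" "covers (x, y) (fst p, snd p - 1)" by (auto simp: covers_def pt_less_def)
  show "p \<notin> Domain \<mu>1"
  proof
    assume "p \<in> Domain \<mu>1"
    then obtain z where z: "(p, z) \<in> \<mu>1" by blast
    then have "covers (p, z) p" using moving_less[OF v1(3) z] by (simp add: covers_def pt_less_def)
    then show False using not_both x z c by blast
  qed
  show "p \<notin> Range \<mu>1"
  proof
    assume "p \<in> Range \<mu>1"
    then obtain z where z: "(z, p) \<in> \<mu>1" by blast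
    then have "covers (z, p) (fst p, snd p - 1)" using moving_less[OF v1(3) z] by (auto simp: covers_def pt_less_def)
    then show False using not_both x z c by blast
  qed
qed

lemma compose_less: "(x, z) \<in> \<mu>12 \<Longrightarrow> pt_less x z"
  unfolding compose_def using moving_less[OF v1(3)] moving_less[OF v2(3)] pt_less_trans by blast

lemma Domain_compose: "Domain \<mu>12 = Domain \<mu>1 \<union> (Domain \<mu>2 - Range \<mu>1)"
  unfolding compose_def by blast

lemma Range_compose: "Range \<mu>12 = Range \<mu>2 \<union> (Range \<mu>1 - Domain \<mu>2)"
  unfolding compose_def by blast

lemma moving_compose: "moving Z \<mu>12"
proof -
  have "single_valued \<mu>12"
    unfolding single_valued_def compose_def
    using strand_sv[OF v1(4)] strand_sv[OF v2(4)] Domain_disjoint by blast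
  moreover have "single_valued (\<mu>12\<inverse>)"
    unfolding single_valued_def compose_def converse_iff
    using strand_inj[OF v1(4)] strand_inj[OF v2(4)] Range_disjoint by blast
  moreover have "\<mu>12 \<subseteq> points Z \<times> points Z"
    using strand_le[OF v1(4)] strand_le[OF v2(4)] unfolding compose_def by blast
  moreover have "\<forall>(x, y)\<in>\<mu>12. pt_le x y" using compose_less pt_less_imp_le by blast
  moreover have "(x, x) \<notin> \<mu>12" for x using compose_less[of x x] by auto
  ultimately show ?thesis by (simp add: moving_def strand_diagram_def)
qed

text \<open>The common end is recorded because it identifies the strand: it makes the strand of the
  composite over a given step unique in \<open>h_grading_compose\<close>.\<close>

lemma compose_cover:
  assumes "w \<in> \<mu>12" "covers w e"
  shows "(\<exists>c\<in>\<mu>1. covers c e \<and> fst c = fst w) \<or> (\<exists>c\<in>\<mu>2. covers c e \<and> snd c = snd w)"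
proof -
  obtain x z where w: "w = (x, z)" by (cases w)
  from assms(1) consider y where "(x, y) \<in> \<mu>1" "(y, z) \<in> \<mu>2" | "(x, z) \<in> \<mu>1" | "(x, z) \<in> \<mu>2"
    unfolding w compose_def by blast
  then show ?thesis
  proof cases
    case 1
    then have "covers (x, y) e \<or> covers (y, z) e"
      using assms(2) moving_less[OF v1(3) 1(1)] moving_less[OF v2(3) 1(2)] by (auto simp: w covers_def pt_less_def)
    then show ?thesis using 1 w by (metis fst_conv snd_conv)
  qed (use assms w in auto)
qed

lemma cover_compose:
  "(\<exists>w\<in>\<mu>12. covers w e) \<longleftrightarrow> (\<exists>c\<in>\<mu>1. covers c e) \<or> (\<exists>c\<in>\<mu>2. covers c e)"
proof
  assume "\<exists>w\<in>\<mu>12. covers w e"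
  then show "(\<exists>c\<in>\<mu>1. covers c e) \<or> (\<exists>c\<in>\<mu>2. covers c e)" using compose_cover by blast
next
  have l: "covers (x, z) e" if "covers (x, y) e" "pt_less y z" for x y z
    using that by (auto simp: covers_def pt_less_def)
  have r: "covers (x, z) e" if "covers (y, z) e" "pt_less x y" for x y z
    using that by (auto simp: covers_def pt_less_def)
  assume "(\<exists>c\<in>\<mu>1. covers c e) \<or> (\<exists>c\<in>\<mu>2. covers c e)"
  then consider x y where "(x, y) \<in> \<mu>1" "covers (x, y) e" | x y where "(x, y) \<in> \<mu>2" "covers (x, y) e" by (metis surj_pair)
  then show "\<exists>w\<in>\<mu>12. covers w e"
  proof cases
    case 1
    show ?thesis
    proof (cases "y \<in> Domain \<mu>2")
      case True
      then obtain z where "(y, z) \<in> \<mu>2" by blast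
      then have "(x, z) \<in> \<mu>12" "covers (x, z) e" using 1 l moving_less[OF v2(3)] unfolding compose_def by blast+
      then show ?thesis by blast
    next
      case False
      then have "(x, y) \<in> \<mu>12" using 1 unfolding compose_def by blast
      then show ?thesis using 1 by blast
    qed
  next
    case 2
    show ?thesis
    proof (cases "x \<in> Range \<mu>1")
      case True
      then obtain z where "(z, x) \<in> \<mu>1" by blast
      then have "(z, y) \<in> \<mu>12" "covers (z, y) e" using 2 r moving_less[OF v1(3)] unfolding compose_def by blast+
      then show ?thesis by blast
    next
      case False
      then have "(x, y) \<in> \<mu>12" using 2 unfolding compose_def by blast
      then show ?thesis using 2 by blast
    qed
  qed
qed

lemma h_grading_compose: "h_grading \<mu>12 = (\<lambda>e. h_grading \<mu>1 e + h_grading \<mu>2 e)"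
proof
  fix e
  have s: "strand_diagram Z \<mu>12" using moving_compose by (simp add: moving_def)
  have un: "w = w'" if w: "w \<in> \<mu>12" "covers w e" and w': "w' \<in> \<mu>12" "covers w' e" for w w'
  proof -
    from compose_cover[OF w] show ?thesis
    proof
      assume "\<exists>c\<in>\<mu>1. covers c e \<and> fst c = fst w"
      then obtain c where c: "c \<in> \<mu>1" "covers c e" "fst c = fst w" by blast
      then obtain c' where c': "c' \<in> \<mu>1" "covers c' e" "fst c' = fst w'" using compose_cover[OF w'] not_both by blast
      then have "fst w = fst w'" using cover_unique[OF v1(2) c(1) c'(1) c(2) c'(2)] c by simp
      then show ?thesis using strand_sv[OF s] w w' by (metis prod.collapse)
    next
      assume "\<exists>c\<in>\<mu>2. covers c e \<and> snd c = snd w"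
      then obtain c where c: "c \<in> \<mu>2" "covers c e" "snd c = snd w" by blast
      then obtain c' where c': "c' \<in> \<mu>2" "covers c' e" "snd c' = snd w'" using compose_cover[OF w'] not_both by blast
      then have "snd w = snd w'" using cover_unique[OF v2(2) c(1) c'(1) c(2) c'(2)] c by simp
      then show ?thesis using strand_inj[OF s] w w' by (metis prod.collapse)
    qed
  qed
  have "h_grading \<mu>12 e = of_bool (\<exists>w\<in>\<mu>12. covers w e)"
  proof (cases "\<exists>w\<in>\<mu>12. covers w e")
    case True
    then obtain w where "{w\<in>\<mu>12. covers w e} = {w}" using un by blast
    then have "card {w\<in>\<mu>12. covers w e} = 1" by simp
    then show ?thesis using True by (simp add: h_grading_card[OF s finite_strands[OF s]])
  next
    case False
    then have "{w\<in>\<mu>12. covers w e} = {}" by blast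
    then have "card {w\<in>\<mu>12. covers w e} = 0" by (simp only: card.empty)
    then show ?thesis using False by (simp add: h_grading_card[OF s finite_strands[OF s]])
  qed
  moreover have "h_grading \<mu>1 e = of_bool (\<exists>w\<in>\<mu>1. covers w e)" using h_eq_1_iff[OF v1(2), of e] by (auto simp: of_bool_def)
  moreover have "h_grading \<mu>2 e = of_bool (\<exists>w\<in>\<mu>2. covers w e)" using h_eq_1_iff[OF v2(2), of e] by (auto simp: of_bool_def)
  ultimately show "h_grading \<mu>12 e = h_grading \<mu>1 e + h_grading \<mu>2 e"
    using cover_compose[of e] not_both[of _ _ e] by (auto simp: of_bool_def)
qed

lemma viable_compose: "viable_strands \<mu>12"
  using moving_compose viable_sum by (simp add: viable_strands_def h_grading_compose)

section \<open>Products of terms and of diagrams\<close>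

lemma compose_fill:
  assumes "V1 \<inter> Range \<mu>1 = {}" "V2 \<inter> Domain \<mu>2 = {}" "Range \<mu>1 \<union> V1 = Domain \<mu>2 \<union> V2"
  shows "(\<mu>1 \<union> Id_on V1) O (\<mu>2 \<union> Id_on V2) = \<mu>12 \<union> Id_on (V1 \<inter> V2)"
proof -
  have "y \<in> V2 \<longleftrightarrow> y \<notin> Domain \<mu>2" if "y \<in> Range \<mu>1" for y using assms that by blast
  moreover have "y \<in> V1 \<longleftrightarrow> y \<notin> Range \<mu>1" if "y \<in> Domain \<mu>2" for y using assms that by blast
  ultimately show ?thesis unfolding compose_def by blast
qed

lemma passes_compose:
  assumes "p \<notin> Range \<mu>1"
  shows "passes \<mu>12 p \<longleftrightarrow> passes \<mu>1 p \<or> passes \<mu>2 p"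
proof
  assume "passes \<mu>12 p"
  then obtain x z where x: "(x, z) \<in> \<mu>12" "pt_less x p" "pt_less p z" unfolding passes_def by blast
  then consider y where "(x, y) \<in> \<mu>1" "(y, z) \<in> \<mu>2" | "(x, z) \<in> \<mu>1" | "(x, z) \<in> \<mu>2"
    unfolding compose_def by blast
  then show "passes \<mu>1 p \<or> passes \<mu>2 p"
  proof cases
    case 1
    have "y \<noteq> p" using 1 assms by blast
    moreover have "fst y = fst p" using moving_less[OF v1(3) 1(1)] x by (simp add: pt_less_def)
    ultimately have "pt_less p y \<or> pt_less y p" by (cases y; cases p) (auto simp: pt_less_def)
    then show ?thesis unfolding passes_def using 1 x by blast
  qed (use x in \<open>unfold passes_def, blast+\<close>)
next
  assume "passes \<mu>1 p \<or> passes \<mu>2 p"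
  then consider x y where "(x, y) \<in> \<mu>1" "pt_less x p" "pt_less p y" | x y where "(x, y) \<in> \<mu>2" "pt_less x p" "pt_less p y"
    unfolding passes_def by blast
  then show "passes \<mu>12 p"
  proof cases
    case 1
    then show ?thesis using moving_less[OF v2(3)] pt_less_trans unfolding passes_def compose_def by blast
  next
    case 2
    then show ?thesis using moving_less[OF v1(3)] pt_less_trans unfolding passes_def compose_def by blast
  qed
qed

text \<open>Once the ends fit, no crossing is lost. A horizontal strand crossed in one factor is
  horizontal in the other, and by viability it is not crossed there. The crossings of the product
  are thus the disjoint union of those of the factors.\<close>

lemma mult_terms:
  assumes "V1 \<in> fills Z \<mu>1 s t" "V2 \<in> fills Z \<mu>2 t u"
  shows "mult_strands (\<mu>1 \<union> Id_on V1) (\<mu>2 \<union> Id_on V2) =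
    (if Range \<mu>1 \<union> V1 = Domain \<mu>2 \<union> V2 then basis (\<mu>12 \<union> Id_on (V1 \<inter> V2)) else 0)"
proof (cases "Range \<mu>1 \<union> V1 = Domain \<mu>2 \<union> V2")
  case True
  have V1: "V1 \<inter> Domain \<mu>1 = {}" "V1 \<inter> Range \<mu>1 = {}" "finite V1"
    and V2: "V2 \<inter> Domain \<mu>2 = {}" "V2 \<inter> Range \<mu>2 = {}" "finite V2"
    using assms finite_points finite_subset by (auto simp: fills_def)
  have e: "(\<mu>1 \<union> Id_on V1) O (\<mu>2 \<union> Id_on V2) = \<mu>12 \<union> Id_on (V1 \<inter> V2)"
    using compose_fill[OF V1(2) V2(1) True] .
  have d: "(V1 \<inter> V2) \<inter> Domain \<mu>12 = {}" "(V1 \<inter> V2) \<inter> Range \<mu>12 = {}"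
    using V1 V2 unfolding Domain_compose Range_compose by blast+
  have a: "p \<in> V2" if "p \<in> V1" "passes \<mu>1 p" for p using True that passes_disjoint(1)[OF that(2)] by blast
  have b: "p \<in> V1" if "p \<in> V2" "passes \<mu>2 p" for p using True that passes_disjoint'(2)[OF that(2)] by blast
  have "{p \<in> V1 \<inter> V2. passes \<mu>12 p} = {p\<in>V1. passes \<mu>1 p} \<union> {p\<in>V2. passes \<mu>2 p}"
    using passes_compose V1(2) a b by blast
  moreover have "{p\<in>V1. passes \<mu>1 p} \<inter> {p\<in>V2. passes \<mu>2 p} = {}" using passes_disjoint(3) by blast
  ultimately have "card {p \<in> V1 \<inter> V2. passes \<mu>12 p} = card {p\<in>V1. passes \<mu>1 p} + card {p\<in>V2. passes \<mu>2 p}"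
    using V1(3) V2(3) by (simp add: card_Un_disjoint)
  then have "inv_num (\<mu>12 \<union> Id_on (V1 \<inter> V2)) = inv_num (\<mu>1 \<union> Id_on V1) + inv_num (\<mu>2 \<union> Id_on V2)"
    using inv_num_fill[OF viable_compose d] inv_num_fill[OF v1(2) V1(1,2)] inv_num_fill[OF v2(2) V2(1,2)] by simp
  then show ?thesis unfolding mult_strands_def e using True by simp
qed (simp add: mult_strands_def)

lemma pair_analysis:
  assumes "\<not> mismatch Z \<mu>1 \<mu>2 P" "P \<in> pairs Z"
  shows "compat Z (\<mu>12, s, u) P" "dotted Z (\<mu>12, s, u) P \<longleftrightarrow> dotted Z (\<mu>1, s, t) P \<and> dotted Z (\<mu>2, t, u) P"
proof -
  obtain p q where pq: "plc Z P = {p, q}" "p \<noteq> q" using pair_places[OF assms(2)] .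
  have c1: "compat Z (\<mu>1, s, t) P" and c2: "compat Z (\<mu>2, t, u) P" using v1(7) v2(7) assms(2) by auto
  have m: "x \<in> Domain \<mu>12 \<longleftrightarrow> x \<in> Domain \<mu>1 \<or> (x \<in> Domain \<mu>2 \<and> x \<notin> Range \<mu>1)"
    "x \<in> Range \<mu>12 \<longleftrightarrow> x \<in> Range \<mu>2 \<or> (x \<in> Range \<mu>1 \<and> x \<notin> Domain \<mu>2)" for x
    unfolding Domain_compose Range_compose by blast+
  show "compat Z (\<mu>12, s, u) P"
    using c1 c2 assms(1) unfolding compat_bits[OF pq] mismatch_bits[OF pq] m by argo
  show "dotted Z (\<mu>12, s, u) P \<longleftrightarrow> dotted Z (\<mu>1, s, t) P \<and> dotted Z (\<mu>2, t, u) P"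
    using c1 c2 assms(1) unfolding compat_bits[OF pq] dotted_bits[OF pq(1)] mismatch_bits[OF pq] m by argo
qed

lemma diagram_compose:
  assumes "\<forall>P\<in>pairs Z. \<not> mismatch Z \<mu>1 \<mu>2 P"
  shows "viable_diagram \<mu>12 s u"
  unfolding viable_diagram_def diagram_iff
  using moving_compose v1(5) v2(6) pair_analysis(1) assms viable_sum h_grading_compose by auto

text \<open>The horizontal strands of the composite are those common to both factors. The first
  factor needs further ones to meet the free sources of the second, and the second to meet the free
  targets of the first. That the common middle set belongs to the idempotent \<open>t\<close> is
  checked at each pair.\<close>

lemma fills_compose:
  assumes "V \<in> fills Z \<mu>12 s u" "\<forall>P\<in>pairs Z. \<not> mismatch Z \<mu>1 \<mu>2 P"
  shows "V \<union> (Domain \<mu>2 - Range \<mu>1) \<in> fills Z \<mu>1 s t" "V \<union> (Range \<mu>1 - Domain \<mu>2) \<in> fills Z \<mu>2 t u"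
proof -
  have V: "V \<subseteq> points Z" "V \<inter> Domain \<mu>12 = {}" "V \<inter> Range \<mu>12 = {}"
    "section_of Z s (Domain \<mu>12 \<union> V)" "section_of Z u (Range \<mu>12 \<union> V)" using assms(1) by (auto simp: fills_def)
  have pts: "Domain \<mu>1 \<subseteq> points Z" "Range \<mu>1 \<subseteq> points Z" "Domain \<mu>2 \<subseteq> points Z" "Range \<mu>2 \<subseteq> points Z"
    using strand_le[OF v1(4)] strand_le[OF v2(4)] by blast+
  have m: "x \<in> Domain \<mu>12 \<longleftrightarrow> x \<in> Domain \<mu>1 \<or> (x \<in> Domain \<mu>2 \<and> x \<notin> Range \<mu>1)"
    "x \<in> Range \<mu>12 \<longleftrightarrow> x \<in> Range \<mu>2 \<or> (x \<in> Range \<mu>1 \<and> x \<notin> Domain \<mu>2)" for x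
    unfolding Domain_compose Range_compose by blast+
  let ?W = "Range \<mu>1 \<union> Domain \<mu>2 \<union> V"
  have key: "(x \<notin> V \<or> x \<notin> Range \<mu>1 \<or> x \<notin> Domain \<mu>2) \<and> card (?W \<inter> plc Z P) = of_bool (P \<in> t)"
    if P: "P \<in> pairs Z" "x \<in> plc Z P" for P x
  proof -
    obtain p q where pq: "plc Z P = {p, q}" "p \<noteq> q" using pair_places[OF P(1)] .
    have c1: "compat Z (\<mu>1, s, t) P" and c2: "compat Z (\<mu>2, t, u) P" using v1(7) v2(7) P(1) by auto
    have nV: "(p \<notin> V \<or> p \<notin> Domain \<mu>12 \<and> p \<notin> Range \<mu>12) \<and> (q \<notin> V \<or> q \<notin> Domain \<mu>12 \<and> q \<notin> Range \<mu>12)" using V by blast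
    note S = section_bits[OF V(4) P(1) pq] section_bits[OF V(5) P(1) pq]
    have W: "y \<in> ?W \<longleftrightarrow> y \<in> Range \<mu>1 \<or> y \<in> Domain \<mu>2 \<or> y \<in> V" for y by blast
    have U: "y \<in> A \<union> B \<longleftrightarrow> y \<in> A \<or> y \<in> B" for y :: "'i \<times> nat" and A B by blast
    have "(p \<notin> V \<or> p \<notin> Range \<mu>1 \<or> p \<notin> Domain \<mu>2) \<and> (q \<notin> V \<or> q \<notin> Range \<mu>1 \<or> q \<notin> Domain \<mu>2) \<and>
       ((P \<in> t \<and> (p \<in> ?W \<longleftrightarrow> q \<notin> ?W)) \<or> (P \<notin> t \<and> p \<notin> ?W \<and> q \<notin> ?W))"
      using c1 c2 bspec[OF assms(2) P(1)] S nV unfolding compat_bits[OF pq] mismatch_bits[OF pq] W U m by argo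
    then show ?thesis using P(2) pq unfolding card_plc_of_bool[OF pq] by auto
  qed
  have VRD: "V \<inter> Range \<mu>1 \<inter> Domain \<mu>2 = {}"
  proof (rule ccontr)
    assume "V \<inter> Range \<mu>1 \<inter> Domain \<mu>2 \<noteq> {}"
    then obtain x a b where x: "x \<in> V" "(a, x) \<in> \<mu>1" "(x, b) \<in> \<mu>2" by blast
    then have "x \<in> places Z"
      using between_place[of a b x] moving_less[OF v1(3)] moving_less[OF v2(3)] strand_le[OF v1(4)] strand_le[OF v2(4)] by blast
    then show False using key[of "pair_of Z x" x] place_in_plc[of x Z] x by blast
  qed
  have "card (?W \<inter> plc Z P) = of_bool (P \<in> t)" if P: "P \<in> pairs Z" for P
  proof -
    obtain p q where "plc Z P = {p, q}" "p \<noteq> q" using pair_places[OF P] .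
    then show ?thesis using key[OF P, of p] by blast
  qed
  then have W: "section_of Z t ?W" using pts V(1) by (auto simp: section_of_def)
  have D: "Domain \<mu>1 \<union> (V \<union> (Domain \<mu>2 - Range \<mu>1)) = Domain \<mu>12 \<union> V"
    "Range \<mu>1 \<union> (V \<union> (Domain \<mu>2 - Range \<mu>1)) = ?W"
    "Domain \<mu>2 \<union> (V \<union> (Range \<mu>1 - Domain \<mu>2)) = ?W"
    "Range \<mu>2 \<union> (V \<union> (Range \<mu>1 - Domain \<mu>2)) = Range \<mu>12 \<union> V"
    unfolding Domain_compose Range_compose by blast+
  show "V \<union> (Domain \<mu>2 - Range \<mu>1) \<in> fills Z \<mu>1 s t"
    unfolding fills_def mem_Collect_eq D
    using V W VRD pts Domain_disjoint unfolding Domain_compose Range_compose by blast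
  show "V \<union> (Range \<mu>1 - Domain \<mu>2) \<in> fills Z \<mu>2 t u"
    unfolding fills_def mem_Collect_eq D
    using V W VRD pts Range_disjoint unfolding Domain_compose Range_compose by blast
qed

lemma fills_restrict:
  assumes "V1 \<in> fills Z \<mu>1 s t" "V2 \<in> fills Z \<mu>2 t u" "Range \<mu>1 \<union> V1 = Domain \<mu>2 \<union> V2"
  shows "V1 \<inter> V2 \<in> fills Z \<mu>12 s u" "V1 = (V1 \<inter> V2) \<union> (Domain \<mu>2 - Range \<mu>1)" "V2 = (V1 \<inter> V2) \<union> (Range \<mu>1 - Domain \<mu>2)"
proof -
  have V1: "V1 \<subseteq> points Z" "V1 \<inter> Domain \<mu>1 = {}" "V1 \<inter> Range \<mu>1 = {}" "section_of Z s (Domain \<mu>1 \<union> V1)"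
    and V2: "V2 \<subseteq> points Z" "V2 \<inter> Domain \<mu>2 = {}" "V2 \<inter> Range \<mu>2 = {}" "section_of Z u (Range \<mu>2 \<union> V2)"
    using assms(1,2) by (auto simp: fills_def)
  have el: "x \<in> Range \<mu>1 \<or> x \<in> V1 \<longleftrightarrow> x \<in> Domain \<mu>2 \<or> x \<in> V2" for x
    using eqset_imp_iff[OF assms(3), of x] by simp
  have dis: "x \<in> V1 \<Longrightarrow> x \<notin> Range \<mu>1" "x \<in> V2 \<Longrightarrow> x \<notin> Domain \<mu>2" for x using V1(3) V2(2) by blast+
  show e1: "V1 = (V1 \<inter> V2) \<union> (Domain \<mu>2 - Range \<mu>1)" 
    by (rule set_eqI) (use el dis in blast)
  show e2: "V2 = (V1 \<inter> V2) \<union> (Range \<mu>1 - Domain \<mu>2)"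
    by (rule set_eqI) (use el dis in blast)
  have "Domain \<mu>12 \<union> (V1 \<inter> V2) = Domain \<mu>1 \<union> V1" "Range \<mu>12 \<union> (V1 \<inter> V2) = Range \<mu>2 \<union> V2"
    unfolding Domain_compose Range_compose using e1 e2 by blast+
  then show "V1 \<inter> V2 \<in> fills Z \<mu>12 s u"
    unfolding fills_def mem_Collect_eq using V1 V2 unfolding Domain_compose Range_compose by auto
qed

text \<open>Matching ends would have to contain both places of the pair, whereas the middle
  idempotent allows at most one.\<close>

lemma mult_elt_mismatch:
  assumes "P \<in> pairs Z" "mismatch Z \<mu>1 \<mu>2 P"
  shows "elt Z (\<mu>1, s, t) \<odot> elt Z (\<mu>2, t, u) = 0"
proof -
  obtain p q where pq: "p \<in> plc Z P" "q \<in> plc Z P" "p \<noteq> q" "p \<in> Range \<mu>1" "q \<in> Domain \<mu>2"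
    using assms(2) unfolding mismatch_def by blast
  have "mult_strands (\<mu>1 \<union> Id_on V1) (\<mu>2 \<union> Id_on V2) = 0"
    if V: "V1 \<in> fills Z \<mu>1 s t" "V2 \<in> fills Z \<mu>2 t u" for V1 V2
  proof -
    have "Range \<mu>1 \<union> V1 \<noteq> Domain \<mu>2 \<union> V2"
    proof
      assume e: "Range \<mu>1 \<union> V1 = Domain \<mu>2 \<union> V2"
      then have "p \<in> Range \<mu>1 \<union> V1" "q \<in> Range \<mu>1 \<union> V1" using pq by blast+
      moreover have "section_of Z t (Range \<mu>1 \<union> V1)" using V by (simp add: fills_def)
      moreover obtain p' q' where "plc Z P = {p', q'}" "p' \<noteq> q'" using pair_places[OF assms(1)] .
      ultimately show False using section_bits[of t "Range \<mu>1 \<union> V1" P p' q'] assms(1) pq(1-3) by auto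
    qed
    then show ?thesis using mult_terms[OF V] by simp
  qed
  then show ?thesis
    unfolding elt_eq[OF v1(3)] elt_eq[OF v2(3)] by (simp add: mult_sum_left mult_sum_right mult_basis)
qed

lemma mult_elt:
  assumes "\<forall>P\<in>pairs Z. \<not> mismatch Z \<mu>1 \<mu>2 P"
  shows "elt Z (\<mu>1, s, t) \<odot> elt Z (\<mu>2, t, u) = elt Z (\<mu>12, s, u)"
proof -
  let ?F1 = "fills Z \<mu>1 s t" and ?F2 = "fills Z \<mu>2 t u"
  let ?A = "{(V1, V2) \<in> ?F1 \<times> ?F2. Range \<mu>1 \<union> V1 = Domain \<mu>2 \<union> V2}"
  have "elt Z (\<mu>1, s, t) \<odot> elt Z (\<mu>2, t, u) = (\<Sum>V1\<in>?F1. \<Sum>V2\<in>?F2. mult_strands (\<mu>1 \<union> Id_on V1) (\<mu>2 \<union> Id_on V2))"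
    unfolding elt_eq[OF v1(3)] elt_eq[OF v2(3)] mult_sum_left mult_sum_right mult_basis by (rule sum.swap)
  also have "\<dots> = (\<Sum>q\<in>?F1 \<times> ?F2. if q \<in> ?A then basis (\<mu>12 \<union> Id_on (fst q \<inter> snd q)) else 0)"
    unfolding sum.cartesian_product
  proof (rule sum.cong[OF refl])
    fix q assume "q \<in> ?F1 \<times> ?F2"
    then show "(case q of (V1, V2) \<Rightarrow> mult_strands (\<mu>1 \<union> Id_on V1) (\<mu>2 \<union> Id_on V2)) =
        (if q \<in> ?A then basis (\<mu>12 \<union> Id_on (fst q \<inter> snd q)) else 0)"
      using mult_terms[of "fst q" "snd q"] by (simp add: case_prod_unfold mem_Times_iff)
  qed
  also have "\<dots> = (\<Sum>q\<in>?A. basis (\<mu>12 \<union> Id_on (fst q \<inter> snd q)))"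
  proof -
    have fin: "finite (?F1 \<times> ?F2)" by (simp add: finite_fills)
    have "(?F1 \<times> ?F2) \<inter> ?A = ?A" by blast
    then show ?thesis
      using sum.inter_restrict[OF fin, of "\<lambda>q. basis (\<mu>12 \<union> Id_on (fst q \<inter> snd q))" ?A] by (simp only:)
  qed
  also have "\<dots> = (\<Sum>V\<in>fills Z \<mu>12 s u. basis (\<mu>12 \<union> Id_on V))"
  proof (rule sum.reindex_bij_betw)
    show "bij_betw (\<lambda>q. fst q \<inter> snd q) ?A (fills Z \<mu>12 s u)"
    proof (rule bij_betw_byWitness[where f' = "\<lambda>V. (V \<union> (Domain \<mu>2 - Range \<mu>1), V \<union> (Range \<mu>1 - Domain \<mu>2))"])
      show "\<forall>q\<in>?A. (fst q \<inter> snd q \<union> (Domain \<mu>2 - Range \<mu>1), fst q \<inter> snd q \<union> (Range \<mu>1 - Domain \<mu>2)) = q"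
        using fills_restrict(2,3) by auto
      show "\<forall>V\<in>fills Z \<mu>12 s u. fst (V \<union> (Domain \<mu>2 - Range \<mu>1), V \<union> (Range \<mu>1 - Domain \<mu>2)) \<inter>
          snd (V \<union> (Domain \<mu>2 - Range \<mu>1), V \<union> (Range \<mu>1 - Domain \<mu>2)) = V" by auto
      show "(\<lambda>q. fst q \<inter> snd q) ` ?A \<subseteq> fills Z \<mu>12 s u" using fills_restrict(1) by auto
      show "(\<lambda>V. (V \<union> (Domain \<mu>2 - Range \<mu>1), V \<union> (Range \<mu>1 - Domain \<mu>2))) ` fills Z \<mu>12 s u \<subseteq> ?A"
        using fills_compose assms by auto
    qed
  qed
  finally show ?thesis by (simp add: elt_eq[OF moving_compose])
qed

lemma crossing_places_compose:
  assumes "\<forall>P\<in>pairs Z. \<not> mismatch Z \<mu>1 \<mu>2 P"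
  shows "p \<in> crossing_places Z (\<mu>12, s, u) \<longleftrightarrow>
    (p \<in> crossing_places Z (\<mu>1, s, t) \<or> p \<in> crossing_places Z (\<mu>2, t, u)) \<and>
    dotted Z (\<mu>1, s, t) (pair_of Z p) \<and> dotted Z (\<mu>2, t, u) (pair_of Z p)"
proof (cases "p \<in> places Z")
  case True
  have P: "pair_of Z p \<in> pairs Z" "p \<in> plc Z (pair_of Z p)" using place_in_plc[OF True] by auto
  have "dotted Z (\<mu>12, s, u) (pair_of Z p) \<longleftrightarrow> dotted Z (\<mu>1, s, t) (pair_of Z p) \<and> dotted Z (\<mu>2, t, u) (pair_of Z p)"
    using pair_analysis(2) assms P by blast
  moreover have "p \<notin> Range \<mu>1" if "dotted Z (\<mu>1, s, t) (pair_of Z p)" using that P by (auto simp: dotted_def)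
  ultimately show ?thesis using passes_compose[of p] by (auto simp: crossing_places_def)
qed (simp add: crossing_places_def)

end

section \<open>Local analysis at a matched pair\<close>

text \<open>In the following propositional predicates, \<open>b\<close> and \<open>a\<close> tell whether the steps before and after
  a place are covered, \<open>D\<close>, \<open>R\<close> and \<open>V\<close> whether a strand starts, ends or passes there, and
  \<open>S\<close> and \<open>T\<close> whether the pair lies in the left and right idempotent.\<close>

definition diagram_bits :: "bool \<Rightarrow> bool \<Rightarrow> bool \<Rightarrow> bool \<Rightarrow> bool \<Rightarrow> bool \<Rightarrow>
    bool \<Rightarrow> bool \<Rightarrow> bool \<Rightarrow> bool \<Rightarrow> bool \<Rightarrow> bool \<Rightarrow> bool" where
  "diagram_bits b a b' a' S T D R V D' R' V' \<longleftrightarrow>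
     (b \<longleftrightarrow> R \<or> V) \<and> (a \<longleftrightarrow> D \<or> V) \<and> (V \<longrightarrow> \<not> D \<and> \<not> R) \<and>
     (b' \<longleftrightarrow> R' \<or> V') \<and> (a' \<longleftrightarrow> D' \<or> V') \<and> (V' \<longrightarrow> \<not> D' \<and> \<not> R') \<and>
     ((S \<and> T \<and> \<not> D \<and> \<not> D' \<and> \<not> R \<and> \<not> R') \<or>
      (((S \<and> (D \<longleftrightarrow> \<not> D')) \<or> (\<not> S \<and> \<not> D \<and> \<not> D')) \<and> ((T \<and> (R \<longleftrightarrow> \<not> R')) \<or> (\<not> T \<and> \<not> R \<and> \<not> R'))))"

text \<open>The additional clauses say that there is no crossing at the pair and that the H-data are
  good there.\<close>

definition tight_bits :: "bool \<Rightarrow> bool \<Rightarrow> bool \<Rightarrow> bool \<Rightarrow> bool \<Rightarrow> bool \<Rightarrow>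
    bool \<Rightarrow> bool \<Rightarrow> bool \<Rightarrow> bool \<Rightarrow> bool \<Rightarrow> bool \<Rightarrow> bool" where
  "tight_bits b a b' a' S T D R V D' R' V' \<longleftrightarrow> diagram_bits b a b' a' S T D R V D' R' V' \<and>
     \<not> (S \<and> T \<and> \<not> D \<and> \<not> D' \<and> \<not> R \<and> \<not> R' \<and> (V \<or> V')) \<and> (S \<and> T \<longrightarrow> (b \<and> a \<longleftrightarrow> b' \<and> a'))"

text \<open>A condition on the multiplicities alone, implied by \<open>tight_bits\<close>. It frees
  the verification of the Maslov grading from the bits describing strands.\<close>

definition data_bits :: "bool \<Rightarrow> bool \<Rightarrow> bool \<Rightarrow> bool \<Rightarrow> bool \<Rightarrow> bool \<Rightarrow> bool" where
  "data_bits b a b' a' S T \<longleftrightarrow>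
     (if S then if T then (b \<longleftrightarrow> a') \<and> (a \<longleftrightarrow> b')
        else (\<not> b \<and> a \<and> (b' \<longleftrightarrow> a')) \<or> (\<not> b' \<and> a' \<and> (b \<longleftrightarrow> a))
      else if T then (b \<and> \<not> a \<and> (b' \<longleftrightarrow> a')) \<or> (b' \<and> \<not> a' \<and> (b \<longleftrightarrow> a))
        else (b \<longleftrightarrow> a) \<and> (b' \<longleftrightarrow> a'))"

lemma tight_bits_intro:
  assumes "diagram_bits b a b' a' S T D R V D' R' V'"
    "\<not> ((S \<and> T \<and> \<not> D \<and> \<not> D' \<and> \<not> R \<and> \<not> R') \<and> (V \<or> V'))" "S \<and> T \<longrightarrow> (b \<and> a \<longleftrightarrow> b' \<and> a')"
  shows "tight_bits b a b' a' S T D R V D' R' V'"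
  using assms unfolding tight_bits_def by argo

lemma tight_bits_data: "tight_bits b a b' a' S T D R V D' R' V' \<Longrightarrow> data_bits b a b' a' S T"
  unfolding tight_bits_def diagram_bits_def data_bits_def by argo

definition disjoint3 :: "bool \<Rightarrow> bool \<Rightarrow> bool \<Rightarrow> bool" where
  "disjoint3 x y z \<longleftrightarrow> \<not> (x \<and> y) \<and> \<not> (x \<and> z) \<and> \<not> (y \<and> z)"

context
  fixes b1 a1 b1' a1' b2 a2 b2' a2' b3 a3 b3' a3' S1 T1 T2 T3 D1 R1 V1 D1' R1' V1' D2 R2 V2 D2' R2' V2'
    D3 R3 V3 D3' R3' V3' :: bool
  assumes t: "tight_bits b1 a1 b1' a1' S1 T1 D1 R1 V1 D1' R1' V1'"
    "tight_bits b2 a2 b2' a2' T1 T2 D2 R2 V2 D2' R2' V2'"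
    "tight_bits b3 a3 b3' a3' T2 T3 D3 R3 V3 D3' R3' V3'"
  and dis: "disjoint3 b1 b2 b3" "disjoint3 a1 a2 a3" "disjoint3 b1' b2' b3'" "disjoint3 a1' a2' a3'"
begin

text \<open>The first assumption says that the total H-data admit some diagram at the pair, which
  need not be a product; this is what separates critical from singular.\<close>

lemma mismatch_12:
  assumes "diagram_bits (b1 \<or> b2 \<or> b3) (a1 \<or> a2 \<or> a3) (b1' \<or> b2' \<or> b3') (a1' \<or> a2' \<or> a3') S1 T3 D R V D' R' V'"
    "R1" "D2'"
  shows "\<not> S1 \<and> T1 \<and> \<not> T2 \<and> T3 \<and> b1 \<and> a2' \<and> b3'"
  using t dis assms unfolding tight_bits_def diagram_bits_def disjoint3_def by argo

text \<open>The disjunction \<open>R2 \<or> (R1 \<and> \<not> D2)\<close> describes the targets of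
  the composite of the first two factors, which is formed only if these have no mismatch.\<close>

lemma mismatch_123:
  assumes "diagram_bits (b1 \<or> b2 \<or> b3) (a1 \<or> a2 \<or> a3) (b1' \<or> b2' \<or> b3') (a1' \<or> a2' \<or> a3') S1 T3 D R V D' R' V'"
    "R2 \<or> (R1 \<and> \<not> D2)" "D3'" "\<not> (R1 \<and> D2')" "\<not> (R1' \<and> D2)"
  shows "S1 \<and> \<not> T1 \<and> T2 \<and> \<not> T3 \<and> a1 \<and> b2 \<and> a3'"
  using t dis assms unfolding tight_bits_def diagram_bits_def disjoint3_def by argo

lemma pattern_mismatch_12: "\<not> S1 \<and> T1 \<and> \<not> T2 \<and> T3 \<and> b1 \<and> a2' \<and> b3' \<Longrightarrow> R1 \<and> D2'"
  using t dis unfolding tight_bits_def diagram_bits_def disjoint3_def by argo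

lemma pattern_mismatch_23: "S1 \<and> \<not> T1 \<and> T2 \<and> \<not> T3 \<and> a1 \<and> b2 \<and> a3' \<Longrightarrow> R2 \<and> D3'"
  using t dis unfolding tight_bits_def diagram_bits_def disjoint3_def by argo

end

text \<open>Twice the contribution \<open>m(h, S)\<close> of a pair to the Maslov grading of a tight diagram.\<close>

definition mass_bits :: "bool \<Rightarrow> bool \<Rightarrow> bool \<Rightarrow> bool \<Rightarrow> bool \<Rightarrow> bool \<Rightarrow> int" where
  "mass_bits b a b' a' S T = (if S then if T then (if b then 1 else 0) + (if a then 1 else 0) else 1 else 0)"

lemma tight_bits_mass:
  assumes "tight_bits b a b' a' S T D R V D' R' V'"
  shows "of_bool D * (of_bool b + of_bool a) + of_bool D' * (of_bool b' + of_bool a') = mass_bits b a b' a' S T"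
  using assms unfolding tight_bits_def diagram_bits_def mass_bits_def
  by (cases S; cases T; cases D; cases D'; cases R; cases R'; simp)

text \<open>Twice the contribution of one place to the pairing of one homology class with the
  boundary of another: the first bracket is the boundary coefficient, the second is twice the
  average multiplicity.\<close>

definition pairing_bits :: "bool \<Rightarrow> bool \<Rightarrow> bool \<Rightarrow> bool \<Rightarrow> int" where
  "pairing_bits b1 a1 b2 a2 = (of_bool b1 - of_bool a1) * (of_bool b2 + of_bool a2)"

text \<open>The two ways, mirror images of each other, in which a product of three tight diagrams can be critical at
  a pair. In the first one the second factor ends at a place and the third starts at the other; in the second one
  this happens to the first two factors.\<close>

definition pattern_bits where
  "pattern_bits b1 a1 b1' a1' b2 a2 b2' a2' b3 a3 b3' a3' S1 T1 T2 T3 \<longleftrightarrow>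
     (S1 \<and> \<not> T1 \<and> T2 \<and> \<not> T3 \<and> (a1 \<and> b2 \<and> a3' \<or> a1' \<and> b2' \<and> a3)) \<or>
     (\<not> S1 \<and> T1 \<and> \<not> T2 \<and> T3 \<and> (b1 \<and> a2' \<and> b3' \<or> b1' \<and> a2 \<and> b3))"

text \<open>A finite verification over the idempotents and the multiplicities. All averages are
  doubled to stay within the integers, so the value -2 stands for one unit of the Maslov
  grading.\<close>

lemma maslov_defect:
  assumes "data_bits b1 a1 b1' a1' S1 T1" "data_bits b2 a2 b2' a2' T1 T2" "data_bits b3 a3 b3' a3' T2 T3"
    "data_bits (b1 \<or> b2 \<or> b3) (a1 \<or> a2 \<or> a3) (b1' \<or> b2' \<or> b3') (a1' \<or> a2' \<or> a3') S1 T3"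
    "disjoint3 b1 b2 b3" "disjoint3 a1 a2 a3" "disjoint3 b1' b2' b3'" "disjoint3 a1' a2' a3'"
  shows "mass_bits (b1 \<or> b2 \<or> b3) (a1 \<or> a2 \<or> a3) (b1' \<or> b2' \<or> b3') (a1' \<or> a2' \<or> a3') S1 T3
     - (mass_bits b1 a1 b1' a1' S1 T1 + mass_bits b2 a2 b2' a2' T1 T2 + mass_bits b3 a3 b3' a3' T2 T3)
     + (pairing_bits b1 a1 b2 a2 + pairing_bits b1' a1' b2' a2' + (pairing_bits b1 a1 b3 a3 + pairing_bits b1' a1' b3' a3')
        + (pairing_bits b2 a2 b3 a3 + pairing_bits b2' a2' b3' a3'))
   = - 2 * of_bool (pattern_bits b1 a1 b1' a1' b2 a2 b2' a2' b3 a3 b3' a3' S1 T1 T2 T3)"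
  using assms
  by (cases S1; cases T1; cases T2; cases T3; simp add: data_bits_def)
    ((cases b1; cases a1; cases b1'; cases a1'; simp add: disjoint3_def; cases b2; cases a2; cases b2'; cases a2'; simp;
     cases b3; cases a3; cases b3'; cases a3'; simp add: mass_bits_def pairing_bits_def pattern_bits_def)+)

text \<open>Criticality at a pair, in terms of H-data only, so that it is visibly independent of
  representatives. The order in which the two places are named is irrelevant by
  \<open>pattern_bits_sym\<close>.\<close>

definition pattern_at :: "('i, 'l) arc_diag \<Rightarrow> 'i h1 \<Rightarrow> 'i h1 \<Rightarrow> 'i h1 \<Rightarrow> 'l set \<Rightarrow> 'l set \<Rightarrow> 'l set \<Rightarrow> 'l set \<Rightarrow> 'l \<Rightarrow> bool" where
  "pattern_at Z h1 h2 h3 s1 t1 t2 t3 P \<longleftrightarrow> (\<exists>p q. plc Z P = {p, q} \<and> p \<noteq> q \<and>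
     pattern_bits (before h1 p = 1) (h1 p = 1) (before h1 q = 1) (h1 q = 1)
       (before h2 p = 1) (h2 p = 1) (before h2 q = 1) (h2 q = 1)
       (before h3 p = 1) (h3 p = 1) (before h3 q = 1) (h3 q = 1) (P \<in> s1) (P \<in> t1) (P \<in> t2) (P \<in> t3))"

lemma pattern_bits_sym:
  "pattern_bits b1 a1 b1' a1' b2 a2 b2' a2' b3 a3 b3' a3' S1 T1 T2 T3 \<longleftrightarrow>
   pattern_bits b1' a1' b1 a1 b2' a2' b2 a2 b3' a3' b3 a3 S1 T1 T2 T3"
  unfolding pattern_bits_def by argo

lemma pattern_at_iff:
  assumes "plc Z P = {p, q}" "p \<noteq> q"
  shows "pattern_at Z h1 h2 h3 s1 t1 t2 t3 P \<longleftrightarrow>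
     pattern_bits (before h1 p = 1) (h1 p = 1) (before h1 q = 1) (h1 q = 1)
       (before h2 p = 1) (h2 p = 1) (before h2 q = 1) (h2 q = 1)
       (before h3 p = 1) (h3 p = 1) (before h3 q = 1) (h3 q = 1) (P \<in> s1) (P \<in> t1) (P \<in> t2) (P \<in> t3)"
    (is "_ \<longleftrightarrow> ?B p q")
proof
  assume "pattern_at Z h1 h2 h3 s1 t1 t2 t3 P"
  then obtain p' q' where *: "plc Z P = {p', q'}" "p' \<noteq> q'" "?B p' q'" unfolding pattern_at_def by blast
  then have "(p' = p \<and> q' = q) \<or> (p' = q \<and> q' = p)" using assms by (metis doubleton_eq_iff)
  then show "?B p q" using *(3) pattern_bits_sym by metis
qed (use assms in \<open>unfold pattern_at_def, blast\<close>)

context arc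
begin

lemma place_steps: "p \<in> places Z \<Longrightarrow> p \<in> steps Z \<and> (fst p, snd p - 1) \<in> steps Z"
  by (auto simp: places_def steps_def)

lemma tightD:
  assumes "tight Z (\<mu>, s, t)"
  shows "viable_diagram \<mu> s t" "crossing_places Z (\<mu>, s, t) = {}" "good Z (h_grading \<mu>, s, t)"
  using assms tight_iff by auto

lemma diagram_bitsI:
  assumes "viable_diagram \<mu> s t" "P \<in> pairs Z" "plc Z P = {p, q}" "p \<noteq> q"
  defines "h \<equiv> h_grading \<mu>"
  shows "diagram_bits (before h p = 1) (h p = 1) (before h q = 1) (h q = 1) (P \<in> s) (P \<in> t)
    (p \<in> Domain \<mu>) (p \<in> Range \<mu>) (passes \<mu> p) (q \<in> Domain \<mu>) (q \<in> Range \<mu>) (passes \<mu> q)"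
proof -
  note v = viable_diagramD[OF assms(1)]
  have "p \<in> places Z" "q \<in> places Z" using assms(3) by (auto simp: plc_def)
  note b = local_bits[OF v(2) place_snd[OF this(1)], folded h_def] and b' = local_bits[OF v(2) place_snd[OF this(2)], folded h_def]
  have c: "compat Z (\<mu>, s, t) P" by (rule v(7)[OF assms(2)])
  show ?thesis
    unfolding diagram_bits_def
    by (intro conjI impI b(1,3) b'(1,3) b(5,6) b'(5,6) c[unfolded compat_bits[OF assms(3,4)]])
qed

lemma tight_bitsI:
  assumes "tight Z (\<mu>, s, t)" "P \<in> pairs Z" "plc Z P = {p, q}" "p \<noteq> q"
  defines "h \<equiv> h_grading \<mu>"
  shows "tight_bits (before h p = 1) (h p = 1) (before h q = 1) (h q = 1) (P \<in> s) (P \<in> t)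
    (p \<in> Domain \<mu>) (p \<in> Range \<mu>) (passes \<mu> p) (q \<in> Domain \<mu>) (q \<in> Range \<mu>) (passes \<mu> q)"
proof -
  note td = tightD[OF assms(1)]
  have pl: "p \<in> places Z" "q \<in> places Z" "pair_of Z p = P" "pair_of Z q = P" using assms(3) by (auto simp: plc_def)
  have c: "\<not> (dotted Z (\<mu>, s, t) P \<and> (passes \<mu> p \<or> passes \<mu> q))"
  proof
    assume "dotted Z (\<mu>, s, t) P \<and> (passes \<mu> p \<or> passes \<mu> q)"
    then have "p \<in> crossing_places Z (\<mu>, s, t) \<or> q \<in> crossing_places Z (\<mu>, s, t)"
      using pl by (simp add: crossing_places_def)
    then show False using td(2) by blast
  qed
  have g: "P \<in> s \<and> P \<in> t \<longrightarrow> (through h p \<longleftrightarrow> through h q)"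
    using td(3) assms(2,3) unfolding good_def h_def by auto
  show ?thesis
    using tight_bits_intro[OF diagram_bitsI[OF td(1) assms(2-4)]] c g
    unfolding dotted_bits[OF assms(3)] through_def h_def by blast
qed

lemma viable_value: "viable_diagram \<mu> s t \<Longrightarrow> e \<in> steps Z \<Longrightarrow> h_grading \<mu> e = of_bool (h_grading \<mu> e = 1)"
  by (auto simp: viable_diagram_def viable_h_def)

end

section \<open>Products of three tight diagrams\<close>

locale tight_triple = arc Z for Z :: "('i, 'l) arc_diag" +
  fixes \<mu>1 \<mu>2 \<mu>3 :: "'i strands" and s1 t1 t2 t3 :: "'l set"
  assumes tight1: "tight Z (\<mu>1, s1, t1)" and tight2: "tight Z (\<mu>2, t1, t2)" and tight3: "tight Z (\<mu>3, t2, t3)"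
    and viable_sum3: "viable_h Z (\<lambda>e. h_grading \<mu>1 e + h_grading \<mu>2 e + h_grading \<mu>3 e)"
begin

abbreviation "h1 \<equiv> h_grading \<mu>1"
abbreviation "h2 \<equiv> h_grading \<mu>2"
abbreviation "h3 \<equiv> h_grading \<mu>3"
abbreviation "h123 \<equiv> (\<lambda>e. h1 e + h2 e + h3 e)"
abbreviation "pattern \<equiv> pattern_at Z h1 h2 h3 s1 t1 t2 t3"

lemma step_values:
  assumes "e \<in> steps Z"
  shows "h1 e = of_bool (h1 e = 1)" "h2 e = of_bool (h2 e = 1)" "h3 e = of_bool (h3 e = 1)"
    "disjoint3 (h1 e = 1) (h2 e = 1) (h3 e = 1)" "h123 e = 1 \<longleftrightarrow> h1 e = 1 \<or> h2 e = 1 \<or> h3 e = 1"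
    "h123 e = of_bool (h1 e = 1 \<or> h2 e = 1 \<or> h3 e = 1)"
proof -
  show v: "h1 e = of_bool (h1 e = 1)" "h2 e = of_bool (h2 e = 1)" "h3 e = of_bool (h3 e = 1)"
    using viable_value assms tightD(1) tight1 tight2 tight3 by blast+
  have "h123 e = 0 \<or> h123 e = 1" using viable_sum3 assms by (simp add: viable_h_def)
  then show "disjoint3 (h1 e = 1) (h2 e = 1) (h3 e = 1)" "h123 e = 1 \<longleftrightarrow> h1 e = 1 \<or> h2 e = 1 \<or> h3 e = 1"
    "h123 e = of_bool (h1 e = 1 \<or> h2 e = 1 \<or> h3 e = 1)"
    using v unfolding disjoint3_def by (auto simp: of_bool_def split: if_splits)
qed

lemma before_values:
  assumes "p \<in> places Z"
  shows "disjoint3 (before h1 p = 1) (before h2 p = 1) (before h3 p = 1)" "disjoint3 (h1 p = 1) (h2 p = 1) (h3 p = 1)"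
    "before h123 p = 1 \<longleftrightarrow> before h1 p = 1 \<or> before h2 p = 1 \<or> before h3 p = 1"
    "h123 p = 1 \<longleftrightarrow> h1 p = 1 \<or> h2 p = 1 \<or> h3 p = 1"
  using step_values(4,5) place_steps[OF assms] unfolding before_def by blast+

lemma pair_sum_viable:
  "viable_h Z (\<lambda>e. h1 e + h2 e)" "viable_h Z (\<lambda>e. h2 e + h3 e)"
  unfolding viable_h_def
proof safe
  fix e assume e: "e \<in> steps Z"
  note v = step_values[OF e]
  show "h1 e + h2 e = 0" if "h1 e + h2 e \<noteq> 1" using v(1,2,4) that by (auto simp: disjoint3_def of_bool_def split: if_splits)
  show "h2 e + h3 e = 0" if "h2 e + h3 e \<noteq> 1" using v(2,3,4) that by (auto simp: disjoint3_def of_bool_def split: if_splits)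
qed

sublocale c12: composable Z \<mu>1 \<mu>2 s1 t1 t2
  by unfold_locales (use tightD(1) tight1 tight2 pair_sum_viable in auto)

sublocale c23: composable Z \<mu>2 \<mu>3 t1 t2 t3
  by unfold_locales (use tightD(1) tight2 tight3 pair_sum_viable in auto)

abbreviation "\<mu>12 \<equiv> compose \<mu>1 \<mu>2"
abbreviation "\<mu>123 \<equiv> compose \<mu>12 \<mu>3"

lemma composable_123:
  assumes "viable_diagram \<mu>12 s1 t2"
  shows "composable Z \<mu>12 \<mu>3 s1 t2 t3"
  by unfold_locales (use assms tightD(1)[OF tight3] viable_sum3 in \<open>simp_all add: c12.h_grading_compose\<close>)

context
  fixes P p q
  assumes P: "P \<in> pairs Z" and pq: "plc Z P = {p, q}" "p \<noteq> q"
begin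

lemma pl: "p \<in> places Z" "q \<in> places Z"
  using pq by (auto simp: plc_def)

lemmas tb = tight_bitsI[OF tight1 P pq] tight_bitsI[OF tight2 P pq] tight_bitsI[OF tight3 P pq]

lemmas dj = before_values(1,2)[OF pl(1)] before_values(1,2)[OF pl(2)]

lemma total_bits:
  assumes "viable_diagram \<mu> s1 t3" "h_grading \<mu> = h123"
  shows "diagram_bits (before h1 p = 1 \<or> before h2 p = 1 \<or> before h3 p = 1) (h1 p = 1 \<or> h2 p = 1 \<or> h3 p = 1)
      (before h1 q = 1 \<or> before h2 q = 1 \<or> before h3 q = 1) (h1 q = 1 \<or> h2 q = 1 \<or> h3 q = 1) (P \<in> s1) (P \<in> t3)
    (p \<in> Domain \<mu>) (p \<in> Range \<mu>) (passes \<mu> p) (q \<in> Domain \<mu>) (q \<in> Range \<mu>) (passes \<mu> q)"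
  using diagram_bitsI[OF assms(1) P pq] unfolding assms(2) before_values(3,4)[OF pl(1)] before_values(3,4)[OF pl(2)] .

lemma mismatch_12_pattern:
  assumes "viable_diagram \<mu> s1 t3" "h_grading \<mu> = h123" "p \<in> Range \<mu>1" "q \<in> Domain \<mu>2"
  shows "pattern P"
  unfolding pattern_at_iff[OF pq] pattern_bits_def
  using mismatch_12[OF tb dj total_bits[OF assms(1,2)] assms(3,4)] by blast

lemma mismatch_123_pattern:
  assumes "viable_diagram \<mu> s1 t3" "h_grading \<mu> = h123" "p \<in> Range \<mu>12" "q \<in> Domain \<mu>3" "\<not> mismatch Z \<mu>1 \<mu>2 P"
  shows "pattern P"
proof -
  have "p \<in> Range \<mu>2 \<or> (p \<in> Range \<mu>1 \<and> p \<notin> Domain \<mu>2)" using assms(3) unfolding c12.Range_compose by blast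
  moreover have "\<not> (p \<in> Range \<mu>1 \<and> q \<in> Domain \<mu>2)" "\<not> (q \<in> Range \<mu>1 \<and> p \<in> Domain \<mu>2)"
    using assms(5) unfolding mismatch_bits[OF pq] by auto
  ultimately show ?thesis
    unfolding pattern_at_iff[OF pq] pattern_bits_def
    using mismatch_123[OF tb dj total_bits[OF assms(1,2)] _ assms(4)] by blast
qed

end

text \<open>Recovers the strands that obstruct the product from the multiplicities. The two namings
  of the places are merged, which leaves one case for each of the mirror images.\<close>

lemma pattern_cases:
  assumes "P \<in> pairs Z" "pattern P"
  obtains (A) p q where "plc Z P = {p, q}" "p \<noteq> q" "p \<in> Range \<mu>2" "q \<in> Domain \<mu>3"
      "P \<in> s1" "P \<notin> t1" "P \<in> t2" "P \<notin> t3" "h1 p = 1" "before h2 p = 1" "h3 q = 1"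
    | (B) p q where "plc Z P = {p, q}" "p \<noteq> q" "p \<in> Range \<mu>1" "q \<in> Domain \<mu>2"
      "P \<notin> s1" "P \<in> t1" "P \<notin> t2" "P \<in> t3" "before h1 p = 1" "h2 q = 1" "before h3 q = 1"
proof -
  obtain p q where pq: "plc Z P = {p, q}" "p \<noteq> q" using pair_places[OF assms(1)] .
  have qp: "plc Z P = {q, p}" "q \<noteq> p" using pq by auto
  have pl: "p \<in> places Z" "q \<in> places Z" using pq by (auto simp: plc_def)
  note tb = tight_bitsI[OF tight1 assms(1) pq] tight_bitsI[OF tight2 assms(1) pq] tight_bitsI[OF tight3 assms(1) pq]
  note tb' = tight_bitsI[OF tight1 assms(1) qp] tight_bitsI[OF tight2 assms(1) qp] tight_bitsI[OF tight3 assms(1) qp]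
  note dj = before_values(1,2)[OF pl(1)] before_values(1,2)[OF pl(2)]
  note dj' = before_values(1,2)[OF pl(2)] before_values(1,2)[OF pl(1)]
  from assms(2) consider
      "P \<in> s1 \<and> P \<notin> t1 \<and> P \<in> t2 \<and> P \<notin> t3 \<and> h1 p = 1 \<and> before h2 p = 1 \<and> h3 q = 1"
    | "P \<in> s1 \<and> P \<notin> t1 \<and> P \<in> t2 \<and> P \<notin> t3 \<and> h1 q = 1 \<and> before h2 q = 1 \<and> h3 p = 1"
    | "P \<notin> s1 \<and> P \<in> t1 \<and> P \<notin> t2 \<and> P \<in> t3 \<and> before h1 p = 1 \<and> h2 q = 1 \<and> before h3 q = 1"
    | "P \<notin> s1 \<and> P \<in> t1 \<and> P \<notin> t2 \<and> P \<in> t3 \<and> before h1 q = 1 \<and> h2 p = 1 \<and> before h3 p = 1"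
    unfolding pattern_at_iff[OF pq] pattern_bits_def by blast
  then show ?thesis
  proof cases
    case 1
    then show ?thesis using A[OF pq] pattern_mismatch_23[OF tb dj 1] by blast
  next
    case 2
    then show ?thesis using A[OF qp] pattern_mismatch_23[OF tb' dj' 2] by blast
  next
    case 3
    then show ?thesis using B[OF pq] pattern_mismatch_12[OF tb dj 3] by blast
  next
    case 4
    then show ?thesis using B[OF qp] pattern_mismatch_12[OF tb' dj' 4] by blast
  qed
qed

lemma prod_elts3: "prod_elts Z [(\<mu>1, s1, t1), (\<mu>2, t1, t2), (\<mu>3, t2, t3)] =
    elt Z (\<mu>1, s1, t1) \<odot> elt Z (\<mu>2, t1, t2) \<odot> elt Z (\<mu>3, t2, t3)"
  by (simp add: prod_elts_def)

text \<open>In case \<open>B\<close> the first two factors already have a mismatch. In case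
  \<open>A\<close> the strand of the second factor which ends at \<open>p\<close> keeps its target
  in the composite and is mismatched with the third factor.\<close>

lemma pattern_prod:
  assumes "P \<in> pairs Z" "pattern P"
  shows "elt Z (\<mu>1, s1, t1) \<odot> elt Z (\<mu>2, t1, t2) \<odot> elt Z (\<mu>3, t2, t3) = 0"
proof (cases "\<exists>Q\<in>pairs Z. mismatch Z \<mu>1 \<mu>2 Q")
  case True
  then show ?thesis using c12.mult_elt_mismatch by force
next
  case False
  then have n: "\<forall>Q\<in>pairs Z. \<not> mismatch Z \<mu>1 \<mu>2 Q" by blast
  interpret c: composable Z \<mu>12 \<mu>3 s1 t2 t3 by (rule composable_123[OF c12.diagram_compose[OF n]])
  from assms have "mismatch Z \<mu>12 \<mu>3 P"
  proof (cases rule: pattern_cases)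
    case (A p q)
    then show ?thesis unfolding mismatch_bits[OF A(1,2)] c12.Range_compose by blast
  next
    case (B p q)
    then show ?thesis using bspec[OF n assms(1)] mismatch_bits[OF B(1,2)] by blast
  qed
  then show ?thesis unfolding c12.mult_elt[OF n] by (rule c.mult_elt_mismatch[OF assms(1)])
qed

text \<open>A mismatch at either multiplication would be a pattern, since some diagram has the total
  H-data. Crossings of a composite come from crossings of the factors, so none can appear.\<close>

lemma no_pattern_prod:
  assumes "\<And>P. P \<in> pairs Z \<Longrightarrow> \<not> pattern P" "viable_diagram \<mu> s1 t3" "h_grading \<mu> = h123"
  shows "elt Z (\<mu>1, s1, t1) \<odot> elt Z (\<mu>2, t1, t2) \<odot> elt Z (\<mu>3, t2, t3) = elt Z (\<mu>123, s1, t3)"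
    "viable_diagram \<mu>123 s1 t3" "h_grading \<mu>123 = h123" "crossing_places Z (\<mu>123, s1, t3) = {}"
proof -
  have n0: "\<not> mismatch Z \<mu>1 \<mu>2 Q" if Q: "Q \<in> pairs Z" for Q
  proof
    assume "mismatch Z \<mu>1 \<mu>2 Q"
    then obtain p q where p: "p \<in> plc Z Q" "q \<in> plc Z Q" "p \<noteq> q" "p \<in> Range \<mu>1" "q \<in> Domain \<mu>2" unfolding mismatch_def by blast
    obtain q' where "plc Z Q = {p, q'}" using plc_obtain[OF Q p(1)] by blast
    then have "plc Z Q = {p, q}" using p by auto
    then show False using mismatch_12_pattern[OF Q _ p(3) assms(2,3) p(4,5)] assms(1)[OF Q] by blast
  qed
  then have n: "\<forall>Q\<in>pairs Z. \<not> mismatch Z \<mu>1 \<mu>2 Q" by blast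
  interpret c: composable Z \<mu>12 \<mu>3 s1 t2 t3 by (rule composable_123[OF c12.diagram_compose[OF n]])
  have "\<not> mismatch Z \<mu>12 \<mu>3 Q" if Q: "Q \<in> pairs Z" for Q
  proof
    assume "mismatch Z \<mu>12 \<mu>3 Q"
    then obtain p q where p: "p \<in> plc Z Q" "q \<in> plc Z Q" "p \<noteq> q" "p \<in> Range \<mu>12" "q \<in> Domain \<mu>3" unfolding mismatch_def by blast
    obtain q' where "plc Z Q = {p, q'}" using plc_obtain[OF Q p(1)] by blast
    then have "plc Z Q = {p, q}" using p by auto
    then show False using mismatch_123_pattern[OF Q _ p(3) assms(2,3) p(4,5) n0[OF Q]] assms(1)[OF Q] by blast
  qed
  then have n': "\<forall>Q\<in>pairs Z. \<not> mismatch Z \<mu>12 \<mu>3 Q" by blast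
  show "elt Z (\<mu>1, s1, t1) \<odot> elt Z (\<mu>2, t1, t2) \<odot> elt Z (\<mu>3, t2, t3) = elt Z (\<mu>123, s1, t3)"
    unfolding c12.mult_elt[OF n] c.mult_elt[OF n'] ..
  show "viable_diagram \<mu>123 s1 t3" by (rule c.diagram_compose[OF n'])
  show "h_grading \<mu>123 = h123" unfolding c.h_grading_compose c12.h_grading_compose ..
  have "crossing_places Z (\<mu>12, s1, t2) = {}"
    using c12.crossing_places_compose[OF n] tightD(2)[OF tight1] tightD(2)[OF tight2] by blast
  then show "crossing_places Z (\<mu>123, s1, t3) = {}"
    using c.crossing_places_compose[OF n'] tightD(2)[OF tight3] by blast
qed

end

context arc
begin

section \<open>Tight representatives and tensor products\<close>

lemma tight_class:
  assumes "tight Z D"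
  shows "hclass Z (elt Z D) \<in> homology_at Z (hdata_of D)" "hclass Z (elt Z D) \<noteq> hzero Z"
proof -
  obtain \<mu> s t where D: "D = (\<mu>, s, t)" by (cases D)
  note td = tightD[OF assms[unfolded D]]
  show "hclass Z (elt Z D) \<in> homology_at Z (hdata_of D)"
    unfolding D hdata_of_def homology_at_def prod.case
    using elt_cycle(2)[OF td(1,2)] elt_alg_at[OF viable_diagramD(1)[OF td(1)]] by blast
  show "hclass Z (elt Z D) \<noteq> hzero Z" using assms by (simp add: tight_def)
qed

lemma tight_class_data:
  assumes "tight Z (\<mu>, s, t)" "tight Z D" "hclass Z (elt Z D) = hclass Z (elt Z (\<mu>, s, t))"
  shows "\<exists>\<mu>'. D = (\<mu>', s, t) \<and> h_grading \<mu>' = h_grading \<mu>"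
proof -
  have "hdata_of D = hdata_of (\<mu>, s, t)"
    using homology_at_unique tight_class assms by metis
  then show ?thesis by (cases D) (simp add: hdata_of_def)
qed

lemma tight_reps3:
  assumes "tight_reps Z Ds [M1, M2, M3]"
  obtains D1 D2 D3 where "Ds = [D1, D2, D3]" "tight Z D1" "tight Z D2" "tight Z D3"
    "hclass Z (elt Z D1) = M1" "hclass Z (elt Z D2) = M2" "hclass Z (elt Z D3) = M3"
  using assms unfolding tight_reps_def list_all2_Cons2 by auto

lemma tensor_hdata3: "tensor_hdata [(h1, s1, t1), (h2, s2, t2), (h3, s3, t3)] = ((\<lambda>e. h1 e + h2 e + h3 e), s1, t3)"
  by (simp add: tensor_hdata_def add.assoc)

text \<open>The H-data of a nonzero class are unique, so those supplied by the definition must be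
  the H-data of the given representatives.\<close>

lemma viable_tensor3_iff:
  assumes "tight Z (\<mu>1, s1, t1)" "tight Z (\<mu>2, s2, t2)" "tight Z (\<mu>3, s3, t3)"
  shows "viable_tensor Z [hclass Z (elt Z (\<mu>1, s1, t1)), hclass Z (elt Z (\<mu>2, s2, t2)), hclass Z (elt Z (\<mu>3, s3, t3))] \<longleftrightarrow>
    t1 = s2 \<and> t2 = s3 \<and> viable_h Z (\<lambda>e. h_grading \<mu>1 e + h_grading \<mu>2 e + h_grading \<mu>3 e)"
    (is "viable_tensor Z [?M1, ?M2, ?M3] \<longleftrightarrow> ?R")
proof -
  let ?d1 = "(h_grading \<mu>1, s1, t1)" and ?d2 = "(h_grading \<mu>2, s2, t2)" and ?d3 = "(h_grading \<mu>3, s3, t3)"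
  have c: "?M1 \<in> homology_at Z ?d1" "?M2 \<in> homology_at Z ?d2" "?M3 \<in> homology_at Z ?d3"
    "?M1 \<noteq> hzero Z" "?M2 \<noteq> hzero Z" "?M3 \<noteq> hzero Z"
    using tight_class[OF assms(1)] tight_class[OF assms(2)] tight_class[OF assms(3)] by (auto simp: hdata_of_def)
  have chain: "(\<forall>i. Suc i < length [?d1, ?d2, ?d3] \<longrightarrow> snd (snd ([?d1, ?d2, ?d3] ! i)) = fst (snd ([?d1, ?d2, ?d3] ! Suc i))) \<longleftrightarrow> t1 = s2 \<and> t2 = s3"
    by (auto simp: less_Suc_eq all_conj_distrib)
  show ?thesis
  proof
    assume "viable_tensor Z [?M1, ?M2, ?M3]"
    then obtain ds where ds: "list_all2 (\<lambda>M d. M \<in> homology_at Z d \<and> M \<noteq> hzero Z) [?M1, ?M2, ?M3] ds"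
       "\<forall>i. Suc i < length ds \<longrightarrow> snd (snd (ds ! i)) = fst (snd (ds ! Suc i))"
       "viable_h Z (fst (tensor_hdata ds))" unfolding viable_tensor_def by blast
    from ds(1) obtain d1 d2 d3 where d: "ds = [d1, d2, d3]" "?M1 \<in> homology_at Z d1" "?M2 \<in> homology_at Z d2" "?M3 \<in> homology_at Z d3"
      unfolding list_all2_Cons1 list_all2_Nil by blast
    have "ds = [?d1, ?d2, ?d3]"
      using homology_at_unique[OF c(1) d(2) c(4)] homology_at_unique[OF c(2) d(3) c(5)] homology_at_unique[OF c(3) d(4) c(6)] d(1) by simp
    then show ?R using ds(2,3) chain by (simp add: tensor_hdata3)
  next
    assume ?R
    then show "viable_tensor Z [?M1, ?M2, ?M3]"
      unfolding viable_tensor_def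
      by (intro exI[of _ "[?d1, ?d2, ?d3]"]) (use c chain in \<open>simp add: tensor_hdata3\<close>)
  qed
qed

lemma alg_at_nonzero:
  assumes "viable_h Z h"
  shows "alg_at Z (h, s, t) \<noteq> {0} \<longleftrightarrow> (\<exists>\<mu>. viable_diagram \<mu> s t \<and> h_grading \<mu> = h)"
proof
  assume "alg_at Z (h, s, t) \<noteq> {0}"
  then obtain x where x: "x \<in> alg_at Z (h, s, t)" "x \<noteq> 0" using alg_at_0 by blast
  from alg_at_viableE[OF x(1) assms] obtain F where "\<And>\<mu>. \<mu> \<in> F \<Longrightarrow> viable_diagram \<mu> s t" "\<And>\<mu>. \<mu> \<in> F \<Longrightarrow> h_grading \<mu> = h"
     "x = (\<Sum>\<mu>\<in>F. elt Z (\<mu>, s, t))" by metis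
  then show "\<exists>\<mu>. viable_diagram \<mu> s t \<and> h_grading \<mu> = h" using x(2) by (metis sum.empty ex_in_conv)
next
  assume "\<exists>\<mu>. viable_diagram \<mu> s t \<and> h_grading \<mu> = h"
  then obtain \<mu> where m: "viable_diagram \<mu> s t" "h_grading \<mu> = h" by blast
  then have "elt Z (\<mu>, s, t) \<in> alg_at Z (h, s, t)" "elt Z (\<mu>, s, t) \<noteq> 0"
    using elt_alg_at[OF viable_diagramD(1)[OF m(1)]] by (auto simp: viable_diagram_def diagram_def)
  then show "alg_at Z (h, s, t) \<noteq> {0}" by blast
qed

end

context tight_triple
begin

abbreviation "M1 \<equiv> hclass Z (elt Z (\<mu>1, s1, t1))"
abbreviation "M2 \<equiv> hclass Z (elt Z (\<mu>2, t1, t2))"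
abbreviation "M3 \<equiv> hclass Z (elt Z (\<mu>3, t2, t3))"

text \<open>Any other tight representatives again form a tight triple with the same H-data. Results
  phrased with patterns therefore transfer to whatever representatives the definitions of tightness
  provide.\<close>

lemma other_reps:
  assumes "tight_reps Z Ds [M1, M2, M3]"
  obtains \<nu>1 \<nu>2 \<nu>3 where "Ds = [(\<nu>1, s1, t1), (\<nu>2, t1, t2), (\<nu>3, t2, t3)]"
    "tight_triple Z \<nu>1 \<nu>2 \<nu>3 s1 t1 t2 t3" "h_grading \<nu>1 = h1" "h_grading \<nu>2 = h2" "h_grading \<nu>3 = h3"
proof -
  obtain D1 D2 D3 where D: "Ds = [D1, D2, D3]" "tight Z D1" "tight Z D2" "tight Z D3"
    "hclass Z (elt Z D1) = M1" "hclass Z (elt Z D2) = M2" "hclass Z (elt Z D3) = M3" using tight_reps3[OF assms] .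
  obtain \<nu>1 \<nu>2 \<nu>3 where n: "D1 = (\<nu>1, s1, t1)" "h_grading \<nu>1 = h1" "D2 = (\<nu>2, t1, t2)" "h_grading \<nu>2 = h2" "D3 = (\<nu>3, t2, t3)" "h_grading \<nu>3 = h3"
    using tight_class_data[OF tight1 D(2,5)] tight_class_data[OF tight2 D(3,6)] tight_class_data[OF tight3 D(4,7)] by blast
  have "tight_triple Z \<nu>1 \<nu>2 \<nu>3 s1 t1 t2 t3"
    by unfold_locales (use D n viable_sum3 in auto)
  then show ?thesis using that D(1) n by blast
qed

lemma viable_tensor3: "viable_tensor Z [M1, M2, M3]"
  using viable_tensor3_iff[OF tight1 tight2 tight3] viable_sum3 by simp

lemma own_reps: "tight_reps Z [(\<mu>1, s1, t1), (\<mu>2, t1, t2), (\<mu>3, t2, t3)] [M1, M2, M3]"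
  using tight1 tight2 tight3 by (simp add: tight_reps_def)

lemma tight_tensor_iff:
  "tight_tensor Z [M1, M2, M3] \<longleftrightarrow> (\<forall>P\<in>pairs Z. \<not> pattern P) \<and> good Z (h123, s1, t3) \<and>
     (\<exists>\<mu>. viable_diagram \<mu> s1 t3 \<and> h_grading \<mu> = h123)"
proof
  assume "tight_tensor Z [M1, M2, M3]"
  then obtain Ds D where Ds: "tight_reps Z Ds [M1, M2, M3]" and D: "tight Z D" "prod_elts Z Ds = elt Z D"
    unfolding tight_tensor_def by blast
  obtain \<nu>1 \<nu>2 \<nu>3 where n: "Ds = [(\<nu>1, s1, t1), (\<nu>2, t1, t2), (\<nu>3, t2, t3)]"
    "tight_triple Z \<nu>1 \<nu>2 \<nu>3 s1 t1 t2 t3" "h_grading \<nu>1 = h1" "h_grading \<nu>2 = h2" "h_grading \<nu>3 = h3"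
    using other_reps[OF Ds] .
  interpret n: tight_triple Z \<nu>1 \<nu>2 \<nu>3 s1 t1 t2 t3 by (rule n(2))
  have nz: "elt Z D \<noteq> 0" using D(1) by (cases D) (auto simp: tight_def diagram_def)
  then have np: "\<forall>P\<in>pairs Z. \<not> pattern P"
    using n.pattern_prod D(2) unfolding n(1,3-5) n.prod_elts3 by metis
  obtain \<mu> s t where D': "D = (\<mu>, s, t)" by (cases D)
  note td = tightD[OF D(1)[unfolded D']]
  \<comment> \<open>The product lies in the expected summand, so comparing the H-data of one of its
    terms determines those of \<open>D\<close>.\<close>
  have e: "prod_elts Z Ds \<in> alg_at Z (h123, s1, t3)"
  proof (cases "\<exists>Q\<in>pairs Z. mismatch Z \<nu>1 \<nu>2 Q")
    case True
    then have "prod_elts Z Ds = 0" unfolding n(1) n.prod_elts3 using n.c12.mult_elt_mismatch by force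
    then show ?thesis using alg_at_0 by simp
  next
    case False
    then have m: "\<forall>Q\<in>pairs Z. \<not> mismatch Z \<nu>1 \<nu>2 Q" by blast
    interpret c: composable Z "compose \<nu>1 \<nu>2" \<nu>3 s1 t2 t3 by (rule n.composable_123[OF n.c12.diagram_compose[OF m]])
    show ?thesis
    proof (cases "\<exists>Q\<in>pairs Z. mismatch Z (compose \<nu>1 \<nu>2) \<nu>3 Q")
      case True
      then have "prod_elts Z Ds = 0" unfolding n(1) n.prod_elts3 n.c12.mult_elt[OF m] using c.mult_elt_mismatch by blast
      then show ?thesis using alg_at_0 by simp
    next
      case False
      then have m': "\<forall>Q\<in>pairs Z. \<not> mismatch Z (compose \<nu>1 \<nu>2) \<nu>3 Q" by blast
      have "prod_elts Z Ds = elt Z (compose (compose \<nu>1 \<nu>2) \<nu>3, s1, t3)"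
        unfolding n(1) n.prod_elts3 n.c12.mult_elt[OF m] using c.mult_elt[OF m'] .
      then show ?thesis
        using elt_alg_at[OF viable_diagramD(1)[OF c.diagram_compose[OF m']]]
        by (simp add: c.h_grading_compose n.c12.h_grading_compose n(3-5))
    qed
  qed
  obtain \<kappa> where k: "\<kappa> \<in> keys (elt Z D)" using nz by (metis keys_eq_empty ex_in_conv)
  have "strand_data Z \<kappa> = (h123, s1, t3)" using alg_at_data[OF e] k D(2) by simp
  moreover have "strand_data Z \<kappa> = (h_grading \<mu>, s, t)"
    using elt_strand(2)[OF viable_diagramD(1)[OF td(1)]] k D' by simp
  ultimately have "h_grading \<mu> = h123" "s = s1" "t = t3" by auto
  then show "(\<forall>P\<in>pairs Z. \<not> pattern P) \<and> good Z (h123, s1, t3) \<and> (\<exists>\<mu>. viable_diagram \<mu> s1 t3 \<and> h_grading \<mu> = h123)"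
    using np td by auto
next
  assume a: "(\<forall>P\<in>pairs Z. \<not> pattern P) \<and> good Z (h123, s1, t3) \<and> (\<exists>\<mu>. viable_diagram \<mu> s1 t3 \<and> h_grading \<mu> = h123)"
  then obtain \<mu> where m: "viable_diagram \<mu> s1 t3" "h_grading \<mu> = h123" by blast
  from a have "\<And>P. P \<in> pairs Z \<Longrightarrow> \<not> pattern P" by blast
  note np = no_pattern_prod[OF this m]
  have t: "tight Z (\<mu>123, s1, t3)" using np(2-4) a by (simp add: tight_iff)
  have e: "prod_elts Z [(\<mu>1, s1, t1), (\<mu>2, t1, t2), (\<mu>3, t2, t3)] = elt Z (\<mu>123, s1, t3)"
    unfolding prod_elts3 by (rule np(1))
  show "tight_tensor Z [M1, M2, M3]"
    unfolding tight_tensor_def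
    by (rule conjI[OF viable_tensor3], rule exI, rule conjI[OF own_reps], rule exI, rule conjI[OF t e])
qed

lemma critical_tensor_iff:
  "critical_tensor Z [M1, M2, M3] \<longleftrightarrow> (\<exists>P\<in>pairs Z. pattern P) \<and> (\<exists>\<mu>. viable_diagram \<mu> s1 t3 \<and> h_grading \<mu> = h123)"
proof
  assume "critical_tensor Z [M1, M2, M3]"
  then obtain Ds where Ds: "tight_reps Z Ds [M1, M2, M3]" and D: "prod_elts Z Ds = 0"
    "alg_at Z (tensor_hdata (map hdata_of Ds)) \<noteq> {0}"
    unfolding critical_tensor_def by blast
  obtain \<nu>1 \<nu>2 \<nu>3 where n: "Ds = [(\<nu>1, s1, t1), (\<nu>2, t1, t2), (\<nu>3, t2, t3)]"
    "tight_triple Z \<nu>1 \<nu>2 \<nu>3 s1 t1 t2 t3" "h_grading \<nu>1 = h1" "h_grading \<nu>2 = h2" "h_grading \<nu>3 = h3"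
    using other_reps[OF Ds] .
  interpret n: tight_triple Z \<nu>1 \<nu>2 \<nu>3 s1 t1 t2 t3 by (rule n(2))
  have "tensor_hdata (map hdata_of Ds) = (h123, s1, t3)" by (simp add: n(1,3-5) hdata_of_def tensor_hdata3)
  then obtain \<mu> where m: "viable_diagram \<mu> s1 t3" "h_grading \<mu> = h123" using alg_at_nonzero[OF viable_sum3] D(2) by auto
  have "\<exists>P\<in>pairs Z. pattern P"
  proof (rule ccontr)
    assume "\<not> (\<exists>P\<in>pairs Z. pattern P)"
    then have np: "\<And>P. P \<in> pairs Z \<Longrightarrow> \<not> n.pattern P" by (simp add: n(3-5))
    have m': "h_grading \<mu> = n.h123" using m(2) by (simp add: n(3-5))
    have "elt Z (n.\<mu>123, s1, t3) = 0" using n.no_pattern_prod(1)[OF np m(1) m'] D(1) unfolding n(1) n.prod_elts3 by simp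
    then show False using n.no_pattern_prod(2)[OF np m(1) m'] by (simp add: viable_diagram_def diagram_def)
  qed
  then show "(\<exists>P\<in>pairs Z. pattern P) \<and> (\<exists>\<mu>. viable_diagram \<mu> s1 t3 \<and> h_grading \<mu> = h123)" using m by blast
next
  assume a: "(\<exists>P\<in>pairs Z. pattern P) \<and> (\<exists>\<mu>. viable_diagram \<mu> s1 t3 \<and> h_grading \<mu> = h123)"
  then have p: "prod_elts Z [(\<mu>1, s1, t1), (\<mu>2, t1, t2), (\<mu>3, t2, t3)] = 0" using pattern_prod prod_elts3 by auto
  have d: "tensor_hdata (map hdata_of [(\<mu>1, s1, t1), (\<mu>2, t1, t2), (\<mu>3, t2, t3)]) = (h123, s1, t3)"
    by (simp add: hdata_of_def tensor_hdata3)
  have n: "alg_at Z (tensor_hdata (map hdata_of [(\<mu>1, s1, t1), (\<mu>2, t1, t2), (\<mu>3, t2, t3)])) \<noteq> {0}"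
    unfolding d alg_at_nonzero[OF viable_sum3] using a by (rule conjunct2)
  show "critical_tensor Z [M1, M2, M3]"
    unfolding critical_tensor_def
    by (rule conjI[OF viable_tensor3], rule exI, rule conjI[OF own_reps], rule conjI[OF p n])
qed

end

section \<open>Fragments\<close>

text \<open>Indices 0 and 1 are the steps before and after the place naming the interval. All other
  values are zero so that \<open>h_grading_cut\<close> is an equality of functions.\<close>

definition local_h :: "('i, 'l) arc_diag \<Rightarrow> 'l \<Rightarrow> 'i h1 \<Rightarrow> ('i \<times> nat) h1" where
  "local_h Z P h = (\<lambda>(p, k). if p \<in> plc Z P then if k = 0 then before h p else if k = 1 then h p else 0 else 0)"

lemma plc_fragment: "plc (fragment Z P) P = (\<lambda>p. (p, 1)) ` plc Z P"
  by (auto simp: plc_def places_def fragment_def)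

lemma steps_fragment: "e \<in> steps (fragment Z P) \<longleftrightarrow> fst e \<in> plc Z P \<and> snd e \<le> 1"
  by (cases e) (simp add: steps_def fragment_def plc_def)

lemma points_fragment: "e \<in> points (fragment Z P) \<longleftrightarrow> fst e \<in> plc Z P \<and> snd e \<le> 2"
  by (cases e) (auto simp: points_def fragment_def plc_def)

lemma pairs_fragment:
  assumes "P \<in> pairs Z"
  shows "pairs (fragment Z P) = {P}"
proof -
  obtain p where "p \<in> places Z" "pair_of Z p = P" using assms by (auto simp: pairs_def)
  then have "(p, 1) \<in> places (fragment Z P)" by (simp add: places_def fragment_def)
  then show ?thesis unfolding pairs_def by (auto simp: fragment_def)
qed

lemma local_h_values:
  assumes "p \<in> plc Z P"
  shows "before (local_h Z P h) (p, 1) = before h p" "local_h Z P h (p, 1) = h p"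
    "through (local_h Z P h) (p, 1) \<longleftrightarrow> through h p"
  using assms by (auto simp: local_h_def before_def through_def)

lemma through_fragment:
  "(\<forall>x\<in>plc (fragment Z P) P. through (local_h Z P h) x) \<longleftrightarrow> (\<forall>p\<in>plc Z P. through h p)"
  "(\<forall>x\<in>plc (fragment Z P) P. \<not> through (local_h Z P h) x) \<longleftrightarrow> (\<forall>p\<in>plc Z P. \<not> through h p)"
proof -
  have b: "(\<forall>x\<in>plc (fragment Z P) P. A x) \<longleftrightarrow> (\<forall>p\<in>plc Z P. A (p, 1))" for A
    unfolding plc_fragment by blast
  show "(\<forall>x\<in>plc (fragment Z P) P. through (local_h Z P h) x) \<longleftrightarrow> (\<forall>p\<in>plc Z P. through h p)"
    unfolding b by (rule ball_cong[OF refl]) (rule local_h_values(3))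
  show "(\<forall>x\<in>plc (fragment Z P) P. \<not> through (local_h Z P h) x) \<longleftrightarrow> (\<forall>p\<in>plc Z P. \<not> through h p)"
    unfolding b by (rule ball_cong[OF refl], subst local_h_values(3)) (assumption, rule refl)
qed

lemma good_fragment:
  assumes "P \<in> pairs Z"
  shows "good (fragment Z P) (local_h Z P h, s \<inter> {P}, t \<inter> {P}) \<longleftrightarrow>
    (P \<in> s \<longrightarrow> P \<in> t \<longrightarrow> (\<forall>p\<in>plc Z P. through h p) \<or> (\<forall>p\<in>plc Z P. \<not> through h p))"
proof -
  have aux: "(\<forall>Q\<in>{P}. Q \<in> s \<inter> {P} \<longrightarrow> Q \<in> t \<inter> {P} \<longrightarrow> A Q) \<longleftrightarrow> (P \<in> s \<longrightarrow> P \<in> t \<longrightarrow> A P)" for A by simp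
  show ?thesis unfolding good_def prod.case pairs_fragment[OF assms] aux through_fragment ..
qed

lemma local_h_sum: "local_h Z P (\<lambda>e. h1 e + h2 e + h3 e) = (\<lambda>e. local_h Z P h1 e + local_h Z P h2 e + local_h Z P h3 e)"
  by (auto simp: local_h_def before_def)

lemma pattern_fragment:
  assumes "plc Z P = {p, q}" "p \<noteq> q"
  shows "pattern_at (fragment Z P) (local_h Z P h1) (local_h Z P h2) (local_h Z P h3) (s1 \<inter> {P}) (t1 \<inter> {P}) (t2 \<inter> {P}) (t3 \<inter> {P}) P
    \<longleftrightarrow> pattern_at Z h1 h2 h3 s1 t1 t2 t3 P"
proof -
  have pq: "p \<in> plc Z P" "q \<in> plc Z P" using assms by auto
  have f: "plc (fragment Z P) P = {(p, 1), (q, 1)}" "(p, 1) \<noteq> (q, 1::nat)" using assms by (auto simp: plc_fragment)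
  show ?thesis
    unfolding pattern_at_iff[OF f] pattern_at_iff[OF assms] local_h_values(1,2)[OF pq(1)] local_h_values(1,2)[OF pq(2)] by simp
qed

context arc
begin

lemma arc_fragment:
  assumes "P \<in> pairs Z"
  shows "arc (fragment Z P)"
proof
  show "finite (intervals (fragment Z P))" using finite_plc[of P] by (simp add: fragment_def plc_def)
  fix Q assume "Q \<in> pairs (fragment Z P)"
  then have "Q = P" using pairs_fragment[OF assms] by simp
  then show "card (plc (fragment Z P) Q) = 2"
    using card_plc[OF assms] by (simp add: plc_fragment card_image inj_on_def)
qed

text \<open>On the interval named by a place, 0, 1 and 2 stand for minus infinity, the place and
  plus infinity. The three possible strands arise from a strand ending at, starting at or passing
  over the place.\<close>

lemma cut_iff:
  assumes "moving Z \<mu>"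
  shows "((p, a), (q, b)) \<in> cut_strands Z P \<mu> \<longleftrightarrow> q = p \<and> p \<in> plc Z P \<and>
    (a = 0 \<and> b = 1 \<and> p \<in> Range \<mu> \<or> a = 1 \<and> b = 2 \<and> p \<in> Domain \<mu> \<or> a = 0 \<and> b = 2 \<and> passes \<mu> p)"
    (is "?L \<longleftrightarrow> ?R")
proof
  have clip0: "clip p x = 0 \<longleftrightarrow> pt_less x p" "clip p x = 1 \<longleftrightarrow> x = p" "clip p x = 2 \<longleftrightarrow> pt_less p x"
    if "fst x = fst p" for p x :: "'i \<times> nat"
    using that by (cases p; cases x; auto simp: clip_def pt_less_def)+
  have clip3: "clip p x = 0 \<or> clip p x = 1 \<or> clip p x = 2" for p x :: "'i \<times> nat" by (simp add: clip_def)
  {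
    assume ?L
    then obtain x y where xy: "q = p" "p \<in> places Z" "pair_of Z p = P" "(x, y) \<in> \<mu>" "fst x = fst p" "fst y = fst p"
      "a = clip p x" "b = clip p y" "clip p x < clip p y" unfolding cut_strands_def by blast
    then consider "a = 0" "b = 1" | "a = 0" "b = 2" | "a = 1" "b = 2" using clip3[of p x] clip3[of p y] by auto
    then show ?R
    proof cases
      case 1
      then have "y = p" using clip0(2)[OF xy(6)] xy(8) by simp
      then show ?thesis using xy 1 by (auto simp: plc_def)
    next
      case 2
      then have "pt_less x p" "pt_less p y" using clip0(1)[OF xy(5)] clip0(3)[OF xy(6)] xy(7,8) by auto
      then have "passes \<mu> p" unfolding passes_def using xy(4) by blast
      then show ?thesis using xy 2 by (simp add: plc_def)
    next
      case 3
      then have "x = p" using clip0(2)[OF xy(5)] xy(7) by simp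
      then show ?thesis using xy 3 by (auto simp: plc_def)
    qed
  }
  have I: "((p, clip p x), (p, clip p y)) \<in> cut_strands Z P \<mu>" if "p \<in> plc Z P" "(x, y) \<in> \<mu>" "fst x = fst p" "fst y = fst p" "clip p x < clip p y" for x y
  proof -
    have "p \<in> places Z" "pair_of Z p = P" using that(1) by (auto simp: plc_def)
    then show ?thesis unfolding cut_strands_def using that by blast
  qed
  {
    assume R: ?R
    then have p: "q = p" "p \<in> plc Z P" by auto
    from R consider "a = 0" "b = 1" "p \<in> Range \<mu>" | "a = 1" "b = 2" "p \<in> Domain \<mu>" | "a = 0" "b = 2" "passes \<mu> p" by blast
    then show ?L
    proof cases
      case 1
      then obtain x where x: "(x, p) \<in> \<mu>" by blast
      have l: "pt_less x p" using moving_less[OF assms x] .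
      have "fst x = fst p" using l by (simp add: pt_less_def)
      then have "clip p x = 0" "clip p p = 1" using clip0 l by auto
      then show ?thesis using I[OF p(2) x \<open>fst x = fst p\<close>] p 1 by simp
    next
      case 2
      then obtain y where y: "(p, y) \<in> \<mu>" by blast
      have l: "pt_less p y" using moving_less[OF assms y] .
      have "fst y = fst p" using l by (simp add: pt_less_def)
      then have "clip p y = 2" "clip p p = 1" using clip0 l by auto
      then show ?thesis using I[OF p(2) y _ \<open>fst y = fst p\<close>] p 2 by simp
    next
      case 3
      then obtain x y where xy: "(x, y) \<in> \<mu>" "pt_less x p" "pt_less p y" unfolding passes_def by blast
      then have f: "fst x = fst p" "fst y = fst p" by (auto simp: pt_less_def)
      then have "clip p x = 0" "clip p y = 2" using clip0 xy by auto
      then show ?thesis using I[OF p(2) xy(1) f] p 3 by simp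
    qed
  }
qed

lemma cut_ends:
  assumes "moving Z \<mu>" "p \<in> plc Z P"
  shows "(p, 1) \<in> Domain (cut_strands Z P \<mu>) \<longleftrightarrow> p \<in> Domain \<mu>" "(p, 1) \<in> Range (cut_strands Z P \<mu>) \<longleftrightarrow> p \<in> Range \<mu>"
proof -
  have "(p, 1) \<in> Domain (cut_strands Z P \<mu>) \<longleftrightarrow> (\<exists>q b. ((p, 1), (q, b)) \<in> cut_strands Z P \<mu>)" by auto
  then show "(p, 1) \<in> Domain (cut_strands Z P \<mu>) \<longleftrightarrow> p \<in> Domain \<mu>" unfolding cut_iff[OF assms(1)] using assms(2) by simp
  have "(p, 1) \<in> Range (cut_strands Z P \<mu>) \<longleftrightarrow> (\<exists>q b. ((q, b), (p, 1)) \<in> cut_strands Z P \<mu>)" by auto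
  then show "(p, 1) \<in> Range (cut_strands Z P \<mu>) \<longleftrightarrow> p \<in> Range \<mu>" unfolding cut_iff[OF assms(1)] using assms(2) by auto
qed

lemma moving_cut:
  assumes "viable_strands \<mu>"
  shows "moving (fragment Z P) (cut_strands Z P \<mu>)"
proof -
  have m: "moving Z \<mu>" using assms by (simp add: viable_strands_def)
  have ex: "passes \<mu> p \<Longrightarrow> p \<notin> Domain \<mu> \<and> p \<notin> Range \<mu>" if "p \<in> plc Z P" for p
    using local_bits(5,6)[OF assms place_snd, of p] that by (auto simp: plc_def)
  have 1: "y = z" if "(x, y) \<in> cut_strands Z P \<mu>" "(x, z) \<in> cut_strands Z P \<mu>" for x y z
    using that ex by (cases x; cases y; cases z) (auto simp: cut_iff[OF m])
  have 2: "y = z" if "(y, x) \<in> cut_strands Z P \<mu>" "(z, x) \<in> cut_strands Z P \<mu>" for x y z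
    using that ex by (cases x; cases y; cases z) (auto simp: cut_iff[OF m])
  have 3: "x \<in> points (fragment Z P) \<and> y \<in> points (fragment Z P) \<and> pt_less x y" if "(x, y) \<in> cut_strands Z P \<mu>" for x y
    using that by (cases x; cases y) (auto simp: cut_iff[OF m] points_fragment pt_less_def)
  show ?thesis
    unfolding moving_def strand_diagram_def single_valued_def converse_iff
  proof (intro conjI allI impI)
    show "cut_strands Z P \<mu> \<subseteq> points (fragment Z P) \<times> points (fragment Z P)" using 3 by auto
    show "\<forall>(x, y)\<in>cut_strands Z P \<mu>. pt_le x y" using 3 pt_less_imp_le by blast
  qed (use 1 2 3 pt_less_irrefl in blast)+
qed

lemma h_grading_cut:
  assumes "viable_strands \<mu>" "P \<in> pairs Z"
  shows "h_grading (cut_strands Z P \<mu>) = local_h Z P (h_grading \<mu>)"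
proof
  interpret f: arc "fragment Z P" by (rule arc_fragment[OF assms(2)])
  have m: "moving Z \<mu>" using assms by (simp add: viable_strands_def)
  let ?c = "cut_strands Z P \<mu>"
  have s: "strand_diagram (fragment Z P) ?c" using moving_cut[OF assms(1)] by (simp add: moving_def)
  fix e :: "('i \<times> nat) \<times> nat"
  obtain p k where e: "e = (p, k)" by (cases e)
  have H: "h_grading ?c e = int (card {u \<in> ?c. covers u e})" by (rule h_grading_card[OF s f.finite_strands[OF s]])
  show "h_grading ?c e = local_h Z P (h_grading \<mu>) e"
  proof (cases "p \<in> plc Z P \<and> k \<le> 1")
    case False
    have "\<not> covers (x, y) e" if "(x, y) \<in> ?c" for x y
      using that False by (cases x; cases y) (auto simp: cut_iff[OF m] covers_def e)
    then have "{u \<in> ?c. covers u e} = {}" by auto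
    then have "h_grading ?c e = 0" using H by (simp only: card.empty of_nat_0)
    then show ?thesis using False by (auto simp: e local_h_def)
  next
    case True
    have sp: "snd p > 0" using True place_snd[of p Z] by (simp add: plc_def)
    note b = local_bits[OF assms(1) sp]
    have c: "covers ((q, a), (r, b)) e \<longleftrightarrow> q = p \<and> a \<le> k \<and> k < b" for q a r b by (simp add: covers_def e)
    show ?thesis
    proof (cases "k = 0")
      case k: True
      have 0: "{u \<in> ?c. covers u e} = (if p \<in> Range \<mu> then {((p, 0), (p, 1))} else {}) \<union> (if passes \<mu> p then {((p, 0), (p, 2))} else {})"
        using True by (auto simp: cut_iff[OF m] c k)
      show ?thesis unfolding H 0 using b(1,2,6) True k by (cases "p \<in> Range \<mu>"; cases "passes \<mu> p") (auto simp: e local_h_def)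
    next
      case False
      then have k: "k = 1" using True by simp
      have 0: "{u \<in> ?c. covers u e} = (if p \<in> Domain \<mu> then {((p, 1), (p, 2))} else {}) \<union> (if passes \<mu> p then {((p, 0), (p, 2))} else {})"
        using True by (auto simp: cut_iff[OF m] c k)
      show ?thesis unfolding H 0 using b(3,4,5) True k by (cases "p \<in> Domain \<mu>"; cases "passes \<mu> p") (auto simp: e local_h_def)
    qed
  qed
qed

lemma viable_local:
  assumes "viable_h Z h"
  shows "viable_h (fragment Z P) (local_h Z P h)"
  unfolding viable_h_def
proof
  fix e assume "e \<in> steps (fragment Z P)"
  then obtain p k where e: "e = (p, k)" "p \<in> plc Z P" "k \<le> 1" by (cases e) (auto simp: steps_fragment)
  then have "p \<in> steps Z" "(fst p, snd p - 1) \<in> steps Z" using place_steps[of p] by (auto simp: plc_def)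
  then have "h p = 0 \<or> h p = 1" "before h p = 0 \<or> before h p = 1" using assms by (auto simp: viable_h_def before_def)
  then show "local_h Z P h e = 0 \<or> local_h Z P h e = 1" using e by (auto simp: local_h_def)
qed

lemma viable_diagram_cut:
  assumes "viable_diagram \<mu> s t" "P \<in> pairs Z"
  shows "arc.viable_diagram (fragment Z P) (cut_strands Z P \<mu>) (s \<inter> {P}) (t \<inter> {P})"
proof -
  interpret f: arc "fragment Z P" by (rule arc_fragment[OF assms(2)])
  note v = viable_diagramD[OF assms(1)]
  obtain p q where pq: "plc Z P = {p, q}" "p \<noteq> q" using pair_places[OF assms(2)] .
  have pm: "p \<in> plc Z P" "q \<in> plc Z P" using pq by auto
  have fpq: "plc (fragment Z P) P = {(p, 1), (q, 1)}" "(p, 1) \<noteq> (q, 1::nat)" using pq by (auto simp: plc_fragment)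
  have "compat (fragment Z P) (cut_strands Z P \<mu>, s \<inter> {P}, t \<inter> {P}) P"
    using v(7)[OF assms(2)]
    unfolding f.compat_bits[OF fpq] compat_bits[OF pq] cut_ends[OF v(3) pm(1)] cut_ends[OF v(3) pm(2)] by simp
  then show ?thesis
    unfolding f.viable_diagram_def f.diagram_iff pairs_fragment[OF assms(2)] h_grading_cut[OF v(2) assms(2)]
    using moving_cut[OF v(2)] viable_local assms(1) by (simp add: viable_diagram_def)
qed

lemma good_local:
  assumes "good Z (h, s, t)" "P \<in> pairs Z"
  shows "good (fragment Z P) (local_h Z P h, s \<inter> {P}, t \<inter> {P})"
  unfolding good_fragment[OF assms(2)] using assms unfolding good_def by blast

lemma tight_cut:
  assumes "tight Z (\<mu>, s, t)" "P \<in> pairs Z"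
  shows "tight (fragment Z P) (cut_strands Z P \<mu>, s \<inter> {P}, t \<inter> {P})"
proof -
  interpret f: arc "fragment Z P" by (rule arc_fragment[OF assms(2)])
  note td = tightD[OF assms(1)]
  note v = viable_diagramD[OF td(1)]
  note vc = viable_diagram_cut[OF td(1) assms(2)]
  obtain p q where pq: "plc Z P = {p, q}" "p \<noteq> q" using pair_places[OF assms(2)] .
  have pm: "p \<in> plc Z P" "q \<in> plc Z P" using pq by auto
  have fpq: "plc (fragment Z P) P = {(p, 1), (q, 1)}" "(p, 1) \<noteq> (q, 1::nat)" using pq by (auto simp: plc_fragment)
  have d: "dotted (fragment Z P) (cut_strands Z P \<mu>, s \<inter> {P}, t \<inter> {P}) P \<longleftrightarrow> dotted Z (\<mu>, s, t) P"
    unfolding f.dotted_bits[OF fpq(1)] dotted_bits[OF pq(1)] cut_ends[OF v(3) pm(1)] cut_ends[OF v(3) pm(2)] by simp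
  have "crossing_places (fragment Z P) (cut_strands Z P \<mu>, s \<inter> {P}, t \<inter> {P}) = {}"
  proof (rule ccontr)
    assume "\<not> ?thesis"
    then obtain x where x: "x \<in> places (fragment Z P)" "dotted (fragment Z P) (cut_strands Z P \<mu>, s \<inter> {P}, t \<inter> {P}) (pair_of (fragment Z P) x)"
      "through (h_grading (cut_strands Z P \<mu>)) x" using f.crossing_places_iff[OF vc] by blast
    have px: "pair_of (fragment Z P) x = P" by (simp add: fragment_def)
    have "x \<in> plc (fragment Z P) P" using x(1) px by (simp add: plc_def)
    then obtain r where r: "x = (r, 1)" "r \<in> plc Z P" by (auto simp: plc_fragment)
    have "through (h_grading \<mu>) r" using x(3) local_h_values(3)[OF r(2)] unfolding h_grading_cut[OF v(2) assms(2)] r(1) by simp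
    moreover have "dotted Z (\<mu>, s, t) (pair_of Z r)" "r \<in> places Z" using x(2) d px r by (auto simp: plc_def)
    ultimately have "r \<in> crossing_places Z (\<mu>, s, t)" using crossing_places_iff[OF td(1)] by blast
    then show False using td(2) by blast
  qed
  then show ?thesis
    using vc good_local[OF td(3) assms(2)] by (simp add: f.tight_iff h_grading_cut[OF v(2) assms(2)])
qed

end

section \<open>Tight and critical pairs\<close>

context tight_triple
begin

lemma triple_cut:
  assumes "P \<in> pairs Z"
  shows "tight_triple (fragment Z P) (cut_strands Z P \<mu>1) (cut_strands Z P \<mu>2) (cut_strands Z P \<mu>3)
    (s1 \<inter> {P}) (t1 \<inter> {P}) (t2 \<inter> {P}) (t3 \<inter> {P})"
    "h_grading (cut_strands Z P \<mu>1) = local_h Z P h1" "h_grading (cut_strands Z P \<mu>2) = local_h Z P h2"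
    "h_grading (cut_strands Z P \<mu>3) = local_h Z P h3"
proof -
  interpret f: arc "fragment Z P" by (rule arc_fragment[OF assms])
  show h: "h_grading (cut_strands Z P \<mu>1) = local_h Z P h1" "h_grading (cut_strands Z P \<mu>2) = local_h Z P h2"
    "h_grading (cut_strands Z P \<mu>3) = local_h Z P h3"
    using h_grading_cut[OF viable_diagramD(2) assms] tightD(1) tight1 tight2 tight3 by blast+
  show "tight_triple (fragment Z P) (cut_strands Z P \<mu>1) (cut_strands Z P \<mu>2) (cut_strands Z P \<mu>3)
    (s1 \<inter> {P}) (t1 \<inter> {P}) (t2 \<inter> {P}) (t3 \<inter> {P})"
  proof
    show "viable_h (fragment Z P) (\<lambda>e. h_grading (cut_strands Z P \<mu>1) e + h_grading (cut_strands Z P \<mu>2) e + h_grading (cut_strands Z P \<mu>3) e)"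
      unfolding h using viable_local[OF viable_sum3] by (simp add: local_h_sum)
  qed (rule tight_cut[OF tight1 assms] tight_cut[OF tight2 assms] tight_cut[OF tight3 assms])+
qed

lemma local_tensor3: "local_tensor Z P [(\<mu>1, s1, t1), (\<mu>2, t1, t2), (\<mu>3, t2, t3)] =
   [hclass (fragment Z P) (elt (fragment Z P) (cut_strands Z P \<mu>1, s1 \<inter> {P}, t1 \<inter> {P})),
    hclass (fragment Z P) (elt (fragment Z P) (cut_strands Z P \<mu>2, t1 \<inter> {P}, t2 \<inter> {P})),
    hclass (fragment Z P) (elt (fragment Z P) (cut_strands Z P \<mu>3, t2 \<inter> {P}, t3 \<inter> {P}))]"
  by (simp add: local_tensor_def cut_diag_def)

text \<open>The cut diagrams form a tight triple over the fragment, whose only pair is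
  \<open>P\<close>, so the global characterisations of tight and critical tensor products apply to
  the fragment itself.\<close>

lemma local_iffs:
  assumes "P \<in> pairs Z"
  shows "tight_tensor (fragment Z P) (local_tensor Z P [(\<mu>1, s1, t1), (\<mu>2, t1, t2), (\<mu>3, t2, t3)]) \<longleftrightarrow>
     \<not> pattern P \<and> good (fragment Z P) (local_h Z P h123, s1 \<inter> {P}, t3 \<inter> {P}) \<and>
     (\<exists>\<mu>. arc.viable_diagram (fragment Z P) \<mu> (s1 \<inter> {P}) (t3 \<inter> {P}) \<and> h_grading \<mu> = local_h Z P h123)"
    "critical_tensor (fragment Z P) (local_tensor Z P [(\<mu>1, s1, t1), (\<mu>2, t1, t2), (\<mu>3, t2, t3)]) \<longleftrightarrow> pattern P \<and>
     (\<exists>\<mu>. arc.viable_diagram (fragment Z P) \<mu> (s1 \<inter> {P}) (t3 \<inter> {P}) \<and> h_grading \<mu> = local_h Z P h123)"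
proof -
  note c = triple_cut[OF assms]
  interpret f: tight_triple "fragment Z P" "cut_strands Z P \<mu>1" "cut_strands Z P \<mu>2" "cut_strands Z P \<mu>3"
    "s1 \<inter> {P}" "t1 \<inter> {P}" "t2 \<inter> {P}" "t3 \<inter> {P}" by (rule c(1))
  obtain p q where pq: "plc Z P = {p, q}" "p \<noteq> q" using pair_places[OF assms] .
  have pat: "f.pattern P \<longleftrightarrow> pattern P" unfolding c(2-4) by (rule pattern_fragment[OF pq])
  have hs: "f.h123 = local_h Z P h123" unfolding c(2-4) local_h_sum ..
  show "tight_tensor (fragment Z P) (local_tensor Z P [(\<mu>1, s1, t1), (\<mu>2, t1, t2), (\<mu>3, t2, t3)]) \<longleftrightarrow>
     \<not> pattern P \<and> good (fragment Z P) (local_h Z P h123, s1 \<inter> {P}, t3 \<inter> {P}) \<and>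
     (\<exists>\<mu>. arc.viable_diagram (fragment Z P) \<mu> (s1 \<inter> {P}) (t3 \<inter> {P}) \<and> h_grading \<mu> = local_h Z P h123)"
    unfolding local_tensor3 f.tight_tensor_iff pairs_fragment[OF assms] ball_simps pat hs by simp
  show "critical_tensor (fragment Z P) (local_tensor Z P [(\<mu>1, s1, t1), (\<mu>2, t1, t2), (\<mu>3, t2, t3)]) \<longleftrightarrow> pattern P \<and>
     (\<exists>\<mu>. arc.viable_diagram (fragment Z P) \<mu> (s1 \<inter> {P}) (t3 \<inter> {P}) \<and> h_grading \<mu> = local_h Z P h123)"
    unfolding local_tensor3 f.critical_tensor_iff pairs_fragment[OF assms] bex_simps pat hs by simp
qed

text \<open>The last claim keeps the existence of a local diagram in the form of bits. It is needed
  where tightness is known pair by pair and no global diagram with the total H-data is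
  available.\<close>

lemma tight_at_imp:
  assumes "P \<in> pairs Z" "tight_at Z P [M1, M2, M3]"
  shows "\<not> pattern P" "P \<in> s1 \<Longrightarrow> P \<in> t3 \<Longrightarrow> (\<forall>p\<in>plc Z P. through h123 p) \<or> (\<forall>p\<in>plc Z P. \<not> through h123 p)"
    "plc Z P = {p, q} \<Longrightarrow> p \<noteq> q \<Longrightarrow> \<exists>D R V D' R' V'. diagram_bits (before h123 p = 1) (h123 p = 1) (before h123 q = 1) (h123 q = 1)
       (P \<in> s1) (P \<in> t3) D R V D' R' V'"
proof -
  obtain Ds where Ds: "tight_reps Z Ds [M1, M2, M3]" "tight_tensor (fragment Z P) (local_tensor Z P Ds)"
    using assms(2) unfolding tight_at_def by blast
  obtain \<nu>1 \<nu>2 \<nu>3 where n: "Ds = [(\<nu>1, s1, t1), (\<nu>2, t1, t2), (\<nu>3, t2, t3)]"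
    "tight_triple Z \<nu>1 \<nu>2 \<nu>3 s1 t1 t2 t3" "h_grading \<nu>1 = h1" "h_grading \<nu>2 = h2" "h_grading \<nu>3 = h3"
    using other_reps[OF Ds(1)] .
  interpret n: tight_triple Z \<nu>1 \<nu>2 \<nu>3 s1 t1 t2 t3 by (rule n(2))
  have all: "\<not> pattern P \<and> good (fragment Z P) (local_h Z P h123, s1 \<inter> {P}, t3 \<inter> {P}) \<and>
     (\<exists>\<mu>. arc.viable_diagram (fragment Z P) \<mu> (s1 \<inter> {P}) (t3 \<inter> {P}) \<and> h_grading \<mu> = local_h Z P h123)"
    using Ds(2) unfolding n(1) n.local_iffs[OF assms(1)] n(3-5) .
  then have *: "\<not> pattern P" "good (fragment Z P) (local_h Z P h123, s1 \<inter> {P}, t3 \<inter> {P})" by auto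
  show "\<exists>D R V D' R' V'. diagram_bits (before h123 p = 1) (h123 p = 1) (before h123 q = 1) (h123 q = 1)
       (P \<in> s1) (P \<in> t3) D R V D' R' V'" if pq: "plc Z P = {p, q}" "p \<noteq> q"
  proof -
    interpret f: arc "fragment Z P" by (rule arc_fragment[OF assms(1)])
    obtain \<mu> where m: "f.viable_diagram \<mu> (s1 \<inter> {P}) (t3 \<inter> {P})" "h_grading \<mu> = local_h Z P h123" using all by blast
    have f: "plc (fragment Z P) P = {(p, 1), (q, 1)}" "(p, 1) \<noteq> (q, 1::nat)" using pq by (auto simp: plc_fragment)
    have pm: "p \<in> plc Z P" "q \<in> plc Z P" using pq by auto
    have "P \<in> pairs (fragment Z P)" by (simp add: pairs_fragment[OF assms(1)])
    from f.diagram_bitsI[OF m(1) this f] show ?thesis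
      unfolding m(2) local_h_values(1,2)[OF pm(1)] local_h_values(1,2)[OF pm(2)] Int_iff singleton_iff simp_thms by blast
  qed
  show "\<not> pattern P" by (rule *)
  show "(\<forall>p\<in>plc Z P. through h123 p) \<or> (\<forall>p\<in>plc Z P. \<not> through h123 p)" if "P \<in> s1" "P \<in> t3"
    using *(2) that unfolding good_fragment[OF assms(1)] by blast
qed

lemma critical_at_imp:
  assumes "P \<in> pairs Z" "critical_at Z P [M1, M2, M3]"
  shows "pattern P"
proof -
  obtain Ds where Ds: "tight_reps Z Ds [M1, M2, M3]" "critical_tensor (fragment Z P) (local_tensor Z P Ds)"
    using assms(2) unfolding critical_at_def by blast
  obtain \<nu>1 \<nu>2 \<nu>3 where n: "Ds = [(\<nu>1, s1, t1), (\<nu>2, t1, t2), (\<nu>3, t2, t3)]"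
    "tight_triple Z \<nu>1 \<nu>2 \<nu>3 s1 t1 t2 t3" "h_grading \<nu>1 = h1" "h_grading \<nu>2 = h2" "h_grading \<nu>3 = h3"
    using other_reps[OF Ds(1)] .
  interpret n: tight_triple Z \<nu>1 \<nu>2 \<nu>3 s1 t1 t2 t3 by (rule n(2))
  show "pattern P"
    using Ds(2) unfolding n(1) n.local_iffs[OF assms(1)] n(3-5) by simp
qed

text \<open>A global diagram with the total H-data can be cut, so no pair is singular; good H-data
  exclude twisted pairs. Only the distinction by patterns remains.\<close>

lemma local_classification:
  assumes "P \<in> pairs Z" "viable_diagram \<mu> s1 t3" "h_grading \<mu> = h123" "good Z (h123, s1, t3)"
  shows "critical_at Z P [M1, M2, M3] \<longleftrightarrow> pattern P" "tight_at Z P [M1, M2, M3] \<longleftrightarrow> \<not> pattern P"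
proof -
  have ex: "\<exists>\<mu>. arc.viable_diagram (fragment Z P) \<mu> (s1 \<inter> {P}) (t3 \<inter> {P}) \<and> h_grading \<mu> = local_h Z P h123"
    using viable_diagram_cut[OF assms(2,1)] h_grading_cut[OF viable_diagramD(2)[OF assms(2)] assms(1)] assms(3) by auto
  show "critical_at Z P [M1, M2, M3] \<longleftrightarrow> pattern P"
  proof
    assume "pattern P"
    then have "critical_tensor (fragment Z P) (local_tensor Z P [(\<mu>1, s1, t1), (\<mu>2, t1, t2), (\<mu>3, t2, t3)])"
      unfolding local_iffs[OF assms(1)] using ex by blast
    then show "critical_at Z P [M1, M2, M3]" unfolding critical_at_def using own_reps by blast
  qed (rule critical_at_imp[OF assms(1)])
  show "tight_at Z P [M1, M2, M3] \<longleftrightarrow> \<not> pattern P"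
  proof
    assume "\<not> pattern P"
    then have "tight_tensor (fragment Z P) (local_tensor Z P [(\<mu>1, s1, t1), (\<mu>2, t1, t2), (\<mu>3, t2, t3)])"
      unfolding local_iffs[OF assms(1)] using ex good_local[OF assms(4,1)] by blast
    then show "tight_at Z P [M1, M2, M3]" unfolding tight_at_def using own_reps by blast
  qed (rule tight_at_imp(1)[OF assms(1)])
qed

end

section \<open>Counting crossingless terms of a product\<close>

context
  fixes b1 a1 b1' a1' b2 a2 b2' a2' b3 a3 b3' a3' S1 T1 T2 T3 D1 R1 V1 D1' R1' V1' D2 R2 V2 D2' R2' V2'
    D3 R3 V3 D3' R3' V3' :: bool
  assumes t: "tight_bits b1 a1 b1' a1' S1 T1 D1 R1 V1 D1' R1' V1'"
    "tight_bits b2 a2 b2' a2' T1 T2 D2 R2 V2 D2' R2' V2'"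
    "tight_bits b3 a3 b3' a3' T2 T3 D3 R3 V3 D3' R3' V3'"
  and dis: "disjoint3 b1 b2 b3" "disjoint3 a1 a2 a3" "disjoint3 b1' b2' b3'" "disjoint3 a1' a2' a3'"
begin

context
  fixes D R V D' R' V' :: bool
  assumes total: "diagram_bits (b1 \<or> b2 \<or> b3) (a1 \<or> a2 \<or> a3) (b1' \<or> b2' \<or> b3') (a1' \<or> a2' \<or> a3') S1 T3 D R V D' R' V'"
    and total_good: "S1 \<and> T3 \<longrightarrow> ((b1 \<or> b2 \<or> b3) \<and> (a1 \<or> a2 \<or> a3) \<longleftrightarrow> (b1' \<or> b2' \<or> b3') \<and> (a1' \<or> a2' \<or> a3'))"
    and no_pattern: "\<not> pattern_bits b1 a1 b1' a1' b2 a2 b2' a2' b3 a3 b3' a3' S1 T1 T2 T3"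
begin

text \<open>Away from patterns the intermediate H-data inherit goodness from the total H-data, so
  the count behaves there as an invariant should.\<close>

lemma good_12: "S1 \<and> T2 \<longrightarrow> ((b1 \<or> b2) \<and> (a1 \<or> a2) \<longleftrightarrow> (b1' \<or> b2') \<and> (a1' \<or> a2'))"
  using t dis total total_good no_pattern
  unfolding tight_bits_def diagram_bits_def disjoint3_def pattern_bits_def by argo

lemma good_23: "T1 \<and> T3 \<longrightarrow> ((b2 \<or> b3) \<and> (a2 \<or> a3) \<longleftrightarrow> (b2' \<or> b3') \<and> (a2' \<or> a3'))"
  using t dis total total_good no_pattern
  unfolding tight_bits_def diagram_bits_def disjoint3_def pattern_bits_def by argo

text \<open>Here the left factor is an arbitrary diagram with the H-data of the first product, not
  the composite. The values of f_2 contain such diagrams.\<close>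

lemma no_mismatch_left:
  assumes "diagram_bits (b1 \<or> b2) (a1 \<or> a2) (b1' \<or> b2') (a1' \<or> a2') S1 T2 DE RE VE DE' RE' VE'"
  shows "\<not> (RE \<and> D3')"
  using t dis total total_good no_pattern assms
  unfolding tight_bits_def diagram_bits_def disjoint3_def pattern_bits_def by argo

lemma no_mismatch_right:
  assumes "diagram_bits (b2 \<or> b3) (a2 \<or> a3) (b2' \<or> b3') (a2' \<or> a3') T1 T3 DE RE VE DE' RE' VE'"
  shows "\<not> (R1 \<and> DE')"
  using t dis total total_good no_pattern assms
  unfolding tight_bits_def diagram_bits_def disjoint3_def pattern_bits_def by argo

end

lemma no_mismatch_consecutive: "\<not> (R1 \<and> D2')" "\<not> (R2 \<and> D3')"
  if "diagram_bits (b1 \<or> b2 \<or> b3) (a1 \<or> a2 \<or> a3) (b1' \<or> b2' \<or> b3') (a1' \<or> a2' \<or> a3') S1 T3 D R V D' R' V'"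
    "\<not> pattern_bits b1 a1 b1' a1' b2 a2 b2' a2' b3 a3 b3' a3' S1 T1 T2 T3"
  using t dis that unfolding tight_bits_def diagram_bits_def disjoint3_def pattern_bits_def by argo+

text \<open>Only one of the two places is interior for the first product, so its H-data have no
  homology, and the second product has no diagrams at all. A diagram with the H-data of the first
  product that has moving ends at the pair has a target at the first place, where it is mismatched
  with the third factor.\<close>

lemma pattern_A_bits:
  assumes "S1" "\<not> T1" "T2" "\<not> T3" "a1" "b2" "a3'"
  shows "(b1 \<or> b2) \<and> (a1 \<or> a2)" "\<not> ((b1' \<or> b2') \<and> (a1' \<or> a2'))"
    "\<not> diagram_bits (b2 \<or> b3) (a2 \<or> a3) (b2' \<or> b3') (a2' \<or> a3') T1 T3 DE RE VE DE' RE' VE'"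
    "diagram_bits (b1 \<or> b2) (a1 \<or> a2) (b1' \<or> b2') (a1' \<or> a2') S1 T2 DE RE VE DE' RE' VE' \<Longrightarrow>
      DE \<or> RE \<or> DE' \<or> RE' \<Longrightarrow> RE"
  using t dis assms unfolding tight_bits_def diagram_bits_def disjoint3_def by argo+

text \<open>The mirror image of \<open>pattern_A_bits\<close>: the roles of the two products, of
  sources and targets, and of the two places are exchanged.\<close>

lemma pattern_B_bits:
  assumes "\<not> S1" "T1" "\<not> T2" "T3" "b1" "a2'" "b3'"
  shows "(b2' \<or> b3') \<and> (a2' \<or> a3')" "\<not> ((b2 \<or> b3) \<and> (a2 \<or> a3))"
    "\<not> diagram_bits (b1 \<or> b2) (a1 \<or> a2) (b1' \<or> b2') (a1' \<or> a2') S1 T2 DE RE VE DE' RE' VE'"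
    "diagram_bits (b2 \<or> b3) (a2 \<or> a3) (b2' \<or> b3') (a2' \<or> a3') T1 T3 DE RE VE DE' RE' VE' \<Longrightarrow>
      DE \<or> RE \<or> DE' \<or> RE' \<Longrightarrow> DE'"
  using t dis assms unfolding tight_bits_def diagram_bits_def disjoint3_def by argo+

end

text \<open>Applied to one factor when the other covers all four steps at the pair: then nothing can
  move there, and a pair in an idempotent has to be dotted.\<close>

lemma full_forces_dotted:
  assumes "diagram_bits b a b' a' S T D R V D' R' V'" "\<not> b" "\<not> a" "\<not> b'" "\<not> a'" "S \<or> T"
  shows "S \<and> T \<and> \<not> D \<and> \<not> D' \<and> \<not> R \<and> \<not> R'"
  using assms unfolding diagram_bits_def by argo

section \<open>Counts of products of two diagrams\<close>

context composable
begin

lemma exclusive: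
  assumes "e \<in> steps Z" "h_grading \<mu>1 e = 1"
  shows "h_grading \<mu>2 e \<noteq> 1"
  using viable_sum assms unfolding viable_h_def by fastforce

lemma dotted_right:
  assumes "P \<in> pairs Z" "P \<in> t" "\<forall>p\<in>plc Z P. through (h_grading \<mu>1) p"
  shows "dotted Z (\<mu>2, t, u) P"
proof -
  obtain p q where pq: "plc Z P = {p, q}" "p \<noteq> q" using pair_places[OF assms(1)] .
  have "before (h_grading \<mu>2) x \<noteq> 1 \<and> h_grading \<mu>2 x \<noteq> 1" if x: "x \<in> plc Z P" for x
  proof -
    have "through (h_grading \<mu>1) x" using assms(3) x by blast
    moreover have "x \<in> steps Z \<and> (fst x, snd x - 1) \<in> steps Z" using place_steps[of x] x by (simp add: plc_def)
    ultimately show ?thesis using exclusive unfolding through_def before_def by blast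
  qed
  then have "\<not> before (h_grading \<mu>2) p = 1" "\<not> h_grading \<mu>2 p = 1" "\<not> before (h_grading \<mu>2) q = 1" "\<not> h_grading \<mu>2 q = 1"
    using pq by auto
  from full_forces_dotted[OF diagram_bitsI[OF vd2 assms(1) pq] this] show ?thesis
    using assms(2) unfolding dotted_bits[OF pq(1)] by blast
qed

lemma dotted_left:
  assumes "P \<in> pairs Z" "P \<in> t" "\<forall>p\<in>plc Z P. through (h_grading \<mu>2) p"
  shows "dotted Z (\<mu>1, s, t) P"
proof -
  obtain p q where pq: "plc Z P = {p, q}" "p \<noteq> q" using pair_places[OF assms(1)] .
  have "before (h_grading \<mu>1) x \<noteq> 1 \<and> h_grading \<mu>1 x \<noteq> 1" if x: "x \<in> plc Z P" for x
  proof -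
    have "through (h_grading \<mu>2) x" using assms(3) x by blast
    moreover have "x \<in> steps Z \<and> (fst x, snd x - 1) \<in> steps Z" using place_steps[of x] x by (simp add: plc_def)
    ultimately show ?thesis using exclusive unfolding through_def before_def by blast
  qed
  then have "\<not> before (h_grading \<mu>1) p = 1" "\<not> h_grading \<mu>1 p = 1" "\<not> before (h_grading \<mu>1) q = 1" "\<not> h_grading \<mu>1 q = 1"
    using pq by auto
  from full_forces_dotted[OF diagram_bitsI[OF vd1 assms(1) pq] this] show ?thesis
    using assms(2) unfolding dotted_bits[OF pq(1)] by blast
qed

lemma crossing_full:
  assumes "viable_diagram \<mu> s' t'" "x \<in> crossing_places Z (\<mu>, s', t')" 
    "\<forall>p\<in>plc Z (pair_of Z x). \<forall>q\<in>plc Z (pair_of Z x). through (h_grading \<mu>) p \<longrightarrow> through (h_grading \<mu>) q"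
  shows "pair_of Z x \<in> pairs Z" "pair_of Z x \<in> s'" "pair_of Z x \<in> t'" "dotted Z (\<mu>, s', t') (pair_of Z x)"
    "\<forall>p\<in>plc Z (pair_of Z x). through (h_grading \<mu>) p"
proof -
  have x: "x \<in> places Z" "dotted Z (\<mu>, s', t') (pair_of Z x)" "through (h_grading \<mu>) x"
    using crossing_places_iff[OF assms(1)] assms(2) by auto
  show "pair_of Z x \<in> pairs Z" "pair_of Z x \<in> s'" "pair_of Z x \<in> t'" "dotted Z (\<mu>, s', t') (pair_of Z x)"
    using x place_in_plc[OF x(1)] by (auto simp: dotted_def)
  show "\<forall>p\<in>plc Z (pair_of Z x). through (h_grading \<mu>) p" using assms(3) x(3) place_in_plc[OF x(1)] by blast
qed

text \<open>In the following two lemmas the data of one factor need not be good at the pair \<open>P\<close> with places \<open>X\<close>;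
  if both are good, \<open>X\<close> is taken to be empty.\<close>

lemma count_mult_left:
  assumes P: "\<And>Q p q. Q \<in> pairs Z \<Longrightarrow> plc Z Q \<noteq> X \<Longrightarrow> Q \<in> s \<Longrightarrow> Q \<in> t \<Longrightarrow> p \<in> plc Z Q \<Longrightarrow> q \<in> plc Z Q \<Longrightarrow>
      through (h_grading \<mu>1) p \<Longrightarrow> through (h_grading \<mu>1) q" "X = {} \<or> X = plc Z P \<and> P \<notin> u"
    and g2: "good Z (h_grading \<mu>2, t, u)" and ad: "adapted can (\<lambda>e. h_grading \<mu>1 e + h_grading \<mu>2 e, s, u)"
    and mm: "crossing_places Z (\<mu>2, t, u) = {} \<Longrightarrow> (\<exists>Q\<in>pairs Z. mismatch Z \<mu>1 \<mu>2 Q) \<longleftrightarrow> bad"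
  shows "crossless_count can (elt Z (\<mu>1, s, t) \<odot> elt Z (\<mu>2, t, u)) =
    of_bool (\<not> bad \<and> crossing_places Z (\<mu>1, s, t) \<subseteq> X) * of_bool (crossing_places Z (\<mu>2, t, u) = {})"
proof -
  \<comment> \<open>At a crossing of the second factor both places are interior to its support, by
    goodness. The first factor has no strands there, so it is dotted and the crossing survives in
    the product.\<close>
  have c2: "dotted Z (\<mu>1, s, t) (pair_of Z x) \<and> dotted Z (\<mu>2, t, u) (pair_of Z x)"
    if x: "x \<in> crossing_places Z (\<mu>2, t, u)" for x
  proof -
    have "x \<in> places Z" "dotted Z (\<mu>2, t, u) (pair_of Z x)" using x by (auto simp: crossing_places_def)
    then have "pair_of Z x \<in> pairs Z" "pair_of Z x \<in> t" "pair_of Z x \<in> u" using place_in_plc[of x Z] by (auto simp: dotted_def)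
    then have "\<forall>p\<in>plc Z (pair_of Z x). \<forall>q\<in>plc Z (pair_of Z x). through (h_grading \<mu>2) p \<longrightarrow> through (h_grading \<mu>2) q"
      using g2 unfolding good_def by blast
    from crossing_full[OF vd2 x this] show ?thesis using dotted_left by blast
  qed
  have c1: "dotted Z (\<mu>2, t, u) (pair_of Z x) \<and> dotted Z (\<mu>1, s, t) (pair_of Z x)"
    if x: "x \<in> crossing_places Z (\<mu>1, s, t)" "x \<notin> X" for x
  proof -
    have xp: "x \<in> places Z" "dotted Z (\<mu>1, s, t) (pair_of Z x)" using x by (auto simp: crossing_places_def)
    then have "pair_of Z x \<in> pairs Z" "pair_of Z x \<in> s" "pair_of Z x \<in> t" "plc Z (pair_of Z x) \<noteq> X"
      using place_in_plc[OF xp(1)] x(2) by (auto simp: dotted_def)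
    then have "\<forall>p\<in>plc Z (pair_of Z x). \<forall>q\<in>plc Z (pair_of Z x). through (h_grading \<mu>1) p \<longrightarrow> through (h_grading \<mu>1) q"
      using P(1) by blast
    from crossing_full[OF vd1 x(1) this] show ?thesis using dotted_right by blast
  qed
  show ?thesis
  proof (cases "\<exists>Q\<in>pairs Z. mismatch Z \<mu>1 \<mu>2 Q")
    case True
    then have "elt Z (\<mu>1, s, t) \<odot> elt Z (\<mu>2, t, u) = 0" using mult_elt_mismatch by blast
    then show ?thesis using mm True by auto
  next
    case False
    then have n: "\<forall>Q\<in>pairs Z. \<not> mismatch Z \<mu>1 \<mu>2 Q" by blast
    note vc = diagram_compose[OF n]
    have "adapted can (h_grading \<mu>12, s, u)" using ad by (simp add: h_grading_compose)
    then have c: "crossless_count can (elt Z (\<mu>1, s, t) \<odot> elt Z (\<mu>2, t, u)) = of_bool (crossing_places Z (\<mu>12, s, u) = {})"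
      unfolding mult_elt[OF n] by (rule crossless_count_elt[OF vc])
    show ?thesis
    proof (cases "crossing_places Z (\<mu>2, t, u) = {}")
      case False
      then have "crossing_places Z (\<mu>12, s, u) \<noteq> {}" using c2 crossing_places_compose[OF n] by blast
      then show ?thesis using c False by simp
    next
      case e2: True
      have "crossing_places Z (\<mu>12, s, u) = {} \<longleftrightarrow> crossing_places Z (\<mu>1, s, t) \<subseteq> X"
      proof
        assume "crossing_places Z (\<mu>12, s, u) = {}"
        then show "crossing_places Z (\<mu>1, s, t) \<subseteq> X" using c1 crossing_places_compose[OF n] by blast
      next
        assume sub: "crossing_places Z (\<mu>1, s, t) \<subseteq> X"
        show "crossing_places Z (\<mu>12, s, u) = {}"
        proof (rule ccontr)
          assume "crossing_places Z (\<mu>12, s, u) \<noteq> {}"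
          \<comment> \<open>A crossing at \<open>P\<close> cannot survive, because \<open>u\<close>
            does not contain \<open>P\<close> and the horizontal strand is not continued in the
            second factor.\<close>
          then obtain x where x: "x \<in> crossing_places Z (\<mu>1, s, t)" "dotted Z (\<mu>2, t, u) (pair_of Z x)"
            using crossing_places_compose[OF n] e2 by blast
          then have "X = plc Z P \<and> P \<notin> u" "x \<in> X" using sub P(2) by blast+
          moreover from this have "pair_of Z x = P" by (simp add: plc_def)
          ultimately show False using x(2) by (simp add: dotted_def)
        qed
      qed
      then show ?thesis using c e2 mm[OF e2] False by simp
    qed
  qed
qed

lemma count_mult_right:
  assumes P: "\<And>Q p q. Q \<in> pairs Z \<Longrightarrow> Q \<noteq> P \<Longrightarrow> Q \<in> t \<Longrightarrow> Q \<in> u \<Longrightarrow> p \<in> plc Z Q \<Longrightarrow> q \<in> plc Z Q \<Longrightarrow>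
      through (h_grading \<mu>2) p \<Longrightarrow> through (h_grading \<mu>2) q" "P \<notin> s"
    and g1: "good Z (h_grading \<mu>1, s, t)" and ad: "adapted can (\<lambda>e. h_grading \<mu>1 e + h_grading \<mu>2 e, s, u)"
    and mm: "crossing_places Z (\<mu>1, s, t) = {} \<Longrightarrow> (\<exists>Q\<in>pairs Z. mismatch Z \<mu>1 \<mu>2 Q) \<longleftrightarrow> bad"
  shows "crossless_count can (elt Z (\<mu>1, s, t) \<odot> elt Z (\<mu>2, t, u)) =
    of_bool (crossing_places Z (\<mu>1, s, t) = {}) * of_bool (\<not> bad \<and> crossing_places Z (\<mu>2, t, u) \<subseteq> plc Z P)"
proof -
  have c1: "dotted Z (\<mu>1, s, t) (pair_of Z x) \<and> dotted Z (\<mu>2, t, u) (pair_of Z x)"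
    if x: "x \<in> crossing_places Z (\<mu>1, s, t)" for x
  proof -
    have "x \<in> places Z" "dotted Z (\<mu>1, s, t) (pair_of Z x)" using x by (auto simp: crossing_places_def)
    then have "pair_of Z x \<in> pairs Z" "pair_of Z x \<in> s" "pair_of Z x \<in> t" using place_in_plc[of x Z] by (auto simp: dotted_def)
    then have "\<forall>p\<in>plc Z (pair_of Z x). \<forall>q\<in>plc Z (pair_of Z x). through (h_grading \<mu>1) p \<longrightarrow> through (h_grading \<mu>1) q"
      using g1 unfolding good_def by blast
    from crossing_full[OF vd1 x this] show ?thesis using dotted_right by blast
  qed
  have c2: "dotted Z (\<mu>1, s, t) (pair_of Z x) \<and> dotted Z (\<mu>2, t, u) (pair_of Z x)"
    if x: "x \<in> crossing_places Z (\<mu>2, t, u)" "x \<notin> plc Z P" for x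
  proof -
    have xp: "x \<in> places Z" "dotted Z (\<mu>2, t, u) (pair_of Z x)" using x by (auto simp: crossing_places_def)
    then have "pair_of Z x \<in> pairs Z" "pair_of Z x \<in> t" "pair_of Z x \<in> u" "pair_of Z x \<noteq> P"
      using place_in_plc[OF xp(1)] x(2) by (auto simp: dotted_def)
    then have "\<forall>p\<in>plc Z (pair_of Z x). \<forall>q\<in>plc Z (pair_of Z x). through (h_grading \<mu>2) p \<longrightarrow> through (h_grading \<mu>2) q"
      using P(1) by blast
    from crossing_full[OF vd2 x(1) this] show ?thesis using dotted_left by blast
  qed
  show ?thesis
  proof (cases "\<exists>Q\<in>pairs Z. mismatch Z \<mu>1 \<mu>2 Q")
    case True
    then have "elt Z (\<mu>1, s, t) \<odot> elt Z (\<mu>2, t, u) = 0" using mult_elt_mismatch by blast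
    then show ?thesis using mm True by auto
  next
    case False
    then have n: "\<forall>Q\<in>pairs Z. \<not> mismatch Z \<mu>1 \<mu>2 Q" by blast
    note vc = diagram_compose[OF n]
    have "adapted can (h_grading \<mu>12, s, u)" using ad by (simp add: h_grading_compose)
    then have c: "crossless_count can (elt Z (\<mu>1, s, t) \<odot> elt Z (\<mu>2, t, u)) = of_bool (crossing_places Z (\<mu>12, s, u) = {})"
      unfolding mult_elt[OF n] by (rule crossless_count_elt[OF vc])
    show ?thesis
    proof (cases "crossing_places Z (\<mu>1, s, t) = {}")
      case False
      then have "crossing_places Z (\<mu>12, s, u) \<noteq> {}" using c1 crossing_places_compose[OF n] by blast
      then show ?thesis using c False by simp
    next
      case e1: True
      have "crossing_places Z (\<mu>12, s, u) = {} \<longleftrightarrow> crossing_places Z (\<mu>2, t, u) \<subseteq> plc Z P"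
      proof
        assume "crossing_places Z (\<mu>12, s, u) = {}"
        then show "crossing_places Z (\<mu>2, t, u) \<subseteq> plc Z P" using c2 crossing_places_compose[OF n] by blast
      next
        assume sub: "crossing_places Z (\<mu>2, t, u) \<subseteq> plc Z P"
        show "crossing_places Z (\<mu>12, s, u) = {}"
        proof (rule ccontr)
          assume "crossing_places Z (\<mu>12, s, u) \<noteq> {}"
          then obtain x where x: "x \<in> crossing_places Z (\<mu>2, t, u)" "dotted Z (\<mu>1, s, t) (pair_of Z x)"
            using crossing_places_compose[OF n] e1 by blast
          then have "pair_of Z x = P" using sub by (auto simp: plc_def)
          then show False using x(2) P(2) by (simp add: dotted_def)
        qed
      qed
      then show ?thesis using c e1 mm[OF e1] False by simp
    qed
  qed
qed

end

context arc
begin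

text \<open>Resolutions at other pairs cancel as for good H-data. At \<open>P\<close> only
  \<open>p\<close> can be a crossing place, so its resolution has no partner, and it is counted iff
  no crossings are left elsewhere.\<close>

lemma count_diff_except:
  assumes vd: "viable_diagram \<mu> s t" and ad: "adapted can (h_grading \<mu>, s, t)"
    and P: "plc Z P = {p, q}" "through (h_grading \<mu>) p" "\<not> through (h_grading \<mu>) q"
    and g: "\<And>Q x y. Q \<in> pairs Z \<Longrightarrow> Q \<noteq> P \<Longrightarrow> Q \<in> s \<Longrightarrow> Q \<in> t \<Longrightarrow> x \<in> plc Z Q \<Longrightarrow> y \<in> plc Z Q \<Longrightarrow>
      through (h_grading \<mu>) x \<Longrightarrow> through (h_grading \<mu>) y"
  shows "crossless_count can (diff (elt Z (\<mu>, s, t))) = of_bool (dotted Z (\<mu>, s, t) P \<and> crossing_places Z (\<mu>, s, t) \<subseteq> plc Z P)"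
proof -
  let ?c = "crossing_places Z (\<mu>, s, t)" and ?f = "\<lambda>x. of_bool (crossing_places Z (break_at x \<mu>, s, t) = {}) :: bit"
  note ci = crossing_places_iff[OF vd]
  have pp: "p \<in> places Z" "pair_of Z p = P" using P by (auto simp: plc_def)
  have cP: "?c \<inter> plc Z P \<subseteq> {p}" using P ci by auto
  have pc: "p \<in> ?c \<longleftrightarrow> dotted Z (\<mu>, s, t) P" using ci pp P(2) by auto
  have A: "(\<Sum>x\<in>?c - {p}. ?f x) = 0"
  proof (rule count_break_cancel[OF vd])
    fix x y assume x: "x \<in> ?c - {p}" and y: "y \<in> plc Z (pair_of Z x)"
    have *: "x \<in> places Z" "dotted Z (\<mu>, s, t) (pair_of Z x)" "through (h_grading \<mu>) x" using x ci by auto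
    have nP: "pair_of Z x \<noteq> P" using x cP *(1) by (auto simp: plc_def)
    have "through (h_grading \<mu>) y"
      using g[of "pair_of Z x" x y] nP y *(2,3) place_in_plc[OF *(1)] by (auto simp: dotted_def)
    then show "y \<in> ?c - {p}" using ci *(2) y nP pp(2) by (auto simp: plc_def)
  qed (use finite_crossing_places in auto)
  show ?thesis
  proof (cases "p \<in> ?c")
    case True
    have "(\<Sum>x\<in>?c. ?f x) = ?f p + (\<Sum>x\<in>?c - {p}. ?f x)"
      by (rule sum.remove[OF finite_crossing_places True])
    also have "\<dots> = of_bool (?c - plc Z P = {})"
      using A break_viable_diagram(3)[OF vd True] pp(2) by simp
    finally show ?thesis
      unfolding crossless_count_diff_elt[OF vd ad] using True pc by (simp add: Diff_eq_empty_iff)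
  next
    case False
    then have "?c - {p} = ?c" by blast
    then show ?thesis unfolding crossless_count_diff_elt[OF vd ad] using A False pc by simp
  qed
qed

end

text \<open>What tightness at a pair provides, expressed by H-data alone. It therefore persists when
  representatives are replaced by other diagrams of the chains f_1.\<close>

definition regular_at :: "('i, 'l) arc_diag \<Rightarrow> 'i h1 \<Rightarrow> 'i h1 \<Rightarrow> 'i h1 \<Rightarrow> 'l set \<Rightarrow> 'l set \<Rightarrow> 'l set \<Rightarrow> 'l set \<Rightarrow> 'l \<Rightarrow> bool" where
  "regular_at Z h1 h2 h3 s1 t1 t2 t3 Q \<longleftrightarrow> \<not> pattern_at Z h1 h2 h3 s1 t1 t2 t3 Q \<and>
    (Q \<in> s1 \<longrightarrow> Q \<in> t3 \<longrightarrow> (\<forall>p\<in>plc Z Q. through (\<lambda>e. h1 e + h2 e + h3 e) p) \<or> (\<forall>p\<in>plc Z Q. \<not> through (\<lambda>e. h1 e + h2 e + h3 e) p)) \<and>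
    (\<forall>p q. plc Z Q = {p, q} \<longrightarrow> p \<noteq> q \<longrightarrow> (\<exists>D R V D' R' V'. diagram_bits
       (before (\<lambda>e. h1 e + h2 e + h3 e) p = 1) (h1 p + h2 p + h3 p = 1)
       (before (\<lambda>e. h1 e + h2 e + h3 e) q = 1) (h1 q + h2 q + h3 q = 1) (Q \<in> s1) (Q \<in> t3) D R V D' R' V'))"

context arc
begin

text \<open>By bilinearity it suffices that the count factorises on pairs of diagrams.\<close>

lemma crossless_count_mult:
  assumes "\<And>\<mu> \<nu>. \<mu> \<in> F \<Longrightarrow> \<nu> \<in> G \<Longrightarrow> crossless_count can (elt Z (\<mu>, s, t) \<odot> elt Z (\<nu>, t, u)) = \<phi> \<mu> * \<psi> \<nu>"
  shows "crossless_count can ((\<Sum>\<mu>\<in>F. elt Z (\<mu>, s, t)) \<odot> (\<Sum>\<nu>\<in>G. elt Z (\<nu>, t, u))) = (\<Sum>\<mu>\<in>F. \<phi> \<mu>) * (\<Sum>\<nu>\<in>G. \<psi> \<nu>)"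
proof -
  have "crossless_count can ((\<Sum>\<mu>\<in>F. elt Z (\<mu>, s, t)) \<odot> (\<Sum>\<nu>\<in>G. elt Z (\<nu>, t, u))) =
      (\<Sum>\<mu>\<in>F. \<Sum>\<nu>\<in>G. crossless_count can (elt Z (\<mu>, s, t) \<odot> elt Z (\<nu>, t, u)))"
    unfolding mult_sum_left mult_sum_right crossless_count_sum by (rule sum.swap)
  also have "\<dots> = (\<Sum>\<mu>\<in>F. \<Sum>\<nu>\<in>G. \<phi> \<mu> * \<psi> \<nu>)" using assms by simp
  finally show ?thesis unfolding sum_product .
qed

end

context tight_triple
begin

abbreviation "regular \<equiv> regular_at Z h1 h2 h3 s1 t1 t2 t3"
abbreviation "h12 \<equiv> (\<lambda>e. h1 e + h2 e)"
abbreviation "h23 \<equiv> (\<lambda>e. h2 e + h3 e)"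

lemma tight_at_regular:
  assumes "P \<in> pairs Z" "tight_at Z P [M1, M2, M3]"
  shows "regular P"
  unfolding regular_at_def using tight_at_imp[OF assms] by blast

lemma pair_values:
  assumes "p \<in> places Z"
  shows "before h12 p = 1 \<longleftrightarrow> before h1 p = 1 \<or> before h2 p = 1" "h12 p = 1 \<longleftrightarrow> h1 p = 1 \<or> h2 p = 1"
    "before h23 p = 1 \<longleftrightarrow> before h2 p = 1 \<or> before h3 p = 1" "h23 p = 1 \<longleftrightarrow> h2 p = 1 \<or> h3 p = 1"
proof -
  have *: "(h12 e = 1 \<longleftrightarrow> h1 e = 1 \<or> h2 e = 1) \<and> (h23 e = 1 \<longleftrightarrow> h2 e = 1 \<or> h3 e = 1)" if "e \<in> steps Z" for e
    using step_values(1-4)[OF that] unfolding disjoint3_def by (auto simp: of_bool_def split: if_splits)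
  show "before h12 p = 1 \<longleftrightarrow> before h1 p = 1 \<or> before h2 p = 1" "h12 p = 1 \<longleftrightarrow> h1 p = 1 \<or> h2 p = 1"
    "before h23 p = 1 \<longleftrightarrow> before h2 p = 1 \<or> before h3 p = 1" "h23 p = 1 \<longleftrightarrow> h2 p = 1 \<or> h3 p = 1"
    unfolding before_def using * place_steps[OF assms] by blast+
qed

context
  fixes Q p q
  assumes Q: "Q \<in> pairs Z" and pq: "plc Z Q = {p, q}" "p \<noteq> q"
begin

lemma places_pq: "p \<in> places Z" "q \<in> places Z"
  using pq by (auto simp: plc_def)

lemmas tbs = tight_bitsI[OF tight1 Q pq] tight_bitsI[OF tight2 Q pq] tight_bitsI[OF tight3 Q pq]

lemmas djs = before_values(1,2)[OF places_pq(1)] before_values(1,2)[OF places_pq(2)]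

lemma left_bits:
  assumes "viable_diagram E s1 t2" "h_grading E = h12"
  shows "diagram_bits (before h1 p = 1 \<or> before h2 p = 1) (h1 p = 1 \<or> h2 p = 1)
      (before h1 q = 1 \<or> before h2 q = 1) (h1 q = 1 \<or> h2 q = 1) (Q \<in> s1) (Q \<in> t2)
    (p \<in> Domain E) (p \<in> Range E) (passes E p) (q \<in> Domain E) (q \<in> Range E) (passes E q)"
  using diagram_bitsI[OF assms(1) Q pq] unfolding assms(2) pair_values[OF places_pq(1)] pair_values[OF places_pq(2)] .

lemma right_bits:
  assumes "viable_diagram E t1 t3" "h_grading E = h23"
  shows "diagram_bits (before h2 p = 1 \<or> before h3 p = 1) (h2 p = 1 \<or> h3 p = 1)
      (before h2 q = 1 \<or> before h3 q = 1) (h2 q = 1 \<or> h3 q = 1) (Q \<in> t1) (Q \<in> t3)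
    (p \<in> Domain E) (p \<in> Range E) (passes E p) (q \<in> Domain E) (q \<in> Range E) (passes E q)"
  using diagram_bitsI[OF assms(1) Q pq] unfolding assms(2) pair_values[OF places_pq(1)] pair_values[OF places_pq(2)] .

lemma regular_bits:
  assumes "regular Q"
  obtains D R V D' R' V' where
    "diagram_bits (before h1 p = 1 \<or> before h2 p = 1 \<or> before h3 p = 1) (h1 p = 1 \<or> h2 p = 1 \<or> h3 p = 1)
      (before h1 q = 1 \<or> before h2 q = 1 \<or> before h3 q = 1) (h1 q = 1 \<or> h2 q = 1 \<or> h3 q = 1) (Q \<in> s1) (Q \<in> t3) D R V D' R' V'"
    "Q \<in> s1 \<and> Q \<in> t3 \<longrightarrow> ((before h1 p = 1 \<or> before h2 p = 1 \<or> before h3 p = 1) \<and> (h1 p = 1 \<or> h2 p = 1 \<or> h3 p = 1) \<longleftrightarrow>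
      (before h1 q = 1 \<or> before h2 q = 1 \<or> before h3 q = 1) \<and> (h1 q = 1 \<or> h2 q = 1 \<or> h3 q = 1))"
    "\<not> pattern_bits (before h1 p = 1) (h1 p = 1) (before h1 q = 1) (h1 q = 1)
       (before h2 p = 1) (h2 p = 1) (before h2 q = 1) (h2 q = 1)
       (before h3 p = 1) (h3 p = 1) (before h3 q = 1) (h3 q = 1) (Q \<in> s1) (Q \<in> t1) (Q \<in> t2) (Q \<in> t3)"
proof -
  have 1: "\<not> pattern Q" "Q \<in> s1 \<longrightarrow> Q \<in> t3 \<longrightarrow> (\<forall>p\<in>plc Z Q. through h123 p) \<or> (\<forall>p\<in>plc Z Q. \<not> through h123 p)"
    "\<exists>D R V D' R' V'. diagram_bits (before h123 p = 1) (h123 p = 1) (before h123 q = 1) (h123 q = 1) (Q \<in> s1) (Q \<in> t3) D R V D' R' V'"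
    using assms pq unfolding regular_at_def by blast+
  have 2: "Q \<in> s1 \<and> Q \<in> t3 \<longrightarrow> (through h123 p \<longleftrightarrow> through h123 q)" using 1(2) pq(1) by blast
  from 1(3) obtain D R V D' R' V' where 3: "diagram_bits (before h123 p = 1) (h123 p = 1) (before h123 q = 1) (h123 q = 1) (Q \<in> s1) (Q \<in> t3) D R V D' R' V'"
    by blast
  note bv = before_values(3,4)[OF places_pq(1)] before_values(3,4)[OF places_pq(2)]
  show ?thesis
    by (rule that[OF 3[unfolded bv] 2[unfolded through_def bv] 1(1)[unfolded pattern_at_iff[OF pq]]])
qed

lemma regular_good:
  assumes "regular Q"
  shows "Q \<in> s1 \<Longrightarrow> Q \<in> t2 \<Longrightarrow> through h12 p \<longleftrightarrow> through h12 q" "Q \<in> t1 \<Longrightarrow> Q \<in> t3 \<Longrightarrow> through h23 p \<longleftrightarrow> through h23 q"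
proof -
  obtain D R V D' R' V' where *: 
    "diagram_bits (before h1 p = 1 \<or> before h2 p = 1 \<or> before h3 p = 1) (h1 p = 1 \<or> h2 p = 1 \<or> h3 p = 1)
      (before h1 q = 1 \<or> before h2 q = 1 \<or> before h3 q = 1) (h1 q = 1 \<or> h2 q = 1 \<or> h3 q = 1) (Q \<in> s1) (Q \<in> t3) D R V D' R' V'"
    "Q \<in> s1 \<and> Q \<in> t3 \<longrightarrow> ((before h1 p = 1 \<or> before h2 p = 1 \<or> before h3 p = 1) \<and> (h1 p = 1 \<or> h2 p = 1 \<or> h3 p = 1) \<longleftrightarrow>
      (before h1 q = 1 \<or> before h2 q = 1 \<or> before h3 q = 1) \<and> (h1 q = 1 \<or> h2 q = 1 \<or> h3 q = 1))"
    "\<not> pattern_bits (before h1 p = 1) (h1 p = 1) (before h1 q = 1) (h1 q = 1)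
       (before h2 p = 1) (h2 p = 1) (before h2 q = 1) (h2 q = 1)
       (before h3 p = 1) (h3 p = 1) (before h3 q = 1) (h3 q = 1) (Q \<in> s1) (Q \<in> t1) (Q \<in> t2) (Q \<in> t3)"
    using regular_bits[OF assms] .
  show "Q \<in> s1 \<Longrightarrow> Q \<in> t2 \<Longrightarrow> through h12 p \<longleftrightarrow> through h12 q"
    unfolding through_def pair_values(1,2)[OF places_pq(1)] pair_values(1,2)[OF places_pq(2)]
    using good_12[OF tbs djs *] by blast
  show "Q \<in> t1 \<Longrightarrow> Q \<in> t3 \<Longrightarrow> through h23 p \<longleftrightarrow> through h23 q"
    unfolding through_def pair_values(3,4)[OF places_pq(1)] pair_values(3,4)[OF places_pq(2)]
    using good_23[OF tbs djs *] by blast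
qed

lemma regular_ends:
  assumes "regular Q"
  shows "\<not> (p \<in> Range \<mu>1 \<and> q \<in> Domain \<mu>2)" "\<not> (p \<in> Range \<mu>2 \<and> q \<in> Domain \<mu>3)"
    "viable_diagram E s1 t2 \<Longrightarrow> h_grading E = h12 \<Longrightarrow> \<not> (p \<in> Range E \<and> q \<in> Domain \<mu>3)"
    "viable_diagram E t1 t3 \<Longrightarrow> h_grading E = h23 \<Longrightarrow> \<not> (p \<in> Range \<mu>1 \<and> q \<in> Domain E)"
proof -
  obtain D R V D' R' V' where *: 
    "diagram_bits (before h1 p = 1 \<or> before h2 p = 1 \<or> before h3 p = 1) (h1 p = 1 \<or> h2 p = 1 \<or> h3 p = 1)
      (before h1 q = 1 \<or> before h2 q = 1 \<or> before h3 q = 1) (h1 q = 1 \<or> h2 q = 1 \<or> h3 q = 1) (Q \<in> s1) (Q \<in> t3) D R V D' R' V'"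
    "Q \<in> s1 \<and> Q \<in> t3 \<longrightarrow> ((before h1 p = 1 \<or> before h2 p = 1 \<or> before h3 p = 1) \<and> (h1 p = 1 \<or> h2 p = 1 \<or> h3 p = 1) \<longleftrightarrow>
      (before h1 q = 1 \<or> before h2 q = 1 \<or> before h3 q = 1) \<and> (h1 q = 1 \<or> h2 q = 1 \<or> h3 q = 1))"
    "\<not> pattern_bits (before h1 p = 1) (h1 p = 1) (before h1 q = 1) (h1 q = 1)
       (before h2 p = 1) (h2 p = 1) (before h2 q = 1) (h2 q = 1)
       (before h3 p = 1) (h3 p = 1) (before h3 q = 1) (h3 q = 1) (Q \<in> s1) (Q \<in> t1) (Q \<in> t2) (Q \<in> t3)"
    using regular_bits[OF assms] .
  show "\<not> (p \<in> Range \<mu>1 \<and> q \<in> Domain \<mu>2)" "\<not> (p \<in> Range \<mu>2 \<and> q \<in> Domain \<mu>3)"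
    by (rule no_mismatch_consecutive[OF tbs djs *(1,3)])+
  show "\<not> (p \<in> Range E \<and> q \<in> Domain \<mu>3)" if "viable_diagram E s1 t2" "h_grading E = h12"
    by (rule no_mismatch_left[OF tbs djs * left_bits[OF that]])
  show "\<not> (p \<in> Range \<mu>1 \<and> q \<in> Domain E)" if "viable_diagram E t1 t3" "h_grading E = h23"
    by (rule no_mismatch_right[OF tbs djs * right_bits[OF that]])
qed

end

lemma plc_pair:
  assumes "Q \<in> pairs Z" "p \<in> plc Z Q" "q \<in> plc Z Q" "p \<noteq> q"
  shows "plc Z Q = {p, q}"
  using plc_obtain[OF assms(1,2)] assms(3,4) by (metis insert_iff singletonD)

lemma regular_through:
  assumes "Q \<in> pairs Z" "regular Q" "p \<in> plc Z Q" "q \<in> plc Z Q"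
  shows "Q \<in> s1 \<Longrightarrow> Q \<in> t2 \<Longrightarrow> through h12 p \<Longrightarrow> through h12 q" "Q \<in> t1 \<Longrightarrow> Q \<in> t3 \<Longrightarrow> through h23 p \<Longrightarrow> through h23 q"
  using regular_good[OF assms(1) plc_pair[OF assms(1,3,4)] _ assms(2)] by (cases "p = q"; blast)+

lemma regular_mismatch:
  assumes "Q \<in> pairs Z" "regular Q"
  shows "\<not> mismatch Z \<mu>1 \<mu>2 Q" "\<not> mismatch Z \<mu>2 \<mu>3 Q"
    "viable_diagram E s1 t2 \<Longrightarrow> h_grading E = h12 \<Longrightarrow> \<not> mismatch Z E \<mu>3 Q"
    "viable_diagram E t1 t3 \<Longrightarrow> h_grading E = h23 \<Longrightarrow> \<not> mismatch Z \<mu>1 E Q"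
proof -
  have I: "\<not> mismatch Z \<mu> \<nu> Q" if n: "\<And>p q. plc Z Q = {p, q} \<Longrightarrow> p \<noteq> q \<Longrightarrow> \<not> (p \<in> Range \<mu> \<and> q \<in> Domain \<nu>)" for \<mu> \<nu>
  proof
    assume "mismatch Z \<mu> \<nu> Q"
    then obtain p q where p: "p \<in> plc Z Q" "q \<in> plc Z Q" "p \<noteq> q" "p \<in> Range \<mu>" "q \<in> Domain \<nu>" unfolding mismatch_def by blast
    then show False using n[OF plc_pair[OF assms(1) p(1-3)] p(3)] by simp
  qed
  show "\<not> mismatch Z \<mu>1 \<mu>2 Q" by (rule I) (rule regular_ends(1)[OF assms(1) _ _ assms(2)])
  show "\<not> mismatch Z \<mu>2 \<mu>3 Q" by (rule I) (rule regular_ends(2)[OF assms(1) _ _ assms(2)])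
  show "\<not> mismatch Z E \<mu>3 Q" if "viable_diagram E s1 t2" "h_grading E = h12"
    by (rule I) (rule regular_ends(3)[OF assms(1) _ _ assms(2) that])
  show "\<not> mismatch Z \<mu>1 E Q" if "viable_diagram E t1 t3" "h_grading E = h23"
    by (rule I) (rule regular_ends(4)[OF assms(1) _ _ assms(2) that])
qed

lemma no_mismatch_outside:
  assumes "P \<in> pairs Z" "P \<notin> t" "viable_diagram \<mu> s t"
  shows "\<not> mismatch Z \<mu> \<nu> P"
proof -
  obtain p q where pq: "plc Z P = {p, q}" "p \<noteq> q" using pair_places[OF assms(1)] .
  have "compat Z (\<mu>, s, t) P" by (rule viable_diagramD(7)[OF assms(3,1)])
  then show ?thesis using assms(2) unfolding compat_bits[OF pq] mismatch_bits[OF pq] by blast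
qed

lemma total_good:
  assumes "\<And>Q. Q \<in> pairs Z \<Longrightarrow> Q \<noteq> P \<Longrightarrow> regular Q" "P \<notin> s1 \<or> P \<notin> t3"
  shows "good Z (h123, s1, t3)"
  unfolding good_def prod.case using assms unfolding regular_at_def by blast

text \<open>The chains f_1 may contain diagrams other than the chosen representatives. Those without
  crossings are tight, since their H-data are good, so the analysis of tight triples applies to them
  as well.\<close>

lemma replace_reps:
  assumes "viable_diagram \<nu>1 s1 t1" "h_grading \<nu>1 = h1" "crossing_places Z (\<nu>1, s1, t1) = {}"
    "viable_diagram \<nu>2 t1 t2" "h_grading \<nu>2 = h2" "crossing_places Z (\<nu>2, t1, t2) = {}"
    "viable_diagram \<nu>3 t2 t3" "h_grading \<nu>3 = h3" "crossing_places Z (\<nu>3, t2, t3) = {}"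
  shows "tight_triple Z \<nu>1 \<nu>2 \<nu>3 s1 t1 t2 t3"
  by unfold_locales (use assms tightD(3)[OF tight1] tightD(3)[OF tight2] tightD(3)[OF tight3] viable_sum3 in \<open>simp_all add: tight_iff\<close>)

lemmas own = tightD(1)[OF tight1] refl tightD(2)[OF tight1] tightD(1)[OF tight2] refl tightD(2)[OF tight2]
  tightD(1)[OF tight3] refl tightD(2)[OF tight3]

lemma viable_h_parts: "viable_h Z h1" "viable_h Z h2" "viable_h Z h3"
  using tightD(1) tight1 tight2 tight3 by (auto simp: viable_diagram_def)

lemma goods: "good Z (h1, s1, t1)" "good Z (h2, t1, t2)" "good Z (h3, t2, t3)"
  using tightD(3) tight1 tight2 tight3 by blast+

text \<open>Crossingless diagrams of the two chains are tight, and regularity excludes mismatches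
  between them away from \<open>P\<close>; at \<open>P\<close> no strand of the first factor ends.
  Diagrams with crossings contribute zero on both sides.\<close>

lemma count_12:
  assumes reg: "\<And>Q. Q \<in> pairs Z \<Longrightarrow> Q \<noteq> P \<Longrightarrow> regular Q" and P: "P \<in> pairs Z" "P \<notin> t1" and ad: "adapted can (h12, s1, t2)"
    and x: "x \<in> alg_at Z (h1, s1, t1)" "y \<in> alg_at Z (h2, t1, t2)"
  shows "crossless_count can (x \<odot> y) = crossless_count can x * crossless_count can y"
proof -
  have ch: "choice can" using ad by (simp add: adapted_def)
  obtain F where F: "finite F" "\<And>\<mu>. \<mu> \<in> F \<Longrightarrow> viable_diagram \<mu> s1 t1" "\<And>\<mu>. \<mu> \<in> F \<Longrightarrow> h_grading \<mu> = h1" "x = (\<Sum>\<mu>\<in>F. elt Z (\<mu>, s1, t1))"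
    by (rule alg_at_viableE[OF x(1) viable_h_parts(1)]) blast
  obtain G where G: "finite G" "\<And>\<mu>. \<mu> \<in> G \<Longrightarrow> viable_diagram \<mu> t1 t2" "\<And>\<mu>. \<mu> \<in> G \<Longrightarrow> h_grading \<mu> = h2" "y = (\<Sum>\<mu>\<in>G. elt Z (\<mu>, t1, t2))"
    by (rule alg_at_viableE[OF x(2) viable_h_parts(2)]) blast
  have c1: "crossless_count can (elt Z (\<mu>, s1, t1)) = of_bool (crossing_places Z (\<mu>, s1, t1) = {})" if "\<mu> \<in> F" for \<mu>
    using crossless_count_elt[OF F(2)[OF that]] good_adapted[OF goods(1) ch] F(3)[OF that] by simp
  have c2: "crossless_count can (elt Z (\<nu>, t1, t2)) = of_bool (crossing_places Z (\<nu>, t1, t2) = {})" if "\<nu> \<in> G" for \<nu>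
    using crossless_count_elt[OF G(2)[OF that]] good_adapted[OF goods(2) ch] G(3)[OF that] by simp
  have "crossless_count can (elt Z (\<mu>, s1, t1) \<odot> elt Z (\<nu>, t1, t2)) =
      of_bool (crossing_places Z (\<mu>, s1, t1) = {}) * of_bool (crossing_places Z (\<nu>, t1, t2) = {})"
    if m: "\<mu> \<in> F" "\<nu> \<in> G" for \<mu> \<nu>
  proof -
    interpret c: composable Z \<mu> \<nu> s1 t1 t2
      by unfold_locales (use F(2,3)[OF m(1)] G(2,3)[OF m(2)] pair_sum_viable in simp_all)
    show ?thesis
    proof (cases "crossing_places Z (\<mu>, s1, t1) = {}")
      case True
      have "crossless_count can (elt Z (\<mu>, s1, t1) \<odot> elt Z (\<nu>, t1, t2)) =
        of_bool (\<not> False \<and> crossing_places Z (\<mu>, s1, t1) \<subseteq> {}) * of_bool (crossing_places Z (\<nu>, t1, t2) = {})"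
      proof (rule c.count_mult_left)
        show "through (h_grading \<mu>) q" if "Q \<in> pairs Z" "Q \<in> s1" "Q \<in> t1" "p \<in> plc Z Q" "q \<in> plc Z Q" "through (h_grading \<mu>) p" for Q p q
          using goods(1) that F(3)[OF m(1)] unfolding good_def by auto
        show "good Z (h_grading \<nu>, t1, t2)" using goods(2) G(3)[OF m(2)] by simp
        show "adapted can (\<lambda>e. h_grading \<mu> e + h_grading \<nu> e, s1, t2)" using ad F(3)[OF m(1)] G(3)[OF m(2)] by simp
        show "(\<exists>Q\<in>pairs Z. mismatch Z \<mu> \<nu> Q) \<longleftrightarrow> False" if c0: "crossing_places Z (\<nu>, t1, t2) = {}"
        proof -
          interpret n: tight_triple Z \<mu> \<nu> \<mu>3 s1 t1 t2 t3
            by (rule replace_reps[OF F(2,3)[OF m(1)] True G(2,3)[OF m(2)] c0 own(7-9)])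
          have "\<not> mismatch Z \<mu> \<nu> Q" if Q: "Q \<in> pairs Z" for Q
          proof (cases "Q = P")
            case False
            then have "n.regular Q" using reg[OF Q] F(3)[OF m(1)] G(3)[OF m(2)] by simp
            then show ?thesis using n.regular_mismatch(1)[OF Q] by blast
          qed (use no_mismatch_outside[OF P F(2)[OF m(1)]] in simp)
          then show ?thesis by blast
        qed
      qed simp
      then show ?thesis using True by simp
    next
      case False
      \<comment> \<open>With crossings in the first factor there is no tight triple to rule out
        mismatches. The parameter of \<open>count_mult_left\<close> is set to the existence of a
        mismatch, whose truth value does not matter as the crossings make the factor zero.\<close>
      have "crossless_count can (elt Z (\<mu>, s1, t1) \<odot> elt Z (\<nu>, t1, t2)) =
        of_bool (\<not> (\<exists>Q\<in>pairs Z. mismatch Z \<mu> \<nu> Q) \<and> crossing_places Z (\<mu>, s1, t1) \<subseteq> {}) * of_bool (crossing_places Z (\<nu>, t1, t2) = {})"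
      proof (rule c.count_mult_left)
        show "through (h_grading \<mu>) q" if "Q \<in> pairs Z" "Q \<in> s1" "Q \<in> t1" "p \<in> plc Z Q" "q \<in> plc Z Q" "through (h_grading \<mu>) p" for Q p q
          using goods(1) that F(3)[OF m(1)] unfolding good_def by auto
        show "good Z (h_grading \<nu>, t1, t2)" using goods(2) G(3)[OF m(2)] by simp
        show "adapted can (\<lambda>e. h_grading \<mu> e + h_grading \<nu> e, s1, t2)" using ad F(3)[OF m(1)] G(3)[OF m(2)] by simp
      qed simp_all
      then show ?thesis using False by simp
    qed
  qed
  from crossless_count_mult[OF this] show ?thesis
    unfolding F(4) G(4) crossless_count_sum using c1 c2 by simp
qed

lemma count_23:
  assumes reg: "\<And>Q. Q \<in> pairs Z \<Longrightarrow> Q \<noteq> P \<Longrightarrow> regular Q" and P: "P \<in> pairs Z" "P \<notin> t2" and ad: "adapted can (h23, t1, t3)"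
    and x: "x \<in> alg_at Z (h2, t1, t2)" "y \<in> alg_at Z (h3, t2, t3)"
  shows "crossless_count can (x \<odot> y) = crossless_count can x * crossless_count can y"
proof -
  have ch: "choice can" using ad by (simp add: adapted_def)
  obtain F where F: "finite F" "\<And>\<mu>. \<mu> \<in> F \<Longrightarrow> viable_diagram \<mu> t1 t2" "\<And>\<mu>. \<mu> \<in> F \<Longrightarrow> h_grading \<mu> = h2" "x = (\<Sum>\<mu>\<in>F. elt Z (\<mu>, t1, t2))"
    by (rule alg_at_viableE[OF x(1) viable_h_parts(2)]) blast
  obtain G where G: "finite G" "\<And>\<mu>. \<mu> \<in> G \<Longrightarrow> viable_diagram \<mu> t2 t3" "\<And>\<mu>. \<mu> \<in> G \<Longrightarrow> h_grading \<mu> = h3" "y = (\<Sum>\<mu>\<in>G. elt Z (\<mu>, t2, t3))"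
    by (rule alg_at_viableE[OF x(2) viable_h_parts(3)]) blast
  have c1: "crossless_count can (elt Z (\<mu>, t1, t2)) = of_bool (crossing_places Z (\<mu>, t1, t2) = {})" if "\<mu> \<in> F" for \<mu>
    using crossless_count_elt[OF F(2)[OF that]] good_adapted[OF goods(2) ch] F(3)[OF that] by simp
  have c2: "crossless_count can (elt Z (\<nu>, t2, t3)) = of_bool (crossing_places Z (\<nu>, t2, t3) = {})" if "\<nu> \<in> G" for \<nu>
    using crossless_count_elt[OF G(2)[OF that]] good_adapted[OF goods(3) ch] G(3)[OF that] by simp
  have "crossless_count can (elt Z (\<mu>, t1, t2) \<odot> elt Z (\<nu>, t2, t3)) =
      of_bool (crossing_places Z (\<mu>, t1, t2) = {}) * of_bool (crossing_places Z (\<nu>, t2, t3) = {})"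
    if m: "\<mu> \<in> F" "\<nu> \<in> G" for \<mu> \<nu>
  proof -
    interpret c: composable Z \<mu> \<nu> t1 t2 t3
      by unfold_locales (use F(2,3)[OF m(1)] G(2,3)[OF m(2)] pair_sum_viable in simp_all)
    show ?thesis
    proof (cases "crossing_places Z (\<mu>, t1, t2) = {}")
      case True
      have "crossless_count can (elt Z (\<mu>, t1, t2) \<odot> elt Z (\<nu>, t2, t3)) =
        of_bool (\<not> False \<and> crossing_places Z (\<mu>, t1, t2) \<subseteq> {}) * of_bool (crossing_places Z (\<nu>, t2, t3) = {})"
      proof (rule c.count_mult_left)
        show "through (h_grading \<mu>) q" if "Q \<in> pairs Z" "Q \<in> t1" "Q \<in> t2" "p \<in> plc Z Q" "q \<in> plc Z Q" "through (h_grading \<mu>) p" for Q p q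
          using goods(2) that F(3)[OF m(1)] unfolding good_def by auto
        show "good Z (h_grading \<nu>, t2, t3)" using goods(3) G(3)[OF m(2)] by simp
        show "adapted can (\<lambda>e. h_grading \<mu> e + h_grading \<nu> e, t1, t3)" using ad F(3)[OF m(1)] G(3)[OF m(2)] by simp
        show "(\<exists>Q\<in>pairs Z. mismatch Z \<mu> \<nu> Q) \<longleftrightarrow> False" if c0: "crossing_places Z (\<nu>, t2, t3) = {}"
        proof -
          interpret n: tight_triple Z \<mu>1 \<mu> \<nu> s1 t1 t2 t3
            by (rule replace_reps[OF own(1-3) F(2,3)[OF m(1)] True G(2,3)[OF m(2)] c0])
          have "\<not> mismatch Z \<mu> \<nu> Q" if Q: "Q \<in> pairs Z" for Q
          proof (cases "Q = P")
            case False
            then have "n.regular Q" using reg[OF Q] F(3)[OF m(1)] G(3)[OF m(2)] by simp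
            then show ?thesis using n.regular_mismatch(2)[OF Q] by blast
          qed (use no_mismatch_outside[OF P F(2)[OF m(1)]] in simp)
          then show ?thesis by blast
        qed
      qed simp
      then show ?thesis using True by simp
    next
      case False
      have "crossless_count can (elt Z (\<mu>, t1, t2) \<odot> elt Z (\<nu>, t2, t3)) =
        of_bool (\<not> (\<exists>Q\<in>pairs Z. mismatch Z \<mu> \<nu> Q) \<and> crossing_places Z (\<mu>, t1, t2) \<subseteq> {}) * of_bool (crossing_places Z (\<nu>, t2, t3) = {})"
      proof (rule c.count_mult_left)
        show "through (h_grading \<mu>) q" if "Q \<in> pairs Z" "Q \<in> t1" "Q \<in> t2" "p \<in> plc Z Q" "q \<in> plc Z Q" "through (h_grading \<mu>) p" for Q p q
          using goods(2) that F(3)[OF m(1)] unfolding good_def by auto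
        show "good Z (h_grading \<nu>, t2, t3)" using goods(3) G(3)[OF m(2)] by simp
        show "adapted can (\<lambda>e. h_grading \<mu> e + h_grading \<nu> e, t1, t3)" using ad F(3)[OF m(1)] G(3)[OF m(2)] by simp
      qed simp_all
      then show ?thesis using False by simp
    qed
  qed
  from crossless_count_mult[OF this] show ?thesis
    unfolding F(4) G(4) crossless_count_sum using c1 c2 by simp
qed

end

section \<open>The count at the critical pair\<close>

context tight_triple
begin

text \<open>By the last claim, at \<open>P\<close> multiplication by the third factor keeps exactly
  the diagrams which are dotted there. By \<open>count_diff_except\<close> these are also the ones
  that can contribute to the count of the differential.\<close>

lemma pattern_A_facts:
  assumes P: "P \<in> pairs Z" "plc Z P = {p, q}" "p \<noteq> q"
    and A: "P \<in> s1" "P \<notin> t1" "P \<in> t2" "P \<notin> t3" "h1 p = 1" "before h2 p = 1" "h3 q = 1"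
  shows "through h12 p" "\<not> through h12 q" "\<not> (viable_diagram E t1 t3 \<and> h_grading E = h23)"
    "viable_diagram E s1 t2 \<Longrightarrow> h_grading E = h12 \<Longrightarrow> mismatch Z E \<mu>3 P \<longleftrightarrow> \<not> dotted Z (E, s1, t2) P"
proof -
  note b = pattern_A_bits[OF tbs[OF P] djs[OF P] A]
  note pv = pair_values[OF places_pq(1)[OF P]] pair_values[OF places_pq(2)[OF P]]
  show "through h12 p" "\<not> through h12 q" unfolding through_def pv using b(1,2) by blast+
  show "\<not> (viable_diagram E t1 t3 \<and> h_grading E = h23)" using b(3) right_bits[OF P] by blast
  have q: "q \<in> Domain \<mu>3" using pattern_mismatch_23[OF tbs[OF P] djs[OF P]] A by blast
  show "mismatch Z E \<mu>3 P \<longleftrightarrow> \<not> dotted Z (E, s1, t2) P" if E: "viable_diagram E s1 t2" "h_grading E = h12"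
  proof
    assume "mismatch Z E \<mu>3 P"
    then show "\<not> dotted Z (E, s1, t2) P" unfolding mismatch_def dotted_def by blast
  next
    assume "\<not> dotted Z (E, s1, t2) P"
    then have "p \<in> Domain E \<or> p \<in> Range E \<or> q \<in> Domain E \<or> q \<in> Range E"
      using A unfolding dotted_bits[OF P(2)] by blast
    then have "p \<in> Range E" using b(4)[OF left_bits[OF P E]] by blast
    then show "mismatch Z E \<mu>3 P" using q unfolding mismatch_bits[OF P(2,3)] by blast
  qed
qed

lemma pattern_B_facts:
  assumes P: "P \<in> pairs Z" "plc Z P = {p, q}" "p \<noteq> q"
    and A: "P \<notin> s1" "P \<in> t1" "P \<notin> t2" "P \<in> t3" "before h1 p = 1" "h2 q = 1" "before h3 q = 1"
  shows "through h23 q" "\<not> through h23 p" "\<not> (viable_diagram E s1 t2 \<and> h_grading E = h12)"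
    "viable_diagram E t1 t3 \<Longrightarrow> h_grading E = h23 \<Longrightarrow> mismatch Z \<mu>1 E P \<longleftrightarrow> \<not> dotted Z (E, t1, t3) P"
proof -
  note b = pattern_B_bits[OF tbs[OF P] djs[OF P] A]
  note pv = pair_values[OF places_pq(1)[OF P]] pair_values[OF places_pq(2)[OF P]]
  show "through h23 q" "\<not> through h23 p" unfolding through_def pv using b(1,2) by blast+
  show "\<not> (viable_diagram E s1 t2 \<and> h_grading E = h12)" using b(3) left_bits[OF P] by blast
  have p: "p \<in> Range \<mu>1" using pattern_mismatch_12[OF tbs[OF P] djs[OF P]] A by blast
  show "mismatch Z \<mu>1 E P \<longleftrightarrow> \<not> dotted Z (E, t1, t3) P" if E: "viable_diagram E t1 t3" "h_grading E = h23"
  proof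
    assume "mismatch Z \<mu>1 E P"
    then show "\<not> dotted Z (E, t1, t3) P" unfolding mismatch_def dotted_def by blast
  next
    assume "\<not> dotted Z (E, t1, t3) P"
    then have "p \<in> Domain E \<or> p \<in> Range E \<or> q \<in> Domain E \<or> q \<in> Range E"
      using A unfolding dotted_bits[OF P(2)] by blast
    then have "q \<in> Domain E" using b(4)[OF right_bits[OF P E]] by blast
    then show "mismatch Z \<mu>1 E P" using p unfolding mismatch_bits[OF P(2,3)] by blast
  qed
qed

text \<open>A diagram of \<open>y\<close> contributes iff it is dotted at \<open>P\<close> and
  crossed at most there. This is so for the count of \<open>diff y\<close>, since its crossing at
  the interior place is resolved, and for the count of the product with a crossingless diagram of
  \<open>x3\<close>, since \<open>P\<close> is missing from \<open>t3\<close> and the crossing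
  disappears. Hence the two counts agree up to the factor of \<open>x3\<close>, and
  \<open>diff y\<close> is a product to which \<open>count_12\<close> applies.\<close>

lemma pattern_A_count:
  assumes reg: "\<And>Q. Q \<in> pairs Z \<Longrightarrow> Q \<noteq> P \<Longrightarrow> regular Q"
    and P: "P \<in> pairs Z" "plc Z P = {p, q}" "p \<noteq> q"
    and A: "P \<in> s1" "P \<notin> t1" "P \<in> t2" "P \<notin> t3" "h1 p = 1" "before h2 p = 1" "h3 q = 1"
    and x: "x1 \<in> alg_at Z (h1, s1, t1)" "x2 \<in> alg_at Z (h2, t1, t2)" "x3 \<in> alg_at Z (h3, t2, t3)"
      "y \<in> alg_at Z (h12, s1, t2)" "diff y = x1 \<odot> x2"
  shows "\<exists>can. choice can \<and> crossless_count can (y \<odot> x3) = crossless_count can x1 * crossless_count can x2 * crossless_count can x3"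
proof -
  note Af = pattern_A_facts[OF P A]
  obtain c0 where c0: "choice c0" using ex_choice by blast
  \<comment> \<open>Only \<open>p\<close> is interior to the support of the first product, so it
    must be selected at \<open>P\<close>; at the other pairs any selection works.\<close>
  define can where "can = c0(P := p)"
  have ch: "choice can" using c0 P by (auto simp: choice_def can_def)
  have th12: "through h12 b" if "Q \<in> pairs Z" "Q \<noteq> P" "Q \<in> s1" "Q \<in> t2" "a \<in> plc Z Q" "b \<in> plc Z Q" "through h12 a" for Q a b
    using regular_through(1)[OF that(1) reg[OF that(1,2)] that(5,6,3,4,7)] .
  have ad12: "adapted can (h12, s1, t2)"
    unfolding adapted_def prod.case
  proof (intro conjI ballI impI ch)
    fix Q assume Q: "Q \<in> pairs Z" "Q \<in> s1" "Q \<in> t2" "\<exists>p\<in>plc Z Q. through h12 p"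
    show "through h12 (can Q)"
    proof (cases "Q = P")
      case True
      then show ?thesis using Af(1) by (simp add: can_def)
    next
      case False
      obtain a where "a \<in> plc Z Q" "through h12 a" using Q(4) by blast
      then show ?thesis using th12[OF Q(1) False Q(2,3)] ch Q(1) unfolding choice_def by blast
    qed
  qed
  \<comment> \<open>The total H-data are good even at \<open>P\<close>, which does not belong to
    both outer idempotents.\<close>
  have ad: "adapted can (h123, s1, t3)" by (rule good_adapted[OF total_good[of P] ch]) (use reg A in blast)+
  obtain F where F: "finite F" "\<And>\<mu>. \<mu> \<in> F \<Longrightarrow> viable_diagram \<mu> s1 t2" "\<And>\<mu>. \<mu> \<in> F \<Longrightarrow> h_grading \<mu> = h12" "y = (\<Sum>\<mu>\<in>F. elt Z (\<mu>, s1, t2))"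
    by (rule alg_at_viableE[OF x(4) pair_sum_viable(1)]) blast
  obtain G where G: "finite G" "\<And>\<mu>. \<mu> \<in> G \<Longrightarrow> viable_diagram \<mu> t2 t3" "\<And>\<mu>. \<mu> \<in> G \<Longrightarrow> h_grading \<mu> = h3" "x3 = (\<Sum>\<mu>\<in>G. elt Z (\<mu>, t2, t3))"
    by (rule alg_at_viableE[OF x(3) viable_h_parts(3)]) blast
  have c1: "crossless_count can (diff (elt Z (E, s1, t2))) =
      of_bool (dotted Z (E, s1, t2) P \<and> crossing_places Z (E, s1, t2) \<subseteq> plc Z P)" if E: "E \<in> F" for E
  proof (rule count_diff_except[OF F(2)[OF E] _ P(2)])
    show "adapted can (h_grading E, s1, t2)" using ad12 F(3)[OF E] by simp
    show "through (h_grading E) p" "\<not> through (h_grading E) q" using Af(1,2) F(3)[OF E] by simp_all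
    show "through (h_grading E) b" if "Q \<in> pairs Z" "Q \<noteq> P" "Q \<in> s1" "Q \<in> t2" "a \<in> plc Z Q" "b \<in> plc Z Q" "through (h_grading E) a" for Q a b
      using th12[OF that(1-6)] that(7) F(3)[OF E] by simp
  qed
  have c2: "crossless_count can (elt Z (\<nu>, t2, t3)) = of_bool (crossing_places Z (\<nu>, t2, t3) = {})" if "\<nu> \<in> G" for \<nu>
    using crossless_count_elt[OF G(2)[OF that]] good_adapted[OF goods(3) ch] G(3)[OF that] by simp
  have "crossless_count can (elt Z (E, s1, t2) \<odot> elt Z (\<nu>, t2, t3)) =
      of_bool (dotted Z (E, s1, t2) P \<and> crossing_places Z (E, s1, t2) \<subseteq> plc Z P) * of_bool (crossing_places Z (\<nu>, t2, t3) = {})"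
    if m: "E \<in> F" "\<nu> \<in> G" for E \<nu>
  proof -
    interpret c: composable Z E \<nu> s1 t2 t3
      by unfold_locales (use F(2,3)[OF m(1)] G(2,3)[OF m(2)] viable_sum3 in simp_all)
    have "crossless_count can (elt Z (E, s1, t2) \<odot> elt Z (\<nu>, t2, t3)) =
      of_bool (\<not> (\<not> dotted Z (E, s1, t2) P) \<and> crossing_places Z (E, s1, t2) \<subseteq> plc Z P) * of_bool (crossing_places Z (\<nu>, t2, t3) = {})"
    proof (rule c.count_mult_left[where P = P])
      show "through (h_grading E) b" if "Q \<in> pairs Z" "plc Z Q \<noteq> plc Z P" "Q \<in> s1" "Q \<in> t2" "a \<in> plc Z Q" "b \<in> plc Z Q" "through (h_grading E) a" for Q a b
        using th12[OF that(1) _ that(3-6)] that(2,7) F(3)[OF m(1)] by auto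
      show "plc Z P = {} \<or> plc Z P = plc Z P \<and> P \<notin> t3" using A by simp
      show "good Z (h_grading \<nu>, t2, t3)" using goods(3) G(3)[OF m(2)] by simp
      show "adapted can (\<lambda>e. h_grading E e + h_grading \<nu> e, s1, t3)" using ad F(3)[OF m(1)] G(3)[OF m(2)] by simp
      show "(\<exists>Q\<in>pairs Z. mismatch Z E \<nu> Q) \<longleftrightarrow> \<not> dotted Z (E, s1, t2) P" if c0: "crossing_places Z (\<nu>, t2, t3) = {}"
      proof -
        interpret n: tight_triple Z \<mu>1 \<mu>2 \<nu> s1 t1 t2 t3
          by (rule replace_reps[OF own(1-6) G(2,3)[OF m(2)] c0])
        have "\<not> mismatch Z E \<nu> Q" if Q: "Q \<in> pairs Z" "Q \<noteq> P" for Q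
          by (rule n.regular_mismatch(3)[OF Q(1) _ F(2,3)[OF m(1) ]]) (use reg[OF Q] G(3)[OF m(2)] m(1) in simp_all)
        moreover have "h3' q = 1" if "h3' = h3" for h3' using A(7) that by simp
        then have "mismatch Z E \<nu> P \<longleftrightarrow> \<not> dotted Z (E, s1, t2) P"
          using n.pattern_A_facts(4)[OF P A(1-6) _ F(2,3)[OF m(1)]] G(3)[OF m(2)] by blast
        ultimately show ?thesis using P(1) by metis
      qed
    qed
    then show ?thesis by simp
  qed
  from crossless_count_mult[OF this]
  have "crossless_count can (y \<odot> x3) = crossless_count can (diff y) * crossless_count can x3"
    unfolding F(4) G(4) diff_sum crossless_count_sum using c1 c2 by simp
  also have "crossless_count can (diff y) = crossless_count can x1 * crossless_count can x2"
    unfolding x(5) by (rule count_12[OF reg P(1) A(2) ad12 x(1,2)])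
  finally show ?thesis using ch by blast
qed

text \<open>The mirror image of \<open>pattern_A_count\<close>, with \<open>y\<close> on the right.
  The crossing at \<open>P\<close> now disappears because \<open>P\<close> is missing from the left
  idempotent \<open>s1\<close>.\<close>

lemma pattern_B_count:
  assumes reg: "\<And>Q. Q \<in> pairs Z \<Longrightarrow> Q \<noteq> P \<Longrightarrow> regular Q"
    and P: "P \<in> pairs Z" "plc Z P = {p, q}" "p \<noteq> q"
    and A: "P \<notin> s1" "P \<in> t1" "P \<notin> t2" "P \<in> t3" "before h1 p = 1" "h2 q = 1" "before h3 q = 1"
    and x: "x1 \<in> alg_at Z (h1, s1, t1)" "x2 \<in> alg_at Z (h2, t1, t2)" "x3 \<in> alg_at Z (h3, t2, t3)"
      "y \<in> alg_at Z (h23, t1, t3)" "diff y = x2 \<odot> x3"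
  shows "\<exists>can. choice can \<and> crossless_count can (x1 \<odot> y) = crossless_count can x1 * crossless_count can x2 * crossless_count can x3"
proof -
  note Af = pattern_B_facts[OF P A]
  obtain c0 where c0: "choice c0" using ex_choice by blast
  \<comment> \<open>For the product of the last two factors the interior place is
    \<open>q\<close>.\<close>
  define can where "can = c0(P := q)"
  have ch: "choice can" using c0 P by (auto simp: choice_def can_def)
  have th23: "through h23 b" if "Q \<in> pairs Z" "Q \<noteq> P" "Q \<in> t1" "Q \<in> t3" "a \<in> plc Z Q" "b \<in> plc Z Q" "through h23 a" for Q a b
    using regular_through(2)[OF that(1) reg[OF that(1,2)] that(5,6,3,4,7)] .
  have ad23: "adapted can (h23, t1, t3)"
    unfolding adapted_def prod.case
  proof (intro conjI ballI impI ch)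
    fix Q assume Q: "Q \<in> pairs Z" "Q \<in> t1" "Q \<in> t3" "\<exists>p\<in>plc Z Q. through h23 p"
    show "through h23 (can Q)"
    proof (cases "Q = P")
      case True
      then show ?thesis using Af(1) by (simp add: can_def)
    next
      case False
      obtain a where "a \<in> plc Z Q" "through h23 a" using Q(4) by blast
      then show ?thesis using th23[OF Q(1) False Q(2,3)] ch Q(1) unfolding choice_def by blast
    qed
  qed
  have ad: "adapted can (h123, s1, t3)" by (rule good_adapted[OF total_good[of P] ch]) (use reg A in blast)+
  obtain F where F: "finite F" "\<And>\<mu>. \<mu> \<in> F \<Longrightarrow> viable_diagram \<mu> s1 t1" "\<And>\<mu>. \<mu> \<in> F \<Longrightarrow> h_grading \<mu> = h1" "x1 = (\<Sum>\<mu>\<in>F. elt Z (\<mu>, s1, t1))"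
    by (rule alg_at_viableE[OF x(1) viable_h_parts(1)]) blast
  obtain G where G: "finite G" "\<And>\<mu>. \<mu> \<in> G \<Longrightarrow> viable_diagram \<mu> t1 t3" "\<And>\<mu>. \<mu> \<in> G \<Longrightarrow> h_grading \<mu> = h23" "y = (\<Sum>\<mu>\<in>G. elt Z (\<mu>, t1, t3))"
    by (rule alg_at_viableE[OF x(4) pair_sum_viable(2)]) blast
  have c1: "crossless_count can (diff (elt Z (E, t1, t3))) =
      of_bool (dotted Z (E, t1, t3) P \<and> crossing_places Z (E, t1, t3) \<subseteq> plc Z P)" if E: "E \<in> G" for E
  proof (rule count_diff_except[OF G(2)[OF E]])
    show "adapted can (h_grading E, t1, t3)" using ad23 G(3)[OF E] by simp
    show "plc Z P = {q, p}" using P(2) by auto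
    show "through (h_grading E) q" "\<not> through (h_grading E) p" using Af(1,2) G(3)[OF E] by simp_all
    show "through (h_grading E) b" if "Q \<in> pairs Z" "Q \<noteq> P" "Q \<in> t1" "Q \<in> t3" "a \<in> plc Z Q" "b \<in> plc Z Q" "through (h_grading E) a" for Q a b
      using th23[OF that(1-6)] that(7) G(3)[OF E] by simp
  qed
  have c2: "crossless_count can (elt Z (\<nu>, s1, t1)) = of_bool (crossing_places Z (\<nu>, s1, t1) = {})" if "\<nu> \<in> F" for \<nu>
    using crossless_count_elt[OF F(2)[OF that]] good_adapted[OF goods(1) ch] F(3)[OF that] by simp
  have "crossless_count can (elt Z (\<nu>, s1, t1) \<odot> elt Z (E, t1, t3)) =
      of_bool (crossing_places Z (\<nu>, s1, t1) = {}) * of_bool (dotted Z (E, t1, t3) P \<and> crossing_places Z (E, t1, t3) \<subseteq> plc Z P)"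
    if m: "\<nu> \<in> F" "E \<in> G" for \<nu> E
  proof -
    have vs: "viable_h Z (\<lambda>e. h_grading \<nu> e + h_grading E e)"
      using viable_sum3 F(3)[OF m(1)] G(3)[OF m(2)] by (simp add: add.assoc)
    interpret c: composable Z \<nu> E s1 t1 t3
      by unfold_locales (use F(2)[OF m(1)] G(2)[OF m(2)] vs in simp_all)
    have "crossless_count can (elt Z (\<nu>, s1, t1) \<odot> elt Z (E, t1, t3)) =
      of_bool (crossing_places Z (\<nu>, s1, t1) = {}) * of_bool (\<not> (\<not> dotted Z (E, t1, t3) P) \<and> crossing_places Z (E, t1, t3) \<subseteq> plc Z P)"
    proof (rule c.count_mult_right[where P = P])
      show "through (h_grading E) b" if "Q \<in> pairs Z" "Q \<noteq> P" "Q \<in> t1" "Q \<in> t3" "a \<in> plc Z Q" "b \<in> plc Z Q" "through (h_grading E) a" for Q a b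
        using th23[OF that(1-6)] that(7) G(3)[OF m(2)] by simp
      show "P \<notin> s1" by (rule A)
      show "good Z (h_grading \<nu>, s1, t1)" using goods(1) F(3)[OF m(1)] by simp
      show "adapted can (\<lambda>e. h_grading \<nu> e + h_grading E e, s1, t3)" using ad F(3)[OF m(1)] G(3)[OF m(2)] by (simp add: add.assoc)
      show "(\<exists>Q\<in>pairs Z. mismatch Z \<nu> E Q) \<longleftrightarrow> \<not> dotted Z (E, t1, t3) P" if c0: "crossing_places Z (\<nu>, s1, t1) = {}"
      proof -
        interpret n: tight_triple Z \<nu> \<mu>2 \<mu>3 s1 t1 t2 t3
          by (rule replace_reps[OF F(2,3)[OF m(1)] c0 own(4-9)])
        have "\<not> mismatch Z \<nu> E Q" if Q: "Q \<in> pairs Z" "Q \<noteq> P" for Q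
          by (rule n.regular_mismatch(4)[OF Q(1) _ G(2,3)[OF m(2)]]) (use reg[OF Q] F(3)[OF m(1)] m(2) in simp_all)
        moreover have "before (h_grading \<nu>) p = 1" using A(5) F(3)[OF m(1)] by simp
        then have "mismatch Z \<nu> E P \<longleftrightarrow> \<not> dotted Z (E, t1, t3) P"
          using n.pattern_B_facts(4)[OF P A(1-4) _ A(6,7) G(2,3)[OF m(2)]] by blast
        ultimately show ?thesis using P(1) by metis
      qed
    qed
    then show ?thesis by simp
  qed
  from crossless_count_mult[OF this]
  have "crossless_count can (x1 \<odot> y) = crossless_count can x1 * crossless_count can (diff y)"
    unfolding F(4) G(4) diff_sum crossless_count_sum using c1 c2 by simp
  also have "crossless_count can (diff y) = crossless_count can x2 * crossless_count can x3"
    unfolding x(5) by (rule count_23[OF reg P(1) A(3) ad23 x(2,3)])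
  finally show ?thesis using ch by (auto simp: mult.assoc)
qed

end

section \<open>The Maslov grading\<close>

text \<open>Minus the Maslov grading of a tight diagram. Moving strands suffice, because a
  horizontal strand that is not crossed sits at a place where the average multiplicity is
  zero.\<close>

definition mass :: "('i, 'l) arc_diag \<Rightarrow> 'i strands \<Rightarrow> rat" where
  "mass Z \<mu> = m_chain Z (h_grading \<mu>) (\<lambda>p. if p \<in> Domain \<mu> then 1 else 0)"

context arc
begin

lemma sum_places: "(\<Sum>p\<in>places Z. g p) = (\<Sum>P\<in>pairs Z. \<Sum>p\<in>plc Z P. g p)"
  unfolding pairs_def plc_def by (rule sum.image_gen[OF finite_places])

lemma maslov_tight:
  assumes "tight Z (\<mu>, s, t)" "\<nu> \<in> keys (elt Z (\<mu>, s, t))"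
  shows "maslov Z \<nu> = - mass Z \<mu>"
proof -
  note td = tightD[OF assms(1)]
  note v = viable_diagramD[OF td(1)]
  obtain V where V: "V \<in> fills Z \<mu> s t" "\<nu> = \<mu> \<union> Id_on V" using assms(2) keys_elt[OF v(3)] by auto
  have "crossings \<nu> = {}" using assms by (simp add: tight_def)
  moreover have "h_grading \<nu> = h_grading \<mu>" using elt_strand(2)[OF v(1) assms(2)] by (simp add: strand_data_def)
  moreover have "m_chain Z (h_grading \<mu>) (\<lambda>p. if p \<in> Domain \<nu> then 1 else 0) = mass Z \<mu>"
    unfolding mass_def m_chain_def
  proof (rule sum.cong[OF refl])
    fix p assume p: "p \<in> places Z"
    show "of_int (if p \<in> Domain \<nu> then 1 else 0) * avg_mult (h_grading \<mu>) p = of_int (if p \<in> Domain \<mu> then 1 else 0) * avg_mult (h_grading \<mu>) p"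
    proof (cases "p \<in> V")
      case True
      then have "p \<notin> Domain \<mu>" "p \<notin> Range \<mu>" using V by (auto simp: fills_def)
      moreover have "\<not> passes \<mu> p" using fill_crossing[OF v(1) V(1) True _ v(2)] td(2) by blast
      ultimately have "avg_mult (h_grading \<mu>) p = 0"
        using local_bits(2,4)[OF v(2) place_snd[OF p]] by (simp add: avg_mult_def before_def)
      then show ?thesis by simp
    next
      case False
      then have "p \<in> Domain \<nu> \<longleftrightarrow> p \<in> Domain \<mu>" by (simp add: V(2))
      then show ?thesis by simp
    qed
  qed
  ultimately show ?thesis by (simp add: maslov_def inv_num_def)
qed

lemma viable_before: "viable_diagram \<mu> s t \<Longrightarrow> p \<in> places Z \<Longrightarrow>
    before (h_grading \<mu>) p = of_bool (before (h_grading \<mu>) p = 1) \<and> h_grading \<mu> p = of_bool (h_grading \<mu> p = 1)"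
  unfolding before_def using viable_value place_steps by blast

lemma mass_pair:
  assumes "tight Z (\<mu>, s, t)" "P \<in> pairs Z" "plc Z P = {p, q}" "p \<noteq> q"
  defines "h \<equiv> h_grading \<mu>"
  shows "(\<Sum>x\<in>plc Z P. of_int (if x \<in> Domain \<mu> then 1 else 0) * avg_mult h x) =
    of_int (mass_bits (before h p = 1) (h p = 1) (before h q = 1) (h q = 1) (P \<in> s) (P \<in> t)) / 2"
proof -
  have pl: "p \<in> places Z" "q \<in> places Z" using assms(3) by (auto simp: plc_def)
  have v: "before h x = of_bool (before h x = 1)" "h x = of_bool (h x = 1)" if "x \<in> places Z" for x
    using viable_before[OF tightD(1)[OF assms(1)] that] unfolding h_def by blast+
  have a: "avg_mult h x = of_int (of_bool (before h x = 1) + of_bool (h x = 1)) / 2" if "x \<in> places Z" for x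
    unfolding avg_mult_def before_def[symmetric] using v[OF that] by (metis of_int_add)
  have "(\<Sum>x\<in>plc Z P. of_int (if x \<in> Domain \<mu> then 1 else 0) * avg_mult h x) =
     of_int (of_bool (p \<in> Domain \<mu>) * (of_bool (before h p = 1) + of_bool (h p = 1)) +
       of_bool (q \<in> Domain \<mu>) * (of_bool (before h q = 1) + of_bool (h q = 1))) / 2"
    using assms(3,4) a[OF pl(1)] a[OF pl(2)] by (simp add: of_bool_def add_divide_distrib)
  then show ?thesis using tight_bits_mass[OF tight_bitsI[OF assms(1-4)]] by (simp add: h_def)
qed

lemma pairing_pair:
  assumes "viable_diagram \<mu> s t" "viable_diagram \<nu> s' t'" "plc Z P = {p, q}" "p \<noteq> q"
  defines "h \<equiv> h_grading \<mu>" and "k \<equiv> h_grading \<nu>"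
  shows "(\<Sum>x\<in>plc Z P. of_int (h_bdry h x) * avg_mult k x) =
    of_int (pairing_bits (before h p = 1) (h p = 1) (before k p = 1) (k p = 1) +
      pairing_bits (before h q = 1) (h q = 1) (before k q = 1) (k q = 1)) / 2"
proof -
  have pl: "p \<in> places Z" "q \<in> places Z" using assms(3) by (auto simp: plc_def)
  have v: "before h x = of_bool (before h x = 1)" "h x = of_bool (h x = 1)"
     "before k x = of_bool (before k x = 1)" "k x = of_bool (k x = 1)" if "x \<in> places Z" for x
    using viable_before[OF assms(1) that] viable_before[OF assms(2) that] unfolding h_def k_def by blast+
  have g: "of_int (h_bdry h x) * avg_mult k x = of_int (pairing_bits (before h x = 1) (h x = 1) (before k x = 1) (k x = 1)) / (2::rat)"
    if "x \<in> places Z" for x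
  proof -
    have "of_int (h_bdry h x) * avg_mult k x = of_int ((before h x - h x) * (before k x + k x)) / (2::rat)"
      by (simp add: h_bdry_def avg_mult_def before_def)
    also have "(before h x - h x) * (before k x + k x) = pairing_bits (before h x = 1) (h x = 1) (before k x = 1) (k x = 1)"
      unfolding pairing_bits_def using v[OF that] by metis
    finally show ?thesis .
  qed
  show ?thesis using assms(3,4) by (simp add: g[OF pl(1)] g[OF pl(2)] add_divide_distrib)
qed

end

text \<open>Both the masses and the pairings are sums over places, hence over pairs, and
  \<open>maslov_defect\<close> evaluates each pair; the halves of the averages absorb its factor
  two.\<close>

lemma (in tight_triple) maslov_patterns:
  assumes "tight Z (\<mu>, s1, t3)" "h_grading \<mu> = h123"
  shows "mass Z \<mu> - (mass Z \<mu>1 + mass Z \<mu>2 + mass Z \<mu>3) +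
    (m_chain Z h2 (h_bdry h1) + m_chain Z h3 (h_bdry h1) + m_chain Z h3 (h_bdry h2)) =
    - of_nat (card {P \<in> pairs Z. pattern P})"
proof -
  have loc: "(\<Sum>x\<in>plc Z P. of_int (if x \<in> Domain \<mu> then 1 else 0) * avg_mult h123 x)
     - ((\<Sum>x\<in>plc Z P. of_int (if x \<in> Domain \<mu>1 then 1 else 0) * avg_mult h1 x)
      + (\<Sum>x\<in>plc Z P. of_int (if x \<in> Domain \<mu>2 then 1 else 0) * avg_mult h2 x)
      + (\<Sum>x\<in>plc Z P. of_int (if x \<in> Domain \<mu>3 then 1 else 0) * avg_mult h3 x))
     + ((\<Sum>x\<in>plc Z P. of_int (h_bdry h1 x) * avg_mult h2 x) + (\<Sum>x\<in>plc Z P. of_int (h_bdry h1 x) * avg_mult h3 x)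
      + (\<Sum>x\<in>plc Z P. of_int (h_bdry h2 x) * avg_mult h3 x)) = - of_bool (pattern P)" if P: "P \<in> pairs Z" for P
  proof -
    obtain p q where pq: "plc Z P = {p, q}" "p \<noteq> q" using pair_places[OF P] .
    note tb = tight_bitsI[OF tight1 P pq] tight_bitsI[OF tight2 P pq] tight_bitsI[OF tight3 P pq] tight_bitsI[OF assms(1) P pq]
    note d = tb[THEN tight_bits_data]
    note bv = before_values(3,4)[OF pl(1)[OF P pq]] before_values(3,4)[OF pl(2)[OF P pq]]
    note vd = tightD(1)[OF tight1] tightD(1)[OF tight2] tightD(1)[OF tight3]
    note M = maslov_defect[OF d(1-3) d(4)[unfolded assms(2) bv] dj[OF P pq]]
    show ?thesis
      unfolding mass_pair[OF tight1 P pq] mass_pair[OF tight2 P pq] mass_pair[OF tight3 P pq]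
        mass_pair[OF assms(1) P pq, unfolded assms(2) bv]
        pairing_pair[OF vd(1,2) pq] pairing_pair[OF vd(1,3) pq] pairing_pair[OF vd(2,3) pq]
        pattern_at_iff[OF pq]
      using arg_cong[OF M, of "of_int :: int \<Rightarrow> rat"] by (simp add: field_simps)
  qed
  have "mass Z \<mu> - (mass Z \<mu>1 + mass Z \<mu>2 + mass Z \<mu>3) +
    (m_chain Z h2 (h_bdry h1) + m_chain Z h3 (h_bdry h1) + m_chain Z h3 (h_bdry h2)) = (\<Sum>P\<in>pairs Z. - of_bool (pattern P))"
    unfolding mass_def m_chain_def sum_places assms(2) using loc
    by (simp flip: sum.distrib sum_subtractf)
  also have "\<dots> = - of_nat (card {P \<in> pairs Z. pattern P})"
    using finite_pairs by (simp add: sum_negf of_bool_def sum.If_cases Int_def)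
  finally show ?thesis .
qed

section \<open>The triple product\<close>

context arc
begin

lemma mult_idem_ne:
  assumes "x \<in> alg_at Z (h, s, t)" "y \<in> alg_at Z (h', s', t')" "t \<noteq> s'"
  shows "x \<odot> y = 0"
proof -
  have "mult_strands \<mu> \<nu> = 0" if "\<mu> \<in> keys x" "\<nu> \<in> keys y" for \<mu> \<nu>
  proof -
    have "Range \<mu> \<noteq> Domain \<nu>"
      using alg_at_data[OF assms(1) that(1)] alg_at_data[OF assms(2) that(2)] assms(3) by (auto simp: strand_data_def)
    then show ?thesis by (simp add: mult_strands_def)
  qed
  then show ?thesis by (simp add: mult_def)
qed

lemma boundaries_closed: "b \<in> boundaries Z \<Longrightarrow> diff b = 0"
  unfolding boundaries_def using diff_diff alg_strand by blast

lemma hzero_boundaries: "hzero Z = boundaries Z"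
  by (auto simp: hzero_def hclass_mem)

lemma hadd_hzero: "hadd (hzero Z) (hzero Z) = hzero Z"
proof -
  have "hadd (boundaries Z) (boundaries Z) \<subseteq> boundaries Z" using boundaries_add by (auto simp: hadd_def)
  moreover have "x \<in> hadd (boundaries Z) (boundaries Z)" if "x \<in> boundaries Z" for x
    unfolding hadd_def using that boundaries_0 by force
  ultimately show ?thesis unfolding hzero_boundaries by blast
qed

lemma hzero_homology: "hzero Z \<in> homology Z"
  unfolding homology_def hzero_def using alg_0 by (auto simp: cycles_def)

text \<open>The zero class is its own double, so by additivity the value is the sum of two copies of
  itself, which is zero in characteristic two.\<close>

lemma multilinear_hzero:
  fixes F :: "'i hclass list \<Rightarrow> 'i chain"
  assumes "multilinear Z n (+) F" "set as \<union> set bs \<subseteq> homology Z" "length as + 1 + length bs = n"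
  shows "F (as @ hzero Z # bs) = 0"
proof -
  have "F (as @ hadd (hzero Z) (hzero Z) # bs) = F (as @ hzero Z # bs) + F (as @ hzero Z # bs)"
    using assms hzero_homology unfolding multilinear_def by blast
  then show ?thesis by (simp add: hadd_hzero)
qed

lemma tight_homology: "tight Z D \<Longrightarrow> hclass Z (elt Z D) \<in> homology Z"
  using tight_class(1)[of D] by (auto simp: homology_at_def homology_def)

lemma tight_nonzero_class: "tight Z D \<Longrightarrow> hclass Z (elt Z D) \<in> nonzero_diagram_classes Z"
proof -
  assume t: "tight Z D"
  obtain \<mu> s t where D: "D = (\<mu>, s, t)" by (cases D)
  have "elt Z D \<in> cycles Z" "diagram Z D"
    using elt_cycle(2)[OF tightD(1,2)[OF t[unfolded D]]] viable_diagramD(1)[OF tightD(1)[OF t[unfolded D]]] by (simp_all add: D)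
  then show ?thesis using tight_class(2)[OF t] unfolding nonzero_diagram_classes_def by blast
qed

text \<open>The given diagram may be any cycle with nonzero class;
  \<open>nonzero_cycle_tight\<close> replaces it by a tight one with the same H-data.\<close>

lemma nonzero_diagram_classE:
  assumes "M \<in> nonzero_diagram_classes Z"
  obtains \<mu> s t where "tight Z (\<mu>, s, t)" "M = hclass Z (elt Z (\<mu>, s, t))"
proof -
  obtain \<mu> s t where D: "diagram Z (\<mu>, s, t)" "elt Z (\<mu>, s, t) \<in> cycles Z" "M = hclass Z (elt Z (\<mu>, s, t))" "M \<noteq> hzero Z"
    using assms unfolding nonzero_diagram_classes_def by auto
  have "diff (elt Z (\<mu>, s, t)) = 0" "elt Z (\<mu>, s, t) \<notin> boundaries Z"
    using D by (auto simp: cycles_def hclass_eq_hzero)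
  from nonzero_cycle_tight[OF elt_alg_at[OF D(1)] this] show ?thesis using that D(3) by metis
qed

lemma tight_piece:
  assumes "tight Z (\<mu>, s, t)"
  shows "hclass Z (elt Z (\<mu>, s, t)) \<in> homology_piece Z (h_grading \<mu>, s, t) (- mass Z \<mu>)"
  unfolding homology_piece_def alg_piece_def
  using elt_cycle(2)[OF tightD(1,2)[OF assms]] elt_alg_at[OF viable_diagramD(1)[OF tightD(1)[OF assms]]]
    maslov_tight[OF assms] by blast

end

lemma tensor_hdata2: "tensor_hdata [(h1, s1, t1), (h2, s2, t2)] = ((\<lambda>e. h1 e + h2 e), s1, t2)"
  by (simp add: tensor_hdata_def)

lemma tensor_maslov3: "tensor_maslov Z [(h1, s1, t1), (h2, s2, t2), (h3, s3, t3)] [e1, e2, e3] =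
  e1 + e2 + e3 + (m_chain Z h2 (h_bdry h1) + m_chain Z h3 (h_bdry h1) + m_chain Z h3 (h_bdry h2))"
  by (simp add: tensor_maslov_def numeral_3_eq_3 lessThan_Suc add_ac)

section \<open>Consequences of Kadeishvili's equations\<close>

locale kadeishvili_maps = arc Z for Z :: "('i, 'l) arc_diag" +
  fixes U :: "nat \<Rightarrow> 'i hclass list \<Rightarrow> 'i chain"
    and X :: "nat \<Rightarrow> 'i hclass list \<Rightarrow> 'i hclass"
    and f :: "nat \<Rightarrow> 'i hclass list \<Rightarrow> 'i chain"
  assumes kad: "kadeishvili Z U X f" and bal: "balanced Z 2 U X f"
begin

abbreviation cls where "cls \<mu> s t \<equiv> hclass Z (elt Z (\<mu>, s, t))"

lemma kad_at:
  assumes "n \<ge> 1"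
  shows "multilinear Z n (+) (f n)" "graded Z n (of_nat n - 2) (alg_piece Z) (U n)"
    "graded Z n (of_nat n - 2) (homology_piece Z) (X n)" "graded Z n (of_nat n - 1) (alg_piece Z) (f n)"
    "length Ms = n \<Longrightarrow> set Ms \<subseteq> homology Z \<Longrightarrow> U n Ms \<in> cycles Z \<and> X n Ms \<in> homology Z \<and> f n Ms \<in> alg Z"
  using kad assms unfolding kadeishvili_def by blast+

lemma kad_eqs:
  assumes "n \<ge> 2" "length Ms = n" "set Ms \<subseteq> homology Z"
  shows "U n Ms = (\<Sum>j=1..n - 1. f j (take j Ms) \<odot> f (n - j) (drop j Ms)) +
          (\<Sum>j=2..n - 1. \<Sum>k=0..n - j.
             f (n - j + 1) (take k Ms @ X j (take j (drop k Ms)) # drop (k + j) Ms))"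
    "X n Ms = hclass Z (U n Ms)" "diff (f n Ms) = f 1 [X n Ms] - U n Ms"
  using kad assms unfolding kadeishvili_def by blast+

lemma eqs2:
  assumes "M \<in> homology Z" "N \<in> homology Z"
  shows "U 2 [M, N] = f 1 [M] \<odot> f 1 [N]" "X 2 [M, N] = hclass Z (U 2 [M, N])"
    "diff (f 2 [M, N]) = f 1 [X 2 [M, N]] - U 2 [M, N]" "diff (U 2 [M, N]) = 0" "X 2 [M, N] \<in> homology Z"
  using kad_eqs[of 2 "[M, N]"] kad_at(5)[of 2 "[M, N]"] assms by (auto simp: cycles_def)

lemma eqs3:
  assumes "M1 \<in> homology Z" "M2 \<in> homology Z" "M3 \<in> homology Z"
  shows "U 3 [M1, M2, M3] = f 1 [M1] \<odot> f 2 [M2, M3] + f 2 [M1, M2] \<odot> f 1 [M3] +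
      (f 2 [X 2 [M1, M2], M3] + f 2 [M1, X 2 [M2, M3]])"
    "X 3 [M1, M2, M3] = hclass Z (U 3 [M1, M2, M3])" "diff (U 3 [M1, M2, M3]) = 0"
proof -
  have s: "{1..(3::nat) - 1} = {1, 2}" "{2..(3::nat) - 1} = {2}" "{0..(3::nat) - 2} = {0, 1}" by auto
  show "U 3 [M1, M2, M3] = f 1 [M1] \<odot> f 2 [M2, M3] + f 2 [M1, M2] \<odot> f 1 [M3] +
      (f 2 [X 2 [M1, M2], M3] + f 2 [M1, X 2 [M2, M3]])"
    using kad_eqs(1)[of 3 "[M1, M2, M3]"] assms unfolding s
    by (simp add: numeral_2_eq_2 numeral_3_eq_3)
  show "X 3 [M1, M2, M3] = hclass Z (U 3 [M1, M2, M3])" "diff (U 3 [M1, M2, M3]) = 0"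
    using kad_eqs[of 3 "[M1, M2, M3]"] kad_at(5)[of 3 "[M1, M2, M3]"] assms by (auto simp: cycles_def)
qed

lemma f_hzero: "f 1 [hzero Z] = 0" "N \<in> homology Z \<Longrightarrow> f 2 [hzero Z, N] = 0" "N \<in> homology Z \<Longrightarrow> f 2 [N, hzero Z] = 0"
proof -
  have "f 1 ([] @ hzero Z # []) = 0" by (rule multilinear_hzero[OF kad_at(1)[of 1]]) simp_all
  then show "f 1 [hzero Z] = 0" by (simp only: append_Nil)
  show "f 2 [hzero Z, N] = 0" if "N \<in> homology Z"
    using multilinear_hzero[OF kad_at(1)[of 2], of "[]" "[N]"] that by simp
  show "f 2 [N, hzero Z] = 0" if "N \<in> homology Z"
    using multilinear_hzero[OF kad_at(1)[of 2], of "[N]" "[]"] that by simp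
qed

text \<open>The cycle f_1 represents a nonzero class with good H-data, so its count is one for every
  selection, whichever cycle has been chosen.\<close>

lemma f1_alg: 
  assumes "tight Z (\<mu>, s, t)"
  shows "f 1 [cls \<mu> s t] \<in> alg_at Z (h_grading \<mu>, s, t)" "choice can \<Longrightarrow> crossless_count can (f 1 [cls \<mu> s t]) = 1"
proof -
  have "f 1 [cls \<mu> s t] \<in> alg_piece Z (tensor_hdata [(h_grading \<mu>, s, t)]) (tensor_maslov Z [(h_grading \<mu>, s, t)] [- mass Z \<mu>] + (of_nat 1 - 1))"
    using kad_at(4)[of 1] tight_piece[OF assms] unfolding graded_def by simp
  then show a: "f 1 [cls \<mu> s t] \<in> alg_at Z (h_grading \<mu>, s, t)"
    unfolding alg_piece_def by (simp add: tensor_hdata_def)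
  note td = tightD[OF assms]
  have "f 1 [cls \<mu> s t] \<in> cls \<mu> s t" using kad tight_homology[OF assms] unfolding kadeishvili_def by blast
  then have b: "f 1 [cls \<mu> s t] + elt Z (\<mu>, s, t) \<in> boundaries Z" by (simp add: hclass_mem)
  have "diff (f 1 [cls \<mu> s t]) = 0"
    using boundaries_closed[OF b] elt_cycle(1)[OF td(1,2)] by (simp add: diff_add)
  moreover have "hclass Z (f 1 [cls \<mu> s t]) = cls \<mu> s t" unfolding hclass_eq_iff by (rule b)
  then have "f 1 [cls \<mu> s t] \<notin> boundaries Z"
    using tight_class(2)[OF assms] unfolding hclass_eq_hzero[symmetric] by simp
  ultimately show "crossless_count can (f 1 [cls \<mu> s t]) = 1" if "choice can"
    using nonzero_cycle_count[OF a _ _ td(3) that] td(1) by (simp add: viable_diagram_def)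
qed

lemma graded2:
  assumes "tight Z (\<mu>, s, t)" "tight Z (\<nu>, s', t')"
  shows "f 2 [cls \<mu> s t, cls \<nu> s' t'] \<in> alg_at Z (\<lambda>e. h_grading \<mu> e + h_grading \<nu> e, s, t')"
    "U 2 [cls \<mu> s t, cls \<nu> s' t'] \<in> alg_at Z (\<lambda>e. h_grading \<mu> e + h_grading \<nu> e, s, t')"
proof -
  let ?ds = "[(h_grading \<mu>, s, t), (h_grading \<nu>, s', t')]" and ?es = "[- mass Z \<mu>, - mass Z \<nu>]"
  have p: "\<forall>i<2. [cls \<mu> s t, cls \<nu> s' t'] ! i \<in> homology_piece Z (?ds ! i) (?es ! i)"
    using tight_piece[OF assms(1)] tight_piece[OF assms(2)] by (simp add: numeral_2_eq_2 less_Suc_eq all_conj_distrib)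
  have "graded Z 2 r (alg_piece Z) F \<Longrightarrow> F [cls \<mu> s t, cls \<nu> s' t'] \<in> alg_piece Z (tensor_hdata ?ds) (tensor_maslov Z ?ds ?es + r)" for F r
    unfolding graded_def using p by simp
  from this[OF kad_at(4)[of 2]] this[OF kad_at(2)[of 2]] show "f 2 [cls \<mu> s t, cls \<nu> s' t'] \<in> alg_at Z (\<lambda>e. h_grading \<mu> e + h_grading \<nu> e, s, t')"
    "U 2 [cls \<mu> s t, cls \<nu> s' t'] \<in> alg_at Z (\<lambda>e. h_grading \<mu> e + h_grading \<nu> e, s, t')"
    unfolding tensor_hdata2 alg_piece_def by simp_all
qed

text \<open>The product of the chosen cycles vanishes, but this alone makes f_2 only a cycle.
  Balance turns it into zero.\<close>

lemma idem_ne2: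
  assumes "tight Z (\<mu>, s, t)" "tight Z (\<nu>, s', t')" "t \<noteq> s'"
  shows "X 2 [cls \<mu> s t, cls \<nu> s' t'] = hzero Z" "f 2 [cls \<mu> s t, cls \<nu> s' t'] = 0"
proof -
  note e = eqs2[OF tight_homology[OF assms(1)] tight_homology[OF assms(2)]]
  have u: "U 2 [cls \<mu> s t, cls \<nu> s' t'] = 0"
    unfolding e(1) by (rule mult_idem_ne[OF f1_alg(1)[OF assms(1)] f1_alg(1)[OF assms(2)] assms(3)])
  show x: "X 2 [cls \<mu> s t, cls \<nu> s' t'] = hzero Z" unfolding e(2) u hzero_def ..
  have "f 1 [X 2 [cls \<mu> s t, cls \<nu> s' t']] - U 2 [cls \<mu> s t, cls \<nu> s' t'] = 0" unfolding x u f_hzero(1) by simp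
  then show "f 2 [cls \<mu> s t, cls \<nu> s' t'] = 0"
    using bal tight_nonzero_class[OF assms(1)] tight_nonzero_class[OF assms(2)] unfolding balanced_def by simp
qed

lemma X2_cases:
  assumes "tight Z (\<mu>, s, t)" "tight Z (\<nu>, s', t')"
  obtains "X 2 [cls \<mu> s t, cls \<nu> s' t'] = hzero Z"
    | \<kappa> where "tight Z (\<kappa>, s, t')" "h_grading \<kappa> = (\<lambda>e. h_grading \<mu> e + h_grading \<nu> e)" "X 2 [cls \<mu> s t, cls \<nu> s' t'] = cls \<kappa> s t'"
proof -
  note e = eqs2[OF tight_homology[OF assms(1)] tight_homology[OF assms(2)]]
  show ?thesis
  proof (cases "U 2 [cls \<mu> s t, cls \<nu> s' t'] \<in> boundaries Z")
    case True
    then have "X 2 [cls \<mu> s t, cls \<nu> s' t'] = hzero Z" unfolding e(2) hclass_eq_hzero .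
    then show ?thesis by (rule that(1))
  next
    case False
    obtain \<kappa> where k: "tight Z (\<kappa>, s, t')" "h_grading \<kappa> = (\<lambda>e. h_grading \<mu> e + h_grading \<nu> e)"
      "hclass Z (U 2 [cls \<mu> s t, cls \<nu> s' t']) = cls \<kappa> s t'"
      using nonzero_cycle_tight[OF graded2(2)[OF assms] e(4) False] .
    show ?thesis by (rule that(2)[OF k(1,2)]) (simp only: e(2) k(3))
  qed
qed

text \<open>If adjacent idempotents differ, all four terms of U_3 vanish: each either contains a
  product or a value of f_2 across the gap, or an f_2 with the zero class as an argument. A nonzero
  X_2 of the other two factors keeps the outer idempotent, so the gap persists.\<close>

lemma X3_chain:
  assumes "tight Z (\<mu>1, s1, t1)" "tight Z (\<mu>2, s2, t2)" "tight Z (\<mu>3, s3, t3)"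
    and n: "X 3 [cls \<mu>1 s1 t1, cls \<mu>2 s2 t2, cls \<mu>3 s3 t3] \<noteq> hzero Z"
  shows "t1 = s2" "t2 = s3"
proof -
  note th = tight_homology[OF assms(1)] tight_homology[OF assms(2)] tight_homology[OF assms(3)]
  note e = eqs3[OF th]
  have u: "U 3 [cls \<mu>1 s1 t1, cls \<mu>2 s2 t2, cls \<mu>3 s3 t3] \<noteq> 0" using n by (auto simp: e(2) hzero_def)
  show "t1 = s2"
  proof (rule ccontr)
    assume ne: "t1 \<noteq> s2"
    have "f 1 [cls \<mu>1 s1 t1] \<odot> f 2 [cls \<mu>2 s2 t2, cls \<mu>3 s3 t3] = 0"
      by (rule mult_idem_ne[OF f1_alg(1)[OF assms(1)] graded2(1)[OF assms(2,3)] ne])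
    moreover have "f 2 [cls \<mu>1 s1 t1, X 2 [cls \<mu>2 s2 t2, cls \<mu>3 s3 t3]] = 0"
      by (rule X2_cases[OF assms(2,3)]) (use f_hzero(3) th idem_ne2(2)[OF assms(1) _ ne] in simp_all)
    ultimately show False using u idem_ne2[OF assms(1,2) ne] f_hzero th by (simp add: e(1))
  qed
  show "t2 = s3"
  proof (rule ccontr)
    assume ne: "t2 \<noteq> s3"
    have "f 2 [cls \<mu>1 s1 t1, cls \<mu>2 s2 t2] \<odot> f 1 [cls \<mu>3 s3 t3] = 0"
      by (rule mult_idem_ne[OF graded2(1)[OF assms(1,2)] f1_alg(1)[OF assms(3)] ne])
    moreover have "f 2 [X 2 [cls \<mu>1 s1 t1, cls \<mu>2 s2 t2], cls \<mu>3 s3 t3] = 0"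
      by (rule X2_cases[OF assms(1,2)]) (use f_hzero(2) th idem_ne2(2)[OF _ assms(3) ne] in simp_all)
    ultimately show False using u idem_ne2[OF assms(2,3) ne] f_hzero th by (simp add: e(1))
  qed
qed

text \<open>A nonzero class determines only its H-data, so the Maslov grading must be read off from
  a tight diagram which occurs in a homogeneous representative. The summand 1 is the Maslov degree 3
  - 2 of X_3.\<close>

lemma X3_tight:
  assumes "tight Z (\<mu>1, s1, t1)" "tight Z (\<mu>2, s2, t2)" "tight Z (\<mu>3, s3, t3)"
    and n: "X 3 [cls \<mu>1 s1 t1, cls \<mu>2 s2 t2, cls \<mu>3 s3 t3] \<noteq> hzero Z"
  obtains \<mu> where "tight Z (\<mu>, s1, t3)" "h_grading \<mu> = (\<lambda>e. h_grading \<mu>1 e + h_grading \<mu>2 e + h_grading \<mu>3 e)"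
    "mass Z \<mu> + 1 = mass Z \<mu>1 + mass Z \<mu>2 + mass Z \<mu>3 -
      (m_chain Z (h_grading \<mu>2) (h_bdry (h_grading \<mu>1)) + m_chain Z (h_grading \<mu>3) (h_bdry (h_grading \<mu>1)) +
       m_chain Z (h_grading \<mu>3) (h_bdry (h_grading \<mu>2)))"
proof -
  let ?h = "\<lambda>e. h_grading \<mu>1 e + h_grading \<mu>2 e + h_grading \<mu>3 e"
  let ?ds = "[(h_grading \<mu>1, s1, t1), (h_grading \<mu>2, s2, t2), (h_grading \<mu>3, s3, t3)]"
  let ?es = "[- mass Z \<mu>1, - mass Z \<mu>2, - mass Z \<mu>3]"
  let ?m = "m_chain Z (h_grading \<mu>2) (h_bdry (h_grading \<mu>1)) + m_chain Z (h_grading \<mu>3) (h_bdry (h_grading \<mu>1)) +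
       m_chain Z (h_grading \<mu>3) (h_bdry (h_grading \<mu>2))"
  let ?Ms = "[cls \<mu>1 s1 t1, cls \<mu>2 s2 t2, cls \<mu>3 s3 t3]"
  have "\<forall>i<3. ?Ms ! i \<in> homology_piece Z (?ds ! i) (?es ! i)"
    using tight_piece[OF assms(1)] tight_piece[OF assms(2)] tight_piece[OF assms(3)]
    by (simp add: numeral_3_eq_3 less_Suc_eq all_conj_distrib)
  then have "X 3 ?Ms \<in> homology_piece Z (tensor_hdata ?ds) (tensor_maslov Z ?ds ?es + (of_nat 3 - 2))"
    using kad_at(3)[of 3] unfolding graded_def by simp
  then obtain z where z: "X 3 ?Ms = hclass Z z" "z \<in> cycles Z" "z \<in> alg_at Z (?h, s1, t3)"
    "\<And>\<nu>. \<nu> \<in> keys z \<Longrightarrow> maslov Z \<nu> = - mass Z \<mu>1 - mass Z \<mu>2 - mass Z \<mu>3 + ?m + 1"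
    unfolding tensor_hdata3 tensor_maslov3 homology_piece_def alg_piece_def by auto
  have zb: "diff z = 0" "z \<notin> boundaries Z" using z(1,2) n by (auto simp: cycles_def hclass_eq_hzero)
  obtain can where ch: "choice can" using ex_choice by blast
  have v: "viable_h Z ?h" using nonviable_boundary[OF z(3) zb(1)] zb(2) by blast
  obtain \<mu>0 where "tight Z (\<mu>0, s1, t3)" "h_grading \<mu>0 = ?h" using nonzero_cycle_tight[OF z(3) zb] by metis
  then have g: "good Z (?h, s1, t3)" using tightD(3) by metis
  obtain F where F: "finite F" "\<And>\<mu>. \<mu> \<in> F \<Longrightarrow> viable_diagram \<mu> s1 t3" "\<And>\<mu>. \<mu> \<in> F \<Longrightarrow> h_grading \<mu> = ?h"
    "z = (\<Sum>\<mu>\<in>F. elt Z (\<mu>, s1, t3))"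
    by (rule alg_at_viableE[OF z(3) v]) blast
  have "crossless_count can z = 1" using nonzero_cycle_count[OF z(3) zb(1) v g ch] zb(2) by blast
  moreover have "crossless_count can z = (\<Sum>\<mu>\<in>F. of_bool (crossing_places Z (\<mu>, s1, t3) = {}))"
    unfolding F(4) crossless_count_sum
    by (rule sum.cong[OF refl], rule crossless_count_elt) (use F(2,3) good_adapted[OF g ch] in simp_all)
  \<comment> \<open>An odd number of diagrams in \<open>z\<close> has no crossings. Any of them is
    tight, and its terms occur in \<open>z\<close>, whose grading is known.\<close>
  ultimately have "(\<Sum>\<mu>\<in>F. of_bool (crossing_places Z (\<mu>, s1, t3) = {})) \<noteq> (0::bit)" by simp
  then obtain \<mu> where m: "\<mu> \<in> F" "crossing_places Z (\<mu>, s1, t3) = {}"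
    by (rule sum.not_neutral_contains_not_neutral) (simp split: if_splits)
  have t: "tight Z (\<mu>, s1, t3)" using F(2,3)[OF m(1)] m(2) g by (simp add: tight_iff)
  have "elt Z (\<mu>, s1, t3) \<noteq> 0" using F(2)[OF m(1)] by (simp add: viable_diagram_def diagram_def)
  then obtain \<nu> where nu: "\<nu> \<in> keys (elt Z (\<mu>, s1, t3))" using keys_eq_empty by blast
  then have "\<nu> \<in> keys z"
    unfolding F(4) using keys_sum_elt[OF F(1), of s1 t3] viable_diagramD(3)[OF F(2)] m(1) by blast
  then have "- mass Z \<mu> = - mass Z \<mu>1 - mass Z \<mu>2 - mass Z \<mu>3 + ?m + 1"
    using z(4) maslov_tight[OF t nu] by metis
  then show ?thesis using that[OF t F(3)[OF m(1)]] by simp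
qed

lemma X3_nonzeroD:
  assumes "M1 \<in> nonzero_diagram_classes Z" "M2 \<in> nonzero_diagram_classes Z" "M3 \<in> nonzero_diagram_classes Z"
    and n: "X 3 [M1, M2, M3] \<noteq> hzero Z"
  shows "viable_tensor Z [M1, M2, M3]"
    "\<exists>P\<in>pairs Z. {Q \<in> pairs Z. critical_at Z Q [M1, M2, M3]} = {P} \<and> (\<forall>Q\<in>pairs Z - {P}. tight_at Z Q [M1, M2, M3])"
proof -
  obtain \<mu>1 s1 t1 where 1: "tight Z (\<mu>1, s1, t1)" "M1 = cls \<mu>1 s1 t1" using nonzero_diagram_classE[OF assms(1)] .
  obtain \<mu>2 s2 t2 where 2: "tight Z (\<mu>2, s2, t2)" "M2 = cls \<mu>2 s2 t2" using nonzero_diagram_classE[OF assms(2)] .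
  obtain \<mu>3 s3 t3 where 3: "tight Z (\<mu>3, s3, t3)" "M3 = cls \<mu>3 s3 t3" using nonzero_diagram_classE[OF assms(3)] .
  note n' = n[unfolded 1(2) 2(2) 3(2)]
  note ch = X3_chain[OF 1(1) 2(1) 3(1) n']
  obtain \<mu> where m: "tight Z (\<mu>, s1, t3)" "h_grading \<mu> = (\<lambda>e. h_grading \<mu>1 e + h_grading \<mu>2 e + h_grading \<mu>3 e)"
    "mass Z \<mu> + 1 = mass Z \<mu>1 + mass Z \<mu>2 + mass Z \<mu>3 -
      (m_chain Z (h_grading \<mu>2) (h_bdry (h_grading \<mu>1)) + m_chain Z (h_grading \<mu>3) (h_bdry (h_grading \<mu>1)) +
       m_chain Z (h_grading \<mu>3) (h_bdry (h_grading \<mu>2)))"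
    using X3_tight[OF 1(1) 2(1) 3(1) n'] .
  note td = tightD[OF m(1)]
  have v: "viable_h Z (\<lambda>e. h_grading \<mu>1 e + h_grading \<mu>2 e + h_grading \<mu>3 e)"
    using td(1) m(2) by (simp add: viable_diagram_def)
  interpret tt: tight_triple Z \<mu>1 \<mu>2 \<mu>3 s1 t1 t2 t3
    by unfold_locales (use 1(1) 2(1) 3(1) ch v in simp_all)
  have Ms: "[M1, M2, M3] = [tt.M1, tt.M2, tt.M3]" using 1(2) 2(2) 3(2) ch by simp
  show "viable_tensor Z [M1, M2, M3]" unfolding Ms by (rule tt.viable_tensor3)
  \<comment> \<open>The grading computed from the number of patterns is compared with the one forced
    by the degree of X_3.\<close>
  have "- of_nat (card {P \<in> pairs Z. tt.pattern P}) = - (1::rat)"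
    using tt.maslov_patterns[OF m(1,2)] m(3) by linarith
  then have "card {P \<in> pairs Z. tt.pattern P} = 1" by simp
  then obtain P where P: "{P \<in> pairs Z. tt.pattern P} = {P}" by (rule card_1_singletonE)
  note lc = tt.local_classification[OF _ td(1) m(2) td(3)[unfolded m(2)], folded Ms]
  have "{Q \<in> pairs Z. critical_at Z Q [M1, M2, M3]} = {P}" using lc(1) P by blast
  moreover have "\<forall>Q\<in>pairs Z - {P}. tight_at Z Q [M1, M2, M3]" using lc(2) P by blast
  moreover have "P \<in> pairs Z" using P by blast
  ultimately show "\<exists>P\<in>pairs Z. {Q \<in> pairs Z. critical_at Z Q [M1, M2, M3]} = {P} \<and> (\<forall>Q\<in>pairs Z - {P}. tight_at Z Q [M1, M2, M3])"
    by blast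
qed

lemma X3_nonzeroI:
  assumes "M1 \<in> nonzero_diagram_classes Z" "M2 \<in> nonzero_diagram_classes Z" "M3 \<in> nonzero_diagram_classes Z"
    and v: "viable_tensor Z [M1, M2, M3]" and P: "P \<in> pairs Z" "critical_at Z P [M1, M2, M3]"
    and T: "\<And>Q. Q \<in> pairs Z \<Longrightarrow> Q \<noteq> P \<Longrightarrow> tight_at Z Q [M1, M2, M3]"
  shows "X 3 [M1, M2, M3] \<noteq> hzero Z"
proof -
  obtain \<mu>1 s1 t1 where 1: "tight Z (\<mu>1, s1, t1)" "M1 = cls \<mu>1 s1 t1" using nonzero_diagram_classE[OF assms(1)] .
  obtain \<mu>2 s2 t2 where 2: "tight Z (\<mu>2, s2, t2)" "M2 = cls \<mu>2 s2 t2" using nonzero_diagram_classE[OF assms(2)] .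
  obtain \<mu>3 s3 t3 where 3: "tight Z (\<mu>3, s3, t3)" "M3 = cls \<mu>3 s3 t3" using nonzero_diagram_classE[OF assms(3)] .
  have ch: "t1 = s2" "t2 = s3" "viable_h Z (\<lambda>e. h_grading \<mu>1 e + h_grading \<mu>2 e + h_grading \<mu>3 e)"
    using v viable_tensor3_iff[OF 1(1) 2(1) 3(1)] unfolding 1(2) 2(2) 3(2) by blast+
  interpret tt: tight_triple Z \<mu>1 \<mu>2 \<mu>3 s1 t1 t2 t3
    by unfold_locales (use 1(1) 2(1) 3(1) ch in simp_all)
  have Ms: "[M1, M2, M3] = [tt.M1, tt.M2, tt.M3]" using 1(2) 2(2) 3(2) ch by simp
  have pat: "tt.pattern P" using tt.critical_at_imp[OF P(1)] P(2) unfolding Ms .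
  have reg: "tt.regular Q" if "Q \<in> pairs Z" "Q \<noteq> P" for Q
    using tt.tight_at_regular[OF that(1)] T[OF that] unfolding Ms .
  note th = tight_homology[OF tt.tight1] tight_homology[OF tt.tight2] tight_homology[OF tt.tight3]
  note e = eqs3[OF th] and e12 = eqs2[OF th(1,2)] and e23 = eqs2[OF th(2,3)]
  note g12 = graded2[OF tt.tight1 tt.tight2] and g23 = graded2[OF tt.tight2 tt.tight3]
  note a = f1_alg(1)[OF tt.tight1] f1_alg(1)[OF tt.tight2] f1_alg(1)[OF tt.tight3]
  note c = f1_alg(2)[OF tt.tight1] f1_alg(2)[OF tt.tight2] f1_alg(2)[OF tt.tight3]
  have X_zero: "X 2 [M, N] = hzero Z"
    if "U 2 [M, N] \<in> alg_at Z (h, s, t)" "diff (U 2 [M, N]) = 0" "X 2 [M, N] = hclass Z (U 2 [M, N])" "viable_h Z h"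
      "\<not> good Z (h, s, t)" for M N h s t
    using cycle_normal_form[OF that(1,2,4)] that(3,5) by (simp add: hclass_eq_hzero)
  have not_good: "\<not> good Z (h, s, t)" if "P \<in> s" "P \<in> t" "p \<in> plc Z P" "q \<in> plc Z P" "through h p" "\<not> through h q" for h s t p q
    using that P(1) unfolding good_def prod.case by blast
  \<comment> \<open>A pattern excludes \<open>P\<close> from one of the outer idempotents, so the
    total H-data are good and the count detects the class of U_3.\<close>
  have goal: "X 3 [tt.M1, tt.M2, tt.M3] \<noteq> hzero Z"
    if "U 3 [tt.M1, tt.M2, tt.M3] \<in> alg_at Z (tt.h123, s1, t3)" "choice can"
      "crossless_count can (U 3 [tt.M1, tt.M2, tt.M3]) = 1" "P \<notin> s1 \<or> P \<notin> t3" for can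
    using nonzero_cycle_count[OF that(1) e(3) tt.viable_sum3 tt.total_good[OF reg that(4)] that(2)] that(3)
    unfolding e(2) hclass_eq_hzero by blast
  have U3: "U 3 [tt.M1, tt.M2, tt.M3] \<in> alg_at Z (tt.h123, s1, t3)"
  proof -
    let ?ds = "[(tt.h1, s1, t1), (tt.h2, t1, t2), (tt.h3, t2, t3)]" and ?es = "[- mass Z \<mu>1, - mass Z \<mu>2, - mass Z \<mu>3]"
    have "\<forall>i<3. [tt.M1, tt.M2, tt.M3] ! i \<in> homology_piece Z (?ds ! i) (?es ! i)"
      using tight_piece[OF tt.tight1] tight_piece[OF tt.tight2] tight_piece[OF tt.tight3]
      by (simp add: numeral_3_eq_3 less_Suc_eq all_conj_distrib)
    then have "U 3 [tt.M1, tt.M2, tt.M3] \<in> alg_piece Z (tensor_hdata ?ds) (tensor_maslov Z ?ds ?es + (of_nat 3 - 2))"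
      using kad_at(2)[of 3] unfolding graded_def by simp
    then show ?thesis unfolding tensor_hdata3 alg_piece_def by blast
  qed
  show ?thesis
    unfolding Ms using P(1) pat
  proof (cases rule: tt.pattern_cases)
    case (A p q)
    note pf = tt.pattern_A_facts[OF P(1) A(1,2,5-11)]
    \<comment> \<open>With no diagrams for the last two factors, both U_2 and f_2 vanish on them for
      reasons of grading.\<close>
    have "alg_at Z (tt.h23, t1, t3) = {0}" using alg_at_nonzero[OF tt.pair_sum_viable(2), of t1 t3] pf(3) by blast
    then have 23: "f 2 [tt.M2, tt.M3] = 0" "U 2 [tt.M2, tt.M3] = 0" using g23 by blast+
    then have x23: "X 2 [tt.M2, tt.M3] = hzero Z" by (simp add: e23(2) hzero_def)
    \<comment> \<open>\<open>P\<close> lies in both idempotents of this product, but only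
      \<open>p\<close> is interior to its support, so the homology of these H-data is zero.\<close>
    have x12: "X 2 [tt.M1, tt.M2] = hzero Z"
      by (rule X_zero[OF g12(2) e12(4,2) tt.pair_sum_viable(1) not_good[of _ _ p q]]) (use A(1,5,7) pf(1,2) in auto)
    have "diff (f 2 [tt.M1, tt.M2]) = f 1 [tt.M1] \<odot> f 1 [tt.M2]"
      using e12(3) unfolding x12 f_hzero(1) e12(1) chain_minus by simp
    from tt.pattern_A_count[OF reg P(1) A(1,2,5-11) a g12(1) this]
    obtain can where can: "choice can" "crossless_count can (f 2 [tt.M1, tt.M2] \<odot> f 1 [tt.M3]) =
       crossless_count can (f 1 [tt.M1]) * crossless_count can (f 1 [tt.M2]) * crossless_count can (f 1 [tt.M3])" by blast
    have "U 3 [tt.M1, tt.M2, tt.M3] = f 2 [tt.M1, tt.M2] \<odot> f 1 [tt.M3]"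
      unfolding e(1) x12 x23 23(1) using f_hzero(2,3) th by simp
    then show "X 3 [tt.M1, tt.M2, tt.M3] \<noteq> hzero Z" using goal[OF U3 can(1)] can(2) c[OF can(1)] A(8) by simp
  next
    case (B p q)
    note pf = tt.pattern_B_facts[OF P(1) B(1,2,5-11)]
    \<comment> \<open>In the mirror image the first two factors have no diagrams, and the last two
      provide the primitive.\<close>
    have "alg_at Z (tt.h12, s1, t2) = {0}" using alg_at_nonzero[OF tt.pair_sum_viable(1), of s1 t2] pf(3) by blast
    then have 12: "f 2 [tt.M1, tt.M2] = 0" "U 2 [tt.M1, tt.M2] = 0" using g12 by blast+
    then have x12: "X 2 [tt.M1, tt.M2] = hzero Z" by (simp add: e12(2) hzero_def)
    have x23: "X 2 [tt.M2, tt.M3] = hzero Z"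
      by (rule X_zero[OF g23(2) e23(4,2) tt.pair_sum_viable(2) not_good[of _ _ q p]]) (use B(1,6,8) pf(1,2) in auto)
    have "diff (f 2 [tt.M2, tt.M3]) = f 1 [tt.M2] \<odot> f 1 [tt.M3]"
      using e23(3) unfolding x23 f_hzero(1) e23(1) chain_minus by simp
    from tt.pattern_B_count[OF reg P(1) B(1,2,5-11) a g23(1) this]
    obtain can where can: "choice can" "crossless_count can (f 1 [tt.M1] \<odot> f 2 [tt.M2, tt.M3]) =
       crossless_count can (f 1 [tt.M1]) * crossless_count can (f 1 [tt.M2]) * crossless_count can (f 1 [tt.M3])" by blast
    have "U 3 [tt.M1, tt.M2, tt.M3] = f 1 [tt.M1] \<odot> f 2 [tt.M2, tt.M3]"
      unfolding e(1) x12 x23 12(1) using f_hzero(2,3) th by simp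
    then show "X 3 [tt.M1, tt.M2, tt.M3] \<noteq> hzero Z" using goal[OF U3 can(1)] can(2) c[OF can(1)] B(5) by simp
  qed
qed

end

theorem proposition6p9:
  fixes Z :: "('i, 'l) arc_diag"
    and U :: "nat \<Rightarrow> 'i hclass list \<Rightarrow> 'i chain"
    and X :: "nat \<Rightarrow> 'i hclass list \<Rightarrow> 'i hclass"
    and f :: "nat \<Rightarrow> 'i hclass list \<Rightarrow> 'i chain"
    and M1 M2 M3 :: "'i hclass"
  assumes "arc_diagram Z"
    and "kadeishvili Z U X f"
    and "balanced Z 2 U X f"
    and "{M1, M2, M3} \<subseteq> nonzero_diagram_classes Z"
  shows "X 3 [M1, M2, M3] \<noteq> hzero Z \<longleftrightarrow>
    viable_tensor Z [M1, M2, M3] \<and>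
    (\<exists>P\<in>pairs Z. {Q \<in> pairs Z. critical_at Z Q [M1, M2, M3]} = {P} \<and>
       (\<forall>Q\<in>pairs Z - {P}. tight_at Z Q [M1, M2, M3]))"
proof -
  interpret kadeishvili_maps Z U X f
    by unfold_locales (use assms(1-3) in \<open>auto simp: arc_diagram_def plc_def\<close>)
  have M: "M1 \<in> nonzero_diagram_classes Z" "M2 \<in> nonzero_diagram_classes Z" "M3 \<in> nonzero_diagram_classes Z"
    using assms(4) by auto
  show ?thesis using X3_nonzeroD[OF M] X3_nonzeroI[OF M] by blast
qed

end
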